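(* Let $p \geq 1$ be a real number, let $E$ be a Banach lattice and let $k$ be a positive integer. The following statements are equivalent. (a) $E$ has the disjoint Dunford-Pettis property of order $p$ (disjoint $DPP_p$). (b) For any Banach lattice $F$ with order continuous norm, every positive weakly compact $k$-homogeneous polynomial $P \colon E \to F$ is disjoint $p$-convergent. (c) Every positive weakly compact $k$-homogeneous polynomial $P \colon E \to c_0$ is disjoint $p$-convergent. (d) For every disjoint weakly $p$-summable sequence $(x_n)_n$ in $E$ and for every positive weakly null sequence $(P_n)_n$ in $\mathcal{P}^r(^k E)$, it holds $P_n(x_n) \longrightarrow 0$. (e) For every disjoint weakly $p$-summable sequence $(x_n)_n$ in $E$ and for every positive disjoint weakly null sequence $(P_n)_n$ in $\mathcal{P}^r(^k E)$, it holds $P_n(x_n) \longrightarrow 0$. (f) For every disjoint weakly $p$-summable sequence $(x_n)_n$ in $E$ and for every disjoint weakly null sequence $(P_n)_n$ in $\mathcal{P}^r(^k E)$, it holds $P_n(x_n) \longrightarrow 0$.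
   Context: A sequence $(x_n)_n$ in a Banach lattice is disjoint if $|x_n| \wedge |x_m| = 0$ whenever $n \neq m$, and positive if $x_n \geq 0$ for every $n$. A sequence $(x_n)_n$ in a Banach space $X$ is weakly $p$-summable if $\sum_n |x^\ast(x_n)|^p < \infty$ for every $x^\ast \in X^\ast$. A subset $A$ of a Banach space $X$ is a Dunford-Pettis set if every weakly null sequence in $X^\ast$ converges uniformly to zero on $A$. A Banach lattice $E$ has the disjoint $DPP_p$ if, for every disjoint weakly $p$-summable sequence $(x_n)_n$ in $E$, the set $\{x_n : n \in \mathbb{N}\}$ is a Dunford-Pettis set. A (linear or nonlinear) map from a Banach lattice to a Banach space is disjoint $p$-convergent if it sends disjoint weakly $p$-summable sequences to norm null sequences. A $k$-homogeneous polynomial $P \colon E \to F$ between Banach lattices, with associated symmetric $k$-linear operator $T_P \colon E^k \to F$ (so $P(x) = T_P(x, \ldots, x)$), is positive if $T_P(x_1, \ldots, x_k) \geq 0$ for all $x_1, \ldots, x_k \in E^+$. It is weakly compact if it maps the closed unit ball of $E$ onto a relatively weakly compact subset of $F$. The difference of two positive $k$-homogeneous polynomials is called a regular $k$-homogeneous polynomial; $\mathcal{P}^r(^k E, F)$ is the set of all regular $k$-homogeneous polynomials from $E$ to $F$, ordered by $P \leq Q$ if $Q - P$ is positive, and $\mathcal{P}^r(^k E)$ denotes the case where $F$ is the scalar field. If $F$ is Dedekind complete (in particular for the scalar field), $\mathcal{P}^r(^k E, F)$ is a Banach lattice with the regular norm $\|P\|_r = \| |P| \|$, where $|P|$ is the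 absolute value of $P$ and $\|\cdot\|$ is the usual sup norm on the unit ball. Weakly null, positive and disjoint sequences in $\mathcal{P}^r(^k E)$ are understood with respect to this Banach lattice structure. *)

theory Defs
  imports "HOL-Analysis.Analysis" "HOL-Library.Lattice_Algebras" "HOL-Library.Multiset"
begin

section \<open>Banach lattices as types\<close>

class banach_lattice = banach + ordered_real_vector + lattice_ab_group_add_abs +
  assumes norm_mono_abs: "\<bar>x\<bar> \<le> \<bar>y\<bar> \<Longrightarrow> norm x \<le> norm y"

instance real :: banach_lattice
  by standard (auto simp: sup_real_def)

definition disjoint_seq :: "(nat \<Rightarrow> 'a::banach_lattice) \<Rightarrow> bool" where
  "disjoint_seq x \<longleftrightarrow> (\<forall>m n. m \<noteq> n \<longrightarrow> inf \<bar>x m\<bar> \<bar>x n\<bar> = 0)"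

definition weakly_summable :: "real \<Rightarrow> (nat \<Rightarrow> 'a::real_normed_vector) \<Rightarrow> bool" where
  "weakly_summable p x \<longleftrightarrow> (\<forall>f :: 'a \<Rightarrow>\<^sub>L real. summable (\<lambda>n. \<bar>f (x n)\<bar> powr p))"

definition weakly_null :: "(nat \<Rightarrow> 'a::real_normed_vector) \<Rightarrow> bool" where
  "weakly_null x \<longleftrightarrow> (\<forall>f :: 'a \<Rightarrow>\<^sub>L real. (\<lambda>n. f (x n)) \<longlonglongrightarrow> 0)"

definition dunford_pettis_set :: "'a::banach set \<Rightarrow> bool" where
  "dunford_pettis_set A \<longleftrightarrow>
     (\<forall>f :: nat \<Rightarrow> 'a \<Rightarrow>\<^sub>L real. weakly_null f \<longrightarrow>
        uniform_limit A (\<lambda>n. blinfun_apply (f n)) (\<lambda>x. 0) sequentially)"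

definition disjoint_DPP :: "real \<Rightarrow> 'a::banach_lattice itself \<Rightarrow> bool" where
  "disjoint_DPP p E \<longleftrightarrow>
     (\<forall>x :: nat \<Rightarrow> 'a. disjoint_seq x \<and> weakly_summable p x \<longrightarrow> dunford_pettis_set (range x))"

section \<open>Banach lattices with an explicit carrier\<close>

text \<open>
  A formula can quantify neither over types nor over a type depending on the degree \<open>k\<close>.
  The range space \<open>F\<close> of a polynomial and the spaces of regular \<open>k\<close>-homogeneous polynomials
  are therefore structures on a subset of a type. ``Every Banach lattice \<open>F\<close>'' becomes: every
  Banach lattice whose carrier is a subset of \<open>'f\<close>, for an arbitrary type \<open>'f\<close> that is large
  enough to contain a copy of the set of real sequences, and hence of \<open>c\<^sub>0\<close>.
\<close>

record 'v vlattice =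
  vcarrier :: "'v set"
  vadd :: "'v \<Rightarrow> 'v \<Rightarrow> 'v" (infixl \<open>\<oplus>\<index>\<close> 65)
  vzero :: "'v" (\<open>\<zero>\<index>\<close>)
  vscale :: "real \<Rightarrow> 'v \<Rightarrow> 'v" (infixr \<open>\<odot>\<index>\<close> 75)
  vle :: "'v \<Rightarrow> 'v \<Rightarrow> bool" (infix \<open>\<sqsubseteq>\<index>\<close> 50)
  vnorm :: "'v \<Rightarrow> real" (\<open>\<parallel>_\<parallel>\<index>\<close>)

definition vminus :: "('v, 'b) vlattice_scheme \<Rightarrow> 'v \<Rightarrow> 'v \<Rightarrow> 'v" (infixl \<open>\<ominus>\<index>\<close> 65) where
  "x \<ominus>\<^bsub>V\<^esub> y = x \<oplus>\<^bsub>V\<^esub> ((- 1) \<odot>\<^bsub>V\<^esub> y)"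

definition is_lub_on :: "'v set \<Rightarrow> ('v \<Rightarrow> 'v \<Rightarrow> bool) \<Rightarrow> 'v set \<Rightarrow> 'v \<Rightarrow> bool" where
  "is_lub_on C le A s \<longleftrightarrow> s \<in> C \<and> (\<forall>a\<in>A. le a s) \<and> (\<forall>u\<in>C. (\<forall>a\<in>A. le a u) \<longrightarrow> le s u)"

definition is_glb_on :: "'v set \<Rightarrow> ('v \<Rightarrow> 'v \<Rightarrow> bool) \<Rightarrow> 'v set \<Rightarrow> 'v \<Rightarrow> bool" where
  "is_glb_on C le A s \<longleftrightarrow> s \<in> C \<and> (\<forall>a\<in>A. le s a) \<and> (\<forall>u\<in>C. (\<forall>a\<in>A. le u a) \<longrightarrow> le u s)"

definition vsup :: "('v, 'b) vlattice_scheme \<Rightarrow> 'v \<Rightarrow> 'v \<Rightarrow> 'v" where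
  "vsup V x y = (THE s. is_lub_on (vcarrier V) (vle V) {x, y} s)"

definition vinf :: "('v, 'b) vlattice_scheme \<Rightarrow> 'v \<Rightarrow> 'v \<Rightarrow> 'v" where
  "vinf V x y = (THE s. is_glb_on (vcarrier V) (vle V) {x, y} s)"

definition vabs :: "('v, 'b) vlattice_scheme \<Rightarrow> 'v \<Rightarrow> 'v" where
  "vabs V x = vsup V x ((- 1) \<odot>\<^bsub>V\<^esub> x)"

locale vector_space_carrier =
  fixes V :: "('v, 'b) vlattice_scheme" (structure)
  assumes add_closed: "\<lbrakk>x \<in> vcarrier V; y \<in> vcarrier V\<rbrakk> \<Longrightarrow> x \<oplus> y \<in> vcarrier V"
    and zero_closed: "\<zero> \<in> vcarrier V"
    and scale_closed: "x \<in> vcarrier V \<Longrightarrow> c \<odot> x \<in> vcarrier V"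
    and add_assoc: "\<lbrakk>x \<in> vcarrier V; y \<in> vcarrier V; z \<in> vcarrier V\<rbrakk>
                      \<Longrightarrow> (x \<oplus> y) \<oplus> z = x \<oplus> (y \<oplus> z)"
    and add_commute: "\<lbrakk>x \<in> vcarrier V; y \<in> vcarrier V\<rbrakk> \<Longrightarrow> x \<oplus> y = y \<oplus> x"
    and add_zero: "x \<in> vcarrier V \<Longrightarrow> \<zero> \<oplus> x = x"
    and add_inverse: "x \<in> vcarrier V \<Longrightarrow> x \<ominus> x = \<zero>"
    and scale_add: "\<lbrakk>x \<in> vcarrier V; y \<in> vcarrier V\<rbrakk> \<Longrightarrow> c \<odot> (x \<oplus> y) = (c \<odot> x) \<oplus> (c \<odot> y)"
    and add_scale: "x \<in> vcarrier V \<Longrightarrow> (c + d) \<odot> x = (c \<odot> x) \<oplus> (d \<odot> x)"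
    and scale_scale: "x \<in> vcarrier V \<Longrightarrow> c \<odot> (d \<odot> x) = (c * d) \<odot> x"
    and scale_one: "x \<in> vcarrier V \<Longrightarrow> 1 \<odot> x = x"

locale banach_space_carrier = vector_space_carrier +
  assumes norm_nonneg: "x \<in> vcarrier V \<Longrightarrow> 0 \<le> \<parallel>x\<parallel>"
    and norm_eq_zero: "x \<in> vcarrier V \<Longrightarrow> \<parallel>x\<parallel> = 0 \<longleftrightarrow> x = \<zero>"
    and norm_triangle: "\<lbrakk>x \<in> vcarrier V; y \<in> vcarrier V\<rbrakk> \<Longrightarrow> \<parallel>x \<oplus> y\<parallel> \<le> \<parallel>x\<parallel> + \<parallel>y\<parallel>"
    and norm_scale: "x \<in> vcarrier V \<Longrightarrow> \<parallel>c \<odot> x\<parallel> = \<bar>c\<bar> * \<parallel>x\<parallel>"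
    and complete: "\<lbrakk>\<And>n. X n \<in> vcarrier V; \<And>e. 0 < e \<Longrightarrow> \<exists>N. \<forall>m\<ge>N. \<forall>n\<ge>N. \<parallel>X m \<ominus> X n\<parallel> < e\<rbrakk>
                     \<Longrightarrow> \<exists>l\<in>vcarrier V. (\<lambda>n. \<parallel>X n \<ominus> l\<parallel>) \<longlonglongrightarrow> 0"

locale riesz_space_carrier = vector_space_carrier +
  assumes le_refl: "x \<in> vcarrier V \<Longrightarrow> x \<sqsubseteq> x"
    and le_antisym: "\<lbrakk>x \<in> vcarrier V; y \<in> vcarrier V; x \<sqsubseteq> y; y \<sqsubseteq> x\<rbrakk> \<Longrightarrow> x = y"
    and le_trans: "\<lbrakk>x \<in> vcarrier V; y \<in> vcarrier V; z \<in> vcarrier V; x \<sqsubseteq> y; y \<sqsubseteq> z\<rbrakk> \<Longrightarrow> x \<sqsubseteq> z"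
    and add_mono: "\<lbrakk>x \<in> vcarrier V; y \<in> vcarrier V; z \<in> vcarrier V; x \<sqsubseteq> y\<rbrakk> \<Longrightarrow> x \<oplus> z \<sqsubseteq> y \<oplus> z"
    and scale_mono: "\<lbrakk>x \<in> vcarrier V; y \<in> vcarrier V; x \<sqsubseteq> y; 0 \<le> c\<rbrakk> \<Longrightarrow> c \<odot> x \<sqsubseteq> c \<odot> y"
    and lub_exists: "\<lbrakk>x \<in> vcarrier V; y \<in> vcarrier V\<rbrakk> \<Longrightarrow> \<exists>s. is_lub_on (vcarrier V) (vle V) {x, y} s"
    and glb_exists: "\<lbrakk>x \<in> vcarrier V; y \<in> vcarrier V\<rbrakk> \<Longrightarrow> \<exists>s. is_glb_on (vcarrier V) (vle V) {x, y} s"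

locale banach_lattice_carrier = banach_space_carrier + riesz_space_carrier +
  assumes norm_mono: "\<lbrakk>x \<in> vcarrier V; y \<in> vcarrier V; vabs V x \<sqsubseteq> vabs V y\<rbrakk> \<Longrightarrow> \<parallel>x\<parallel> \<le> \<parallel>y\<parallel>"

text \<open>The values of a functional outside the carrier are irrelevant.\<close>

definition vdual :: "('v, 'b) vlattice_scheme \<Rightarrow> ('v \<Rightarrow> real) set" where
  "vdual V = {f. (\<forall>x\<in>vcarrier V. \<forall>y\<in>vcarrier V. f (x \<oplus>\<^bsub>V\<^esub> y) = f x + f y) \<and>
                 (\<forall>c. \<forall>x\<in>vcarrier V. f (c \<odot>\<^bsub>V\<^esub> x) = c * f x) \<and>
                 (\<exists>B. \<forall>x\<in>vcarrier V. \<bar>f x\<bar> \<le> B * \<parallel>x\<parallel>\<^bsub>V\<^esub>)}"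

definition weak_topology :: "('v, 'b) vlattice_scheme \<Rightarrow> 'v topology" where
  "weak_topology V =
     topology_generated_by {{x \<in> vcarrier V. f x \<in> U} | f U. f \<in> vdual V \<and> open U}"

definition relatively_weakly_compact :: "('v, 'b) vlattice_scheme \<Rightarrow> 'v set \<Rightarrow> bool" where
  "relatively_weakly_compact V A \<longleftrightarrow>
     A \<subseteq> vcarrier V \<and> compactin (weak_topology V) (weak_topology V closure_of A)"

text \<open>
  A net decreasing to zero is represented by its range, a downward directed set \<open>D\<close> with
  infimum zero, indexed by itself.
\<close>

definition order_continuous_norm :: "('v, 'b) vlattice_scheme \<Rightarrow> bool" where
  "order_continuous_norm V \<longleftrightarrow>
     (\<forall>D \<subseteq> vcarrier V.
        D \<noteq> {} \<and> (\<forall>a\<in>D. \<forall>b\<in>D. \<exists>c\<in>D. c \<sqsubseteq>\<^bsub>V\<^esub> a \<and> c \<sqsubseteq>\<^bsub>V\<^esub> b) \<and>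
        is_glb_on (vcarrier V) (vle V) D \<zero>\<^bsub>V\<^esub> \<longrightarrow>
        (\<forall>e>0. \<exists>d\<in>D. \<forall>c\<in>D. c \<sqsubseteq>\<^bsub>V\<^esub> d \<longrightarrow> \<parallel>c\<parallel>\<^bsub>V\<^esub> < e))"

definition vpositive_seq :: "('v, 'b) vlattice_scheme \<Rightarrow> (nat \<Rightarrow> 'v) \<Rightarrow> bool" where
  "vpositive_seq V x \<longleftrightarrow> (\<forall>n. x n \<in> vcarrier V \<and> \<zero>\<^bsub>V\<^esub> \<sqsubseteq>\<^bsub>V\<^esub> x n)"

definition vdisjoint_seq :: "('v, 'b) vlattice_scheme \<Rightarrow> (nat \<Rightarrow> 'v) \<Rightarrow> bool" where
  "vdisjoint_seq V x \<longleftrightarrow> (\<forall>n. x n \<in> vcarrier V) \<and>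
     (\<forall>m n. m \<noteq> n \<longrightarrow> vinf V (vabs V (x m)) (vabs V (x n)) = \<zero>\<^bsub>V\<^esub>)"

definition vweakly_null :: "('v, 'b) vlattice_scheme \<Rightarrow> (nat \<Rightarrow> 'v) \<Rightarrow> bool" where
  "vweakly_null V x \<longleftrightarrow> (\<forall>n. x n \<in> vcarrier V) \<and> (\<forall>f\<in>vdual V. (\<lambda>n. f (x n)) \<longlonglongrightarrow> 0)"

definition real_vlattice :: "real vlattice" where
  "real_vlattice = \<lparr>vcarrier = UNIV, vadd = (+), vzero = 0, vscale = (*), vle = (\<le>), vnorm = abs\<rparr>"

definition c0 :: "(nat \<Rightarrow> real) vlattice" where
  "c0 = \<lparr>vcarrier = {a. a \<longlonglongrightarrow> 0}, vadd = (\<lambda>a b n. a n + b n), vzero = (\<lambda>n. 0),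
         vscale = (\<lambda>c a n. c * a n), vle = (\<lambda>a b. \<forall>n. a n \<le> b n), vnorm = (\<lambda>a. SUP n. \<bar>a n\<bar>)\<rparr>"

section \<open>Homogeneous polynomials\<close>

text \<open>
  A map on the \<open>k\<close>-fold product of \<open>E\<close> is a function on lists, of which only the values on
  lists of length \<open>k\<close> matter. Lists have equal multisets iff they are permutations of each other.
\<close>

definition symmetric_multilinear ::
    "('v, 'b) vlattice_scheme \<Rightarrow> nat \<Rightarrow> ('a::real_vector list \<Rightarrow> 'v) \<Rightarrow> bool" where
  "symmetric_multilinear F k T \<longleftrightarrow>
     (\<forall>xs. length xs = k \<longrightarrow> T xs \<in> vcarrier F) \<and>
     (\<forall>xs i u v. length xs = k \<and> i < k \<longrightarrow>
        T (xs[i := u + v]) = T (xs[i := u]) \<oplus>\<^bsub>F\<^esub> T (xs[i := v])) \<and>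
     (\<forall>xs i c u. length xs = k \<and> i < k \<longrightarrow> T (xs[i := c *\<^sub>R u]) = c \<odot>\<^bsub>F\<^esub> T (xs[i := u])) \<and>
     (\<forall>xs ys. length xs = k \<and> mset xs = mset ys \<longrightarrow> T xs = T ys)"

definition associated_operator ::
    "('v, 'b) vlattice_scheme \<Rightarrow> nat \<Rightarrow> ('a::real_vector \<Rightarrow> 'v) \<Rightarrow> ('a list \<Rightarrow> 'v) \<Rightarrow> bool" where
  "associated_operator F k P T \<longleftrightarrow>
     symmetric_multilinear F k T \<and> (\<forall>x. P x = T (replicate k x))"

text \<open>
  By polarization the associated operator is unique on lists of length \<open>k\<close>. Positive operators
  between Banach lattices are automatically continuous.
\<close>

definition positive_poly ::
    "('v, 'b) vlattice_scheme \<Rightarrow> nat \<Rightarrow> ('a::banach_lattice \<Rightarrow> 'v) \<Rightarrow> bool" where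
  "positive_poly F k P \<longleftrightarrow>
     (\<exists>T. associated_operator F k P T \<and>
          (\<forall>xs. length xs = k \<and> (\<forall>x\<in>set xs. 0 \<le> x) \<longrightarrow> \<zero>\<^bsub>F\<^esub> \<sqsubseteq>\<^bsub>F\<^esub> T xs))"

definition weakly_compact_poly ::
    "('v, 'b) vlattice_scheme \<Rightarrow> ('a::real_normed_vector \<Rightarrow> 'v) \<Rightarrow> bool" where
  "weakly_compact_poly F P \<longleftrightarrow> relatively_weakly_compact F (P ` cball 0 1)"

definition disjoint_convergent ::
    "('v, 'b) vlattice_scheme \<Rightarrow> real \<Rightarrow> ('a::banach_lattice \<Rightarrow> 'v) \<Rightarrow> bool" where
  "disjoint_convergent F p P \<longleftrightarrow>
     (\<forall>x. disjoint_seq x \<and> weakly_summable p x \<longrightarrow> (\<lambda>n. \<parallel>P (x n)\<parallel>\<^bsub>F\<^esub>) \<longlonglongrightarrow> 0)"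

definition regular_polys ::
    "('v, 'b) vlattice_scheme \<Rightarrow> nat \<Rightarrow> ('a::banach_lattice \<Rightarrow> 'v) set" where
  "regular_polys F k =
     {P. \<exists>Q R. positive_poly F k Q \<and> positive_poly F k R \<and> (\<forall>x. P x = Q x \<ominus>\<^bsub>F\<^esub> R x)}"

definition poly_le ::
    "('v, 'b) vlattice_scheme \<Rightarrow> nat \<Rightarrow> ('a::banach_lattice \<Rightarrow> 'v) \<Rightarrow> ('a \<Rightarrow> 'v) \<Rightarrow> bool" where
  "poly_le F k P Q \<longleftrightarrow> positive_poly F k (\<lambda>x. Q x \<ominus>\<^bsub>F\<^esub> P x)"

definition poly_abs ::
    "('v, 'b) vlattice_scheme \<Rightarrow> nat \<Rightarrow> ('a::banach_lattice \<Rightarrow> 'v) \<Rightarrow> 'a \<Rightarrow> 'v" where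
  "poly_abs F k P =
     (THE S. is_lub_on (regular_polys F k) (poly_le F k) {P, \<lambda>x. (- 1) \<odot>\<^bsub>F\<^esub> P x} S)"

definition poly_norm ::
    "('v, 'b) vlattice_scheme \<Rightarrow> ('a::real_normed_vector \<Rightarrow> 'v) \<Rightarrow> real" where
  "poly_norm F P = (SUP x\<in>cball 0 1. \<parallel>P x\<parallel>\<^bsub>F\<^esub>)"

text \<open>
  For Dedekind complete \<open>F\<close>, in particular for \<^const>\<open>real_vlattice\<close>, the absolute value always
  exists and the following structure is a Banach lattice.
\<close>

definition regular_poly_space ::
    "('v, 'b) vlattice_scheme \<Rightarrow> nat \<Rightarrow> ('a::banach_lattice \<Rightarrow> 'v) vlattice" where
  "regular_poly_space F k =
     \<lparr>vcarrier = regular_polys F k,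
      vadd = (\<lambda>P Q x. P x \<oplus>\<^bsub>F\<^esub> Q x),
      vzero = (\<lambda>x. \<zero>\<^bsub>F\<^esub>),
      vscale = (\<lambda>c P x. c \<odot>\<^bsub>F\<^esub> P x),
      vle = poly_le F k,
      vnorm = (\<lambda>P. poly_norm F (poly_abs F k P))\<rparr>"

end

theory Submission
  imports Defs
begin

text \<open>
  Throughout, \<open>x\<close> denotes a disjoint weakly \<open>p\<close>-summable sequence in \<open>E\<close>. The disjoint Dunford-Pettis
  property says that \<open>f n (x n)\<close> tends to zero for every weakly null sequence \<open>f\<close> of functionals
  (\<open>disjoint_DPP_diagonal\<close>), and polynomials are reduced to this by exchanging their arguments one
  at a time for elements of the bidual.

  Let \<open>T n\<close> be the \<open>k\<close>-linear forms of a sequence of polynomials, and evaluate forms at bidual elements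
  by iteration, \<open>\<Phi>\<^sub>1 (y\<^sub>1 \<mapsto> \<Phi>\<^sub>2 (y\<^sub>2 \<mapsto> \<dots>))\<close>. If \<open>T n (x n, \<dots>, x n, \<Phi>\<^sub>1, \<Phi>\<^sub>2, \<dots>)\<close> tends to zero for
  all bidual elements, then for fixed \<open>\<Phi>\<^sub>2, \<dots>\<close> the functionals \<open>y \<mapsto> T n (x n, \<dots>, x n, y, \<Phi>\<^sub>2, \<dots>)\<close> are
  weakly null, so \<open>y\<close> may be replaced by \<open>x n\<close>. After \<open>k\<close> steps (\<open>bidual_descent\<close>), \<open>P n (x n)\<close>
  tends to zero provided that all evaluations of \<open>T n\<close> at bidual elements do. For a weakly null
  sequence of regular polynomials this holds because these evaluations are bounded functionals on the
  space of regular polynomials (\<open>disjoint_DPP_imp_polys_null\<close>). Their boundedness for the regular norm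
  rests on the existence of the modulus of a regular form, which the Riesz--Kantorovich formula
  provides (\<open>modulus_form_exists\<close>).

  For a positive weakly compact \<open>P\<close> with range in a Banach lattice with order continuous norm one
  argues by contradiction and composes \<open>P\<close> with positive functionals \<open>h i\<close> that stay away from zero on
  a subsequence of \<open>P \<bar>x n\<bar>\<close>. Taking substitutes for the positive parts of
  \<open>y i - 4\<^sup>i \<Sum>\<^sub>j\<^sub><\<^sub>i y j\<close>, where the \<open>y i\<close> nearly norm the values of \<open>P\<close>, and using order continuity
  (\<open>order_bounded_diagonal_null\<close>), the \<open>h i\<close> can be made to tend to zero pointwise. By weak
  compactness and Goldstine's theorem the evaluations of \<open>h i \<circ> P\<close> at given bidual elements are
  dominated by \<open>h i W\<close> for one element \<open>W\<close> (\<open>bidual_eval_dominated\<close>), so they tend to zero and the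
  descent gives the contradiction (\<open>disjoint_DPP_imp_disjoint_convergent\<close>).

  Conversely, suppose that the property fails. There are then \<open>X n = \<bar>x n\<bar>\<close>, a weakly null \<open>f\<close> and
  positive functionals \<open>g n\<close> with \<open>g n (X n) \<ge> \<epsilon>\<close>, each below the component of \<open>\<bar>f n\<bar>\<close> in the band
  generated by \<open>X n\<close>. No subsequence of \<open>g\<close> dominates the positive cone of \<open>\<ell>\<^sub>1\<close>
  (\<open>localised_not_l1\<close>), since otherwise a gliding hump would produce a functional that does not tend
  to zero along \<open>f\<close>. Consequently the polynomials \<open>(g n)\<^sup>k\<close> are positive, disjoint and weakly null, and
  \<open>z \<mapsto> (g n z)\<^sup>k\<close> defines a positive weakly compact polynomial into \<open>c0\<close>; both are bounded away from
  zero along \<open>X\<close>, which refutes every other statement.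
\<close>

section \<open>Linear functionals below a sublinear functional\<close>

context vector_space_carrier
begin

lemma add_zero_right: "x \<in> vcarrier V \<Longrightarrow> x \<oplus> \<zero> = x"
  using add_commute add_zero zero_closed by metis

lemma zero_scale: "x \<in> vcarrier V \<Longrightarrow> 0 \<odot> x = \<zero>"
  using add_scale[of x 1 "-1"] add_inverse[of x] by (simp add: vminus_def scale_one)

lemma scale_zero: "c \<odot> \<zero> = \<zero>"
  using zero_scale[OF zero_closed] scale_scale[OF zero_closed, of c 0] by simp

lemma neg_closed: "x \<in> vcarrier V \<Longrightarrow> (- 1) \<odot> x \<in> vcarrier V"
  by (rule scale_closed)

lemma minus_closed: "x \<in> vcarrier V \<Longrightarrow> y \<in> vcarrier V \<Longrightarrow> x \<ominus> y \<in> vcarrier V"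
  by (simp add: vminus_def add_closed scale_closed)

lemma add_neg: "x \<in> vcarrier V \<Longrightarrow> x \<oplus> ((- 1) \<odot> x) = \<zero>"
  using add_inverse by (simp add: vminus_def)

lemma neg_add: "x \<in> vcarrier V \<Longrightarrow> ((- 1) \<odot> x) \<oplus> x = \<zero>"
  using add_neg add_commute scale_closed by metis

lemma add_left_commute:
  "\<lbrakk>x \<in> vcarrier V; y \<in> vcarrier V; z \<in> vcarrier V\<rbrakk> \<Longrightarrow> x \<oplus> (y \<oplus> z) = y \<oplus> (x \<oplus> z)"
  using add_assoc add_commute by metis

lemma add_minus_cancel: "\<lbrakk>x \<in> vcarrier V; y \<in> vcarrier V\<rbrakk> \<Longrightarrow> (x \<oplus> y) \<oplus> ((- 1) \<odot> y) = x"
  by (simp add: add_assoc add_neg add_zero_right scale_closed)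

lemma minus_add_cancel: "\<lbrakk>x \<in> vcarrier V; y \<in> vcarrier V\<rbrakk> \<Longrightarrow> (x \<ominus> y) \<oplus> y = x"
  by (simp add: vminus_def add_assoc neg_add add_zero_right scale_closed)

end

definition sublinear_on :: "('v, 'b) vlattice_scheme \<Rightarrow> ('v \<Rightarrow> real) \<Rightarrow> bool" where
  "sublinear_on V q \<longleftrightarrow>
     (\<forall>x\<in>vcarrier V. \<forall>y\<in>vcarrier V. q (x \<oplus>\<^bsub>V\<^esub> y) \<le> q x + q y) \<and>
     (\<forall>c\<ge>0. \<forall>x\<in>vcarrier V. q (c \<odot>\<^bsub>V\<^esub> x) = c * q x)"

definition linear_on_carrier :: "('v, 'b) vlattice_scheme \<Rightarrow> ('v \<Rightarrow> real) \<Rightarrow> bool" where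
  "linear_on_carrier V g \<longleftrightarrow>
     (\<forall>x\<in>vcarrier V. \<forall>y\<in>vcarrier V. g (x \<oplus>\<^bsub>V\<^esub> y) = g x + g y) \<and>
     (\<forall>c. \<forall>x\<in>vcarrier V. g (c \<odot>\<^bsub>V\<^esub> x) = c * g x)"

definition cone_of_constraints :: "('v, 'b) vlattice_scheme \<Rightarrow> ('v \<times> real) set \<Rightarrow> bool" where
  "cone_of_constraints V G \<longleftrightarrow>
     G \<subseteq> vcarrier V \<times> UNIV \<and> (\<zero>\<^bsub>V\<^esub>, 0) \<in> G \<and>
     (\<forall>v c w d. (v, c) \<in> G \<and> (w, d) \<in> G \<longrightarrow> (v \<oplus>\<^bsub>V\<^esub> w, c + d) \<in> G) \<and>
     (\<forall>t\<ge>0. \<forall>v c. (v, c) \<in> G \<longrightarrow> (t \<odot>\<^bsub>V\<^esub> v, t * c) \<in> G)"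

context vector_space_carrier
begin

lemma sublinear_zero: "sublinear_on V q \<Longrightarrow> q \<zero> = 0"
  unfolding sublinear_on_def using zero_closed scale_zero[of 0]
  by (metis mult_zero_left order_refl)

lemma sublinear_lower:
  assumes "sublinear_on V q" "x \<in> vcarrier V"
  shows "- q ((- 1) \<odot> x) \<le> q x"
proof -
  have "q (x \<oplus> ((- 1) \<odot> x)) \<le> q x + q ((- 1) \<odot> x)"
    using assms scale_closed unfolding sublinear_on_def by blast
  then show ?thesis using sublinear_zero[OF assms(1)] add_neg[OF assms(2)] by simp
qed

lemma sublinear_odd_imp_linear:
  assumes q: "sublinear_on V q" and odd: "\<And>x. x \<in> vcarrier V \<Longrightarrow> q ((- 1) \<odot> x) = - q x"
  shows "linear_on_carrier V q"
proof -
  have add: "q (x \<oplus> y) = q x + q y" if x: "x \<in> vcarrier V" and y: "y \<in> vcarrier V" for x y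
  proof (rule antisym)
    show "q (x \<oplus> y) \<le> q x + q y" using q x y unfolding sublinear_on_def by blast
    have "q x = q ((x \<oplus> y) \<oplus> ((- 1) \<odot> y))" using x y by (simp add: add_minus_cancel)
    also have "\<dots> \<le> q (x \<oplus> y) + q ((- 1) \<odot> y)"
      using q x y add_closed scale_closed unfolding sublinear_on_def by blast
    finally show "q x + q y \<le> q (x \<oplus> y)" using odd y by simp
  qed
  have "q (c \<odot> x) = c * q x" if x: "x \<in> vcarrier V" for c x
  proof (cases "0 \<le> c")
    case True then show ?thesis using q x unfolding sublinear_on_def by blast
  next
    case False
    have "c \<odot> x = (- 1) \<odot> ((- c) \<odot> x)" using x by (simp add: scale_scale)
    then have "q (c \<odot> x) = - q ((- c) \<odot> x)" using odd x scale_closed by simp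
    also have "q ((- c) \<odot> x) = (- c) * q x"
      using False q x unfolding sublinear_on_def by simp
    finally show ?thesis by simp
  qed
  with add show ?thesis unfolding linear_on_carrier_def by blast
qed

text \<open>
  Both the extension theorem and its proof lower a sublinear functional so that it takes
  prescribed values; the following construction does this without losing sublinearity.
\<close>

lemma sublinear_shift:
  assumes q: "sublinear_on V q" and G: "cone_of_constraints V G"
    and le: "\<forall>v c. (v, c) \<in> G \<longrightarrow> c \<le> q v"
  defines "r \<equiv> \<lambda>x. (INF (v, c) \<in> G. q (x \<oplus> v) - c)"
  shows "sublinear_on V r" and "\<And>x. x \<in> vcarrier V \<Longrightarrow> r x \<le> q x"
    and "\<And>v c. (v, c) \<in> G \<Longrightarrow> r ((- 1) \<odot> v) \<le> - c"
proof -
  have Gc: "v \<in> vcarrier V" if "(v, c) \<in> G" for v c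
    using G that unfolding cone_of_constraints_def by blast
  have low: "- q ((- 1) \<odot> x) \<le> q (x \<oplus> v) - c" if x: "x \<in> vcarrier V" and vc: "(v, c) \<in> G" for x v c
  proof -
    have v: "v \<in> vcarrier V" using Gc vc .
    have "q v = q ((x \<oplus> v) \<oplus> ((- 1) \<odot> x))"
      using add_minus_cancel[OF v x] add_commute[OF x v] by simp
    also have "\<dots> \<le> q (x \<oplus> v) + q ((- 1) \<odot> x)"
      using q x v add_closed scale_closed unfolding sublinear_on_def by blast
    finally show ?thesis using le vc by force
  qed
  have bdd: "bdd_below ((\<lambda>(v, c). q (x \<oplus> v) - c) ` G)" if "x \<in> vcarrier V" for x
    using low[OF that] by (intro bdd_belowI2[where m = "- q ((- 1) \<odot> x)"]) auto
  have ne: "G \<noteq> {}" using G unfolding cone_of_constraints_def by blast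
  have rle: "r x \<le> q (x \<oplus> v) - c" if "x \<in> vcarrier V" "(v, c) \<in> G" for x v c
    unfolding r_def using cINF_lower[OF bdd[OF that(1)] that(2)] by simp
  have rgr: "m \<le> r x" if "\<And>v c. (v, c) \<in> G \<Longrightarrow> m \<le> q (x \<oplus> v) - c" for m x
    unfolding r_def using ne that by (intro cINF_greatest) auto
  show "r x \<le> q x" if "x \<in> vcarrier V" for x
    using rle[OF that, of \<zero> 0] G that unfolding cone_of_constraints_def
    by (simp add: add_zero_right)
  show "r ((- 1) \<odot> v) \<le> - c" if "(v, c) \<in> G" for v c
    using rle[OF neg_closed[OF Gc[OF that]] that] Gc[OF that] sublinear_zero[OF q]
    by (simp add: neg_add)
  have sub: "r (x \<oplus> y) \<le> r x + r y" if x: "x \<in> vcarrier V" and y: "y \<in> vcarrier V" for x y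
  proof -
    have "r (x \<oplus> y) - (q (x \<oplus> v) - c) \<le> r y" if vc: "(v, c) \<in> G" for v c
    proof (rule rgr)
      fix w d assume wd: "(w, d) \<in> G"
      have v: "v \<in> vcarrier V" and w: "w \<in> vcarrier V" using Gc vc wd by auto
      have "r (x \<oplus> y) \<le> q ((x \<oplus> y) \<oplus> (v \<oplus> w)) - (c + d)"
        using G vc wd x y by (intro rle) (auto simp: cone_of_constraints_def add_closed)
      also have "(x \<oplus> y) \<oplus> (v \<oplus> w) = (x \<oplus> v) \<oplus> (y \<oplus> w)"
        using x y v w by (simp add: add_assoc add_left_commute add_closed)
      also have "q \<dots> \<le> q (x \<oplus> v) + q (y \<oplus> w)"
        using q x y v w add_closed unfolding sublinear_on_def by blast
      finally show "r (x \<oplus> y) - (q (x \<oplus> v) - c) \<le> q (y \<oplus> w) - d" by simp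
    qed
    then have "r (x \<oplus> y) - r y \<le> r x" by (intro rgr) (smt (verit))
    then show ?thesis by simp
  qed
  have le_scale: "r (t \<odot> x) \<le> t * r x" if t: "t > 0" and x: "x \<in> vcarrier V" for t x
  proof -
    have "r (t \<odot> x) / t \<le> r x"
    proof (rule rgr)
      fix v c assume vc: "(v, c) \<in> G"
      have v: "v \<in> vcarrier V" using Gc vc .
      have "r (t \<odot> x) \<le> q ((t \<odot> x) \<oplus> (t \<odot> v)) - t * c"
        using G vc t x scale_closed by (intro rle) (auto simp: cone_of_constraints_def)
      also have "(t \<odot> x) \<oplus> (t \<odot> v) = t \<odot> (x \<oplus> v)" using x v by (simp add: scale_add)
      also have "q \<dots> = t * q (x \<oplus> v)"
        using q t x v add_closed unfolding sublinear_on_def by simp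
      finally show "r (t \<odot> x) / t \<le> q (x \<oplus> v) - c" using t by (simp add: field_simps)
    qed
    then show ?thesis using t by (simp add: field_simps)
  qed
  have scale: "r (t \<odot> x) = t * r x" if t: "t \<ge> 0" and x: "x \<in> vcarrier V" for t x
  proof (cases "t = 0")
    case True
    have "r \<zero> \<ge> 0" using le Gc by (intro rgr) (simp add: add_zero)
    moreover have "r \<zero> \<le> 0"
      using rle[OF zero_closed, of \<zero> 0] G sublinear_zero[OF q] zero_closed
      unfolding cone_of_constraints_def by (simp add: add_zero)
    ultimately show ?thesis using True x by (simp add: zero_scale)
  next
    case False
    then have t: "t > 0" using that by simp
    have "r ((1 / t) \<odot> (t \<odot> x)) \<le> (1 / t) * r (t \<odot> x)"
      using t x scale_closed by (intro le_scale) auto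
    then have "t * r x \<le> r (t \<odot> x)"
      using t x by (simp add: scale_scale scale_one field_simps)
    then show ?thesis using le_scale[OF t x] by simp
  qed
  show "sublinear_on V r" unfolding sublinear_on_def using sub scale by blast
qed

text \<open>
  A minimal sublinear functional is odd, for otherwise it could be lowered at the negative of
  some vector; and an odd sublinear functional is linear.
\<close>

theorem hahn_banach_sublinear:
  assumes q: "sublinear_on V q"
  obtains g where "linear_on_carrier V g" and "\<And>x. x \<in> vcarrier V \<Longrightarrow> g x \<le> q x"
proof -
  \<comment> \<open>Functionals vanish off the carrier so that the pointwise order on the carrier is antisymmetric.\<close>
  define A where "A = {s. sublinear_on V s \<and> (\<forall>x\<in>vcarrier V. s x \<le> q x) \<and> (\<forall>x. x \<notin> vcarrier V \<longrightarrow> s x = 0)}"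
  define P where "P s t \<longleftrightarrow> (\<forall>x\<in>vcarrier V. t x \<le> s x)" for s t :: "_ \<Rightarrow> real"
  have cut: "(\<lambda>x. if x \<in> vcarrier V then s x else 0) \<in> A"
    if "sublinear_on V s" "\<And>x. x \<in> vcarrier V \<Longrightarrow> s x \<le> q x" for s
    using that unfolding A_def sublinear_on_def by (auto simp: add_closed scale_closed)
  have po: "partial_order_on A (relation_of P A)"
  proof (rule partial_order_on_relation_ofI)
    fix s t assume "s \<in> A" "t \<in> A" "P s t" "P t s"
    then show "s = t" unfolding A_def P_def by (intro ext) (metis (mono_tags, lifting) antisym mem_Collect_eq)
  qed (auto simp: P_def intro: order_trans)
  have "\<exists>m\<in>A. \<forall>a\<in>A. P m a \<longrightarrow> a = m"
  proof (rule predicate_Zorn[OF po])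
    fix C assume C: "C \<in> Chains (relation_of P A)"
    have CA: "C \<subseteq> A" using C unfolding Chains_def relation_of_def by blast
    have tot: "P s t \<or> P t s" if "s \<in> C" "t \<in> C" for s t
      using C that unfolding Chains_def relation_of_def by blast
    show "\<exists>u\<in>A. \<forall>a\<in>C. P a u"
    proof (cases "C = {}")
      case True
      then show ?thesis using cut[OF q] by auto
    next
      case ne: False
      define u where "u x = (INF s\<in>C. s x)" for x
      have low: "- q ((- 1) \<odot> x) \<le> s x" if "s \<in> C" "x \<in> vcarrier V" for s x
      proof -
        have "- s ((- 1) \<odot> x) \<le> s x" using CA that sublinear_lower unfolding A_def by blast
        moreover have "s ((- 1) \<odot> x) \<le> q ((- 1) \<odot> x)"
          using CA that scale_closed unfolding A_def by blast
        ultimately show ?thesis by simp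
      qed
      have ule: "u x \<le> s x" if "s \<in> C" "x \<in> vcarrier V" for s x
        unfolding u_def using low that by (intro cINF_lower bdd_belowI2) auto
      have ugr: "m \<le> u x" if "\<And>s. s \<in> C \<Longrightarrow> m \<le> s x" for m x
        unfolding u_def using ne that by (intro cINF_greatest) auto
      have "u (x \<oplus> y) \<le> u x + u y" if x: "x \<in> vcarrier V" and y: "y \<in> vcarrier V" for x y
      proof -
        have "u (x \<oplus> y) - s x \<le> u y" if s: "s \<in> C" for s
        proof (rule ugr)
          fix t assume t: "t \<in> C"
          obtain w where w: "w \<in> C" "w x \<le> s x" "w y \<le> t y"
            using tot[OF s t] s t x y unfolding P_def by (metis order_refl)
          have "u (x \<oplus> y) \<le> w (x \<oplus> y)" using ule w x y add_closed by blast
          also have "\<dots> \<le> w x + w y" using CA w x y unfolding A_def sublinear_on_def by blast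
          finally show "u (x \<oplus> y) - s x \<le> t y" using w by simp
        qed
        then have "u (x \<oplus> y) - u y \<le> u x" by (intro ugr) (smt (verit))
        then show ?thesis by simp
      qed
      moreover have "u (c \<odot> x) = c * u x" if c: "0 \<le> c" and x: "x \<in> vcarrier V" for c x
      proof -
        have eq: "s (c \<odot> x) = c * s x" if "s \<in> C" for s
          using CA that c x unfolding A_def sublinear_on_def by blast
        have bb: "bdd_below ((\<lambda>s. s x) ` C)" using low x by (intro bdd_belowI2) auto
        have "u (c \<odot> x) = (INF s\<in>C. c * s x)" unfolding u_def using eq by (intro INF_cong) auto
        also have "\<dots> = c * u x"
        proof (cases "c = 0")
          case True then show ?thesis using ne by simp
        next
          case False
          then have c0: "c > 0" using c by simp
          show ?thesis
          proof (rule antisym)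
            have "(INF s\<in>C. c * s x) / c \<le> u x"
            proof (rule ugr)
              fix s assume s: "s \<in> C"
              have "(INF s\<in>C. c * s x) \<le> c * s x"
                using s c0 low x
                by (intro cINF_lower bdd_belowI2[where m = "c * - q ((- 1) \<odot> x)"] mult_left_mono) auto
              then show "(INF s\<in>C. c * s x) / c \<le> s x" using c0 by (simp add: field_simps)
            qed
            then show "(INF s\<in>C. c * s x) \<le> c * u x" using c0 by (simp add: field_simps)
            show "c * u x \<le> (INF s\<in>C. c * s x)"
              using ne ule x c0 by (intro cINF_greatest mult_left_mono) auto
          qed
        qed
        finally show ?thesis .
      qed
      ultimately have "sublinear_on V u" unfolding sublinear_on_def by blast
      moreover have "u x \<le> q x" if "x \<in> vcarrier V" for x
      proof -
        obtain s where s: "s \<in> C" using ne by blast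
        then have "s x \<le> q x" using CA that unfolding A_def by blast
        then show ?thesis using ule[OF s that] by linarith
      qed
      ultimately have "(\<lambda>x. if x \<in> vcarrier V then u x else 0) \<in> A" by (rule cut)
      moreover have "P a (\<lambda>x. if x \<in> vcarrier V then u x else 0)" if "a \<in> C" for a
        using ule that unfolding P_def by simp
      ultimately show ?thesis by blast
    qed
  qed
  then obtain m where m: "m \<in> A" and min: "\<And>a. a \<in> A \<Longrightarrow> P m a \<Longrightarrow> a = m" by blast
  have ms: "sublinear_on V m" and mq: "\<And>x. x \<in> vcarrier V \<Longrightarrow> m x \<le> q x" using m unfolding A_def by auto
  have "m ((- 1) \<odot> x) = - m x" if x: "x \<in> vcarrier V" for x
  proof -
    define G where "G = {(t \<odot> x, t * m x) |t. 0 \<le> t}"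
    have G: "cone_of_constraints V G"
      unfolding cone_of_constraints_def
    proof (intro conjI allI impI)
      show "(\<zero>, 0) \<in> G" unfolding G_def using zero_scale[OF x] by (auto intro!: exI[of _ 0])
      fix v c w d assume "(v, c) \<in> G \<and> (w, d) \<in> G"
      then obtain s t where "v = s \<odot> x" "c = s * m x" "w = t \<odot> x" "d = t * m x" "0 \<le> s" "0 \<le> t"
        unfolding G_def by blast
      then show "(v \<oplus> w, c + d) \<in> G"
        unfolding G_def using x by (auto intro!: exI[of _ "s + t"] simp: add_scale algebra_simps)
    next
      fix t :: real and v c assume "0 \<le> t" "(v, c) \<in> G"
      then obtain s where "v = s \<odot> x" "c = s * m x" "0 \<le> s" unfolding G_def by blast
      then show "(t \<odot> v, t * c) \<in> G" unfolding G_def using x \<open>0 \<le> t\<close>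
        by (auto intro!: exI[of _ "t * s"] simp: scale_scale)
    qed (use x in \<open>auto simp: G_def scale_closed\<close>)
    have le: "\<forall>v c. (v, c) \<in> G \<longrightarrow> c \<le> m v"
      using ms x unfolding G_def sublinear_on_def by force
    note sh = sublinear_shift[OF ms G le]
    let ?r = "\<lambda>x. (INF (v, c) \<in> G. m (x \<oplus> v) - c)"
    let ?s = "\<lambda>x. if x \<in> vcarrier V then ?r x else 0"
    have "?r y \<le> q y" if "y \<in> vcarrier V" for y
      using sh(2)[OF that] mq[OF that] by linarith
    then have "?s \<in> A" using sh(1) by (intro cut)
    moreover have "P m ?s" using sh(2) unfolding P_def by simp
    ultimately have sm: "?s = m" by (rule min)
    have "?r ((- 1) \<odot> x) \<le> - m x"
    proof (rule sh(3))
      show "(x, m x) \<in> G" unfolding G_def using x by (auto intro!: exI[of _ 1] simp: scale_one)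
    qed
    moreover have "m ((- 1) \<odot> x) = ?r ((- 1) \<odot> x)"
      using fun_cong[OF sm, of "(- 1) \<odot> x"] neg_closed[OF x] by (simp only: if_True)
    ultimately have "m ((- 1) \<odot> x) \<le> - m x" by linarith
    moreover have "- m ((- 1) \<odot> x) \<le> m x" using sublinear_lower[OF ms x] .
    ultimately show ?thesis by linarith
  qed
  then have "linear_on_carrier V m" using sublinear_odd_imp_linear[OF ms] by blast
  then show thesis using that mq by blast
qed

text \<open>
  The Mazur--Orlicz form of the theorem: a family of lower bounds \<open>c \<le> g v\<close> can be met by one
  linear functional \<open>g \<le> q\<close> as soon as no nonnegative combination of them contradicts \<open>q\<close>. All
  functionals below are produced in this way.
\<close>

theorem mazur_orlicz:
  assumes q: "sublinear_on V q" and G: "cone_of_constraints V G"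
    and le: "\<forall>v c. (v, c) \<in> G \<longrightarrow> c \<le> q v"
  obtains g where "linear_on_carrier V g" and "\<And>x. x \<in> vcarrier V \<Longrightarrow> g x \<le> q x"
    and "\<And>v c. (v, c) \<in> G \<Longrightarrow> c \<le> g v"
proof -
  note sh = sublinear_shift[OF q G le]
  obtain g where g: "linear_on_carrier V g"
    and gr: "\<And>x. x \<in> vcarrier V \<Longrightarrow> g x \<le> (INF (v, c) \<in> G. q (x \<oplus> v) - c)"
    using hahn_banach_sublinear[OF sh(1)] by blast
  have "c \<le> g v" if "(v, c) \<in> G" for v c
  proof -
    have v: "v \<in> vcarrier V" using G that unfolding cone_of_constraints_def by blast
    have "g ((- 1) \<odot> v) \<le> - c" using gr[OF neg_closed[OF v]] sh(3)[OF that] by linarith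
    moreover have "g ((- 1) \<odot> v) = - g v" using g v unfolding linear_on_carrier_def by force
    ultimately show ?thesis by simp
  qed
  moreover have "g x \<le> q x" if "x \<in> vcarrier V" for x
    using gr[OF that] sh(2)[OF that] by linarith
  ultimately show thesis using that g by blast
qed

corollary mazur_orlicz_single:
  assumes q: "sublinear_on V q" and v: "v \<in> vcarrier V" and le: "c \<le> q v"
  obtains g where "linear_on_carrier V g" and "\<And>x. x \<in> vcarrier V \<Longrightarrow> g x \<le> q x" and "c \<le> g v"
proof -
  let ?G = "{(t \<odot> v, t * c) |t. 0 \<le> t}"
  have "cone_of_constraints V ?G"
    unfolding cone_of_constraints_def
  proof (intro conjI allI impI)
    show "(\<zero>, 0) \<in> ?G" using zero_scale[OF v] by (auto intro!: exI[of _ 0])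
    fix x c' w d assume "(x, c') \<in> ?G \<and> (w, d) \<in> ?G"
    then obtain s t where "x = s \<odot> v" "c' = s * c" "w = t \<odot> v" "d = t * c" "0 \<le> s" "0 \<le> t"
      by blast
    then show "(x \<oplus> w, c' + d) \<in> ?G"
      using v by (auto intro!: exI[of _ "s + t"] simp: add_scale algebra_simps)
  next
    fix t :: real and x c' assume "0 \<le> t" "(x, c') \<in> ?G"
    then obtain s where "x = s \<odot> v" "c' = s * c" "0 \<le> s" by blast
    then show "(t \<odot> x, t * c') \<in> ?G" using v \<open>0 \<le> t\<close>
      by (auto intro!: exI[of _ "t * s"] simp: scale_scale)
  qed (use v in \<open>auto simp: scale_closed\<close>)
  moreover have "\<forall>x c'. (x, c') \<in> ?G \<longrightarrow> c' \<le> q x"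
    using q v le unfolding sublinear_on_def by (auto simp: mult_left_mono)
  ultimately obtain g where "linear_on_carrier V g" "\<And>x. x \<in> vcarrier V \<Longrightarrow> g x \<le> q x"
    "\<And>x c'. (x, c') \<in> ?G \<Longrightarrow> c' \<le> g x"
    using mazur_orlicz[OF q] by blast
  moreover have "(v, c) \<in> ?G" using v by (auto intro!: exI[of _ 1] simp: scale_one)
  ultimately show thesis using that by blast
qed

end

section \<open>Banach lattices\<close>

lemma norm_abs: "norm \<bar>x\<bar> = norm (x :: 'a::banach_lattice)"
  by (rule antisym; rule norm_mono_abs) simp_all

lemma norm_mono_pos:
  fixes x y :: "'a::banach_lattice"
  assumes "\<bar>x\<bar> \<le> y" shows "norm x \<le> norm y"
  using assms abs_ge_self[of y] by (intro norm_mono_abs) (rule order_trans)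

lemma pprt_nonneg: "0 \<le> pprt (x :: 'a::lattice_ab_group_add)"
  by (simp add: pprt_def)

lemma pprt_id: "0 \<le> x \<Longrightarrow> pprt (x :: 'a::lattice_ab_group_add) = x"
  by (simp add: pprt_def sup_absorb1)

lemma pprt_zero_of_nonpos: "x \<le> 0 \<Longrightarrow> pprt (x :: 'a::lattice_ab_group_add) = 0"
  by (simp add: pprt_def sup_absorb2)

lemma pprt_minus_pprt_neg: "pprt x - pprt (- x) = (x :: 'a::lattice_ab_group_add)"
  by (metis diff_minus_eq_add pprt_neg prts)

lemma pprt_plus_pprt_neg: "pprt x + pprt (- x) = \<bar>x :: 'a::lattice_ab_group_add_abs\<bar>"
  by (metis abs_prts diff_conv_add_uminus pprt_neg)

lemma pprt_le_abs: "pprt x \<le> \<bar>x :: 'a::lattice_ab_group_add_abs\<bar>"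
  using pprt_plus_pprt_neg[of x] pprt_nonneg[of "- x"] by (metis le_add_same_cancel1)

lemma pprt_add_le: "pprt (x + y) \<le> pprt x + pprt (y :: 'a::lattice_ab_group_add)"
  unfolding pprt_def
  by (intro sup_least add_mono add_nonneg_nonneg) simp_all

lemma sup_scaleR_pos:
  fixes x y :: "'a::banach_lattice"
  assumes "0 < c" shows "sup (c *\<^sub>R x) (c *\<^sub>R y) = c *\<^sub>R sup x y"
proof (rule antisym)
  show "sup (c *\<^sub>R x) (c *\<^sub>R y) \<le> c *\<^sub>R sup x y"
    using assms by (intro sup_least scaleR_left_mono) auto
  have "sup x y \<le> (1 / c) *\<^sub>R sup (c *\<^sub>R x) (c *\<^sub>R y)"
  proof (intro sup_least)
    have "x = (1 / c) *\<^sub>R (c *\<^sub>R x)" "y = (1 / c) *\<^sub>R (c *\<^sub>R y)" using assms by auto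
    then show "x \<le> (1 / c) *\<^sub>R sup (c *\<^sub>R x) (c *\<^sub>R y)" "y \<le> (1 / c) *\<^sub>R sup (c *\<^sub>R x) (c *\<^sub>R y)"
      using assms by (metis divide_nonneg_pos scaleR_left_mono sup_ge1 sup_ge2 zero_le_one)+
  qed
  then have "c *\<^sub>R sup x y \<le> c *\<^sub>R (1 / c) *\<^sub>R sup (c *\<^sub>R x) (c *\<^sub>R y)"
    using assms by (intro scaleR_left_mono) auto
  then show "c *\<^sub>R sup x y \<le> sup (c *\<^sub>R x) (c *\<^sub>R y)" using assms by simp
qed

lemma pprt_scaleR:
  fixes x :: "'a::banach_lattice"
  assumes "0 \<le> c" shows "pprt (c *\<^sub>R x) = c *\<^sub>R pprt x"
  using sup_scaleR_pos[of c x 0] assms by (cases "c = 0") (auto simp: pprt_def)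

lemma abs_scaleR:
  fixes x :: "'a::banach_lattice"
  shows "\<bar>c *\<^sub>R x\<bar> = \<bar>c\<bar> *\<^sub>R \<bar>x\<bar>"
proof -
  have *: "\<bar>d *\<^sub>R x\<bar> = d *\<^sub>R \<bar>x\<bar>" if "0 \<le> d" for d
    using sup_scaleR_pos[of d x "- x"] that by (cases "d = 0") (auto simp: abs_lattice)
  show ?thesis
  proof (cases "0 \<le> c")
    case True then show ?thesis using * by simp
  next
    case False
    have "\<bar>c *\<^sub>R x\<bar> = \<bar>(- c) *\<^sub>R x\<bar>" by (metis abs_minus_cancel scaleR_minus_left)
    then show ?thesis using *[of "- c"] False by simp
  qed
qed

text \<open>The summand below \<open>u\<close> is \<open>r\<close> truncated to the interval from \<open>- u\<close> to \<open>u\<close>.\<close>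

lemma riesz_decomposition_abs:
  fixes r u v :: "'a::lattice_ab_group_add_abs"
  assumes r: "\<bar>r\<bar> \<le> u + v" and u: "0 \<le> u" and v: "0 \<le> v"
  obtains s t where "r = s + t" "\<bar>s\<bar> \<le> u" "\<bar>t\<bar> \<le> v" "\<bar>s\<bar> \<le> \<bar>r\<bar>"
proof -
  define s where "s = sup (- u) (inf r u)"
  have ru: "r \<le> u + v" "- r \<le> u + v" using r by (auto simp: abs_le_iff)
  have "- u \<le> u" using u by (meson neg_le_0_iff_le order_trans)
  then have s: "- u \<le> s" "s \<le> u" by (auto simp: s_def)
  have "r - v \<le> inf r u" using ru v by (auto simp: algebra_simps)
  then have 1: "r - v \<le> s" unfolding s_def by (rule le_supI2)
  have "- (u + v) \<le> r" using ru(2) by (rule minus_le_iff[THEN iffD1])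
  then have "- u \<le> r + v" by (simp add: algebra_simps)
  then have 2: "s \<le> r + v" unfolding s_def using v by (intro sup_least le_infI1) auto
  have "- \<bar>r\<bar> \<le> r" "- \<bar>r\<bar> \<le> u" "- u \<le> \<bar>r\<bar>"
    using u abs_ge_minus_self[of r] abs_ge_zero[of r]
    by (simp add: minus_le_iff, metis neg_le_0_iff_le order_trans, metis neg_le_0_iff_le order_trans)
  then have "- \<bar>r\<bar> \<le> s" "s \<le> \<bar>r\<bar>"
    unfolding s_def using le_infI1[OF abs_ge_self[of r]] by (auto intro: le_supI2)
  then have "\<bar>s\<bar> \<le> \<bar>r\<bar>" by (intro abs_leI) (simp_all add: minus_le_iff)
  moreover have "\<bar>s\<bar> \<le> u" using s by (intro abs_leI) (simp_all add: minus_le_iff)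
  moreover have "\<bar>r - s\<bar> \<le> v" using 1 2 by (intro abs_leI) (simp_all add: algebra_simps)
  ultimately show thesis using that[of s "r - s"] by simp
qed

lemma riesz_decomposition:
  fixes r u v :: "'a::lattice_ab_group_add"
  assumes "0 \<le> r" "r \<le> u + v" "0 \<le> u" "0 \<le> v"
  obtains s t where "r = s + t" "0 \<le> s" "s \<le> u" "0 \<le> t" "t \<le> v"
proof -
  have "r - v \<le> inf r u" using assms by (auto simp: algebra_simps)
  then have le: "r - inf r u \<le> v" by (metis add.commute diff_le_eq)
  define s where "s = inf r u"
  have "0 \<le> s" "s \<le> u" "s \<le> r" using assms by (simp_all add: s_def)
  then show thesis using le by (intro that[of s "r - s"]) (simp_all add: s_def[symmetric])
qed

lemma disjoint_scaleR:
  fixes x y :: "'a::banach_lattice"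
  assumes "inf x y = 0" "0 \<le> c" shows "inf (c *\<^sub>R x) y = 0"
proof -
  have xy: "0 \<le> x" "0 \<le> y" using assms(1) by (metis inf_le1, metis inf_le2)
  define m where "m = max 1 c"
  have m: "1 \<le> m" "c \<le> m" "0 < m" by (auto simp: m_def)
  let ?z = "inf (c *\<^sub>R x) y"
  have z: "0 \<le> ?z" using assms xy by (simp add: scaleR_nonneg_nonneg)
  have "(1 / m) *\<^sub>R ?z \<le> (1 / m) *\<^sub>R (m *\<^sub>R x)"
    using m xy by (intro scaleR_left_mono le_infI1 scaleR_right_mono) auto
  moreover have "(1 / m) *\<^sub>R ?z \<le> 1 *\<^sub>R ?z"
    using m z by (intro scaleR_right_mono) (auto simp: field_simps)
  ultimately have "(1 / m) *\<^sub>R ?z \<le> inf x y" using m by (simp add: le_infI2)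
  then have "m *\<^sub>R (1 / m) *\<^sub>R ?z \<le> m *\<^sub>R 0" using assms(1) m by (intro scaleR_left_mono) auto
  then show ?thesis using z m by simp
qed

lemma disjoint_mono:
  fixes x y :: "'a::lattice_ab_group_add"
  assumes "inf x y = 0" "0 \<le> x'" "x' \<le> x" "0 \<le> y'" "y' \<le> y" shows "inf x' y' = 0"
  using assms by (metis inf_greatest inf_mono antisym)

lemma disjoint_add:
  fixes x y z :: "'a::lattice_ab_group_add"
  assumes "inf x z = 0" "inf y z = 0" shows "inf (x + y) z = 0"
proof -
  have nn: "0 \<le> x" "0 \<le> y" "0 \<le> z" using assms by (metis inf_le1, metis inf_le1, metis inf_le2)
  have "0 \<le> inf (x + y) z" using nn by simp
  moreover obtain s t where st: "inf (x + y) z = s + t" "0 \<le> s" "s \<le> x" "0 \<le> t" "t \<le> y"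
    using nn riesz_decomposition[of "inf (x + y) z" x y] by auto
  have "s + t \<le> z" using st(1) by (metis inf_le2)
  then have "s \<le> z" "t \<le> z" using st by (metis add_increasing2 order_trans order_refl add_increasing le_add_same_cancel1 le_add_same_cancel2)+
  then have "s \<le> inf x z" "t \<le> inf y z" using st by auto
  then have "s = 0" "t = 0" using assms st by auto
  then show ?thesis using st by simp
qed

lemma disjoint_sum:
  fixes x :: "'i \<Rightarrow> 'a::lattice_ab_group_add"
  assumes "finite I" "0 \<le> z" "\<And>i. i \<in> I \<Longrightarrow> inf (x i) z = 0" shows "inf (sum x I) z = 0"
  using assms by (induction I rule: finite_induct) (auto simp: disjoint_add inf_absorb1)

lemma disjoint_add_eq_sup:
  fixes x y :: "'a::lattice_ab_group_add"
  assumes "inf x y = 0" shows "x + y = sup x y"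
  using add_eq_inf_sup[of x y] assms by simp

lemma sum_disjoint_le:
  fixes x :: "nat \<Rightarrow> 'a::lattice_ab_group_add"
  assumes "\<And>m n. m \<noteq> n \<Longrightarrow> inf (x m) (x n) = 0" "\<And>n. x n \<le> y" "0 \<le> y"
  shows "(\<Sum>n<N. x n) \<le> y"
proof (induction N)
  case (Suc N)
  have "inf (\<Sum>n<N. x n) (x N) = 0"
  proof (rule disjoint_sum)
    show "0 \<le> x N" using assms(1)[of N "Suc N"] by (metis inf_le1 n_not_Suc_n)
  qed (use assms(1) in auto)
  then show ?case using Suc assms(2) by (simp add: disjoint_add_eq_sup)
qed (use assms in simp)

lemma disjoint_abs_add:
  fixes x y :: "'a::lattice_ab_group_add_abs"
  assumes "inf \<bar>x\<bar> \<bar>y\<bar> = 0" shows "\<bar>x + y\<bar> = \<bar>x\<bar> + \<bar>y\<bar>"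
proof (rule antisym)
  show "\<bar>x + y\<bar> \<le> \<bar>x\<bar> + \<bar>y\<bar>" by (rule abs_triangle_ineq)
  have "\<bar>x\<bar> \<le> \<bar>x + y\<bar> + \<bar>y\<bar>" by (metis abs_triangle_ineq4 add_diff_cancel_right')
  moreover have "0 \<le> \<bar>x + y\<bar>" "0 \<le> \<bar>y\<bar>" by simp_all
  ultimately obtain s t where st: "\<bar>x\<bar> = s + t" "0 \<le> s" "s \<le> \<bar>x + y\<bar>" "0 \<le> t" "t \<le> \<bar>y\<bar>"
    using riesz_decomposition[of "\<bar>x\<bar>" "\<bar>x + y\<bar>" "\<bar>y\<bar>"] by auto
  have "t \<le> \<bar>x\<bar>" using st by simp
  then have "t \<le> inf \<bar>x\<bar> \<bar>y\<bar>" using st by simp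
  then have "t = 0" using st(4) unfolding assms by (rule antisym)
  then have x: "\<bar>x\<bar> \<le> \<bar>x + y\<bar>" using st by simp
  have "\<bar>y\<bar> \<le> \<bar>x + y\<bar> + \<bar>x\<bar>" by (metis abs_triangle_ineq4 add_diff_cancel_left')
  then obtain s t where st: "\<bar>y\<bar> = s + t" "0 \<le> s" "s \<le> \<bar>x + y\<bar>" "0 \<le> t" "t \<le> \<bar>x\<bar>"
    using riesz_decomposition[of "\<bar>y\<bar>" "\<bar>x + y\<bar>" "\<bar>x\<bar>"] by auto
  have "t \<le> \<bar>y\<bar>" using st by simp
  then have "t \<le> inf \<bar>x\<bar> \<bar>y\<bar>" using st by simp
  then have "t = 0" using st(4) unfolding assms by (rule antisym)
  then have y: "\<bar>y\<bar> \<le> \<bar>x + y\<bar>" using st by simp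
  show "\<bar>x\<bar> + \<bar>y\<bar> \<le> \<bar>x + y\<bar>" using x y disjoint_add_eq_sup[OF assms] by simp
qed

lemma abs_sum_disjoint:
  fixes x :: "nat \<Rightarrow> 'a::lattice_ab_group_add_abs"
  assumes "\<And>m n. m \<noteq> n \<Longrightarrow> inf \<bar>x m\<bar> \<bar>x n\<bar> = 0"
  shows "\<bar>\<Sum>n<N. x n\<bar> = (\<Sum>n<N. \<bar>x n\<bar>)"
proof (induction N)
  case (Suc N)
  have "inf \<bar>\<Sum>n<N. x n\<bar> \<bar>x N\<bar> = inf (\<Sum>n<N. \<bar>x n\<bar>) \<bar>x N\<bar>" using Suc by simp
  also have "\<dots> = 0" using assms by (intro disjoint_sum) auto
  finally show ?case using Suc by (simp add: disjoint_abs_add)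
qed simp

lemma norm_pprt_diff: "norm (pprt x - pprt y) \<le> norm (x - y :: 'a::banach_lattice)"
proof -
  have "pprt x \<le> pprt (x - y) + pprt y" for x y :: 'a using pprt_add_le[of "x - y" y] by simp
  then have "pprt x - pprt y \<le> \<bar>x - y\<bar>" for x y :: 'a
    using pprt_le_abs[of "x - y"] by (metis diff_le_eq order_trans)
  from this[of x y] this[of y x] have "\<bar>pprt x - pprt y\<bar> \<le> \<bar>x - y\<bar>"
    by (intro abs_leI) (simp_all add: abs_minus_commute)
  then show ?thesis by (rule norm_mono_abs)
qed

lemma nonneg_tendsto:
  fixes x :: "nat \<Rightarrow> 'a::banach_lattice"
  assumes "x \<longlonglongrightarrow> l" "eventually (\<lambda>n. 0 \<le> x n) sequentially" shows "0 \<le> l"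
proof -
  have "(\<lambda>n. norm (x n - l)) \<longlonglongrightarrow> 0" using assms(1) by (simp add: LIM_zero tendsto_norm_zero)
  then have "(\<lambda>n. norm (pprt (x n) - pprt l)) \<longlonglongrightarrow> 0"
    by (rule Lim_null_comparison[rotated]) (simp add: norm_pprt_diff)
  then have "(\<lambda>n. pprt (x n)) \<longlonglongrightarrow> pprt l" by (metis LIM_zero_cancel tendsto_norm_zero_cancel)
  moreover have "eventually (\<lambda>n. pprt (x n) = x n) sequentially"
    using assms(2) by eventually_elim (rule pprt_id)
  ultimately have "x \<longlonglongrightarrow> pprt l" by (simp add: tendsto_cong)
  then have "l = pprt l" using assms(1) LIMSEQ_unique by blast
  then show ?thesis by (metis pprt_nonneg)
qed

subsection \<open>Sequences of constraints\<close>

text \<open>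
  Constraints indexed by coefficient sequences, \<open>S N a\<close> being the combination of the first \<open>N\<close> basic
  vectors with coefficients \<open>a\<close>: if no finite nonnegative combination violates the sublinear bound, one
  functional meets all basic constraints \<open>c i\<close> at once.
\<close>

lemma (in vector_space_carrier) mazur_orlicz_family:
  fixes S :: "nat \<Rightarrow> (nat \<Rightarrow> real) \<Rightarrow> 'v" and c :: "nat \<Rightarrow> real"
  assumes q: "sublinear_on V q"
    and closed: "\<And>N a. S N a \<in> vcarrier V"
    and zero: "\<And>a. S 0 a = \<zero>"
    and extend: "\<And>N M a. N \<le> M \<Longrightarrow> (\<And>i. N \<le> i \<Longrightarrow> a i = 0) \<Longrightarrow> S M a = S N a"
    and add: "\<And>N a b. S N (\<lambda>i. a i + b i) = S N a \<oplus> S N b"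
    and scale: "\<And>N a t. S N (\<lambda>i. t * a i) = t \<odot> S N a"
    and le: "\<And>N a. (\<And>i. 0 \<le> a i) \<Longrightarrow> (\<Sum>i<N. a i * c i) \<le> q (S N a)"
  obtains g where "linear_on_carrier V g" and "\<And>x. x \<in> vcarrier V \<Longrightarrow> g x \<le> q x"
    and "\<And>i. c i \<le> g (S (Suc i) (\<lambda>j. if j = i then 1 else 0))"
proof -
  define G where "G = {(S N a, \<Sum>i<N. a i * c i) |N a. (\<forall>i. 0 \<le> a i) \<and> (\<forall>i\<ge>N. a i = 0)}"
  have ext': "(\<Sum>i<M. a i * c i) = (\<Sum>i<N. a i * c i)" if "N \<le> M" "\<forall>i\<ge>N. a i = 0" for N M a
    using that by (intro sum.mono_neutral_right) auto
  have "cone_of_constraints V G"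
    unfolding cone_of_constraints_def
  proof (intro conjI allI impI)
    show "G \<subseteq> vcarrier V \<times> UNIV" using closed unfolding G_def by auto
    show "(\<zero>, 0) \<in> G"
      unfolding G_def using zero by (auto intro!: exI[of _ 0] exI[of _ "\<lambda>_. 0"])
    fix v d w e assume "(v, d) \<in> G \<and> (w, e) \<in> G"
    then obtain N a M b where
      a: "v = S N a" "d = (\<Sum>i<N. a i * c i)" "\<forall>i. 0 \<le> a i" "\<forall>i\<ge>N. a i = 0" and
      b: "w = S M b" "e = (\<Sum>i<M. b i * c i)" "\<forall>i. 0 \<le> b i" "\<forall>i\<ge>M. b i = 0"
      unfolding G_def by blast
    let ?c = "\<lambda>i. a i + b i"
    have "v \<oplus> w = S (N + M) ?c" using a b extend[of N "N + M" a] extend[of M "N + M" b] add by simp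
    moreover have "d + e = (\<Sum>i<N + M. ?c i * c i)"
      using a b ext'[of N "N + M" a] ext'[of M "N + M" b] by (simp add: distrib_right sum.distrib)
    moreover have "(\<forall>i. 0 \<le> ?c i) \<and> (\<forall>i\<ge>N + M. ?c i = 0)" using a b by simp
    ultimately show "(v \<oplus> w, d + e) \<in> G" unfolding G_def by blast
  next
    fix t :: real and v d assume t: "0 \<le> t" "(v, d) \<in> G"
    then obtain N a where
      a: "v = S N a" "d = (\<Sum>i<N. a i * c i)" "\<forall>i. 0 \<le> a i" "\<forall>i\<ge>N. a i = 0"
      unfolding G_def by blast
    let ?c = "\<lambda>i. t * a i"
    have "t \<odot> v = S N ?c" using a scale by simp
    moreover have "t * d = (\<Sum>i<N. ?c i * c i)" using a by (simp add: sum_distrib_left mult.assoc)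
    moreover have "(\<forall>i. 0 \<le> ?c i) \<and> (\<forall>i\<ge>N. ?c i = 0)" using a t by simp
    ultimately show "(t \<odot> v, t * d) \<in> G" unfolding G_def by blast
  qed
  moreover have "\<forall>v d. (v, d) \<in> G \<longrightarrow> d \<le> q v" unfolding G_def using le by auto
  ultimately obtain g where g: "linear_on_carrier V g" "\<And>x. x \<in> vcarrier V \<Longrightarrow> g x \<le> q x"
    "\<And>v d. (v, d) \<in> G \<Longrightarrow> d \<le> g v"
    using mazur_orlicz[OF q] by blast
  have "c i \<le> g (S (Suc i) (\<lambda>j. if j = i then 1 else 0))" for i
  proof (rule g(3))
    have "c i = (\<Sum>j<Suc i. (if j = i then 1 else 0) * c j)"
      by (simp add: if_distrib[of "\<lambda>x. x * _"] sum.delta cong: if_cong)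
    then show "(S (Suc i) (\<lambda>j. if j = i then 1 else 0), c i) \<in> G"
      unfolding G_def by (auto intro!: exI[of _ "Suc i"] exI[of _ "\<lambda>j. if j = i then 1 else 0"])
  qed
  then show thesis using that g by blast
qed

text \<open>This makes the extension theorems available for real vector spaces that are types.\<close>

definition type_space :: "'x::real_vector vlattice" where
  "type_space = \<lparr>vcarrier = UNIV, vadd = (+), vzero = 0, vscale = scaleR,
                 vle = (\<lambda>_ _. True), vnorm = (\<lambda>_. 0)\<rparr>"

lemma type_space_simps [simp]:
  "vcarrier type_space = UNIV" "vadd type_space = (+)" "vzero type_space = 0"
  "vscale type_space = scaleR"
  by (simp_all add: type_space_def)

lemma vector_space_type_space: "vector_space_carrier type_space"
  by standard (simp_all add: vminus_def algebra_simps)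

lemma linear_type_space: "linear_on_carrier type_space g \<longleftrightarrow> linear g"
  by (auto simp: linear_on_carrier_def linear_iff)

text \<open>The linear functionals below the supremum over \<open>Z\<close> are the finitely additive means on \<open>Z\<close>.\<close>

definition bounded_functions :: "'z set \<Rightarrow> ('z \<Rightarrow> real) vlattice" where
  "bounded_functions Z = \<lparr>vcarrier = {h. \<exists>K. \<forall>z\<in>Z. \<bar>h z\<bar> \<le> K}, vadd = (\<lambda>g h z. g z + h z),
     vzero = (\<lambda>_. 0), vscale = (\<lambda>c h z. c * h z), vle = (\<lambda>_ _. True), vnorm = (\<lambda>_. 0)\<rparr>"

lemma bounded_functions_simps [simp]:
  "vcarrier (bounded_functions Z) = {h. \<exists>K. \<forall>z\<in>Z. \<bar>h z\<bar> \<le> K}"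
  "vadd (bounded_functions Z) = (\<lambda>g h z. g z + h z)" "vzero (bounded_functions Z) = (\<lambda>_. 0)"
  "vscale (bounded_functions Z) = (\<lambda>c h z. c * h z)"
  by (simp_all add: bounded_functions_def)

lemma bounded_functions_add:
  "\<exists>K. \<forall>z\<in>Z. \<bar>g z :: real\<bar> \<le> K \<Longrightarrow> \<exists>K. \<forall>z\<in>Z. \<bar>h z :: real\<bar> \<le> K \<Longrightarrow> \<exists>K. \<forall>z\<in>Z. \<bar>g z + h z\<bar> \<le> K"
  by (metis abs_triangle_ineq add_mono order_trans)

lemma bounded_functions_scale:
  "\<exists>K. \<forall>z\<in>Z. \<bar>h z :: real\<bar> \<le> K \<Longrightarrow> \<exists>K. \<forall>z\<in>Z. \<bar>c * h z\<bar> \<le> K"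
  by (metis abs_mult abs_ge_zero mult_left_mono)

lemma vector_space_bounded_functions: "vector_space_carrier (bounded_functions Z)"
  by standard
    (auto simp: vminus_def algebra_simps intro: bounded_functions_add bounded_functions_scale)

lemma sublinear_SUP:
  assumes "Z \<noteq> {}" shows "sublinear_on (bounded_functions Z) (\<lambda>h. SUP z\<in>Z. h z)"
  unfolding sublinear_on_def
proof (intro conjI ballI allI impI)
  have bdd: "bdd_above (h ` Z)" if "h \<in> vcarrier (bounded_functions Z)" for h
    using that by (force simp: bdd_above_def abs_le_iff)
  fix g h assume gh: "g \<in> vcarrier (bounded_functions Z)" "h \<in> vcarrier (bounded_functions Z)"
  show "(SUP z\<in>Z. (g \<oplus>\<^bsub>bounded_functions Z\<^esub> h) z) \<le> (SUP z\<in>Z. g z) + (SUP z\<in>Z. h z)"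
    using assms bdd[OF gh(1)] bdd[OF gh(2)] by (auto intro!: cSUP_least add_mono cSUP_upper)
next
  fix c :: real and h assume c: "0 \<le> c" and h: "h \<in> vcarrier (bounded_functions Z)"
  have bdd: "bdd_above (h ` Z)" using h by (force simp: bdd_above_def abs_le_iff)
  have "(SUP z\<in>Z. c * h z) = c * (SUP z\<in>Z. h z)"
  proof (cases "c = 0")
    case False
    then have c: "0 < c" using c by simp
    show ?thesis
    proof (rule antisym)
      show "(SUP z\<in>Z. c * h z) \<le> c * (SUP z\<in>Z. h z)"
        using assms c bdd by (auto intro!: cSUP_least cSUP_upper)
      have bdd': "bdd_above ((\<lambda>z. c * h z) ` Z)"
      proof -
        obtain M where "\<And>z. z \<in> Z \<Longrightarrow> h z \<le> M" using bdd by (auto simp: bdd_above_def)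
        then show ?thesis using c by (intro bdd_aboveI2[where M = "c * M"]) simp
      qed
      have "(SUP z\<in>Z. h z) \<le> (SUP z\<in>Z. c * h z) / c"
      proof (rule cSUP_least[OF assms])
        fix z assume "z \<in> Z"
        then have "c * h z \<le> (SUP z\<in>Z. c * h z)" using bdd' by (rule cSUP_upper)
        then show "h z \<le> (SUP z\<in>Z. c * h z) / c" using c by (simp add: field_simps)
      qed
      then show "c * (SUP z\<in>Z. h z) \<le> (SUP z\<in>Z. c * h z)" using c by (simp add: field_simps)
    qed
  qed (use assms in simp)
  then show "(SUP z\<in>Z. (c \<odot>\<^bsub>bounded_functions Z\<^esub> h) z) = c * (SUP z\<in>Z. h z)" by simp
qed

section \<open>A gliding hump\<close>

text \<open>
  If the \<open>B n\<close> are absolutely summable uniformly on the unit ball, every subseries of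
  \<open>\<Sum>B n\<close> is a bounded functional. Along a sparse subsequence the off-diagonal part of the matrix
  \<open>B n (f m)\<close> is negligible, so such a subseries would stay large on the weakly null sequence
  \<open>f\<close> if the diagonal did.
\<close>

lemma diagonal_of_summable_functionals:
  fixes B :: "nat \<Rightarrow> 'x::real_normed_vector \<Rightarrow> real" and f :: "nat \<Rightarrow> 'x"
  assumes lin: "\<And>n. linear (B n)" and bound: "\<And>N h. (\<Sum>n<N. \<bar>B n h\<bar>) \<le> C * norm h"
    and null: "weakly_null f" and d: "0 < \<delta>"
  shows "\<exists>n. B n (f n) < \<delta>"
proof (rule ccontr)
  assume "\<not> ?thesis"
  then have diag: "\<delta> \<le> B n (f n)" for n by (simp add: not_less)
  have B1: "\<bar>B n h\<bar> \<le> C * norm h" for n h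
    using bound[where N = "Suc n" and h = h] by (simp add: add_increasing sum_nonneg) (smt (verit) sum_nonneg abs_ge_zero)
  have bl: "bounded_linear g" if "linear g" "\<And>h. \<bar>g h\<bar> \<le> C * norm h" for g :: "'x \<Rightarrow> real"
    using that by (intro bounded_linear_intro[of _ C]) (auto simp: linear_add linear_scale mult.commute)
  have small: "(\<lambda>m. B n (f m)) \<longlonglongrightarrow> 0" for n
  proof -
    have "blinfun_apply (Blinfun (B n)) = B n" by (intro bounded_linear_Blinfun_apply bl lin B1)
    then show ?thesis using null unfolding weakly_null_def by metis
  qed
  have summ: "summable (\<lambda>n. \<bar>B n h\<bar>)" for h
  proof (rule bounded_imp_summable[of _ "C * norm h"])
    show "(\<Sum>k\<le>n. \<bar>B k h\<bar>) \<le> C * norm h" for n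
      using bound[where N = "Suc n" and h = h] by (simp only: lessThan_Suc_atMost)
  qed simp
  \<comment> \<open>At the next index, all earlier functionals are small; at all earlier vectors, the remaining
      functionals have a small absolute sum.\<close>
  define R where "R n n' \<longleftrightarrow> n < n' \<and> (\<forall>j\<in>{..n}. \<bar>B j (f n')\<bar> \<le> \<delta> / 8 * (1 / 2) ^ j \<and>
      (\<forall>M. (\<Sum>l = n'..<M. \<bar>B l (f j)\<bar>) \<le> \<delta> / 4))" for n n'
  have "\<exists>n'. R n n'" for n
  proof -
    have 1: "\<forall>\<^sub>F m in sequentially. \<bar>B j (f m)\<bar> \<le> \<delta> / 8 * (1 / 2) ^ j" for j
    proof -
      have "\<forall>\<^sub>F m in sequentially. dist (B j (f m)) 0 < \<delta> / 8 * (1 / 2) ^ j"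
        using d by (intro tendstoD[OF small]) simp
      then show ?thesis by eventually_elim simp
    qed
    have 2: "\<forall>\<^sub>F m in sequentially. \<forall>M. (\<Sum>l = m..<M. \<bar>B l (f j)\<bar>) \<le> \<delta> / 4" for j
    proof -
      obtain N where N: "\<forall>m\<ge>N. \<forall>n. norm (\<Sum>l = m..<n. \<bar>B l (f j)\<bar>) < \<delta> / 4"
        using summ[of "f j"] d unfolding summable_Cauchy by (metis zero_less_divide_iff zero_less_numeral)
      then show ?thesis unfolding eventually_sequentially
        by (intro exI[of _ N]) (smt (verit) real_norm_def)
    qed
    have "\<forall>\<^sub>F m in sequentially. \<forall>j\<in>{..n}. \<bar>B j (f m)\<bar> \<le> \<delta> / 8 * (1 / 2) ^ j \<and>
      (\<forall>M. (\<Sum>l = m..<M. \<bar>B l (f j)\<bar>) \<le> \<delta> / 4)"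
      by (intro eventually_ball_finite ballI eventually_conj 1 2) simp
    then have "\<forall>\<^sub>F m in sequentially. R n m"
      using eventually_gt_at_top[of n] unfolding R_def by eventually_elim simp
    then show ?thesis using eventually_happens by fastforce
  qed
  then obtain s where s: "\<And>i. R (s i) (s (Suc i))"
    using dependent_nat_choice[of "\<lambda>_ _. True" "\<lambda>_. R"] by auto
  have sm: "strict_mono s" using s unfolding R_def by (intro strict_monoI_Suc) simp
  define \<Psi> where "\<Psi> h = (\<Sum>i. B (s i) h)" for h
  have sub: "(\<Sum>j\<in>J. \<bar>B (s j) h\<bar>) \<le> (\<Sum>l\<in>L. \<bar>B l h\<bar>)" if "s ` J \<subseteq> L" "finite L" for J L h
  proof -
    have "(\<Sum>j\<in>J. \<bar>B (s j) h\<bar>) = (\<Sum>l\<in>s ` J. \<bar>B l h\<bar>)"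
      using sm by (subst sum.reindex) (auto intro: inj_on_subset strict_mono_imp_inj_on)
    also have "\<dots> \<le> (\<Sum>l\<in>L. \<bar>B l h\<bar>)" using that by (intro sum_mono2) auto
    finally show ?thesis .
  qed
  have summs: "summable (\<lambda>i. \<bar>B (s i) h\<bar>)" for h
  proof (rule bounded_imp_summable[of _ "C * norm h"])
    fix n
    have "(\<Sum>k\<le>n. \<bar>B (s k) h\<bar>) \<le> (\<Sum>l<Suc (s n). \<bar>B l h\<bar>)"
      using sm by (intro sub) (auto simp: strict_mono_less_eq less_Suc_eq_le)
    then show "(\<Sum>k\<le>n. \<bar>B (s k) h\<bar>) \<le> C * norm h" using bound by (rule order_trans)
  qed simp
  have summs': "summable (\<lambda>i. B (s i) h)" for h
    using summs by (rule summable_rabs_cancel)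
  have "linear \<Psi>"
    unfolding linear_iff \<Psi>_def using summs' lin
    by (auto simp: linear_add linear_scale suminf_add suminf_mult)
  moreover have "\<bar>\<Psi> h\<bar> \<le> C * norm h" for h
  proof -
    have "\<bar>\<Psi> h\<bar> \<le> (\<Sum>i. \<bar>B (s i) h\<bar>)" unfolding \<Psi>_def using summs by (rule summable_rabs)
    also have "\<dots> \<le> C * norm h"
    proof (rule suminf_le_const[OF summs])
      fix N
      have "(\<Sum>i<N. \<bar>B (s i) h\<bar>) \<le> (\<Sum>l<s N. \<bar>B l h\<bar>)"
        using sm by (intro sub) (auto simp: strict_mono_less)
      then show "(\<Sum>i<N. \<bar>B (s i) h\<bar>) \<le> C * norm h" using bound by (rule order_trans)
    qed
    finally show ?thesis .
  qed
  ultimately have "bounded_linear \<Psi>" by (rule bl)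
  then have "(\<lambda>m. \<Psi> (f m)) \<longlonglongrightarrow> 0"
    using null unfolding weakly_null_def by (metis bounded_linear_Blinfun_apply)
  then have "(\<lambda>i. \<Psi> (f (s i))) \<longlonglongrightarrow> 0" using sm LIMSEQ_subseq_LIMSEQ unfolding o_def by fastforce
  moreover have "\<delta> / 2 \<le> \<Psi> (f (s i))" for i
  proof -
    have "(\<lambda>N. \<Sum>j<N. B (s j) (f (s i))) \<longlonglongrightarrow> \<Psi> (f (s i))"
      unfolding \<Psi>_def using summs' by (rule summable_LIMSEQ)
    moreover have "\<forall>\<^sub>F N in sequentially. \<delta> / 2 \<le> (\<Sum>j<N. B (s j) (f (s i)))"
      using eventually_gt_at_top[of i]
    proof eventually_elim
      case (elim N)
      let ?b = "\<lambda>j. B (s j) (f (s i))"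
      have "{..<N} = {..<i} \<union> {i} \<union> {Suc i..<N}" using elim by auto
      then have "(\<Sum>j<N. ?b j) = (\<Sum>j<i. ?b j) + ?b i + (\<Sum>j = Suc i..<N. ?b j)"
        by (simp add: sum.union_disjoint ivl_disj_int disjoint_iff)
      moreover have "\<bar>\<Sum>j<i. ?b j\<bar> \<le> \<delta> / 4"
      proof -
        have "\<bar>?b j\<bar> \<le> \<delta> / 8 * (1 / 2) ^ j" if ji: "j < i" for j
        proof -
          obtain i' where i': "i = Suc i'" "j \<le> i'" using ji by (cases i) auto
          have "\<bar>?b j\<bar> \<le> \<delta> / 8 * (1 / 2) ^ s j"
            using s[of i'] i' sm unfolding R_def by (simp add: strict_mono_less_eq)
          also have "\<dots> \<le> \<delta> / 8 * (1 / 2) ^ j"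
            using d sm by (intro mult_left_mono power_decreasing strict_mono_imp_increasing) auto
          finally show ?thesis .
        qed
        then have "\<bar>\<Sum>j<i. ?b j\<bar> \<le> (\<Sum>j<i. \<delta> / 8 * (1 / 2) ^ j)"
          by (intro order_trans[OF sum_abs] sum_mono) auto
        also have "\<dots> = \<delta> / 8 * (\<Sum>j<i. (1 / 2) ^ j)" by (simp add: sum_distrib_left)
        also have "(\<Sum>j<i. (1 / 2 :: real) ^ j) = 2 - 2 * (1 / 2) ^ i"
          by (induction i) simp_all
        also have "\<delta> / 8 * \<dots> \<le> \<delta> / 8 * 2" using d by (intro mult_left_mono) simp_all
        finally show ?thesis by simp
      qed
      moreover have "\<bar>\<Sum>j = Suc i..<N. ?b j\<bar> \<le> \<delta> / 4"
      proof -
        have "\<bar>\<Sum>j = Suc i..<N. ?b j\<bar> \<le> (\<Sum>j = Suc i..<N. \<bar>?b j\<bar>)" by (rule sum_abs)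
        also have "\<dots> \<le> (\<Sum>l = s (Suc i)..<s N. \<bar>B l (f (s i))\<bar>)"
          using sm by (intro sub) (auto simp: strict_mono_less strict_mono_less_eq)
        also have "\<dots> \<le> \<delta> / 4" using s[of i] unfolding R_def by simp
        finally show ?thesis .
      qed
      moreover have "\<delta> \<le> ?b i" by (rule diag)
      ultimately show ?case by linarith
    qed
    ultimately show ?thesis by (intro tendsto_lowerbound[of _ "\<Psi> (f (s i))" sequentially]) auto
  qed
  ultimately have "\<delta> / 2 \<le> 0" by (intro tendsto_lowerbound[of _ 0 sequentially]) auto
  then show False using d by simp
qed

section \<open>The modulus of a functional on an ideal\<close>

definition lattice_ideal :: "'a::banach_lattice set \<Rightarrow> bool" where
  "lattice_ideal S \<longleftrightarrow> 0 \<in> S \<and> (\<forall>r\<in>S. \<forall>s\<in>S. r + s \<in> S) \<and> (\<forall>c. \<forall>r\<in>S. c *\<^sub>R r \<in> S) \<and>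
     (\<forall>r\<in>S. \<forall>s. \<bar>s\<bar> \<le> \<bar>r\<bar> \<longrightarrow> s \<in> S)"

definition principal_ideal :: "'a::banach_lattice \<Rightarrow> 'a set" where
  "principal_ideal X = {r. \<exists>j::nat. \<bar>r\<bar> \<le> real j *\<^sub>R X}"

text \<open>
  The Riesz--Kantorovich formula for \<open>\<bar>f\<bar>\<close> at \<open>u\<close>, with the supremum restricted to \<open>S\<close>. For the
  principal ideal of \<open>X\<close> this is the component of \<open>\<bar>f\<bar>\<close> in the band generated by \<open>X\<close>.
\<close>

definition modulus_on :: "'a::banach_lattice set \<Rightarrow> ('a \<Rightarrow>\<^sub>L real) \<Rightarrow> 'a \<Rightarrow> real" where
  "modulus_on S f u = (SUP r\<in>{r \<in> S. \<bar>r\<bar> \<le> u}. f r)"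

lemma lattice_ideal_UNIV: "lattice_ideal UNIV"
  by (simp add: lattice_ideal_def)

lemma lattice_ideal_principal:
  assumes "0 \<le> X" shows "lattice_ideal (principal_ideal X)"
  unfolding lattice_ideal_def
proof (intro conjI ballI allI impI)
  show "0 \<in> principal_ideal X" by (auto simp: principal_ideal_def intro!: exI[of _ 0])
  fix r s assume "r \<in> principal_ideal X" "s \<in> principal_ideal X"
  then obtain i j :: nat where "\<bar>r\<bar> \<le> real i *\<^sub>R X" "\<bar>s\<bar> \<le> real j *\<^sub>R X"
    by (auto simp: principal_ideal_def)
  then have "\<bar>r + s\<bar> \<le> real (i + j) *\<^sub>R X"
    by (simp add: scaleR_add_left) (meson abs_triangle_ineq add_mono order_trans)
  then show "r + s \<in> principal_ideal X" unfolding principal_ideal_def by blast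
next
  fix c r assume "r \<in> principal_ideal X"
  then obtain j :: nat where j: "\<bar>r\<bar> \<le> real j *\<^sub>R X" by (auto simp: principal_ideal_def)
  obtain m :: nat where m: "\<bar>c\<bar> \<le> real m" using real_arch_simple by blast
  have "\<bar>c *\<^sub>R r\<bar> \<le> \<bar>c\<bar> *\<^sub>R (real j *\<^sub>R X)" using j by (simp add: abs_scaleR scaleR_left_mono del: scaleR_scaleR)
  also have "\<dots> \<le> real m *\<^sub>R (real j *\<^sub>R X)"
    using m assms by (intro scaleR_right_mono) (auto simp: scaleR_nonneg_nonneg)
  finally have "\<bar>c *\<^sub>R r\<bar> \<le> real (m * j) *\<^sub>R X" by simp
  then show "c *\<^sub>R r \<in> principal_ideal X" unfolding principal_ideal_def by blast
next
  fix r s assume "r \<in> principal_ideal X" "\<bar>s\<bar> \<le> \<bar>r\<bar>"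
  then show "s \<in> principal_ideal X" by (auto simp: principal_ideal_def intro: order_trans)
qed

lemma blinfun_le_norm: "blinfun_apply (f :: 'a::real_normed_vector \<Rightarrow>\<^sub>L real) x \<le> norm f * norm x"
  using norm_blinfun[of f x] by simp

context
  fixes S :: "'a::banach_lattice set" and f :: "'a \<Rightarrow>\<^sub>L real"
  assumes S: "lattice_ideal S"
begin

lemma bdd_modulus: "bdd_above (blinfun_apply f ` {r \<in> S. \<bar>r\<bar> \<le> u})"
proof (rule bdd_aboveI2)
  fix r assume "r \<in> {r \<in> S. \<bar>r\<bar> \<le> u}"
  then have "norm r \<le> norm u" using norm_mono_pos by blast
  then show "f r \<le> norm f * norm u"
    using blinfun_le_norm[of f r] by (meson mult_left_mono norm_ge_zero order_trans)
qed

lemma modulus_upper: "r \<in> S \<Longrightarrow> \<bar>r\<bar> \<le> u \<Longrightarrow> f r \<le> modulus_on S f u"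
  unfolding modulus_on_def by (intro cSUP_upper bdd_modulus) simp

lemma modulus_least: "0 \<le> u \<Longrightarrow> (\<And>r. r \<in> S \<Longrightarrow> \<bar>r\<bar> \<le> u \<Longrightarrow> f r \<le> m) \<Longrightarrow> modulus_on S f u \<le> m"
  unfolding modulus_on_def using S by (intro cSUP_least) (auto simp: lattice_ideal_def)

lemma modulus_nonneg: "0 \<le> u \<Longrightarrow> 0 \<le> modulus_on S f u"
  using modulus_upper[of 0 u] S by (simp add: lattice_ideal_def)

lemma modulus_le_norm: "0 \<le> u \<Longrightarrow> modulus_on S f u \<le> norm f * norm u"
  by (rule modulus_least)
    (assumption, meson blinfun_le_norm mult_left_mono norm_ge_zero norm_mono_pos order_trans)

lemma modulus_mono: "0 \<le> u \<Longrightarrow> u \<le> v \<Longrightarrow> modulus_on S f u \<le> modulus_on S f v"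
  by (rule modulus_least) (auto intro: modulus_upper order_trans)

lemma modulus_add_le:
  assumes "0 \<le> u" "0 \<le> v" shows "modulus_on S f (u + v) \<le> modulus_on S f u + modulus_on S f v"
proof (rule modulus_least)
  fix r assume r: "r \<in> S" "\<bar>r\<bar> \<le> u + v"
  then obtain s t where st: "r = s + t" "\<bar>s\<bar> \<le> u" "\<bar>t\<bar> \<le> v" "\<bar>s\<bar> \<le> \<bar>r\<bar>"
    using assms by (elim riesz_decomposition_abs)
  have "s \<in> S" using S r st unfolding lattice_ideal_def by blast
  moreover have "t = r + (- 1) *\<^sub>R s" using st by simp
  ultimately have "t \<in> S" using S r unfolding lattice_ideal_def by blast
  with \<open>s \<in> S\<close> show "f r \<le> modulus_on S f u + modulus_on S f v"
    using st modulus_upper by (simp add: blinfun.add_right add_mono)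
qed (use assms in simp)

lemma modulus_scale:
  assumes "0 \<le> c" "0 \<le> u" shows "modulus_on S f (c *\<^sub>R u) = c * modulus_on S f u"
proof (cases "c = 0")
  case True
  have "modulus_on S f 0 \<le> 0" by (rule order_trans[OF modulus_le_norm]) auto
  then show ?thesis using True modulus_nonneg[of 0] by simp
next
  case False
  have le: "modulus_on S f (c *\<^sub>R u) \<le> c * modulus_on S f u" if "0 < c" "0 \<le> u" for c u
  proof (rule modulus_least)
    fix r assume r: "r \<in> S" "\<bar>r\<bar> \<le> c *\<^sub>R u"
    have "(1 / c) *\<^sub>R \<bar>r\<bar> \<le> (1 / c) *\<^sub>R c *\<^sub>R u" using r that by (intro scaleR_left_mono) auto
    then have "f ((1 / c) *\<^sub>R r) \<le> modulus_on S f u"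
      using that r S by (intro modulus_upper) (auto simp: abs_scaleR lattice_ideal_def)
    then show "f r \<le> c * modulus_on S f u" using that by (simp add: blinfun.scaleR_right field_simps)
  qed (use that in \<open>simp add: scaleR_nonneg_nonneg\<close>)
  have c: "0 < c" using False assms by simp
  have "modulus_on S f ((1 / c) *\<^sub>R (c *\<^sub>R u)) \<le> (1 / c) * modulus_on S f (c *\<^sub>R u)"
    using c assms by (intro le) (auto simp: scaleR_nonneg_nonneg)
  then have "c * modulus_on S f u \<le> modulus_on S f (c *\<^sub>R u)" using c by (simp add: field_simps)
  then show ?thesis using le[OF c assms(2)] by simp
qed

end

lemma blinfun_of_bounded:
  fixes g :: "'a::real_normed_vector \<Rightarrow> real"
  assumes "linear g" "\<And>y. g y \<le> C * norm y"
  shows "blinfun_apply (Blinfun g) = g"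
proof (rule bounded_linear_Blinfun_apply, rule bounded_linear_intro[of _ C])
  fix x
  have "- g x \<le> C * norm x" using assms(2)[of "- x"] linear_neg[OF assms(1)] by simp
  then show "norm (g x) \<le> norm x * C" using assms(2)[of x] by (simp add: mult.commute)
qed (use assms(1) in \<open>auto simp: linear_add linear_scale\<close>)

text \<open>
  Weak summability survives taking absolute values: given \<open>f\<close>, the constraints
  \<open>\<bar>f \<bar>x n\<bar>\<bar> \<le> h (x n)\<close> on a functional \<open>h\<close> below the modulus of \<open>f\<close> are consistent since
  \<open>\<bar>\<Sum>a\<^sub>n x\<^sub>n\<bar> = \<Sum>a\<^sub>n \<bar>x\<^sub>n\<bar>\<close> for a disjoint sequence.
\<close>

lemma weakly_summable_abs:
  fixes x :: "nat \<Rightarrow> 'a::banach_lattice"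
  assumes dis: "disjoint_seq x" and ws: "weakly_summable p x" and p: "0 \<le> p"
  shows "weakly_summable p (\<lambda>n. \<bar>x n\<bar>)"
  unfolding weakly_summable_def
proof (intro allI)
  fix f :: "'a \<Rightarrow>\<^sub>L real"
  let ?q = "\<lambda>y. modulus_on UNIV f \<bar>y\<bar>"
  let ?S = "\<lambda>N (a :: nat \<Rightarrow> real). \<Sum>i<N. a i *\<^sub>R x i"
  interpret vector_space_carrier "type_space :: 'a vlattice" by (rule vector_space_type_space)
  have q: "sublinear_on type_space ?q"
    unfolding sublinear_on_def
    by (auto simp: abs_scaleR modulus_scale[OF lattice_ideal_UNIV] abs_triangle_ineq
        intro!: order_trans[OF modulus_mono[OF lattice_ideal_UNIV] modulus_add_le[OF lattice_ideal_UNIV]])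
  obtain h where h: "linear_on_carrier type_space h" "\<And>y. y \<in> vcarrier type_space \<Longrightarrow> h y \<le> ?q y"
    "\<And>i. \<bar>f \<bar>x i\<bar>\<bar> \<le> h (?S (Suc i) (\<lambda>j. if j = i then 1 else 0))"
  proof (rule mazur_orlicz_family[OF q, of ?S "\<lambda>i. \<bar>f \<bar>x i\<bar>\<bar>"])
    fix N and a :: "nat \<Rightarrow> real" assume a: "\<And>i. 0 \<le> a i"
    define r where "r = (\<Sum>i<N. (a i * sgn (f \<bar>x i\<bar>)) *\<^sub>R \<bar>x i\<bar>)"
    have "\<bar>r\<bar> \<le> (\<Sum>i<N. \<bar>(a i * sgn (f \<bar>x i\<bar>)) *\<^sub>R \<bar>x i\<bar>\<bar>)" unfolding r_def by (rule sum_abs)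
    also have "\<dots> \<le> (\<Sum>i<N. a i *\<^sub>R \<bar>x i\<bar>)"
      using a by (intro sum_mono)
        (auto simp: abs_scaleR abs_mult abs_sgn_eq scaleR_nonneg_nonneg intro!: scaleR_right_mono)
    also have "\<dots> = (\<Sum>i<N. \<bar>a i *\<^sub>R x i\<bar>)" using a by (simp add: abs_scaleR)
    also have "\<dots> = \<bar>?S N a\<bar>"
    proof (rule abs_sum_disjoint[symmetric])
      fix m n :: nat assume "m \<noteq> n"
      then have "inf \<bar>x m\<bar> \<bar>x n\<bar> = 0" using dis unfolding disjoint_seq_def by blast
      then have "inf (a m *\<^sub>R \<bar>x m\<bar>) \<bar>x n\<bar> = 0" using a by (intro disjoint_scaleR)
      then have "inf (a n *\<^sub>R \<bar>x n\<bar>) (a m *\<^sub>R \<bar>x m\<bar>) = 0" using a by (intro disjoint_scaleR) (simp_all add: inf_commute)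
      then show "inf \<bar>a m *\<^sub>R x m\<bar> \<bar>a n *\<^sub>R x n\<bar> = 0" using a by (simp add: abs_scaleR inf_commute)
    qed
    finally have "f r \<le> ?q (?S N a)" by (intro modulus_upper[OF lattice_ideal_UNIV]) auto
    moreover have "f r = (\<Sum>i<N. a i * \<bar>f \<bar>x i\<bar>\<bar>)"
      unfolding r_def by (simp add: blinfun.sum_right blinfun.scaleR_right abs_sgn mult.assoc mult.commute[of "sgn _"])
    ultimately show "(\<Sum>i<N. a i * \<bar>f \<bar>x i\<bar>\<bar>) \<le> ?q (?S N a)" by simp
  next
    fix N M and a :: "nat \<Rightarrow> real" assume "N \<le> M" "\<And>i. N \<le> i \<Longrightarrow> a i = 0"
    then show "?S M a = ?S N a" by (intro sum.mono_neutral_right) auto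
  qed (auto simp: scaleR_add_left sum.distrib scaleR_sum_right)
  have "h y \<le> norm f * norm y" for y
    using h(2)[of y] modulus_le_norm[OF lattice_ideal_UNIV, of "\<bar>y\<bar>" f] by (simp add: norm_abs)
  then have B: "blinfun_apply (Blinfun h) = h"
    using h(1) by (intro blinfun_of_bounded) (simp_all add: linear_type_space)
  have "\<bar>f \<bar>x i\<bar>\<bar> \<le> h (x i)" for i
    using h(3)[of i] by (simp add: if_distrib[of "\<lambda>c. c *\<^sub>R _"] sum.delta cong: if_cong)
  then have le: "\<bar>f \<bar>x i\<bar>\<bar> powr p \<le> \<bar>h (x i)\<bar> powr p" for i
    using p order_trans[OF _ abs_ge_self] by (intro powr_mono2) auto
  have "summable (\<lambda>i. \<bar>h (x i)\<bar> powr p)"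
    using ws[unfolded weakly_summable_def, rule_format, of "Blinfun h"] by (simp add: B)
  then show "summable (\<lambda>n. \<bar>f \<bar>x n\<bar>\<bar> powr p)"
    by (rule summable_comparison_test'[of _ 0]) (simp only: real_norm_def abs_of_nonneg[OF powr_ge_zero] le)
qed

section \<open>Functionals localised on a disjoint sequence\<close>

text \<open>
  Working with any functional below the component of \<open>\<bar>f\<bar>\<close> in the band generated by \<open>X\<close> avoids
  constructing this component: such functionals come from the extension theorem. Since the bound
  involves only \<open>pprt y\<close>, they are positive.
\<close>

definition localised :: "'a::banach_lattice \<Rightarrow> ('a \<Rightarrow>\<^sub>L real) \<Rightarrow> ('a \<Rightarrow>\<^sub>L real) \<Rightarrow> bool" where
  "localised X f g \<longleftrightarrow> (\<forall>y. g y \<le> modulus_on (principal_ideal X) f (pprt y))"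

text \<open>
  The bound \<open>y \<mapsto> modulus_on (principal_ideal \<bar>x\<bar>) f (pprt y)\<close> is sublinear, and at \<open>\<bar>x\<bar>\<close> it is at least
  \<open>\<bar>f x\<bar>\<close> because \<open>x\<close> and \<open>- x\<close> belong to the ideal, so a functional below it can be prescribed there.
\<close>

lemma localised_exists:
  fixes x :: "'a::banach_lattice"
  obtains g where "localised \<bar>x\<bar> f g" "\<bar>f x\<bar> \<le> g \<bar>x\<bar>"
proof -
  let ?S = "principal_ideal \<bar>x\<bar>"
  let ?q = "\<lambda>y. modulus_on ?S f (pprt y)"
  have S: "lattice_ideal ?S" by (rule lattice_ideal_principal) simp
  interpret vector_space_carrier "type_space :: 'a vlattice" by (rule vector_space_type_space)
  have q: "sublinear_on type_space ?q"
    unfolding sublinear_on_def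
    by (auto simp: pprt_scaleR modulus_scale[OF S] pprt_nonneg
        intro!: order_trans[OF modulus_mono[OF S] modulus_add_le[OF S]] pprt_add_le)
  have xS: "x \<in> ?S" "- x \<in> ?S" by (auto simp: principal_ideal_def intro!: exI[of _ 1])
  then have "\<bar>f x\<bar> \<le> ?q \<bar>x\<bar>"
    using modulus_upper[OF S xS(1), of "\<bar>x\<bar>" f] modulus_upper[OF S xS(2), of "\<bar>x\<bar>" f]
    by (simp add: pprt_id blinfun.minus_right)
  then obtain g where g: "linear_on_carrier type_space g" "\<And>y. g y \<le> ?q y" "\<bar>f x\<bar> \<le> g \<bar>x\<bar>"
    using mazur_orlicz_single[OF q, of "\<bar>x\<bar>" "\<bar>f x\<bar>"] by (auto simp del: abs_ge_self)
  have "g y \<le> norm f * norm y" for y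
  proof -
    have "norm (pprt y) \<le> norm y"
      using norm_mono_pos[of "pprt y" "\<bar>y\<bar>"] pprt_le_abs[of y] pprt_nonneg[of y] by (simp add: norm_abs)
    then have "?q y \<le> norm f * norm y"
      using modulus_le_norm[OF S pprt_nonneg, of f y] by (meson mult_left_mono norm_ge_zero order_trans)
    then show ?thesis using g(2)[of y] by simp
  qed
  then have "blinfun_apply (Blinfun g) = g"
    using g(1) by (intro blinfun_of_bounded) (simp_all add: linear_type_space)
  then show thesis using g that[of "Blinfun g"] by (simp add: localised_def)
qed

context
  fixes X :: "'a::banach_lattice" and f g :: "'a \<Rightarrow>\<^sub>L real"
  assumes X: "0 \<le> X" and loc: "localised X f g"
begin

lemma localised_nonneg: "0 \<le> y \<Longrightarrow> 0 \<le> g y"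
  using loc[unfolded localised_def, rule_format, of "- y"]
    modulus_scale[OF lattice_ideal_principal[OF X], of 0 0 f]
  by (simp add: pprt_zero_of_nonpos blinfun.minus_right)

lemma localised_le_abs: "g y \<le> g \<bar>y\<bar>"
proof -
  have "0 \<le> g (\<bar>y\<bar> - y)" by (rule localised_nonneg) (simp add: abs_ge_self)
  then show ?thesis by (simp add: blinfun.diff_right)
qed

lemma localised_abs_le: "\<bar>g y\<bar> \<le> g \<bar>y\<bar>"
  using localised_le_abs[of y] localised_le_abs[of "- y"] by (simp add: blinfun.minus_right)

lemma localised_off_ideal:
  assumes "0 \<le> y" "inf y X = 0" shows "g y = 0"
proof -
  have "modulus_on (principal_ideal X) f y \<le> 0"
  proof (rule modulus_least[OF lattice_ideal_principal[OF X] assms(1)])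
    fix r assume r: "r \<in> principal_ideal X" "\<bar>r\<bar> \<le> y"
    then obtain j :: nat where "\<bar>r\<bar> \<le> real j *\<^sub>R X" by (auto simp: principal_ideal_def)
    then have "\<bar>r\<bar> \<le> inf (real j *\<^sub>R X) y" using r by simp
    also have "\<dots> = 0" using assms by (intro disjoint_scaleR) (simp_all add: inf_commute)
    finally have "r = 0" by simp
    then show "f r \<le> 0" by simp
  qed
  then show ?thesis
    using loc[unfolded localised_def, rule_format, of y] localised_nonneg[of y] assms by (simp add: pprt_id)
qed

text \<open>
  If \<open>r\<close> nearly attains the supremum that defines the modulus at \<open>y\<close> and \<open>\<bar>r\<bar> \<le> i *\<^sub>R X\<close>, then
  nothing substantial is left to be attained on \<open>y - inf y (i *\<^sub>R X)\<close>.
\<close>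

lemma localised_remainder:
  assumes y: "0 \<le> y" and e: "0 < e"
  shows "\<exists>i::nat. \<forall>j\<ge>i. g (y - inf y (real j *\<^sub>R X)) \<le> e"
proof -
  let ?S = "principal_ideal X"
  note S = lattice_ideal_principal[OF X]
  have "{r \<in> ?S. \<bar>r\<bar> \<le> y} \<noteq> {}" using S y by (auto simp: lattice_ideal_def)
  moreover have "modulus_on ?S f y - e < (SUP r\<in>{r \<in> ?S. \<bar>r\<bar> \<le> y}. f r)" using e by (simp add: modulus_on_def)
  ultimately obtain r where r: "r \<in> ?S" "\<bar>r\<bar> \<le> y" "modulus_on ?S f y - e < f r"
    using less_cSUP_iff[OF _ bdd_modulus[OF S]] by auto
  then obtain i :: nat where i: "\<bar>r\<bar> \<le> real i *\<^sub>R X" by (auto simp: principal_ideal_def)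
  have "g (y - inf y (real j *\<^sub>R X)) \<le> e" if j: "i \<le> j" for j
  proof -
    have rj: "\<bar>r\<bar> \<le> real j *\<^sub>R X" using i j X by (meson of_nat_mono order_trans scaleR_right_mono)
    let ?v = "y - inf y (real j *\<^sub>R X)"
    have v: "0 \<le> ?v" by (simp only: diff_ge_0_iff_ge inf_le1)
    have "modulus_on ?S f ?v \<le> e"
    proof (rule modulus_least[OF S v])
      fix s assume s: "s \<in> ?S" "\<bar>s\<bar> \<le> ?v"
      have "\<bar>r + s\<bar> \<le> \<bar>r\<bar> + \<bar>s\<bar>" by (rule abs_triangle_ineq)
      also have "\<dots> \<le> inf y (real j *\<^sub>R X) + ?v" using r rj s by (intro add_mono) auto
      also have "\<dots> = y" by (metis add.commute diff_add_cancel)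
      finally have "\<bar>r + s\<bar> \<le> y" .
      then have "f (r + s) \<le> modulus_on ?S f y"
        using S r s by (intro modulus_upper[OF S]) (auto simp: lattice_ideal_def)
      then show "f s \<le> e" using r by (simp add: blinfun.add_right)
    qed
    then show ?thesis
      using loc[unfolded localised_def, rule_format, of ?v] v by (simp add: pprt_id del: diff_ge_0_iff_ge)
  qed
  then show ?thesis by blast
qed

end

lemma blinfun_half_norm:
  fixes h :: "'a::real_normed_vector \<Rightarrow>\<^sub>L real"
  obtains z where "norm z \<le> 1" "norm h / 2 \<le> h z"
proof (cases "h = 0")
  case True then show ?thesis using that[of 0] by simp
next
  case False
  have "\<exists>z. norm h / 2 * norm z < norm (h z)"
  proof (rule ccontr)
    assume "\<not> ?thesis"
    then have "norm h \<le> norm h / 2" by (intro norm_blinfun_bound) (auto simp: not_less)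
    then show False using False by simp
  qed
  then obtain z where z: "norm h / 2 * norm z < norm (h z)" by blast
  then have z0: "z \<noteq> 0" by auto
  let ?w = "(sgn (h z) / norm z) *\<^sub>R z"
  have "norm ?w \<le> 1" using z0 by (auto simp: abs_sgn_eq)
  moreover have hw: "h ?w = \<bar>h z\<bar> / norm z" by (simp add: blinfun.scaleR_right sgn_mult_abs abs_sgn mult.commute)
  have "norm h / 2 \<le> h ?w" unfolding hw using z z0 by (simp add: field_simps)
  ultimately show thesis by (rule that)
qed

text \<open>
  The central lemma: positive functionals localised on the members of a disjoint sequence and
  controlled by a weakly null sequence \<open>f\<close> do not dominate the positive cone of \<open>\<ell>\<^sub>1\<close>. If they
  did, a finitely additive mean over configurations \<open>r\<close> (choices of \<open>r n\<close> in the ideal of \<open>X n\<close>,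
  all below one \<open>y\<close> in the unit ball) would satisfy \<open>\<delta> / 4 \<le> \<mu> (f n (r n))\<close> for every \<open>n\<close>, and the
  functionals \<open>h \<mapsto> \<mu> (h (r n))\<close> would contradict the gliding hump.
\<close>

lemma localised_not_l1:
  fixes f g :: "nat \<Rightarrow> 'a::banach_lattice \<Rightarrow>\<^sub>L real" and X :: "nat \<Rightarrow> 'a"
  assumes null: "weakly_null f" and X: "\<And>m n. m \<noteq> n \<Longrightarrow> inf (X m) (X n) = 0"
    and loc: "\<And>n. localised (X n) (f n) (g n)" and d: "0 < \<delta>"
    and l1: "\<And>N a. (\<And>i. 0 \<le> a i) \<Longrightarrow> \<delta> * (\<Sum>i<N. a i) \<le> norm (\<Sum>i<N. a i *\<^sub>R g i)"
  shows False
proof -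
  have X0: "0 \<le> X n" for n using X[of n "Suc n"] by (metis inf_le1 n_not_Suc_n)
  \<comment> \<open>The configurations. Being disjoint and below one \<open>y\<close>, the vectors \<open>r n\<close> have signed sums with modulus below \<open>y\<close>.\<close>
  define Z where "Z = {r. \<exists>y. norm y \<le> 1 \<and> (\<forall>n. r n \<in> principal_ideal (X n) \<and> \<bar>r n\<bar> \<le> y)}"
  let ?V = "bounded_functions Z"
  let ?q = "\<lambda>h. SUP r\<in>Z. h r"
  interpret vector_space_carrier ?V by (rule vector_space_bounded_functions)
  have Z0: "(\<lambda>_. 0) \<in> Z"
    using lattice_ideal_principal[OF X0] by (auto simp: Z_def lattice_ideal_def intro!: exI[of _ 0])
  have q: "sublinear_on ?V ?q" using Z0 by (intro sublinear_SUP) auto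
  have rn: "norm (r n) \<le> 1" if "r \<in> Z" for r n
  proof -
    obtain y where "norm y \<le> 1" "\<bar>r n\<bar> \<le> y" using \<open>r \<in> Z\<close> unfolding Z_def by blast
    then show ?thesis using norm_mono_pos[of "r n" y] by simp
  qed
  have hb: "\<bar>h (r n)\<bar> \<le> norm h" if "r \<in> Z" for h :: "'a \<Rightarrow>\<^sub>L real" and r n
    using norm_blinfun[of h "r n"] mult_left_le[OF rn[OF that, of n] norm_ge_zero[of h]] by simp
  have hV: "(\<lambda>r. h (r n)) \<in> vcarrier ?V" for h :: "'a \<Rightarrow>\<^sub>L real" and n
    using hb by auto
  let ?S = "\<lambda>N a r. \<Sum>i<N. a i * f i (r i)"
  have comb: "(\<lambda>r. \<Sum>i<N. a i * h i (r i)) \<in> vcarrier ?V" for N and a :: "nat \<Rightarrow> real" and h :: "nat \<Rightarrow> 'a \<Rightarrow>\<^sub>L real"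
  proof -
    have "\<bar>\<Sum>i<N. a i * h i (r i)\<bar> \<le> (\<Sum>i<N. \<bar>a i\<bar> * norm (h i))" if "r \<in> Z" for r
      using hb[OF that] by (intro order_trans[OF sum_abs] sum_mono) (auto simp: abs_mult intro!: mult_left_mono)
    then show ?thesis by auto
  qed
  have bddV: "bdd_above (h ` Z)" if "h \<in> vcarrier ?V" for h
    using that by (force simp: bdd_above_def abs_le_iff)
  \<comment> \<open>One mean must serve all \<open>n\<close>. The consistency condition asks, for given weights \<open>a\<close>, for a single
      configuration at which the weighted sum of the \<open>f i (r i)\<close> is large; it is found near a vector that
      norms \<open>\<Sum>a i g i\<close>, losing \<open>\<delta> / 2\<close> by halving the norm and \<open>\<delta> / 4\<close> in passing from \<open>g\<close> to \<open>f\<close>.\<close>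
  obtain \<mu> where mu: "linear_on_carrier ?V \<mu>" "\<And>h. h \<in> vcarrier ?V \<Longrightarrow> \<mu> h \<le> ?q h"
    "\<And>i. \<delta> / 4 \<le> \<mu> (?S (Suc i) (\<lambda>j. if j = i then 1 else 0))"
  proof (rule mazur_orlicz_family[OF q, of ?S "\<lambda>_. \<delta> / 4"])
    fix N and a :: "nat \<Rightarrow> real" assume a: "\<And>i. 0 \<le> a i"
    obtain z where z: "norm z \<le> 1" "norm (\<Sum>i<N. a i *\<^sub>R g i) / 2 \<le> (\<Sum>i<N. a i *\<^sub>R g i) z"
      using blinfun_half_norm by blast
    have "\<exists>s. s \<in> principal_ideal (X n) \<and> \<bar>s\<bar> \<le> \<bar>z\<bar> \<and> g n z - \<delta> / 4 \<le> f n s" for n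
    proof (rule ccontr)
      assume "\<not> ?thesis"
      then have "modulus_on (principal_ideal (X n)) (f n) \<bar>z\<bar> \<le> g n z - \<delta> / 4"
        by (intro modulus_least lattice_ideal_principal X0) (auto simp: not_le intro: less_imp_le)
      moreover have "g n z \<le> modulus_on (principal_ideal (X n)) (f n) \<bar>z\<bar>"
        using loc[of n] localised_le_abs[OF X0 loc, of n z]
        unfolding localised_def by (metis abs_ge_zero order_trans pprt_id)
      ultimately show False using d by simp
    qed
    then obtain s where s: "\<And>n. s n \<in> principal_ideal (X n)" "\<And>n. \<bar>s n\<bar> \<le> \<bar>z\<bar>"
      "\<And>n. g n z - \<delta> / 4 \<le> f n (s n)" by metis
    have sZ: "s \<in> Z" using s z unfolding Z_def by (auto intro!: exI[of _ "\<bar>z\<bar>"] simp: norm_abs)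
    have "(\<Sum>i<N. a i * (\<delta> / 4)) = \<delta> * (\<Sum>i<N. a i) / 2 - (\<Sum>i<N. a i * (\<delta> / 4))"
      unfolding sum_distrib_right[symmetric] by (simp add: field_simps)
    also have "\<dots> \<le> (\<Sum>i<N. a i *\<^sub>R g i) z - (\<Sum>i<N. a i * (\<delta> / 4))"
      using l1[where N = N and a = a] a z by simp
    also have "\<dots> = (\<Sum>i<N. a i * (g i z - \<delta> / 4))"
      by (simp add: blinfun.sum_left blinfun.scaleR_left right_diff_distrib sum_subtractf)
    also have "\<dots> \<le> ?S N a s" using s a by (intro sum_mono mult_left_mono) auto
    also have "\<dots> \<le> ?q (?S N a)" using sZ by (intro cSUP_upper bddV comb)
    finally show "(\<Sum>i<N. a i * (\<delta> / 4)) \<le> ?q (?S N a)" .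
  next
    fix N M and a :: "nat \<Rightarrow> real" assume "N \<le> M" "\<And>i. N \<le> i \<Longrightarrow> a i = 0"
    then show "?S M a = ?S N a" by (intro ext sum.mono_neutral_right) auto
  qed (use comb in \<open>auto simp: distrib_right sum.distrib sum_distrib_left mult.assoc\<close>)
  have lin: "\<mu> (\<lambda>r. g r + h r) = \<mu> g + \<mu> h" if "g \<in> vcarrier ?V" "h \<in> vcarrier ?V" for g h
    using mu(1) that unfolding linear_on_carrier_def by simp
  have scl: "\<mu> (\<lambda>r. c * h r) = c * \<mu> h" if "h \<in> vcarrier ?V" for c h
    using mu(1) that unfolding linear_on_carrier_def by simp
  define B where "B n h = \<mu> (\<lambda>r. blinfun_apply h (r n))" for n and h :: "'a \<Rightarrow>\<^sub>L real"
  have linB: "linear (B n)" for n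
    unfolding linear_iff B_def using lin[OF hV hV] scl[OF hV]
    by (auto simp: blinfun.add_left blinfun.scaleR_left)
  have sumB: "\<mu> (\<lambda>r. \<Sum>n<N. c n * h (r n)) = (\<Sum>n<N. c n * B n h)" for N c and h :: "'a \<Rightarrow>\<^sub>L real"
  proof (induction N)
    case 0
    show ?case using scl[OF hV, of 0 h 0] by simp
  next
    case (Suc N)
    have "\<mu> (\<lambda>r. (\<Sum>n<N. c n * h (r n)) + c N * h (r N)) =
        \<mu> (\<lambda>r. \<Sum>n<N. c n * h (r n)) + \<mu> (\<lambda>r. c N * h (r N))"
      using comb[of c "\<lambda>_. h" N] scale_closed[OF hV[of h N], of "c N"] by (intro lin) auto
    then show ?case using Suc scl[OF hV, of "c N" h N] by (simp add: B_def)
  qed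
  have "(\<Sum>n<N. \<bar>B n h\<bar>) \<le> 1 * norm h" for N h
  proof -
    \<comment> \<open>The signs move inside the mean, where the bound for a single configuration applies.\<close>
    have "(\<Sum>n<N. \<bar>B n h\<bar>) = \<mu> (\<lambda>r. \<Sum>n<N. sgn (B n h) * h (r n))"
      unfolding sumB by (simp add: abs_sgn mult.commute)
    also have "\<dots> \<le> ?q (\<lambda>r. \<Sum>n<N. sgn (B n h) * h (r n))" by (intro mu(2) comb)
    also have "\<dots> \<le> norm h"
    proof (rule cSUP_least)
      fix r assume r: "r \<in> Z"
      then obtain y where y: "norm y \<le> 1" "\<And>n. r n \<in> principal_ideal (X n)" "\<And>n. \<bar>r n\<bar> \<le> y"
        unfolding Z_def by blast
      have y0: "0 \<le> y" using y(3)[of 0] abs_ge_zero order_trans by blast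
      let ?s = "\<Sum>n<N. sgn (B n h) *\<^sub>R r n"
      have "\<bar>?s\<bar> \<le> (\<Sum>n<N. \<bar>sgn (B n h) *\<^sub>R r n\<bar>)" by (rule sum_abs)
      also have "\<dots> \<le> (\<Sum>n<N. \<bar>r n\<bar>)"
        by (intro sum_mono) (auto simp: abs_scaleR abs_sgn_eq)
      also have "\<dots> \<le> y"
      proof (rule sum_disjoint_le)
        fix m n :: nat assume mn: "m \<noteq> n"
        obtain i j :: nat where i: "\<bar>r m\<bar> \<le> real i *\<^sub>R X m" and j: "\<bar>r n\<bar> \<le> real j *\<^sub>R X n"
          using y(2) unfolding principal_ideal_def by blast
        have "inf (real i *\<^sub>R X m) (X n) = 0" using X[OF mn] by (intro disjoint_scaleR) auto
        then have "inf (X n) (real i *\<^sub>R X m) = 0" by (subst inf_commute)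
        then have "inf (real j *\<^sub>R X n) (real i *\<^sub>R X m) = 0" by (rule disjoint_scaleR) simp
        then have "inf (real i *\<^sub>R X m) (real j *\<^sub>R X n) = 0" by (subst inf_commute)
        from disjoint_mono[OF this abs_ge_zero i abs_ge_zero j] show "inf \<bar>r m\<bar> \<bar>r n\<bar> = 0" .
      qed (use y y0 in auto)
      finally have "norm ?s \<le> 1" using norm_mono_pos y(1) order_trans by blast
      then have "h ?s \<le> norm h"
        using blinfun_le_norm[of h ?s] mult_left_le[of "norm ?s" "norm h"] by simp
      then show "(\<Sum>n<N. sgn (B n h) * h (r n)) \<le> norm h"
        by (simp add: blinfun.sum_right blinfun.scaleR_right)
    qed (use Z0 in auto)
    finally show ?thesis by simp
  qed
  moreover have "\<delta> / 4 \<le> B n (f n)" for n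
    using mu(3)[of n] by (simp add: B_def if_distrib[of "\<lambda>c. c * _"] sum.delta cong: if_cong)
  ultimately show False
    using diagonal_of_summable_functionals[OF linB _ null, where C = 1 and \<delta> = "\<delta> / 4"] d
    by (meson divide_pos_pos not_less zero_less_numeral)
qed

section \<open>Failure of the disjoint Dunford-Pettis property\<close>

lemma not_null_subsequence:
  fixes X :: "nat \<Rightarrow> real"
  assumes "\<not> X \<longlonglongrightarrow> 0"
  obtains \<delta> \<sigma> s where "0 < \<delta>" "\<sigma> \<in> {1, - 1}" "strict_mono s" "\<And>n::nat. \<delta> \<le> \<sigma> * X (s n)"
proof -
  obtain \<delta> where d: "0 < \<delta>" "\<not> (\<forall>\<^sub>F n in sequentially. dist (X n) 0 < \<delta>)"
    using assms unfolding tendsto_iff by blast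
  then have "\<exists>\<^sub>F n in sequentially. \<delta> \<le> \<bar>X n\<bar>" by (simp add: not_eventually not_less)
  then have "\<exists>\<^sub>F n in sequentially. \<delta> \<le> X n \<or> \<delta> \<le> - X n"
    by (rule frequently_elim1) (auto simp: abs_if split: if_splits)
  then have "(\<exists>\<^sub>F n in sequentially. \<delta> \<le> X n) \<or> (\<exists>\<^sub>F n in sequentially. \<delta> \<le> - X n)"
    by (simp add: frequently_disj_iff)
  then have "\<exists>\<sigma>\<in>{1, - 1}. \<exists>\<^sub>F n in sequentially. \<delta> \<le> \<sigma> * X n" by simp
  then obtain \<sigma> where s: "\<sigma> \<in> {1, - 1}" "\<exists>\<^sub>F n in sequentially. \<delta> \<le> \<sigma> * X n" by blast
  then have inf: "infinite {n. \<delta> \<le> \<sigma> * X n}"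
    by (simp add: frequently_cofinite[symmetric] cofinite_eq_sequentially)
  show thesis
    using that[OF d(1) s(1), of "enumerate {n. \<delta> \<le> \<sigma> * X n}"] strict_mono_enumerate[OF inf]
      enumerate_in_set[OF inf] by blast
qed

lemma weakly_null_subseq: "weakly_null f \<Longrightarrow> strict_mono s \<Longrightarrow> weakly_null (\<lambda>n. f (s n))"
  unfolding weakly_null_def using LIMSEQ_subseq_LIMSEQ unfolding o_def by blast

lemma disjoint_seq_subseq: "disjoint_seq x \<Longrightarrow> strict_mono s \<Longrightarrow> disjoint_seq (\<lambda>n. x (s n))"
  unfolding disjoint_seq_def by (metis strict_mono_eq)

lemma weakly_summable_subseq:
  assumes "weakly_summable p x" "strict_mono s" shows "weakly_summable p (\<lambda>n. x (s n))"
  unfolding weakly_summable_def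
proof
  fix f :: "'a \<Rightarrow>\<^sub>L real"
  let ?b = "\<lambda>n. \<bar>f (x n)\<bar> powr p"
  have sm: "summable ?b" using assms unfolding weakly_summable_def by blast
  have "summable (?b \<circ> s)" using sm strict_mono_imp_inj_on[OF assms(2)] by (intro summable_reindex) auto
  then show "summable (\<lambda>n. \<bar>f (x (s n))\<bar> powr p)" by (simp add: o_def)
qed

lemma weakly_summable_imp_null:
  fixes f :: "'a::real_normed_vector \<Rightarrow>\<^sub>L real"
  assumes "weakly_summable p x" "0 < p" shows "(\<lambda>n. blinfun_apply f (x n)) \<longlonglongrightarrow> 0"
proof -
  have "(\<lambda>n. \<bar>f (x n)\<bar> powr p) \<longlonglongrightarrow> 0"
    using assms unfolding weakly_summable_def by (blast intro: summable_LIMSEQ_zero)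
  from tendsto_zero_powrI[OF this tendsto_const, of "1 / p"]
  have "(\<lambda>n. (\<bar>f (x n)\<bar> powr p) powr (1 / p)) \<longlonglongrightarrow> 0" using assms(2) by simp
  moreover have "(\<bar>f (x n)\<bar> powr p) powr (1 / p) = \<bar>f (x n)\<bar>" for n using assms by (simp add: powr_powr)
  ultimately have "(\<lambda>n. \<bar>f (x n)\<bar>) \<longlonglongrightarrow> 0" by (simp only:)
  then show ?thesis by (rule tendsto_rabs_zero_cancel)
qed

text \<open>
  Failure of uniform convergence on \<open>range x\<close> is witnessed on a diagonal: for fixed \<open>m\<close> the values
  \<open>f n (x m)\<close> tend to zero, so the bad index in \<open>x\<close> must escape to infinity with \<open>n\<close>.
\<close>

lemma not_dunford_pettis_diagonal:
  fixes f :: "nat \<Rightarrow> 'a::banach \<Rightarrow>\<^sub>L real" and x :: "nat \<Rightarrow> 'a"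
  assumes null: "weakly_null f"
    and bad: "\<not> uniform_limit (range x) (\<lambda>n. blinfun_apply (f n)) (\<lambda>x. 0) sequentially"
  obtains \<epsilon> s t where "0 < \<epsilon>" "strict_mono s" "strict_mono t" "\<And>i::nat. \<epsilon> \<le> \<bar>f (s i) (x (t i))\<bar>"
proof -
  obtain \<epsilon> where e: "0 < \<epsilon>" "\<not> (\<forall>\<^sub>F n in sequentially. \<forall>y\<in>range x. dist (f n y) 0 < \<epsilon>)"
    using bad unfolding uniform_limit_iff by blast
  have pt: "(\<lambda>n. f n y) \<longlonglongrightarrow> 0" for y
  proof -
    have "bounded_linear (\<lambda>h :: 'a \<Rightarrow>\<^sub>L real. h y)" by (rule blinfun.bounded_linear_left)
    then show ?thesis
      using null[unfolded weakly_null_def, rule_format, of "Blinfun (\<lambda>h :: 'a \<Rightarrow>\<^sub>L real. h y)"]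
      by (simp add: bounded_linear_Blinfun_apply)
  qed
  have "\<exists>z'. fst z < fst z' \<and> snd z < snd z' \<and> \<epsilon> \<le> \<bar>f (fst z') (x (snd z'))\<bar>" for z :: "nat \<times> nat"
  proof -
    have "\<forall>\<^sub>F n in sequentially. \<forall>m\<in>{..snd z}. dist (f n (x m)) 0 < \<epsilon>"
      by (intro eventually_ball_finite ballI tendstoD[OF pt e(1)]) simp
    then have ev: "\<forall>\<^sub>F n in sequentially. (\<exists>m. \<epsilon> \<le> \<bar>f n (x m)\<bar>) \<longrightarrow>
        fst z < n \<and> (\<exists>m>snd z. \<epsilon> \<le> \<bar>f n (x m)\<bar>)"
      using eventually_gt_at_top[of "fst z"]
    proof eventually_elim
      case (elim n)
      then have "snd z < m" if "\<epsilon> \<le> \<bar>f n (x m)\<bar>" for m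
        using that by (metis atMost_iff diff_0_right dist_real_def not_le)
      then show ?case using elim by blast
    qed
    have "\<exists>\<^sub>F n in sequentially. \<exists>m. \<epsilon> \<le> \<bar>f n (x m)\<bar>"
      using e(2) by (simp add: not_eventually not_less)
    from frequently_rev_mp[OF this ev]
    show ?thesis by (auto dest!: frequently_ex)
  qed
  then obtain z where z: "\<And>i::nat. fst (z i) < fst (z (Suc i)) \<and> snd (z i) < snd (z (Suc i)) \<and>
      \<epsilon> \<le> \<bar>f (fst (z (Suc i))) (x (snd (z (Suc i))))\<bar>"
    using dependent_nat_choice[of "\<lambda>_ _. True"
        "\<lambda>_ z z'. fst z < fst z' \<and> snd z < snd z' \<and> \<epsilon> \<le> \<bar>f (fst z') (x (snd z'))\<bar>"] by auto
  show thesis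
    using z by (intro that[OF e(1), of "\<lambda>i. fst (z (Suc i))" "\<lambda>i. snd (z (Suc i))"])
      (auto intro!: strict_monoI_Suc)
qed

text \<open>
  Both sequences may be taken positive: \<open>x\<close> is replaced by \<open>\<bar>x\<bar>\<close>, and \<open>f n\<close> by a functional localised
  on \<open>\<bar>x n\<bar>\<close> whose value there is at least \<open>\<bar>f n (x n)\<bar>\<close>. All statements of the equivalence are refuted
  from this configuration.
\<close>

lemma not_disjoint_DPP_witness:
  assumes p: "1 \<le> p" and bad: "\<not> disjoint_DPP p TYPE('a::banach_lattice)"
  obtains X :: "nat \<Rightarrow> 'a::banach_lattice" and f g :: "nat \<Rightarrow> 'a \<Rightarrow>\<^sub>L real" and \<epsilon>
  where "disjoint_seq X" "weakly_summable p X" "\<And>n. 0 \<le> X n"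
    "\<And>m n. m \<noteq> n \<Longrightarrow> inf (X m) (X n) = 0" "weakly_null f"
    "\<And>n. localised (X n) (f n) (g n)" "0 < \<epsilon>" "\<And>n. \<epsilon> \<le> g n (X n)"
proof -
  obtain x :: "nat \<Rightarrow> 'a" and f :: "nat \<Rightarrow> 'a \<Rightarrow>\<^sub>L real"
    where x: "disjoint_seq x" "weakly_summable p x" and f: "weakly_null f"
      and nu: "\<not> uniform_limit (range x) (\<lambda>n. blinfun_apply (f n)) (\<lambda>x. 0) sequentially"
    using bad unfolding disjoint_DPP_def dunford_pettis_set_def by blast
  obtain \<epsilon> s t where st: "0 < \<epsilon>" "strict_mono s" "strict_mono t" "\<And>i::nat. \<epsilon> \<le> \<bar>f (s i) (x (t i))\<bar>"
    using not_dunford_pettis_diagonal[OF f nu] by blast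
  have "\<exists>g. localised \<bar>x (t i)\<bar> (f (s i)) g \<and> \<bar>f (s i) (x (t i))\<bar> \<le> g \<bar>x (t i)\<bar>" for i
    using localised_exists by metis
  then obtain g where g: "\<And>i. localised \<bar>x (t i)\<bar> (f (s i)) (g i)"
    "\<And>i. \<bar>f (s i) (x (t i))\<bar> \<le> g i \<bar>x (t i)\<bar>" by metis
  have d: "disjoint_seq (\<lambda>i. x (t i))" by (rule disjoint_seq_subseq[OF x(1) st(3)])
  have "weakly_summable p (\<lambda>i. \<bar>x (t i)\<bar>)"
    using p by (intro weakly_summable_abs[OF d weakly_summable_subseq[OF x(2) st(3)]]) simp
  moreover have "inf \<bar>x (t m)\<bar> \<bar>x (t n)\<bar> = 0" if "m \<noteq> n" for m n
    using d that unfolding disjoint_seq_def by blast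
  moreover have "disjoint_seq (\<lambda>i. \<bar>x (t i)\<bar>)" using d unfolding disjoint_seq_def by simp
  moreover have "\<epsilon> \<le> g i \<bar>x (t i)\<bar>" for i using st(4)[of i] g(2)[of i] by linarith
  ultimately show thesis
    using that[of "\<lambda>i. \<bar>x (t i)\<bar>" "\<lambda>i. f (s i)" g \<epsilon>] weakly_null_subseq[OF f st(2)] g(1) st(1)
    by (metis abs_ge_zero)
qed

lemma disjoint_DPP_diagonal:
  fixes x :: "nat \<Rightarrow> 'a::banach_lattice" and f :: "nat \<Rightarrow> 'a \<Rightarrow>\<^sub>L real"
  assumes a: "disjoint_DPP p TYPE('a)" and x: "disjoint_seq x" "weakly_summable p x" and f: "weakly_null f"
  shows "(\<lambda>n. blinfun_apply (f n) (x n)) \<longlonglongrightarrow> 0"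
proof -
  have u: "uniform_limit (range x) (\<lambda>n. blinfun_apply (f n)) (\<lambda>x. 0) sequentially"
    using a[unfolded disjoint_DPP_def dunford_pettis_set_def, rule_format, OF conjI[OF x] f] .
  show ?thesis
  proof (rule tendstoI)
    fix e :: real assume "0 < e"
    then have "\<forall>\<^sub>F n in sequentially. \<forall>y\<in>range x. dist (f n y) 0 < e"
      using u unfolding uniform_limit_iff by blast
    then show "\<forall>\<^sub>F n in sequentially. dist (f n (x n)) 0 < e" by eventually_elim auto
  qed
qed

text \<open>
  Functionals localised on a disjoint sequence are norm bounded: along a subsequence with
  \<open>4 ^ i \<le> norm (g i)\<close> they would dominate the positive cone of \<open>\<ell>\<^sub>1\<close>.
\<close>

lemma localised_bounded:
  fixes f g :: "nat \<Rightarrow> 'a::banach_lattice \<Rightarrow>\<^sub>L real" and X :: "nat \<Rightarrow> 'a"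
  assumes null: "weakly_null f" and X: "\<And>m n. m \<noteq> n \<Longrightarrow> inf (X m) (X n) = 0"
    and loc: "\<And>n. localised (X n) (f n) (g n)"
  shows "\<exists>C>0. \<forall>n. norm (g n) \<le> C"
proof (rule ccontr)
  assume *: "\<not> ?thesis"
  have X0: "0 \<le> X n" for n using X[of n "Suc n"] by (metis inf_le1 n_not_Suc_n)
  have "\<exists>n'>n. K \<le> norm (g n')" for n K
  proof (rule ccontr)
    assume nex: "\<not> ?thesis"
    let ?C = "Max (insert (max 1 K) ((\<lambda>i. norm (g i)) ` {..n}))"
    have "norm (g i) \<le> ?C" for i
    proof (cases "i \<le> n")
      case True
      then show ?thesis by (intro Max_ge) auto
    next
      case False
      then have "\<not> K \<le> norm (g i)" using nex by (auto simp: not_le)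
      then have "norm (g i) \<le> max 1 K" by simp
      also have "\<dots> \<le> ?C" by (intro Max_ge) auto
      finally show ?thesis .
    qed
    moreover have "max 1 K \<le> ?C" by (intro Max_ge) auto
    then have "0 < ?C" by linarith
    ultimately show False using * by blast
  qed
  \<comment> \<open>The second component counts the steps, so that the growth \<open>4 ^ i\<close> can be required of the \<open>i\<close>-th choice.\<close>
  then have "\<exists>z'. fst z < fst z' \<and> snd z' = Suc (snd z) \<and> 4 ^ snd z' \<le> norm (g (fst z'))" for z :: "nat \<times> nat"
    by (metis fst_conv snd_conv)
  then obtain z where z: "\<And>i::nat. fst (z i) < fst (z (Suc i)) \<and> snd (z (Suc i)) = Suc (snd (z i)) \<and>
      4 ^ snd (z (Suc i)) \<le> norm (g (fst (z (Suc i))))"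
    using dependent_nat_choice[of "\<lambda>_ _. True"
        "\<lambda>_ z z'. fst z < fst z' \<and> snd z' = Suc (snd z) \<and> 4 ^ snd z' \<le> norm (g (fst z'))"] by auto
  define s where "s i = fst (z (Suc i))" for i
  have s: "strict_mono s" using z unfolding s_def by (intro strict_monoI_Suc) auto
  have snd: "i \<le> snd (z i)" for i
  proof (induction i)
    case (Suc i)
    then show ?case using z[of i] by simp
  qed simp
  have big: "4 ^ i \<le> norm (g (s i))" for i
  proof -
    have "(4::real) ^ i \<le> 4 ^ snd (z (Suc i))" using snd[of "Suc i"] by (intro power_increasing) auto
    then show ?thesis using z[of i] unfolding s_def by linarith
  qed
  show False
  proof (rule localised_not_l1[of "\<lambda>i. f (s i)" "\<lambda>i. X (s i)" "\<lambda>i. g (s i)" "1 / 4"])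
    show "weakly_null (\<lambda>i. f (s i))" using null s by (rule weakly_null_subseq)
    show "inf (X (s m)) (X (s n)) = 0" if "m \<noteq> n" for m n using that X s by (metis strict_mono_eq)
    fix N and a :: "nat \<Rightarrow> real" assume a: "\<And>i. 0 \<le> a i"
    let ?h = "\<Sum>i<N. a i *\<^sub>R g (s i)"
    have "a i * 4 ^ i \<le> 2 * norm ?h" if i: "i < N" for i
    proof -
      obtain y where y: "norm y \<le> 1" "norm (g (s i)) / 2 \<le> g (s i) y" using blinfun_half_norm by blast
      have "a i * 4 ^ i \<le> a i * norm (g (s i))" using big a by (intro mult_left_mono) auto
      also have "\<dots> \<le> a i * (2 * g (s i) \<bar>y\<bar>)"
        using y a localised_le_abs[OF X0 loc, of "s i" y] by (intro mult_left_mono) auto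
      also have "\<dots> \<le> 2 * (\<Sum>j<N. a j * g (s j) \<bar>y\<bar>)"
        using i a localised_nonneg[OF X0 loc, of "\<bar>y\<bar>"]
          member_le_sum[of i "{..<N}" "\<lambda>j. a j * g (s j) \<bar>y\<bar>"] by simp
      also have "(\<Sum>j<N. a j * g (s j) \<bar>y\<bar>) = ?h \<bar>y\<bar>" by (simp add: blinfun.sum_left blinfun.scaleR_left)
      also have "?h \<bar>y\<bar> \<le> norm ?h"
        using blinfun_le_norm[of ?h "\<bar>y\<bar>"] y mult_left_le[of "norm \<bar>y\<bar>" "norm ?h"] by (simp add: norm_abs)
      finally show ?thesis by simp
    qed
    then have "(\<Sum>i<N. a i) \<le> (\<Sum>i<N. 2 * norm ?h * (1 / 4) ^ i)"
      by (intro sum_mono) (simp add: power_divide field_simps)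
    also have "\<dots> = 2 * norm ?h * (\<Sum>i<N. (1 / 4) ^ i)" by (simp add: sum_distrib_left)
    also have "(\<Sum>i<N. (1 / 4 :: real) ^ i) = 4 / 3 - 4 / 3 * (1 / 4) ^ N" by (induction N) simp_all
    also have "2 * norm ?h * \<dots> \<le> 2 * norm ?h * 2"
      by (intro mult_left_mono) (auto simp: field_simps intro: add_increasing2)
    finally show "1 / 4 * (\<Sum>i<N. a i) \<le> norm ?h" by simp
  qed (use loc in auto)
qed

section \<open>Multilinear forms\<close>

definition multilinear_form :: "nat \<Rightarrow> ('a::real_vector list \<Rightarrow> real) \<Rightarrow> bool" where
  "multilinear_form k T \<longleftrightarrow>
     (\<forall>xs i u v. length xs = k \<and> i < k \<longrightarrow> T (xs[i := u + v]) = T (xs[i := u]) + T (xs[i := v])) \<and>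
     (\<forall>xs i c u. length xs = k \<and> i < k \<longrightarrow> T (xs[i := c *\<^sub>R u]) = c * T (xs[i := u]))"

definition symmetric_form :: "nat \<Rightarrow> ('a list \<Rightarrow> real) \<Rightarrow> bool" where
  "symmetric_form k T \<longleftrightarrow> (\<forall>xs ys. length xs = k \<and> mset xs = mset ys \<longrightarrow> T xs = T ys)"

definition positive_form :: "nat \<Rightarrow> ('a::banach_lattice list \<Rightarrow> real) \<Rightarrow> bool" where
  "positive_form k T \<longleftrightarrow> (\<forall>xs. length xs = k \<and> (\<forall>x\<in>set xs. 0 \<le> x) \<longrightarrow> 0 \<le> T xs)"

lemma real_vlattice_simps [simp]:
  "vcarrier real_vlattice = UNIV" "vadd real_vlattice = (+)" "vzero real_vlattice = 0"
  "vscale real_vlattice = (*)" "vle real_vlattice = (\<le>)" "vnorm real_vlattice = abs"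
  "vminus real_vlattice a b = a - b"
  by (simp_all add: real_vlattice_def vminus_def)

lemma symmetric_multilinear_real:
  "symmetric_multilinear real_vlattice k T \<longleftrightarrow> multilinear_form k T \<and> symmetric_form k T"
  by (simp add: symmetric_multilinear_def multilinear_form_def symmetric_form_def)

lemma multilinear_tail:
  fixes T :: "'a::real_vector list \<Rightarrow> real"
  assumes "multilinear_form (Suc k) T" shows "multilinear_form k (\<lambda>ys. T (x # ys))"
  unfolding multilinear_form_def
proof (intro conjI allI impI)
  fix xs :: "'a list" and i u v assume "length xs = k \<and> i < k"
  then show "T (x # xs[i := u + v]) = T (x # xs[i := u]) + T (x # xs[i := v])"
    using assms[unfolded multilinear_form_def, THEN conjunct1, rule_format, of "x # xs" "Suc i" u v] by simp
next
  fix xs :: "'a list" and i c u assume "length xs = k \<and> i < k"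
  then show "T (x # xs[i := c *\<^sub>R u]) = c * T (x # xs[i := u])"
    using assms[unfolded multilinear_form_def, THEN conjunct2, rule_format, of "x # xs" "Suc i" c u] by simp
qed

lemma multilinear_head_add:
  "multilinear_form (Suc k) T \<Longrightarrow> length ys = k \<Longrightarrow> T ((u + v) # ys) = T (u # ys) + T (v # ys)"
  unfolding multilinear_form_def by (metis length_Cons list_update_code(2) zero_less_Suc)

lemma multilinear_head_scale:
  "multilinear_form (Suc k) T \<Longrightarrow> length ys = k \<Longrightarrow> T ((c *\<^sub>R u) # ys) = c * T (u # ys)"
  unfolding multilinear_form_def by (metis length_Cons list_update_code(2) zero_less_Suc)

lemma multilinear_head_diff:
  "multilinear_form (Suc k) T \<Longrightarrow> length ys = k \<Longrightarrow> T ((u - v) # ys) = T (u # ys) - T (v # ys)"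
  using multilinear_head_add[of k T ys u "- v"] multilinear_head_scale[of k T ys "- 1" v] by simp

lemma multilinear_head_zero:
  "multilinear_form (Suc k) T \<Longrightarrow> length ys = k \<Longrightarrow> T (0 # ys) = 0"
  using multilinear_head_scale[of k T ys 0 0] by simp

lemma multilinear_SucI:
  fixes T :: "'a::real_vector list \<Rightarrow> real"
  assumes "\<And>x. multilinear_form k (\<lambda>ys. T (x # ys))"
    and "\<And>u v ys. length ys = k \<Longrightarrow> T ((u + v) # ys) = T (u # ys) + T (v # ys)"
    and "\<And>c u ys. length ys = k \<Longrightarrow> T ((c *\<^sub>R u) # ys) = c * T (u # ys)"
  shows "multilinear_form (Suc k) T"
  unfolding multilinear_form_def
proof (intro conjI allI impI)
  fix xs :: "'a list" and i u v assume *: "length xs = Suc k \<and> i < Suc k"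
  then obtain y ys where xs: "xs = y # ys" "length ys = k" by (cases xs) auto
  show "T (xs[i := u + v]) = T (xs[i := u]) + T (xs[i := v])"
    using * assms(1)[of y, unfolded multilinear_form_def, THEN conjunct1] xs assms(2) by (cases i) auto
next
  fix xs :: "'a list" and i c u assume *: "length xs = Suc k \<and> i < Suc k"
  then obtain y ys where xs: "xs = y # ys" "length ys = k" by (cases xs) auto
  show "T (xs[i := c *\<^sub>R u]) = c * T (xs[i := u])"
    using * assms(1)[of y, unfolded multilinear_form_def, THEN conjunct2] xs assms(3) by (cases i) auto
qed

lemma multilinear_combine:
  "multilinear_form k T \<Longrightarrow> multilinear_form k T' \<Longrightarrow> multilinear_form k (\<lambda>xs. a * T xs + b * T' xs)"
  unfolding multilinear_form_def by (simp add: algebra_simps)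

lemma multilinear_scale_list:
  assumes "multilinear_form k T" "length xs = k"
  shows "T (map (\<lambda>x. c *\<^sub>R x) xs) = c ^ k * T xs"
  using assms
proof (induction k arbitrary: T xs)
  case (Suc k)
  then obtain y ys where xs: "xs = y # ys" "length ys = k" by (cases xs) auto
  have "T (map (\<lambda>x. c *\<^sub>R x) xs) = c * T (y # map (\<lambda>x. c *\<^sub>R x) ys)"
    using multilinear_head_scale[OF Suc.prems(1)] xs by simp
  then show ?case using Suc.IH[OF multilinear_tail[OF Suc.prems(1)] xs(2)] xs by simp
qed simp

lemma multilinear_replicate_scale:
  "multilinear_form k T \<Longrightarrow> T (replicate k (c *\<^sub>R x)) = c ^ k * T (replicate k x)"
  using multilinear_scale_list[of k T "replicate k x" c] by simp

lemma multilinear_bound_unit: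
  fixes T :: "'a::real_normed_vector list \<Rightarrow> real"
  assumes "multilinear_form k T" "length xs = k"
    and "\<And>ys. length ys = k \<Longrightarrow> (\<forall>y\<in>set ys. norm y \<le> 1) \<Longrightarrow> \<bar>T ys\<bar> \<le> C"
  shows "\<bar>T xs\<bar> \<le> C * prod_list (map norm xs)"
  using assms
proof (induction k arbitrary: T xs)
  case (Suc k)
  then obtain x ys where xs: "xs = x # ys" "length ys = k" by (cases xs) auto
  have "norm ((1 / norm x) *\<^sub>R x) \<le> 1" by simp
  then have "\<bar>T (((1 / norm x) *\<^sub>R x) # ys)\<bar> \<le> C * prod_list (map norm ys)"
    using Suc.prems(3) by (intro Suc.IH[OF multilinear_tail[OF Suc.prems(1)] xs(2)]) auto
  moreover have "\<bar>T xs\<bar> = norm x * \<bar>T (((1 / norm x) *\<^sub>R x) # ys)\<bar>"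
    using multilinear_head_scale[OF Suc.prems(1) xs(2), of "1 / norm x" x]
      multilinear_head_zero[OF Suc.prems(1) xs(2)] xs
    by (cases "x = 0") (auto simp: abs_mult)
  ultimately have "\<bar>T xs\<bar> \<le> norm x * (C * prod_list (map norm ys))"
    by (simp add: mult_left_mono)
  then show ?case using xs by (simp add: mult_ac)
qed simp

subsection \<open>Uniqueness of the symmetric form of a polynomial\<close>

text \<open>
  The expansion of a multilinear form to first order, with an explicit quadratic remainder: it allows the
  derivative along the diagonal to be computed without continuity of the form.
\<close>

lemma multilinear_derivative:
  assumes "multilinear_form k T" "length xs = k"
  shows "\<exists>C. \<forall>t. \<bar>t\<bar> \<le> 1 \<longrightarrow>
    \<bar>T (map (\<lambda>x. x + t *\<^sub>R y) xs) - T xs - t * (\<Sum>i<k. T (xs[i := y]))\<bar> \<le> C * t\<^sup>2"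
  using assms
proof (induction k arbitrary: T xs)
  case (Suc k)
  then obtain x ys where xs: "xs = x # ys" "length ys = k" by (cases xs) auto
  let ?m = "\<lambda>t. map (\<lambda>x. x + t *\<^sub>R y) ys"
  define D where "D z = (\<Sum>i<k. T (z # ys[i := y]))" for z
  obtain C where C: "\<And>t. \<bar>t\<bar> \<le> 1 \<Longrightarrow> \<bar>T (x # ?m t) - T (x # ys) - t * D x\<bar> \<le> C * t\<^sup>2"
    using Suc.IH[OF multilinear_tail[OF Suc.prems(1)] xs(2), of x] unfolding D_def by blast
  obtain C' where C': "\<And>t. \<bar>t\<bar> \<le> 1 \<Longrightarrow> \<bar>T (y # ?m t) - T (y # ys) - t * D y\<bar> \<le> C' * t\<^sup>2"
    using Suc.IH[OF multilinear_tail[OF Suc.prems(1)] xs(2), of y] unfolding D_def by blast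
  have "\<bar>T (map (\<lambda>x. x + t *\<^sub>R y) xs) - T xs - t * (\<Sum>i<Suc k. T (xs[i := y]))\<bar> \<le> (C + (\<bar>C'\<bar> + \<bar>D y\<bar>)) * t\<^sup>2"
    if t: "\<bar>t\<bar> \<le> 1" for t
  proof -
    have 1: "T (map (\<lambda>x. x + t *\<^sub>R y) xs) = T (x # ?m t) + t * T (y # ?m t)"
      using multilinear_head_add[OF Suc.prems(1)] multilinear_head_scale[OF Suc.prems(1)] xs by simp
    have 2: "(\<Sum>i<Suc k. T (xs[i := y])) = T (y # ys) + D x"
      unfolding D_def xs by (subst sum.lessThan_Suc_shift) simp
    have "\<bar>T (y # ?m t) - T (y # ys)\<bar> \<le> (\<bar>C'\<bar> + \<bar>D y\<bar>) * \<bar>t\<bar>"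
    proof -
      have "\<bar>T (y # ?m t) - T (y # ys)\<bar> \<le> C' * t\<^sup>2 + \<bar>t * D y\<bar>" using C'[OF t] by linarith
      moreover have "C' * t\<^sup>2 \<le> \<bar>C'\<bar> * \<bar>t\<bar>"
      proof -
        have "t\<^sup>2 \<le> \<bar>t\<bar>" using mult_left_mono[OF t, of "\<bar>t\<bar>"] by (simp add: power2_eq_square abs_mult[symmetric])
        then have "\<bar>C'\<bar> * t\<^sup>2 \<le> \<bar>C'\<bar> * \<bar>t\<bar>" by (intro mult_left_mono) auto
        moreover have "C' * t\<^sup>2 \<le> \<bar>C'\<bar> * t\<^sup>2" by (intro mult_right_mono) auto
        ultimately show ?thesis by linarith
      qed
      ultimately show ?thesis by (simp add: abs_mult algebra_simps)
    qed
    then have "\<bar>t\<bar> * \<bar>T (y # ?m t) - T (y # ys)\<bar> \<le> \<bar>t\<bar> * ((\<bar>C'\<bar> + \<bar>D y\<bar>) * \<bar>t\<bar>)"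
      by (intro mult_left_mono) auto
    also have "\<dots> = (\<bar>C'\<bar> + \<bar>D y\<bar>) * (\<bar>t\<bar> * \<bar>t\<bar>)" by (simp add: mult_ac)
    also have "\<bar>t\<bar> * \<bar>t\<bar> = t\<^sup>2" by (simp add: power2_eq_square abs_mult[symmetric])
    finally have 3: "\<bar>t * (T (y # ?m t) - T (y # ys))\<bar> \<le> (\<bar>C'\<bar> + \<bar>D y\<bar>) * t\<^sup>2" by (simp add: abs_mult)
    have "T (map (\<lambda>x. x + t *\<^sub>R y) xs) - T xs - t * (\<Sum>i<Suc k. T (xs[i := y])) =
      (T (x # ?m t) - T (x # ys) - t * D x) + t * (T (y # ?m t) - T (y # ys))"
      unfolding 1 2 using xs by (simp add: algebra_simps)
    then have "\<bar>T (map (\<lambda>x. x + t *\<^sub>R y) xs) - T xs - t * (\<Sum>i<Suc k. T (xs[i := y]))\<bar> \<le>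
      C * t\<^sup>2 + (\<bar>C'\<bar> + \<bar>D y\<bar>) * t\<^sup>2" using C[OF t] 3 by linarith
    then show ?thesis by (simp add: distrib_right)
  qed
  then show ?case by blast
qed (auto intro!: exI[of _ 0])

text \<open>
  The derivative of \<open>x \<mapsto> T (x, \<dots>, x)\<close> in direction \<open>y\<close> is a multiple of \<open>T (y, x, \<dots>, x)\<close>, so a form
  that vanishes on the diagonal vanishes there with one argument changed, and induction on the
  degree applies.
\<close>

lemma symmetric_form_zero:
  assumes "multilinear_form k T" "symmetric_form k T" "\<And>x. T (replicate k x) = 0" "length xs = k"
  shows "T xs = 0"
  using assms
proof (induction k arbitrary: T xs)
  case (Suc k)
  then obtain y ys where xs: "xs = y # ys" "length ys = k" by (cases xs) auto
  have "T (y # replicate k x) = 0" for x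
  proof -
    let ?X = "replicate (Suc k) x"
    obtain C where C: "\<And>t. \<bar>t\<bar> \<le> 1 \<Longrightarrow>
      \<bar>T (map (\<lambda>x. x + t *\<^sub>R y) ?X) - T ?X - t * (\<Sum>i<Suc k. T (?X[i := y]))\<bar> \<le> C * t\<^sup>2"
      using multilinear_derivative[OF Suc.prems(1), of ?X y] by auto
    have "T (?X[i := y]) = T (y # replicate k x)" if "i < Suc k" for i
    proof -
      have "mset (?X[i := y]) = mset (y # replicate k x)"
        using that by (simp add: mset_update nth_replicate del: replicate_Suc)
      then show ?thesis using Suc.prems(2) unfolding symmetric_form_def by (metis length_list_update length_replicate)
    qed
    then have "(\<Sum>i<Suc k. T (?X[i := y])) = real (Suc k) * T (y # replicate k x)" by simp
    then have le: "\<bar>t\<bar> * (real (Suc k) * \<bar>T (y # replicate k x)\<bar>) \<le> C * t\<^sup>2" if "\<bar>t\<bar> \<le> 1" for t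
      using C[OF that] Suc.prems(3) by (simp add: abs_mult map_replicate_const del: replicate_Suc)
    have "real (Suc k) * \<bar>T (y # replicate k x)\<bar> \<le> C * t" if "0 < t" "t \<le> 1" for t
    proof -
      have "t * (real (Suc k) * \<bar>T (y # replicate k x)\<bar>) \<le> t * (C * t)"
        using le[of t] that by (simp add: power2_eq_square mult_ac)
      then show ?thesis using that mult_le_cancel_left_pos by blast
    qed
    then have "\<forall>\<^sub>F t in at_right 0. real (Suc k) * \<bar>T (y # replicate k x)\<bar> \<le> C * t"
      by (auto simp: eventually_at_right_field intro!: exI[of _ 1])
    moreover have "((\<lambda>t. C * t) \<longlongrightarrow> C * 0) (at_right 0)" by (intro tendsto_intros)
    ultimately have "real (Suc k) * \<bar>T (y # replicate k x)\<bar> \<le> C * 0"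
      by (intro tendsto_lowerbound) (auto simp: trivial_limit_at_right_real)
    then show ?thesis by (simp add: mult_le_0_iff)
  qed
  moreover have "symmetric_form k (\<lambda>ys. T (y # ys))"
    using Suc.prems(2) unfolding symmetric_form_def by simp
  ultimately show ?case
    using Suc.IH[OF multilinear_tail[OF Suc.prems(1)], of y ys] xs by simp
qed (use assms in auto)

lemma symmetric_form_unique:
  assumes "multilinear_form k T" "symmetric_form k T" "multilinear_form k T'" "symmetric_form k T'"
    and "\<And>x. T (replicate k x) = T' (replicate k x)" "length xs = k"
  shows "T xs = T' xs"
proof -
  have "multilinear_form k (\<lambda>xs. 1 * T xs + (- 1) * T' xs)" using assms by (intro multilinear_combine)
  moreover have "symmetric_form k (\<lambda>xs. 1 * T xs + (- 1) * T' xs)"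
    using assms unfolding symmetric_form_def by metis
  ultimately show ?thesis using symmetric_form_zero[of k "\<lambda>xs. 1 * T xs + (- 1) * T' xs" xs] assms by simp
qed

subsection \<open>Positive forms\<close>

lemma positive_tail: "positive_form (Suc k) T \<Longrightarrow> 0 \<le> x \<Longrightarrow> positive_form k (\<lambda>ys. T (x # ys))"
  unfolding positive_form_def by simp

lemma positive_form_mono:
  assumes "multilinear_form k T" "positive_form k T" "length xs = k"
    and "list_all2 (\<le>) xs ys" "\<forall>x\<in>set xs. 0 \<le> x"
  shows "T xs \<le> T ys"
  using assms
proof (induction k arbitrary: T xs ys)
  case (Suc k)
  then obtain x xs' y ys' where eq: "xs = x # xs'" "ys = y # ys'" "length xs' = k" "x \<le> y" "list_all2 (\<le>) xs' ys'"
    by (cases xs; cases ys) auto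
  have nn: "0 \<le> x" "\<forall>x\<in>set xs'. 0 \<le> x" using Suc.prems eq by auto
  have "T (x # xs') \<le> T (x # ys')"
    using Suc.IH[OF multilinear_tail[OF Suc.prems(1)] positive_tail[OF Suc.prems(2) nn(1)]] eq nn by simp
  also have "\<dots> \<le> T (y # ys')"
  proof -
    have len: "length ys' = k" using eq by (metis list_all2_lengthD)
    have nn': "\<forall>x\<in>set ys'. 0 \<le> x"
    proof
      fix y' assume "y' \<in> set ys'"
      then obtain i where i: "i < length ys'" "y' = ys' ! i" by (metis in_set_conv_nth)
      then have "xs' ! i \<le> y'" "xs' ! i \<in> set xs'" using eq(5) by (auto simp: list_all2_conv_all_nth)
      then show "0 \<le> y'" using nn by (meson order_trans)
    qed
    have "0 \<le> T ((y - x) # ys')"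
      using Suc.prems(2) len nn' eq(4) unfolding positive_form_def by simp
    then show ?thesis using multilinear_head_diff[OF Suc.prems(1) len] by simp
  qed
  finally show ?case using eq by simp
qed simp

lemma dominated_form_abs:
  assumes "multilinear_form k T" "multilinear_form k M"
    and "\<And>xs. length xs = k \<Longrightarrow> (\<forall>x\<in>set xs. 0 \<le> x) \<Longrightarrow> \<bar>T xs\<bar> \<le> M xs" "length xs = k"
  shows "\<bar>T xs\<bar> \<le> M (map abs (xs :: 'a::banach_lattice list))"
  using assms
proof (induction k arbitrary: T M xs)
  case (Suc k)
  then obtain x ys where xs: "xs = x # ys" "length ys = k" by (cases xs) auto
  have le: "\<bar>T (u # ys)\<bar> \<le> M (u # map abs ys)" if "0 \<le> u" for u
    using Suc.prems(3) that
    by (intro Suc.IH[OF multilinear_tail[OF Suc.prems(1), of u] multilinear_tail[OF Suc.prems(2), of u] _ xs(2)]) auto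
  have "T xs = T (pprt x # ys) - T (pprt (- x) # ys)"
    using multilinear_head_diff[OF Suc.prems(1) xs(2), of "pprt x" "pprt (- x)"] xs
    by (simp add: pprt_minus_pprt_neg)
  then have "\<bar>T xs\<bar> \<le> M (pprt x # map abs ys) + M (pprt (- x) # map abs ys)"
    using le[of "pprt x"] le[of "pprt (- x)"] pprt_nonneg[of x] pprt_nonneg[of "- x"] by linarith
  also have "\<dots> = M (map abs xs)"
    using multilinear_head_add[OF Suc.prems(2), of "map abs ys" "pprt x" "pprt (- x)"] xs
    by (simp add: pprt_plus_pprt_neg)
  finally show ?case .
qed (use assms in simp)

lemma positive_form_abs:
  assumes "multilinear_form k T" "positive_form k T" "length xs = k"
  shows "\<bar>T xs\<bar> \<le> T (map abs xs)"
  using assms by (intro dominated_form_abs[of k T T]) (auto simp: positive_form_def)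

lemma le_sum_list_nonneg:
  fixes xs :: "'a::ordered_ab_group_add list"
  shows "\<forall>x\<in>set xs. 0 \<le> x \<Longrightarrow> x \<in> set xs \<Longrightarrow> x \<le> sum_list xs"
proof (induction xs)
  case (Cons y xs)
  have "0 \<le> sum_list xs" using Cons.prems by (intro sum_list_nonneg) auto
  then show ?case using Cons by (auto intro: add_increasing add_increasing2)
qed simp

lemma positive_form_le_diagonal:
  assumes "multilinear_form k T" "positive_form k T" "length xs = k" "\<forall>x\<in>set xs. 0 \<le> x \<and> x \<le> s"
  shows "T xs \<le> T (replicate k s)"
  using assms by (intro positive_form_mono) (auto simp: list_all2_conv_all_nth)

text \<open>
  Automatic continuity: were a positive form unbounded on the unit ball, its values at \<open>xs n\<close> could
  be taken so large that the single vector \<open>s = \<Sum>2\<^sup>-\<^sup>n \<cdot> sum_list (xs n)\<close>, which dominates all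
  \<open>2\<^sup>-\<^sup>n\<close>-multiples of their entries, would have an infinite value.
\<close>

lemma positive_form_bounded_cone:
  fixes T :: "'a::banach_lattice list \<Rightarrow> real"
  assumes T: "multilinear_form k T" "positive_form k T"
  shows "\<exists>C\<ge>0. \<forall>xs. length xs = k \<and> (\<forall>x\<in>set xs. 0 \<le> x \<and> norm x \<le> 1) \<longrightarrow> T xs \<le> C"
proof (rule ccontr)
  assume neg: "\<not> ?thesis"
  have "\<exists>xs. length xs = k \<and> (\<forall>x\<in>set xs. 0 \<le> x \<and> norm x \<le> 1) \<and> real n * (2 ^ n) ^ k < T xs" for n
  proof (rule ccontr)
    assume "\<not> ?thesis"
    moreover have "0 \<le> real n * (2 ^ n) ^ k" by simp
    ultimately show False using neg by (meson not_le)
  qed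
  then obtain xs where xs: "\<And>n. length (xs n) = k" "\<And>n x. x \<in> set (xs n) \<Longrightarrow> 0 \<le> x \<and> norm x \<le> 1"
    "\<And>n. real n * (2 ^ n) ^ k < T (xs n)" by metis
  define v where "v n = (1 / 2) ^ n *\<^sub>R sum_list (xs n)" for n
  have v0: "0 \<le> v n" for n unfolding v_def using xs(2) by (intro scaleR_nonneg_nonneg sum_list_nonneg) auto
  have "norm (sum_list ys) \<le> real (length ys)" if "\<forall>y\<in>set ys. norm y \<le> 1" for ys :: "'a list"
    using that by (induction ys) (auto intro: order_trans[OF norm_triangle_ineq])
  then have "norm (sum_list (xs n)) \<le> real k" for n using xs by metis
  then have "norm (v n) \<le> real k * (1 / 2) ^ n" for n
    unfolding v_def by (simp add: mult.commute divide_right_mono power_one_over)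
  then have "summable v"
    using summable_comparison_test'[OF summable_mult[OF summable_geometric[of "1 / 2 :: real"]], of 0 v "real k"]
    by simp
  then have lim: "(\<lambda>N. \<Sum>n<N. v n) \<longlonglongrightarrow> suminf v" by (rule summable_LIMSEQ)
  have vle: "v n \<le> suminf v" for n
  proof -
    have "0 \<le> suminf v - v n"
    proof (rule nonneg_tendsto)
      show "(\<lambda>N. (\<Sum>n<N. v n) - v n) \<longlonglongrightarrow> suminf v - v n" using lim by (intro tendsto_intros)
      show "\<forall>\<^sub>F N in sequentially. 0 \<le> (\<Sum>n<N. v n) - v n"
        using eventually_gt_at_top[of n]
      proof eventually_elim
        case (elim N)
        then have "(\<Sum>i<N. v i) = v n + (\<Sum>i\<in>{..<N} - {n}. v i)" by (intro sum.remove) auto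
        moreover have "0 \<le> (\<Sum>i\<in>{..<N} - {n}. v i)" using v0 by (intro sum_nonneg) auto
        ultimately show ?case by simp
      qed
    qed
    then show ?thesis by simp
  qed
  have "real n < T (replicate k (suminf v))" for n
  proof -
    let ?ys = "map (\<lambda>x. (1 / 2) ^ n *\<^sub>R x) (xs n)"
    have "((1 / 2) ^ n) ^ k * T (xs n) = T ?ys" using xs(1) T by (simp add: multilinear_scale_list)
    also have "\<dots> \<le> T (replicate k (suminf v))"
    proof (rule positive_form_le_diagonal[OF T])
      show "\<forall>y\<in>set ?ys. 0 \<le> y \<and> y \<le> suminf v"
      proof
        fix y assume "y \<in> set ?ys"
        then obtain x where x: "x \<in> set (xs n)" "y = (1 / 2) ^ n *\<^sub>R x" by auto
        have "y \<le> v n" unfolding v_def x(2) using x(1) xs(2) by (intro scaleR_left_mono le_sum_list_nonneg) auto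
        then show "0 \<le> y \<and> y \<le> suminf v" using vle[of n] x xs(2) by (auto intro: scaleR_nonneg_nonneg)
      qed
    qed (simp add: xs)
    finally have "((1 / 2) ^ n) ^ k * T (xs n) \<le> T (replicate k (suminf v))" .
    moreover have "real n < ((1 / 2) ^ n) ^ k * T (xs n)"
      using xs(3)[of n] by (simp add: power_one_over field_simps)
    ultimately show ?thesis by simp
  qed
  then show False using reals_Archimedean2 less_asym by blast
qed

lemma positive_form_bounded:
  fixes T :: "'a::banach_lattice list \<Rightarrow> real"
  assumes T: "multilinear_form k T" "positive_form k T"
  shows "\<exists>C\<ge>0. \<forall>xs. length xs = k \<longrightarrow> \<bar>T xs\<bar> \<le> C * prod_list (map norm xs)"
proof -
  obtain C where C: "0 \<le> C" "\<And>xs. length xs = k \<Longrightarrow> (\<forall>x\<in>set xs. 0 \<le> x \<and> norm x \<le> 1) \<Longrightarrow> T xs \<le> C"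
    using positive_form_bounded_cone[OF T] by blast
  have "\<bar>T xs\<bar> \<le> C * prod_list (map norm xs)" if "length xs = k" for xs
  proof (rule multilinear_bound_unit[OF T(1) that])
    fix ys :: "'a list" assume ys: "length ys = k" "\<forall>y\<in>set ys. norm y \<le> 1"
    then have "T (map abs ys) \<le> C" by (intro C) (auto simp: norm_abs)
    then show "\<bar>T ys\<bar> \<le> C" using positive_form_abs[OF T ys(1)] by simp
  qed
  then show ?thesis using C(1) by blast
qed

section \<open>The modulus of a multilinear form\<close>

abbreviation nonneg_list :: "nat \<Rightarrow> 'a::banach_lattice list \<Rightarrow> bool" where
  "nonneg_list k xs \<equiv> length xs = k \<and> (\<forall>x\<in>set xs. 0 \<le> x)"

definition partitions :: "'a::banach_lattice \<Rightarrow> 'a list set" where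
  "partitions x = {ps. (\<forall>u\<in>set ps. 0 \<le> u) \<and> sum_list ps = x}"

definition subadditive_cone :: "('a::banach_lattice \<Rightarrow> real) \<Rightarrow> bool" where
  "subadditive_cone g \<longleftrightarrow> g 0 = 0 \<and> (\<forall>u v. 0 \<le> u \<and> 0 \<le> v \<longrightarrow> g (u + v) \<le> g u + g v)"

definition partition_sup :: "('a::banach_lattice \<Rightarrow> real) \<Rightarrow> 'a \<Rightarrow> real" where
  "partition_sup g x = (SUP ps\<in>partitions x. sum_list (map g ps))"

text \<open>
  The Riesz decomposition property cuts each member of a partition of \<open>u + v\<close> into a part below \<open>u\<close> and a
  part below \<open>v\<close>.
\<close>

lemma partition_split:
  assumes "ps \<in> partitions (u + v)" "0 \<le> u" "0 \<le> v"
  shows "\<exists>p\<in>partitions u. \<exists>q\<in>partitions v.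
    \<forall>g. subadditive_cone g \<longrightarrow> sum_list (map g ps) \<le> sum_list (map g p) + sum_list (map g q)"
  using assms
proof (induction ps arbitrary: u v)
  case Nil
  then have "u + v = 0" by (simp add: partitions_def)
  then have "u = 0" "v = 0" using Nil by (auto simp: add_nonneg_eq_0_iff)
  then show ?case by (intro bexI[of _ "[]"]) (auto simp: partitions_def)
next
  case (Cons a ps)
  have a: "0 \<le> a" "\<forall>u\<in>set ps. 0 \<le> u" "a + sum_list ps = u + v" using Cons.prems by (auto simp: partitions_def)
  then have "a \<le> u + v" by (metis le_add_same_cancel1 sum_list_nonneg)
  then obtain s t where st: "a = s + t" "0 \<le> s" "s \<le> u" "0 \<le> t" "t \<le> v"
    using riesz_decomposition[of a u v] a Cons.prems by auto
  have "sum_list ps = (u - s) + (v - t)" using a(3) st(1) by (simp add: algebra_simps)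
  then have "ps \<in> partitions ((u - s) + (v - t))" using a by (simp add: partitions_def)
  then obtain p q where pq: "p \<in> partitions (u - s)" "q \<in> partitions (v - t)"
    "\<And>g. subadditive_cone g \<Longrightarrow> sum_list (map g ps) \<le> sum_list (map g p) + sum_list (map g q)"
    using Cons.IH[of "u - s" "v - t"] st by auto
  have "sum_list (map g (a # ps)) \<le> sum_list (map g (s # p)) + sum_list (map g (t # q))"
    if g: "subadditive_cone g" for g
  proof -
    have "g a \<le> g s + g t" using g st unfolding subadditive_cone_def by simp
    then show ?thesis using pq(3)[OF g] by simp
  qed
  moreover have "s # p \<in> partitions u" "t # q \<in> partitions v" using pq st by (auto simp: partitions_def)
  ultimately show ?case by blast
qed

lemma subadditive_cone_sum:
  "subadditive_cone g \<Longrightarrow> \<forall>u\<in>set ps. 0 \<le> u \<Longrightarrow> g (sum_list ps) \<le> sum_list (map g ps)"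
proof (induction ps)
  case (Cons a ps)
  have "g (a + sum_list ps) \<le> g a + g (sum_list ps)"
    using Cons.prems sum_list_nonneg[of ps] unfolding subadditive_cone_def by auto
  then show ?case using Cons by simp
qed (simp add: subadditive_cone_def)

text \<open>
  A common refinement serves both partitions. It enters later arguments only through its effect on
  sums of subadditive functions, which makes these sums directed.
\<close>

lemma partition_refine:
  assumes "ps \<in> partitions x" "qs \<in> partitions x"
  shows "\<exists>rs\<in>partitions x. \<forall>g. subadditive_cone g \<longrightarrow>
    sum_list (map g ps) \<le> sum_list (map g rs) \<and> sum_list (map g qs) \<le> sum_list (map g rs)"
  using assms
proof (induction ps arbitrary: x qs)
  case Nil
  then have "x = 0" "\<forall>u\<in>set qs. 0 \<le> u" "sum_list qs = 0" by (auto simp: partitions_def)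
  then have "\<forall>u\<in>set qs. u = 0" using le_sum_list_nonneg by (metis antisym)
  then have "sum_list (map g qs) = 0" if "subadditive_cone g" for g
    using that by (induction qs) (auto simp: subadditive_cone_def)
  then show ?case using Nil by (intro bexI[of _ qs]) auto
next
  case (Cons a ps)
  then have a: "0 \<le> a" "\<forall>u\<in>set ps. 0 \<le> u" "x = a + sum_list ps" by (auto simp: partitions_def)
  obtain q1 q2 where q: "q1 \<in> partitions a" "q2 \<in> partitions (sum_list ps)"
    "\<And>g. subadditive_cone g \<Longrightarrow> sum_list (map g qs) \<le> sum_list (map g q1) + sum_list (map g q2)"
    using partition_split[of qs a "sum_list ps"] Cons.prems a sum_list_nonneg[of ps] by auto
  obtain rs where rs: "rs \<in> partitions (sum_list ps)" "\<And>g. subadditive_cone g \<Longrightarrow>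
    sum_list (map g ps) \<le> sum_list (map g rs) \<and> sum_list (map g q2) \<le> sum_list (map g rs)"
    using Cons.IH[of "sum_list ps" q2] q a by (auto simp: partitions_def)
  have "q1 @ rs \<in> partitions x" using q rs a by (auto simp: partitions_def)
  moreover have "sum_list (map g (a # ps)) \<le> sum_list (map g (q1 @ rs)) \<and>
      sum_list (map g qs) \<le> sum_list (map g (q1 @ rs))" if g: "subadditive_cone g" for g
  proof -
    have "g a \<le> sum_list (map g q1)" using subadditive_cone_sum[OF g, of q1] q by (auto simp: partitions_def)
    then show ?thesis using q(3)[OF g] rs(2)[OF g] by simp
  qed
  ultimately show ?case by blast
qed

lemma singleton_partition: "0 \<le> x \<Longrightarrow> [x] \<in> partitions x"
  by (simp add: partitions_def)

lemma partition_sup_least: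
  "0 \<le> x \<Longrightarrow> (\<And>ps. ps \<in> partitions x \<Longrightarrow> sum_list (map g ps) \<le> m) \<Longrightarrow> partition_sup g x \<le> m"
  unfolding partition_sup_def using singleton_partition by (intro cSUP_least) auto

lemma partition_sup_upper:
  "bdd_above ((\<lambda>ps. sum_list (map g ps)) ` partitions x) \<Longrightarrow> ps \<in> partitions x \<Longrightarrow>
    sum_list (map g ps) \<le> partition_sup g x"
  unfolding partition_sup_def by (rule cSUP_upper)

lemma partition_sup_cong:
  "(\<And>u. 0 \<le> u \<Longrightarrow> g u = h u) \<Longrightarrow> partition_sup g x = partition_sup h x"
  unfolding partition_sup_def partitions_def
  by (intro SUP_cong refl arg_cong[where f = sum_list] map_cong) auto

lemma partition_sup_add:
  assumes g: "subadditive_cone g"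
    and bdd: "\<And>x. 0 \<le> x \<Longrightarrow> bdd_above ((\<lambda>ps. sum_list (map g ps)) ` partitions x)"
    and uv: "0 \<le> u" "0 \<le> v"
  shows "partition_sup g (u + v) = partition_sup g u + partition_sup g v"
proof (rule antisym)
  have nn: "0 \<le> u + v" using uv by simp
  show "partition_sup g (u + v) \<le> partition_sup g u + partition_sup g v"
  proof (rule partition_sup_least[OF nn])
    fix ps assume "ps \<in> partitions (u + v)"
    then obtain p q where "p \<in> partitions u" "q \<in> partitions v"
      "sum_list (map g ps) \<le> sum_list (map g p) + sum_list (map g q)"
      using partition_split[OF _ uv] g by blast
    then show "sum_list (map g ps) \<le> partition_sup g u + partition_sup g v"
      using partition_sup_upper[OF bdd[OF uv(1)], of p] partition_sup_upper[OF bdd[OF uv(2)], of q] by linarith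
  qed
  have "partition_sup g u \<le> partition_sup g (u + v) - partition_sup g v"
  proof (rule partition_sup_least[OF uv(1)])
    fix p assume p: "p \<in> partitions u"
    have "partition_sup g v \<le> partition_sup g (u + v) - sum_list (map g p)"
    proof (rule partition_sup_least[OF uv(2)])
      fix q assume q: "q \<in> partitions v"
      have "p @ q \<in> partitions (u + v)" using p q by (auto simp: partitions_def)
      from partition_sup_upper[OF bdd[OF nn] this]
      show "sum_list (map g q) \<le> partition_sup g (u + v) - sum_list (map g p)" by simp
    qed
    then show "sum_list (map g p) \<le> partition_sup g (u + v) - partition_sup g v" by simp
  qed
  then show "partition_sup g u + partition_sup g v \<le> partition_sup g (u + v)" by simp
qed

text \<open>
  Only the inequality \<open>\<ge>\<close> needs an argument: a common refinement of two partitions improves both sums, so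
  that the two suprema are approached along the same partition.
\<close>

lemma partition_sup_sum:
  assumes gh: "subadditive_cone g" "subadditive_cone h" and x: "0 \<le> x"
    and bdd: "bdd_above ((\<lambda>ps. sum_list (map g ps)) ` partitions x)"
      "bdd_above ((\<lambda>ps. sum_list (map h ps)) ` partitions x)"
  shows "partition_sup (\<lambda>u. g u + h u) x = partition_sup g x + partition_sup h x"
proof (rule antisym)
  have le: "sum_list (map (\<lambda>u. g u + h u) ps) \<le> partition_sup g x + partition_sup h x"
    if "ps \<in> partitions x" for ps
    using partition_sup_upper[OF bdd(1) that] partition_sup_upper[OF bdd(2) that]
    by (simp add: sum_list_addf)
  then show "partition_sup (\<lambda>u. g u + h u) x \<le> partition_sup g x + partition_sup h x"
    by (intro partition_sup_least[OF x])
  have bdd': "bdd_above ((\<lambda>ps. sum_list (map (\<lambda>u. g u + h u) ps)) ` partitions x)"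
    using le by (rule bdd_aboveI2)
  have "partition_sup g x \<le> partition_sup (\<lambda>u. g u + h u) x - partition_sup h x"
  proof (rule partition_sup_least[OF x])
    fix ps assume ps: "ps \<in> partitions x"
    have "partition_sup h x \<le> partition_sup (\<lambda>u. g u + h u) x - sum_list (map g ps)"
    proof (rule partition_sup_least[OF x])
      fix qs assume qs: "qs \<in> partitions x"
      obtain rs where rs: "rs \<in> partitions x" "sum_list (map g ps) \<le> sum_list (map g rs)"
        "sum_list (map h qs) \<le> sum_list (map h rs)"
        using partition_refine[OF ps qs] gh by blast
      have "sum_list (map g rs) + sum_list (map h rs) \<le> partition_sup (\<lambda>u. g u + h u) x"
        using partition_sup_upper[OF bdd' rs(1)] by (simp add: sum_list_addf)
      then show "sum_list (map h qs) \<le> partition_sup (\<lambda>u. g u + h u) x - sum_list (map g ps)"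
        using rs by simp
    qed
    then show "sum_list (map g ps) \<le> partition_sup (\<lambda>u. g u + h u) x - partition_sup h x" by simp
  qed
  then show "partition_sup g x + partition_sup h x \<le> partition_sup (\<lambda>u. g u + h u) x" by simp
qed

subsection \<open>Forms that are additive on the positive cone\<close>

definition additive_form :: "nat \<Rightarrow> ('a::banach_lattice list \<Rightarrow> real) \<Rightarrow> bool" where
  "additive_form k G \<longleftrightarrow> (\<forall>xs i u v. nonneg_list k xs \<and> i < k \<and> 0 \<le> u \<and> 0 \<le> v \<longrightarrow>
     G (xs[i := u + v]) = G (xs[i := u]) + G (xs[i := v]))"

lemma multilinear_imp_additive: "multilinear_form k T \<Longrightarrow> additive_form k T"
  by (simp add: multilinear_form_def additive_form_def)

lemma additive_tail:
  fixes G :: "'a::banach_lattice list \<Rightarrow> real"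
  assumes "additive_form (Suc k) G" "0 \<le> x" shows "additive_form k (\<lambda>ys. G (x # ys))"
  unfolding additive_form_def
proof (intro allI impI)
  fix xs :: "'a list" and i and u v :: 'a
  assume "nonneg_list k xs \<and> i < k \<and> 0 \<le> u \<and> 0 \<le> v"
  then show "G (x # xs[i := u + v]) = G (x # xs[i := u]) + G (x # xs[i := v])"
    using assms(1)[unfolded additive_form_def, rule_format, of "x # xs" "Suc i" u v] assms(2) by simp
qed

lemma additive_head:
  assumes "additive_form (Suc k) G" "nonneg_list k ys" "0 \<le> u" "0 \<le> v"
  shows "G ((u + v) # ys) = G (u # ys) + G (v # ys)"
  using assms(1)[unfolded additive_form_def, rule_format, of "0 # ys" 0 u v] assms(2-) by simp

lemma additive_head_zero: "additive_form (Suc k) G \<Longrightarrow> nonneg_list k ys \<Longrightarrow> G (0 # ys) = 0"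
  using additive_head[of k G ys 0 0] by simp

lemma additive_head_sum:
  assumes "additive_form (Suc k) G" "nonneg_list k ys"
  shows "\<forall>u\<in>set ps. 0 \<le> u \<Longrightarrow> (\<Sum>u\<leftarrow>ps. G (u # ys)) = G (sum_list ps # ys)"
proof (induction ps)
  case (Cons a ps)
  then show ?case using additive_head[OF assms, of a "sum_list ps"] sum_list_nonneg[of ps] by simp
qed (use additive_head_zero[OF assms] in simp)

lemma additive_SucI:
  fixes G :: "'a::banach_lattice list \<Rightarrow> real"
  assumes "\<And>x. 0 \<le> x \<Longrightarrow> additive_form k (\<lambda>ys. G (x # ys))"
    and "\<And>u v ys. nonneg_list k ys \<Longrightarrow> 0 \<le> u \<Longrightarrow> 0 \<le> v \<Longrightarrow> G ((u + v) # ys) = G (u # ys) + G (v # ys)"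
  shows "additive_form (Suc k) G"
  unfolding additive_form_def
proof (intro allI impI)
  fix xs :: "'a list" and i and u v :: 'a
  assume *: "nonneg_list (Suc k) xs \<and> i < Suc k \<and> 0 \<le> u \<and> 0 \<le> v"
  then obtain y ys where xs: "xs = y # ys" "nonneg_list k ys" "0 \<le> y" by (cases xs) auto
  show "G (xs[i := u + v]) = G (xs[i := u]) + G (xs[i := v])"
    using * assms(1)[OF xs(3), unfolded additive_form_def] xs assms(2) by (cases i) auto
qed

lemma additive_add:
  "additive_form k G \<Longrightarrow> additive_form k H \<Longrightarrow> additive_form k (\<lambda>xs. G xs + H xs)"
  by (simp add: additive_form_def)

text \<open>
  The Riesz--Kantorovich formula, iterated over the arguments: the modulus with respect to the first
  argument is a supremum over its partitions of moduli with respect to the remaining arguments.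
\<close>

fun modulus_cone :: "nat \<Rightarrow> ('a::banach_lattice list \<Rightarrow> real) \<Rightarrow> 'a list \<Rightarrow> real" where
  "modulus_cone 0 T xs = \<bar>T []\<bar>"
| "modulus_cone (Suc k) T xs = partition_sup (\<lambda>u. modulus_cone k (\<lambda>ys. T (u # ys)) (tl xs)) (hd xs)"

text \<open>
  The statements are proved together because each feeds the next degree: minimality in degree \<open>k\<close>, applied
  to the additive majorant \<open>G u + G v\<close> of \<open>T ((u + v) # _)\<close>, gives subadditivity of the modulus in its first
  argument, which makes the partition sums directed and their supremum additive.
\<close>

lemma modulus_cone_least_majorant:
  assumes "additive_form k T" "additive_form k M" "\<And>xs. nonneg_list k xs \<Longrightarrow> \<bar>T xs\<bar> \<le> M xs"
  shows "additive_form k (modulus_cone k T) \<and>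
    (\<forall>xs. nonneg_list k xs \<longrightarrow> \<bar>T xs\<bar> \<le> modulus_cone k T xs \<and> modulus_cone k T xs \<le> M xs)"
  using assms
proof (induction k arbitrary: T M)
  case 0
  then show ?case by (auto simp: additive_form_def)
next
  case (Suc k)
  let ?g = "\<lambda>ys u. modulus_cone k (\<lambda>zs. T (u # zs)) ys"
  have IH: "additive_form k (\<lambda>ys. ?g ys u)"
    "\<And>ys. nonneg_list k ys \<Longrightarrow> \<bar>T (u # ys)\<bar> \<le> ?g ys u \<and> ?g ys u \<le> M (u # ys)" if u: "0 \<le> u" for u
  proof -
    have "\<bar>T (u # ys)\<bar> \<le> M (u # ys)" if "nonneg_list k ys" for ys
      using Suc.prems(3)[of "u # ys"] that u by simp
    from Suc.IH[OF additive_tail[OF Suc.prems(1) u] additive_tail[OF Suc.prems(2) u] this]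
    show "additive_form k (\<lambda>ys. ?g ys u)"
      "\<And>ys. nonneg_list k ys \<Longrightarrow> \<bar>T (u # ys)\<bar> \<le> ?g ys u \<and> ?g ys u \<le> M (u # ys)" by auto
  qed
  have sub: "subadditive_cone (?g ys)" if ys: "nonneg_list k ys" for ys
    unfolding subadditive_cone_def
  proof (intro conjI allI impI)
    have "M (0 # ys) = 0" using additive_head_zero[OF Suc.prems(2) ys] .
    then show "?g ys 0 = 0" using IH(2)[of 0 ys] ys by auto
    fix u v :: 'a assume uv: "0 \<le> u \<and> 0 \<le> v"
    have "\<bar>T ((u + v) # zs)\<bar> \<le> ?g zs u + ?g zs v" if zs: "nonneg_list k zs" for zs
    proof -
      have "\<bar>T (u # zs)\<bar> \<le> ?g zs u" "\<bar>T (v # zs)\<bar> \<le> ?g zs v" using IH(2) uv zs by auto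
      moreover have "T ((u + v) # zs) = T (u # zs) + T (v # zs)"
        using additive_head[OF Suc.prems(1) zs] uv by simp
      ultimately show ?thesis using abs_triangle_ineq[of "T (u # zs)" "T (v # zs)"] by linarith
    qed
    moreover have "additive_form k (\<lambda>zs. T ((u + v) # zs))" using uv by (intro additive_tail Suc.prems) auto
    moreover have "additive_form k (\<lambda>zs. ?g zs u + ?g zs v)" using uv by (intro additive_add IH) auto
    ultimately show "?g ys (u + v) \<le> ?g ys u + ?g ys v"
      using Suc.IH[of "\<lambda>zs. T ((u + v) # zs)" "\<lambda>zs. ?g zs u + ?g zs v"] ys by blast
  qed
  have bound: "sum_list (map (?g ys) ps) \<le> M (x # ys)" if ys: "nonneg_list k ys" and ps: "ps \<in> partitions x" for ys x ps
  proof -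
    have "sum_list (map (?g ys) ps) \<le> (\<Sum>u\<leftarrow>ps. M (u # ys))"
      using ps IH(2) ys by (intro sum_list_mono) (auto simp: partitions_def)
    also have "\<dots> = M (x # ys)" using additive_head_sum[OF Suc.prems(2) ys] ps by (auto simp: partitions_def)
    finally show ?thesis .
  qed
  have bdd: "bdd_above ((\<lambda>ps. sum_list (map (?g ys) ps)) ` partitions x)" if "nonneg_list k ys" for ys x
    using bound[OF that] by (rule bdd_aboveI2)
  have "additive_form (Suc k) (modulus_cone (Suc k) T)"
  proof (rule additive_SucI)
    fix u v :: 'a and ys :: "'a list" assume "nonneg_list k ys" "0 \<le> u" "0 \<le> v"
    then show "modulus_cone (Suc k) T ((u + v) # ys) = modulus_cone (Suc k) T (u # ys) + modulus_cone (Suc k) T (v # ys)"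
      using partition_sup_add[OF sub bdd] by simp
  next
    fix x :: 'a assume x: "0 \<le> x"
    show "additive_form k (\<lambda>ys. modulus_cone (Suc k) T (x # ys))"
      unfolding additive_form_def
    proof (intro allI impI)
      fix xs :: "'a list" and i and u v :: 'a assume *: "nonneg_list k xs \<and> i < k \<and> 0 \<le> u \<and> 0 \<le> v"
      have nn: "nonneg_list k (xs[i := w])" if "0 \<le> w" for w
        using * that set_update_subset_insert[of xs i w] by auto
      have "modulus_cone (Suc k) T (x # xs[i := u + v]) =
          partition_sup (\<lambda>w. ?g (xs[i := u]) w + ?g (xs[i := v]) w) x"
        using IH(1)[unfolded additive_form_def] * by (auto intro!: partition_sup_cong)
      also have "\<dots> = partition_sup (?g (xs[i := u])) x + partition_sup (?g (xs[i := v])) x"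
        using * by (intro partition_sup_sum sub bdd nn x) auto
      finally show "modulus_cone (Suc k) T (x # xs[i := u + v]) =
        modulus_cone (Suc k) T (x # xs[i := u]) + modulus_cone (Suc k) T (x # xs[i := v])" by simp
    qed
  qed
  moreover have "\<bar>T xs\<bar> \<le> modulus_cone (Suc k) T xs \<and> modulus_cone (Suc k) T xs \<le> M xs"
    if xs: "nonneg_list (Suc k) xs" for xs
  proof -
    obtain x ys where eq: "xs = x # ys" and x: "0 \<le> x" and ys: "nonneg_list k ys" using xs by (cases xs) auto
    have "\<bar>T (x # ys)\<bar> \<le> sum_list (map (?g ys) [x])" using IH(2)[OF x ys] by simp
    also have "\<dots> \<le> partition_sup (?g ys) x"
      by (rule partition_sup_upper[OF bdd[OF ys] singleton_partition[OF x]])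
    finally have "\<bar>T (x # ys)\<bar> \<le> partition_sup (?g ys) x" .
    moreover have "partition_sup (?g ys) x \<le> M (x # ys)" using bound[OF ys] by (rule partition_sup_least[OF x])
    ultimately show ?thesis using eq by simp
  qed
  ultimately show ?case by blast
qed

subsection \<open>Extension from the cone\<close>

text \<open>
  Additivity gives homogeneity for rational factors, and monotonicity, which follows from positivity,
  extends it to real ones.
\<close>

lemma additive_nonneg_homogeneous:
  fixes f :: "'a::banach_lattice \<Rightarrow> real"
  assumes add: "\<And>u v. 0 \<le> u \<Longrightarrow> 0 \<le> v \<Longrightarrow> f (u + v) = f u + f v" and nn: "\<And>u. 0 \<le> u \<Longrightarrow> 0 \<le> f u"
    and c: "0 \<le> c" and u: "0 \<le> u"
  shows "f (c *\<^sub>R u) = c * f u"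
proof -
  have nat: "f (real n *\<^sub>R w) = real n * f w" if "0 \<le> w" for n w
  proof (induction n)
    case 0 then show ?case using add[of 0 0] by simp
  next
    case (Suc n)
    then show ?case using add[of w "real n *\<^sub>R w"] that by (simp add: scaleR_add_left scaleR_nonneg_nonneg algebra_simps)
  qed
  have mono: "f v \<le> f w" if "0 \<le> v" "v \<le> w" for v w
    using add[of v "w - v"] nn[of "w - v"] that by simp
  have "real n * \<bar>f (c *\<^sub>R u) - c * f u\<bar> \<le> f u" for n
  proof -
    define m where "m = nat \<lfloor>real n * c\<rfloor>"
    have m: "real m \<le> real n * c" "real n * c \<le> real (Suc m)" using c unfolding m_def by (auto simp: le_floor_iff) linarith
    have cu: "0 \<le> c *\<^sub>R u" using c u by (rule scaleR_nonneg_nonneg)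
    have "real m * f u \<le> real n * f (c *\<^sub>R u)"
    proof -
      have "f (real m *\<^sub>R u) \<le> f ((real n * c) *\<^sub>R u)"
        using m u by (intro mono scaleR_right_mono scaleR_nonneg_nonneg) auto
      then show ?thesis using nat[OF u, of m] nat[OF cu, of n] by simp
    qed
    moreover have "real n * f (c *\<^sub>R u) \<le> real (Suc m) * f u"
    proof -
      have "f ((real n * c) *\<^sub>R u) \<le> f (real (Suc m) *\<^sub>R u)"
        using m u c by (intro mono scaleR_right_mono scaleR_nonneg_nonneg) auto
      then show ?thesis using nat[OF u, of "Suc m"] nat[OF cu, of n] by simp
    qed
    moreover have "real m * f u \<le> real n * c * f u" "real n * c * f u \<le> real (Suc m) * f u"
      using m nn[OF u] by (auto intro: mult_right_mono)
    ultimately have "\<bar>real n * f (c *\<^sub>R u) - real n * c * f u\<bar> \<le> f u" by (simp add: algebra_simps abs_le_iff)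
    moreover have "real n * \<bar>f (c *\<^sub>R u) - c * f u\<bar> = \<bar>real n * (f (c *\<^sub>R u) - c * f u)\<bar>"
      by (simp add: abs_mult)
    ultimately show ?thesis by (simp add: right_diff_distrib mult.assoc)
  qed
  then have "\<bar>f (c *\<^sub>R u) - c * f u\<bar> = 0"
    by (metis abs_ge_zero antisym_conv not_le reals_Archimedean3)
  then show ?thesis by simp
qed

fun extend_form :: "nat \<Rightarrow> ('a::banach_lattice list \<Rightarrow> real) \<Rightarrow> 'a list \<Rightarrow> real" where
  "extend_form 0 G xs = G []"
| "extend_form (Suc k) G xs = extend_form k (\<lambda>ys. G (pprt (hd xs) # ys)) (tl xs) -
     extend_form k (\<lambda>ys. G (pprt (- hd xs) # ys)) (tl xs)"

lemma extend_form_cong: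
  "(\<And>ys. nonneg_list k ys \<Longrightarrow> G ys = G' ys) \<Longrightarrow> extend_form k G xs = extend_form k G' xs"
proof (induction k arbitrary: G G' xs)
  case (Suc k)
  have "extend_form k (\<lambda>ys. G (u # ys)) (tl xs) = extend_form k (\<lambda>ys. G' (u # ys)) (tl xs)" if "0 \<le> u" for u
    using Suc.prems that by (intro Suc.IH) auto
  then show ?case by (simp add: pprt_nonneg)
qed simp

lemma extend_form_combine:
  "extend_form k (\<lambda>ys. a * G ys + b * H ys) xs = a * extend_form k G xs + b * extend_form k H xs"
  by (induction k arbitrary: G H xs) (auto simp: algebra_simps)

lemma extend_form_add: "extend_form k (\<lambda>ys. G ys + H ys) xs = extend_form k G xs + extend_form k H xs"
  using extend_form_combine[of k 1 G 1 H xs] by simp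

lemma extend_form_scale: "extend_form k (\<lambda>ys. a * G ys) xs = a * extend_form k G xs"
  using extend_form_combine[of k a G 0 G xs] by simp

lemma extend_form_cone:
  assumes "additive_form k G" "nonneg_list k xs" shows "extend_form k G xs = G xs"
  using assms
proof (induction k arbitrary: G xs)
  case (Suc k)
  then obtain x ys where xs: "xs = x # ys" "0 \<le> x" "nonneg_list k ys" by (cases xs) auto
  have "extend_form k (\<lambda>ys. G (0 # ys)) ys = extend_form k (\<lambda>ys. 0 * G ys) ys"
    using additive_head_zero[OF Suc.prems(1)] by (intro extend_form_cong) simp
  also have "\<dots> = 0" by (simp only: extend_form_scale)
  finally have "extend_form (Suc k) G xs = extend_form k (\<lambda>ys. G (x # ys)) ys"
    using xs by (simp add: pprt_id pprt_zero_of_nonpos)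
  also have "\<dots> = G xs" using Suc.IH[OF additive_tail[OF Suc.prems(1) xs(2)] xs(3)] xs by simp
  finally show ?case .
qed simp

lemma extend_form_multilinear:
  assumes "additive_form k G" "\<And>xs. nonneg_list k xs \<Longrightarrow> 0 \<le> G xs"
  shows "multilinear_form k (extend_form k G)"
  using assms
proof (induction k arbitrary: G)
  case 0
  then show ?case by (simp add: multilinear_form_def)
next
  case (Suc k)
  let ?e = "\<lambda>u ys. extend_form k (\<lambda>zs. G (u # zs)) ys"
  have ml: "multilinear_form k (?e u)" if "0 \<le> u" for u
    using Suc.prems that by (intro Suc.IH additive_tail) auto
  have eadd: "?e (u + v) ys = ?e u ys + ?e v ys" if "0 \<le> u" "0 \<le> v" for u v ys
  proof -
    have "?e (u + v) ys = extend_form k (\<lambda>zs. G (u # zs) + G (v # zs)) ys"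
      using additive_head[OF Suc.prems(1) _ that] by (intro extend_form_cong) simp
    then show ?thesis by (simp add: extend_form_add)
  qed
  have escale: "?e (c *\<^sub>R u) ys = c * ?e u ys" if "0 \<le> c" "0 \<le> u" for c u ys
  proof -
    have "G ((c *\<^sub>R u) # zs) = c * G (u # zs)" if "nonneg_list k zs" for zs
      using additive_head[OF Suc.prems(1) that] Suc.prems(2) that \<open>0 \<le> c\<close> \<open>0 \<le> u\<close>
      by (intro additive_nonneg_homogeneous[of "\<lambda>u. G (u # zs)"]) auto
    then have "?e (c *\<^sub>R u) ys = extend_form k (\<lambda>zs. c * G (u # zs)) ys" by (intro extend_form_cong)
    then show ?thesis by (simp add: extend_form_scale)
  qed
  show ?case
  proof (rule multilinear_SucI)
    fix x
    show "multilinear_form k (\<lambda>ys. extend_form (Suc k) G (x # ys))"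
      using multilinear_combine[OF ml ml, of "pprt x" "pprt (- x)" 1 "- 1"] by (simp add: pprt_nonneg)
  next
    fix u v :: 'a and ys :: "'a list" assume "length ys = k"
    let ?p = "pprt :: 'a \<Rightarrow> 'a"
    have "?p (u + v) + (?p (- u) + ?p (- v)) = ?p u + ?p v + ?p (- (u + v))"
      using pprt_minus_pprt_neg[of u] pprt_minus_pprt_neg[of v] pprt_minus_pprt_neg[of "u + v"]
      by (simp add: algebra_simps)
    then have "?e (?p (u + v)) ys + (?e (?p (- u)) ys + ?e (?p (- v)) ys) =
        ?e (?p u) ys + ?e (?p v) ys + ?e (?p (- (u + v))) ys"
      by (metis eadd add_nonneg_nonneg pprt_nonneg)
    then show "extend_form (Suc k) G ((u + v) # ys) = extend_form (Suc k) G (u # ys) + extend_form (Suc k) G (v # ys)"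
      by simp
  next
    fix c and u :: 'a and ys :: "'a list" assume "length ys = k"
    have pos: "extend_form (Suc k) G ((d *\<^sub>R u) # ys) = d * extend_form (Suc k) G (u # ys)" if "0 \<le> d" for d u
      using escale[OF that] that pprt_scaleR[OF that, of "- u"]
      by (simp add: pprt_scaleR pprt_nonneg right_diff_distrib)
    show "extend_form (Suc k) G ((c *\<^sub>R u) # ys) = c * extend_form (Suc k) G (u # ys)"
    proof (cases "0 \<le> c")
      case True then show ?thesis by (rule pos)
    next
      case False
      have "extend_form (Suc k) G ((c *\<^sub>R u) # ys) = - c * extend_form (Suc k) G ((- u) # ys)"
        using pos[of "- c" "- u"] False by simp
      also have "extend_form (Suc k) G ((- u) # ys) = - extend_form (Suc k) G (u # ys)" by simp
      finally show ?thesis by (simp add: algebra_simps)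
    qed
  qed
qed

lemma multilinear_eq_on_cone:
  assumes "multilinear_form k T" "multilinear_form k T'"
    and "\<And>xs. nonneg_list k xs \<Longrightarrow> T xs = T' xs" "length xs = k"
  shows "T xs = T' xs"
proof -
  have "multilinear_form k (\<lambda>xs. 1 * T xs + (- 1) * T' xs)" "multilinear_form k (\<lambda>xs. 0 * T xs + 0 * T' xs)"
    using assms(1,2) by (intro multilinear_combine; simp)+
  from dominated_form_abs[OF this _ assms(4)] assms(3) show ?thesis by simp
qed

lemma permute_list_update:
  assumes "p permutes {..<length xs}" "i < length xs"
  shows "permute_list p (xs[i := u]) = (permute_list p xs)[inv p i := u]"
proof (rule nth_equalityI)
  fix j assume "j < length (permute_list p (xs[i := u]))"
  then have j: "j < length xs" by simp
  have pj: "p j < length xs" using assms(1) j permutes_in_image by fastforce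
  have "p j = i \<longleftrightarrow> j = inv p i" using assms(1) by (metis permutes_inv_eq)
  moreover have "permute_list p (xs[i := u]) ! j = (if p j = i then u else xs ! p j)"
    using assms j pj by (auto simp: permute_list_nth nth_list_update)
  moreover have "(permute_list p xs)[inv p i := u] ! j = (if j = inv p i then u else permute_list p xs ! j)"
    using j by (auto simp: nth_list_update)
  moreover have "permute_list p xs ! j = xs ! p j" using assms j by (simp add: permute_list_nth)
  ultimately show "permute_list p (xs[i := u]) ! j = (permute_list p xs)[inv p i := u] ! j" by simp
qed simp

lemma multilinear_permute:
  fixes T :: "'a::real_vector list \<Rightarrow> real"
  assumes T: "multilinear_form k T" and p: "p permutes {..<k}"
  shows "multilinear_form k (\<lambda>xs. T (permute_list p xs))"
proof -
  have "inv p i < k" if "i < k" for i using permutes_in_image[OF permutes_inv[OF p], of i] that by simp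
  then show ?thesis using T p unfolding multilinear_form_def by (auto simp: permute_list_update)
qed

text \<open>
  The modulus of a symmetric form is symmetric: permuting its arguments gives another majorant of
  the same form, hence nothing smaller, and permutations can be undone.
\<close>

theorem modulus_form_exists:
  fixes T :: "'a::banach_lattice list \<Rightarrow> real"
  assumes T: "multilinear_form k T" "symmetric_form k T"
    and M: "multilinear_form k M" "\<And>xs. nonneg_list k xs \<Longrightarrow> \<bar>T xs\<bar> \<le> M xs"
  obtains S where "multilinear_form k S" "symmetric_form k S"
    "\<And>xs. nonneg_list k xs \<Longrightarrow> \<bar>T xs\<bar> \<le> S xs"
    "\<And>R xs. multilinear_form k R \<Longrightarrow> \<forall>xs. nonneg_list k xs \<longrightarrow> \<bar>T xs\<bar> \<le> R xs \<Longrightarrow> nonneg_list k xs \<Longrightarrow> S xs \<le> R xs"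
proof -
  let ?G = "modulus_cone k T"
  define S where "S = extend_form k ?G"
  have props: "additive_form k ?G \<and> (\<forall>xs. nonneg_list k xs \<longrightarrow> \<bar>T xs\<bar> \<le> ?G xs \<and> ?G xs \<le> R xs)"
    if "multilinear_form k R" "\<And>xs. nonneg_list k xs \<Longrightarrow> \<bar>T xs\<bar> \<le> R xs" for R
    using that multilinear_imp_additive T(1) by (intro modulus_cone_least_majorant) blast+
  note G = props[OF M]
  have SG: "S xs = ?G xs" if "nonneg_list k xs" for xs
    using G that unfolding S_def by (intro extend_form_cone) auto
  have "0 \<le> ?G xs" if "nonneg_list k xs" for xs using G that abs_ge_zero order_trans by blast
  then have S: "multilinear_form k S" unfolding S_def using G by (intro extend_form_multilinear) auto
  have maj: "\<bar>T xs\<bar> \<le> S xs" if "nonneg_list k xs" for xs using G SG that by simp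
  have least: "S xs \<le> R xs"
    if "multilinear_form k R" "\<And>xs. nonneg_list k xs \<Longrightarrow> \<bar>T xs\<bar> \<le> R xs" "nonneg_list k xs" for R xs
    using props[OF that(1,2)] SG that(3) by simp
  have perm: "\<exists>p. p permutes {..<k} \<and> permute_list p xs = ys" if "length xs = k" "mset xs = mset ys" for xs ys :: "'a list"
    using mset_eq_permutation[of ys xs] that by metis
  have le: "S xs \<le> S ys" if xs: "nonneg_list k xs" and eq: "mset xs = mset ys" for xs ys
  proof -
    obtain p where p: "p permutes {..<k}" "permute_list p xs = ys" using perm xs eq by blast
    have "\<bar>T zs\<bar> \<le> S (permute_list p zs)" if zs: "nonneg_list k zs" for zs
    proof -
      have m: "mset zs = mset (permute_list p zs)" using p zs by simp
      then have "T zs = T (permute_list p zs)" using T(2) zs unfolding symmetric_form_def by blast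
      moreover have "nonneg_list k (permute_list p zs)" using zs m p by (metis length_permute_list set_permute_list)
      ultimately show ?thesis using maj by metis
    qed
    from least[OF multilinear_permute[OF S p(1)] this xs] show ?thesis using p by simp
  qed
  have "symmetric_form k S"
    unfolding symmetric_form_def
  proof (intro allI impI)
    fix xs ys :: "'a list" assume *: "length xs = k \<and> mset xs = mset ys"
    then obtain p where p: "p permutes {..<k}" "permute_list p xs = ys" using perm by blast
    have "S zs = S (permute_list p zs)" if zs: "nonneg_list k zs" for zs
    proof -
      have m: "mset zs = mset (permute_list p zs)" using p zs by simp
      moreover have "nonneg_list k (permute_list p zs)" using zs m p by (metis length_permute_list set_permute_list)
      ultimately show ?thesis using le[of zs "permute_list p zs"] le[of "permute_list p zs" zs] zs by (intro antisym) auto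
    qed
    from multilinear_eq_on_cone[OF S multilinear_permute[OF S p(1)] this] show "S xs = S ys" using * p by blast
  qed
  then show thesis using that S maj least by blast
qed

section \<open>Regular scalar polynomials\<close>

lemma associated_operator_real:
  "associated_operator real_vlattice k P T \<longleftrightarrow>
     multilinear_form k T \<and> symmetric_form k T \<and> (\<forall>x. P x = T (replicate k x))"
  by (simp add: associated_operator_def symmetric_multilinear_real conj_assoc)

definition form_of :: "nat \<Rightarrow> ('a::banach_lattice \<Rightarrow> real) \<Rightarrow> 'a list \<Rightarrow> real" where
  "form_of k P = (SOME T. associated_operator real_vlattice k P T)"

lemma associated_unique:
  assumes "associated_operator real_vlattice k P T" "associated_operator real_vlattice k P T'" "length xs = k"
  shows "T xs = T' xs"
proof (rule symmetric_form_unique[of k T T'])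
  show "T (replicate k x) = T' (replicate k x)" for x
    using assms unfolding associated_operator_real by metis
qed (use assms in \<open>simp_all add: associated_operator_real\<close>)

lemma associated_form_of:
  "associated_operator real_vlattice k P T \<Longrightarrow> associated_operator real_vlattice k P (form_of k P)"
  unfolding form_of_def by (rule someI[where P = "associated_operator real_vlattice k P"])

lemma associated_combine:
  assumes "associated_operator real_vlattice k P T" "associated_operator real_vlattice k Q S"
  shows "associated_operator real_vlattice k (\<lambda>x. a * P x + b * Q x) (\<lambda>xs. a * T xs + b * S xs)"
  unfolding associated_operator_real
proof (intro conjI allI)
  show "multilinear_form k (\<lambda>xs. a * T xs + b * S xs)"
    using assms by (intro multilinear_combine) (auto simp: associated_operator_real)
  show "symmetric_form k (\<lambda>xs. a * T xs + b * S xs)"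
    using assms unfolding associated_operator_real symmetric_form_def by metis
qed (use assms in \<open>simp add: associated_operator_real\<close>)

lemma associated_diff:
  "associated_operator real_vlattice k P T \<Longrightarrow> associated_operator real_vlattice k Q S \<Longrightarrow>
    associated_operator real_vlattice k (\<lambda>x. P x - Q x) (\<lambda>xs. T xs - S xs)"
  using associated_combine[of k P T Q S 1 "- 1"] by simp

lemma associated_neg:
  "associated_operator real_vlattice k P T \<Longrightarrow> associated_operator real_vlattice k (\<lambda>x. - P x) (\<lambda>xs. - T xs)"
  using associated_combine[of k P T P T "- 1" 0] by simp

lemma associated_zero: "associated_operator real_vlattice k (\<lambda>x. 0) (\<lambda>xs. 0)"
  by (simp add: associated_operator_real multilinear_form_def symmetric_form_def)

lemma positive_poly_real:
  "positive_poly real_vlattice k P \<longleftrightarrow>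
     (\<exists>T. associated_operator real_vlattice k P T \<and> positive_form k T)"
  by (simp add: positive_poly_def positive_form_def)

lemma positive_poly_iff:
  assumes "associated_operator real_vlattice k P T"
  shows "positive_poly real_vlattice k P \<longleftrightarrow> positive_form k T"
  unfolding positive_poly_real using assms associated_unique[OF assms] by (metis positive_form_def)

lemma poly_le_iff:
  assumes "associated_operator real_vlattice k P T" "associated_operator real_vlattice k Q S"
  shows "poly_le real_vlattice k P Q \<longleftrightarrow> (\<forall>xs. nonneg_list k xs \<longrightarrow> T xs \<le> S xs)"
  unfolding poly_le_def using positive_poly_iff[OF associated_diff[OF assms(2,1)]]
  by (simp add: positive_form_def)

lemma associated_eq_on_cone:
  assumes "associated_operator real_vlattice k P T" "associated_operator real_vlattice k Q S"
    and "\<And>xs. nonneg_list k xs \<Longrightarrow> T xs = S xs"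
  shows "P = Q"
proof
  fix x
  have "multilinear_form k T" "multilinear_form k S" "P x = T (replicate k x)" "Q x = S (replicate k x)"
    using assms(1,2) by (simp_all add: associated_operator_real)
  moreover from multilinear_eq_on_cone[OF this(1,2) assms(3), of "replicate k x"]
  have "T (replicate k x) = S (replicate k x)" by simp
  ultimately show "P x = Q x" by simp
qed

lemma regular_poly_dominated:
  assumes "P \<in> regular_polys real_vlattice k"
  obtains T M where "associated_operator real_vlattice k P T" "multilinear_form k M"
    "\<And>xs. nonneg_list k xs \<Longrightarrow> \<bar>T xs\<bar> \<le> M xs"
proof -
  obtain Q R A B where Q: "associated_operator real_vlattice k Q A" "positive_form k A"
    and R: "associated_operator real_vlattice k R B" "positive_form k B" and P: "\<And>x. P x = Q x - R x"
    using assms unfolding regular_polys_def positive_poly_real by auto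
  have "associated_operator real_vlattice k P (\<lambda>xs. A xs - B xs)"
    using associated_diff[OF Q(1) R(1)] P by presburger
  moreover have "multilinear_form k (\<lambda>xs. 1 * A xs + 1 * B xs)"
    using Q(1) R(1) by (intro multilinear_combine) (auto simp: associated_operator_real)
  moreover have "\<bar>A xs - B xs\<bar> \<le> 1 * A xs + 1 * B xs" if "nonneg_list k xs" for xs
    using Q(2) R(2) that unfolding positive_form_def by (simp add: abs_le_iff)
  ultimately show thesis by (rule that)
qed

lemma positive_imp_regular:
  assumes "positive_poly real_vlattice k P" shows "P \<in> regular_polys real_vlattice k"
proof -
  have "positive_poly real_vlattice k (\<lambda>x. 0)"
    unfolding positive_poly_real using associated_zero by (force simp: positive_form_def)
  then show ?thesis using assms unfolding regular_polys_def by force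
qed

lemma regular_associated:
  "P \<in> regular_polys real_vlattice k \<Longrightarrow> associated_operator real_vlattice k P (form_of k P)"
  using regular_poly_dominated associated_form_of by metis

lemma regular_combine:
  assumes "P \<in> regular_polys real_vlattice k" "Q \<in> regular_polys real_vlattice k"
  shows "(\<lambda>x. a * P x + b * Q x) \<in> regular_polys real_vlattice k"
proof -
  obtain T M where T: "associated_operator real_vlattice k P T" "multilinear_form k M"
    "\<And>xs. nonneg_list k xs \<Longrightarrow> \<bar>T xs\<bar> \<le> M xs" using regular_poly_dominated[OF assms(1)] by blast
  obtain S N where S: "associated_operator real_vlattice k Q S" "multilinear_form k N"
    "\<And>xs. nonneg_list k xs \<Longrightarrow> \<bar>S xs\<bar> \<le> N xs" using regular_poly_dominated[OF assms(2)] by blast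
  let ?U = "\<lambda>xs. a * T xs + b * S xs"
  have U: "associated_operator real_vlattice k (\<lambda>x. a * P x + b * Q x) ?U"
    using associated_combine[OF T(1) S(1)] .
  have dom: "\<bar>?U xs\<bar> \<le> \<bar>a\<bar> * M xs + \<bar>b\<bar> * N xs" if "nonneg_list k xs" for xs
    using mult_left_mono[OF T(3)[OF that], of "\<bar>a\<bar>"] mult_left_mono[OF S(3)[OF that], of "\<bar>b\<bar>"]
    by (simp add: abs_mult[symmetric])
  have Um: "multilinear_form k ?U" "symmetric_form k ?U" using U by (simp_all add: associated_operator_real)
  obtain W where W: "multilinear_form k W" "symmetric_form k W" "\<And>xs. nonneg_list k xs \<Longrightarrow> \<bar>?U xs\<bar> \<le> W xs"
    by (rule modulus_form_exists[OF Um multilinear_combine[OF T(2) S(2)]], erule dom, rule that)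
  have Wp: "associated_operator real_vlattice k (\<lambda>x. W (replicate k x)) W"
    using W by (simp add: associated_operator_real)
  have "positive_poly real_vlattice k (\<lambda>x. W (replicate k x))"
    unfolding positive_poly_iff[OF Wp] positive_form_def using W(3) abs_ge_zero order_trans by blast
  moreover have "positive_poly real_vlattice k (\<lambda>x. W (replicate k x) - (a * P x + b * Q x))"
    unfolding positive_poly_iff[OF associated_diff[OF Wp U]] positive_form_def
    using W(3) by (auto simp: abs_le_iff)
  ultimately show ?thesis unfolding regular_polys_def by force
qed

lemma is_lub_poly_unique:
  assumes "is_lub_on (regular_polys real_vlattice k) (poly_le real_vlattice k) A S"
    and "is_lub_on (regular_polys real_vlattice k) (poly_le real_vlattice k) A S'"
  shows "S = S'"
proof -
  have reg: "S \<in> regular_polys real_vlattice k" "S' \<in> regular_polys real_vlattice k"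
    and le: "poly_le real_vlattice k S S'" "poly_le real_vlattice k S' S"
    using assms unfolding is_lub_on_def by auto
  note a = regular_associated[OF reg(1)] and a' = regular_associated[OF reg(2)]
  show ?thesis
    using le[unfolded poly_le_iff[OF a a'] poly_le_iff[OF a' a]]
    by (intro associated_eq_on_cone[OF a a']) (auto intro: antisym)
qed

lemma poly_abs_form:
  assumes "P \<in> regular_polys real_vlattice k" "associated_operator real_vlattice k P T"
  obtains S where "associated_operator real_vlattice k (poly_abs real_vlattice k P) S"
    "\<And>xs. nonneg_list k xs \<Longrightarrow> \<bar>T xs\<bar> \<le> S xs"
proof -
  obtain T' M where T': "associated_operator real_vlattice k P T'" "multilinear_form k M"
    "\<And>xs. nonneg_list k xs \<Longrightarrow> \<bar>T' xs\<bar> \<le> M xs" using regular_poly_dominated[OF assms(1)] by blast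
  have dom: "\<bar>T xs\<bar> \<le> M xs" if "nonneg_list k xs" for xs
    using T'(3)[OF that] associated_unique[OF assms(2) T'(1), of xs] that by simp
  have Tm: "multilinear_form k T" "symmetric_form k T" using assms(2) by (simp_all add: associated_operator_real)
  obtain S where S: "multilinear_form k S" "symmetric_form k S"
    "\<And>xs. nonneg_list k xs \<Longrightarrow> \<bar>T xs\<bar> \<le> S xs"
    "\<And>R xs. multilinear_form k R \<Longrightarrow> \<forall>xs. nonneg_list k xs \<longrightarrow> \<bar>T xs\<bar> \<le> R xs \<Longrightarrow> nonneg_list k xs \<Longrightarrow> S xs \<le> R xs"
    using modulus_form_exists[OF Tm T'(2) dom] by blast
  let ?S = "\<lambda>x. S (replicate k x)"
  have Sp: "associated_operator real_vlattice k ?S S" using S by (simp add: associated_operator_real)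
  have lub: "is_lub_on (regular_polys real_vlattice k) (poly_le real_vlattice k) {P, \<lambda>x. (- 1) \<odot>\<^bsub>real_vlattice\<^esub> P x} ?S"
    unfolding is_lub_on_def
  proof (intro conjI ballI impI)
    have "positive_poly real_vlattice k ?S"
      unfolding positive_poly_iff[OF Sp] positive_form_def using S(3) abs_ge_zero order_trans by blast
    then show "?S \<in> regular_polys real_vlattice k" by (rule positive_imp_regular)
  next
    fix Q assume "Q \<in> {P, \<lambda>x. (- 1) \<odot>\<^bsub>real_vlattice\<^esub> P x}"
    then consider "Q = P" | "Q = (\<lambda>x. - P x)" by auto
    then show "poly_le real_vlattice k Q ?S"
      using S(3) poly_le_iff[OF assms(2) Sp] poly_le_iff[OF associated_neg[OF assms(2)] Sp]
      by cases (auto simp: abs_le_iff)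
  next
    fix U assume U: "U \<in> regular_polys real_vlattice k"
      and ub: "\<forall>Q\<in>{P, \<lambda>x. (- 1) \<odot>\<^bsub>real_vlattice\<^esub> P x}. poly_le real_vlattice k Q U"
    note Ua = regular_associated[OF U]
    have "\<bar>T xs\<bar> \<le> form_of k U xs" if "nonneg_list k xs" for xs
      using ub poly_le_iff[OF assms(2) Ua] poly_le_iff[OF associated_neg[OF assms(2)] Ua] that
      by (auto simp: abs_le_iff)
    then show "poly_le real_vlattice k ?S U"
      unfolding poly_le_iff[OF Sp Ua] using S(4)[of "form_of k U"] Ua unfolding associated_operator_real by blast
  qed
  then have "poly_abs real_vlattice k P = ?S"
    unfolding poly_abs_def using is_lub_poly_unique by (intro the_equality) blast+
  then show thesis using that Sp S(3) by simp
qed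

lemma poly_abs_positive:
  assumes "positive_poly real_vlattice k P" shows "poly_abs real_vlattice k P = P"
proof -
  obtain T where T: "associated_operator real_vlattice k P T" "positive_form k T"
    using assms positive_poly_real by blast
  have "is_lub_on (regular_polys real_vlattice k) (poly_le real_vlattice k) {P, \<lambda>x. (- 1) \<odot>\<^bsub>real_vlattice\<^esub> P x} P"
    unfolding is_lub_on_def
  proof (intro conjI ballI impI)
    fix Q assume "Q \<in> {P, \<lambda>x. (- 1) \<odot>\<^bsub>real_vlattice\<^esub> P x}"
    then consider "Q = P" | "Q = (\<lambda>x. - P x)" by auto
    then show "poly_le real_vlattice k Q P"
      using T(2) poly_le_iff[OF T(1) T(1)] poly_le_iff[OF associated_neg[OF T(1)] T(1)]
      by cases (auto simp: positive_form_def)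
  qed (use assms positive_imp_regular in auto)
  then show ?thesis unfolding poly_abs_def using is_lub_poly_unique by (intro the_equality) blast+
qed

lemma poly_norm_upper:
  assumes "associated_operator real_vlattice k Q S" "positive_form k S" "norm x \<le> 1"
  shows "\<bar>Q x\<bar> \<le> poly_norm real_vlattice Q"
proof -
  obtain C where C: "0 \<le> C" "\<And>xs. length xs = k \<Longrightarrow> \<bar>S xs\<bar> \<le> C * prod_list (map norm xs)"
    using positive_form_bounded[of k S] assms by (auto simp: associated_operator_real)
  have "\<bar>Q y\<bar> \<le> C" if "norm y \<le> 1" for y
  proof -
    have "\<bar>Q y\<bar> \<le> C * norm y ^ k"
      using C(2)[of "replicate k y"] assms(1) by (simp add: associated_operator_real prod_list_replicate)
    also have "\<dots> \<le> C * 1" using that C(1) by (intro mult_left_mono power_le_one) auto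
    finally show ?thesis by simp
  qed
  then have "bdd_above ((\<lambda>y. \<bar>Q y\<bar>) ` cball 0 1)" by (intro bdd_aboveI2[where M = C]) simp
  then have "\<bar>Q x\<bar> \<le> (SUP y\<in>cball 0 1. \<bar>Q y\<bar>)" using assms(3) by (intro cSUP_upper) auto
  then show ?thesis by (simp add: poly_norm_def)
qed

lemma regular_poly_space_simps [simp]:
  "vcarrier (regular_poly_space real_vlattice k) = regular_polys real_vlattice k"
  "vadd (regular_poly_space real_vlattice k) = (\<lambda>P Q x. P x + Q x)"
  "vzero (regular_poly_space real_vlattice k) = (\<lambda>x. 0)"
  "vscale (regular_poly_space real_vlattice k) = (\<lambda>c P x. c * P x)"
  "vle (regular_poly_space real_vlattice k) = poly_le real_vlattice k"
  "vnorm (regular_poly_space real_vlattice k) P = poly_norm real_vlattice (poly_abs real_vlattice k P)"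
  by (simp_all add: regular_poly_space_def)

lemma norm_sum_list_abs_le:
  fixes ys :: "'a::banach_lattice list"
  shows "\<forall>y\<in>set ys. norm y \<le> 1 \<Longrightarrow> norm (sum_list (map abs ys)) \<le> real (length ys)"
  by (induction ys) (auto intro: order_trans[OF norm_triangle_ineq] simp: norm_abs)

text \<open>
  The regular norm is the sup norm of the modulus. The modulus dominates the form, and by positivity
  its values are dominated by its values on the diagonal.
\<close>

lemma regular_form_bound:
  assumes k: "1 \<le> k" and P: "P \<in> regular_polys real_vlattice k" and xs: "length xs = k"
  shows "\<bar>form_of k P xs\<bar> \<le>
    real k ^ k * vnorm (regular_poly_space real_vlattice k) P * prod_list (map norm (xs :: 'a::banach_lattice list))"
proof (rule multilinear_bound_unit[OF _ xs])
  note a = regular_associated[OF P]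
  show Pm: "multilinear_form k (form_of k P)" using a by (simp add: associated_operator_real)
  obtain S where S: "associated_operator real_vlattice k (poly_abs real_vlattice k P) S"
    "\<And>xs. nonneg_list k xs \<Longrightarrow> \<bar>form_of k P xs\<bar> \<le> S xs" using poly_abs_form[OF P a] by blast
  have Sm: "multilinear_form k S" using S(1) by (simp add: associated_operator_real)
  have Sp: "positive_form k S" unfolding positive_form_def using S(2) abs_ge_zero order_trans by blast
  fix ys :: "'a list" assume ys: "length ys = k" "\<forall>y\<in>set ys. norm y \<le> 1"
  let ?s = "sum_list (map abs ys)"
  have "\<bar>form_of k P ys\<bar> \<le> S (map abs ys)"
    by (rule dominated_form_abs[OF Pm Sm _ ys(1)]) (use S(2) in simp)
  also have "\<dots> \<le> S (replicate k ?s)"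
    using ys(1) by (intro positive_form_le_diagonal[OF Sm Sp]) (auto intro!: le_sum_list_nonneg)
  also have "replicate k ?s = replicate k (real k *\<^sub>R (1 / real k) *\<^sub>R ?s)" using k by simp
  also have "S \<dots> = real k ^ k * S (replicate k ((1 / real k) *\<^sub>R ?s))"
    by (rule multilinear_replicate_scale[OF Sm])
  also have "S (replicate k ((1 / real k) *\<^sub>R ?s)) = poly_abs real_vlattice k P ((1 / real k) *\<^sub>R ?s)"
    using S(1) by (simp add: associated_operator_real)
  also have "\<dots> \<le> poly_norm real_vlattice (poly_abs real_vlattice k P)"
  proof (rule order_trans[OF abs_ge_self poly_norm_upper[OF S(1) Sp]])
    show "norm ((1 / real k) *\<^sub>R ?s) \<le> 1" using norm_sum_list_abs_le[OF ys(2)] ys(1) k by (simp add: field_simps)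
  qed
  finally show "\<bar>form_of k P ys\<bar> \<le> real k ^ k * vnorm (regular_poly_space real_vlattice k) P"
    by (simp add: mult_left_mono)
qed

section \<open>Iterated evaluation at bidual elements\<close>

definition bounded_form :: "nat \<Rightarrow> ('a::real_normed_vector list \<Rightarrow> real) \<Rightarrow> bool" where
  "bounded_form k T \<longleftrightarrow> multilinear_form k T \<and>
     (\<exists>C\<ge>0. \<forall>xs. length xs = k \<longrightarrow> \<bar>T xs\<bar> \<le> C * prod_list (map norm xs))"

text \<open>One of the Arens extensions of a multilinear form to the bidual.\<close>

fun bidual_eval :: "(('a::real_normed_vector \<Rightarrow>\<^sub>L real) \<Rightarrow>\<^sub>L real) list \<Rightarrow> ('a list \<Rightarrow> real) \<Rightarrow> real" where
  "bidual_eval [] T = T []"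
| "bidual_eval (\<Phi> # \<Phi>s) T = \<Phi> (Blinfun (\<lambda>y. bidual_eval \<Phi>s (\<lambda>ys. T (y # ys))))"

lemma bidual_eval_cong:
  "(\<And>ys. length ys = length \<Phi>s \<Longrightarrow> T ys = T' ys) \<Longrightarrow> bidual_eval \<Phi>s T = bidual_eval \<Phi>s T'"
proof (induction \<Phi>s arbitrary: T T')
  case (Cons \<Phi> \<Phi>s)
  have "bidual_eval \<Phi>s (\<lambda>ys. T (y # ys)) = bidual_eval \<Phi>s (\<lambda>ys. T' (y # ys))" for y
    using Cons.prems by (intro Cons.IH) simp
  then show ?case by simp
qed simp

lemma bounded_form_combine:
  assumes "bounded_form k T" "bounded_form k T'"
  shows "bounded_form k (\<lambda>xs. a * T xs + b * T' xs)"
proof -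
  obtain C C' where C: "0 \<le> C" "\<And>xs. length xs = k \<Longrightarrow> \<bar>T xs\<bar> \<le> C * prod_list (map norm xs)"
    "0 \<le> C'" "\<And>xs. length xs = k \<Longrightarrow> \<bar>T' xs\<bar> \<le> C' * prod_list (map norm xs)"
    using assms unfolding bounded_form_def by blast
  have "\<bar>a * T xs + b * T' xs\<bar> \<le> (\<bar>a\<bar> * C + \<bar>b\<bar> * C') * prod_list (map norm xs)" if "length xs = k" for xs
  proof -
    have "\<bar>a * T xs + b * T' xs\<bar> \<le> \<bar>a\<bar> * \<bar>T xs\<bar> + \<bar>b\<bar> * \<bar>T' xs\<bar>"
      by (metis abs_mult abs_triangle_ineq)
    also have "\<dots> \<le> \<bar>a\<bar> * (C * prod_list (map norm xs)) + \<bar>b\<bar> * (C' * prod_list (map norm xs))"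
      using C that by (intro add_mono mult_left_mono) auto
    finally show ?thesis by (simp add: algebra_simps)
  qed
  moreover have "0 \<le> \<bar>a\<bar> * C + \<bar>b\<bar> * C'" using C by simp
  ultimately show ?thesis using assms multilinear_combine unfolding bounded_form_def by blast
qed

lemma bounded_form_tail:
  assumes "bounded_form (Suc k) T" shows "bounded_form k (\<lambda>ys. T (y # ys))"
proof -
  obtain C where C: "0 \<le> C" "\<And>xs. length xs = Suc k \<Longrightarrow> \<bar>T xs\<bar> \<le> C * prod_list (map norm xs)"
    using assms unfolding bounded_form_def by blast
  have "\<bar>T (y # ys)\<bar> \<le> (C * norm y) * prod_list (map norm ys)" if "length ys = k" for ys
    using C(2)[of "y # ys"] that by (simp add: mult.assoc)
  then show ?thesis using C(1) assms multilinear_tail unfolding bounded_form_def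
    by (blast intro: mult_nonneg_nonneg norm_ge_zero)
qed

lemma bounded_form_prefix: "bounded_form (m + j) T \<Longrightarrow> bounded_form j (\<lambda>ys. T (replicate m y @ ys))"
proof (induction m arbitrary: T)
  case (Suc m)
  then show ?case using Suc.IH[OF bounded_form_tail[of "m + j" T y]] by simp
qed simp

text \<open>
  The value of \<open>bidual_eval\<close> is linear in the form and bounded by any bound for it. The two properties
  have to be proved together, because they show that the slices of a form are functionals; the
  following lemma extracts this step for an arbitrary evaluation \<open>E\<close> of forms.
\<close>

lemma slice_functional:
  fixes E :: "('a::real_normed_vector list \<Rightarrow> real) \<Rightarrow> real"
  assumes cong: "\<And>T T'. (\<And>ys. length ys = k \<Longrightarrow> T ys = T' ys) \<Longrightarrow> E T = E T'"
    and combine: "\<And>T T' a b. bounded_form k T \<Longrightarrow> bounded_form k T' \<Longrightarrow>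
      E (\<lambda>xs. a * T xs + b * T' xs) = a * E T + b * E T'"
    and bound: "\<And>T C. multilinear_form k T \<Longrightarrow> 0 \<le> C \<Longrightarrow>
      (\<And>xs. length xs = k \<Longrightarrow> \<bar>T xs\<bar> \<le> C * prod_list (map norm xs)) \<Longrightarrow> \<bar>E T\<bar> \<le> C * c"
    and T: "multilinear_form (Suc k) T" "0 \<le> C"
      "\<And>xs. length xs = Suc k \<Longrightarrow> \<bar>T xs\<bar> \<le> C * prod_list (map norm xs)"
  shows "blinfun_apply (Blinfun (\<lambda>y. E (\<lambda>ys. T (y # ys)))) = (\<lambda>y. E (\<lambda>ys. T (y # ys)))"
    and "\<bar>E (\<lambda>ys. T (y # ys))\<bar> \<le> C * c * norm y"
proof -
  let ?h = "\<lambda>y. E (\<lambda>ys. T (y # ys))"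
  have bf: "bounded_form k (\<lambda>ys. T (y # ys))" for y
    using T by (intro bounded_form_tail) (auto simp: bounded_form_def)
  have "?h (u + v) = ?h u + ?h v" for u v
  proof -
    have "?h (u + v) = E (\<lambda>ys. 1 * T (u # ys) + 1 * T (v # ys))"
      using multilinear_head_add[OF T(1)] by (intro cong) simp
    then show ?thesis using combine[OF bf bf, of 1 u 1 v] by simp
  qed
  moreover have "?h (r *\<^sub>R u) = r * ?h u" for r u
  proof -
    have "?h (r *\<^sub>R u) = E (\<lambda>ys. r * T (u # ys) + 0 * T (u # ys))"
      using multilinear_head_scale[OF T(1)] by (intro cong) simp
    then show ?thesis using combine[OF bf bf, of r u 0 u] by simp
  qed
  ultimately have lin: "linear ?h" by (simp add: linear_iff)
  show le: "\<bar>?h y\<bar> \<le> C * c * norm y" for y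
  proof -
    have "\<bar>?h y\<bar> \<le> (C * norm y) * c"
    proof (rule bound)
      show "multilinear_form k (\<lambda>ys. T (y # ys))" using T(1) by (rule multilinear_tail)
      fix ys :: "'a list" assume "length ys = k"
      then show "\<bar>T (y # ys)\<bar> \<le> C * norm y * prod_list (map norm ys)" using T(3)[of "y # ys"] by (simp add: mult.assoc)
    qed (use T in simp)
    then show ?thesis by (simp add: mult_ac)
  qed
  show "blinfun_apply (Blinfun ?h) = ?h"
    by (rule blinfun_of_bounded[OF lin order_trans[OF abs_ge_self le]])
qed

lemma bidual_eval_bound_combine:
  shows "\<And>T C. multilinear_form (length \<Phi>s) T \<Longrightarrow> 0 \<le> C \<Longrightarrow>
      (\<And>xs. length xs = length \<Phi>s \<Longrightarrow> \<bar>T xs\<bar> \<le> C * prod_list (map norm xs)) \<Longrightarrow>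
      \<bar>bidual_eval \<Phi>s T\<bar> \<le> C * prod_list (map norm \<Phi>s)"
    and "\<And>T T' a b. bounded_form (length \<Phi>s) T \<Longrightarrow> bounded_form (length \<Phi>s) T' \<Longrightarrow>
      bidual_eval \<Phi>s (\<lambda>xs. a * T xs + b * T' xs) = a * bidual_eval \<Phi>s T + b * bidual_eval \<Phi>s T'"
proof (induction \<Phi>s)
  case Nil
  { case 1 then show ?case by simp }
  { case 2 show ?case by simp }
next
  case (Cons \<Phi> \<Phi>s)
  let ?k = "length \<Phi>s"
  let ?h = "\<lambda>T y. bidual_eval \<Phi>s (\<lambda>ys. T (y # ys))"
  note slice = slice_functional[of ?k "bidual_eval \<Phi>s" "prod_list (map norm \<Phi>s)", OF bidual_eval_cong Cons.IH(2) Cons.IH(1)]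
  have app: "blinfun_apply (Blinfun (?h T)) = ?h T" if "bounded_form (Suc ?k) T" for T
    using that slice(1)[of T] unfolding bounded_form_def by blast
  {
    case (1 T C)
    have p: "0 \<le> prod_list (map norm \<Phi>s)" by (induction \<Phi>s) auto
    have ap: "blinfun_apply (Blinfun (?h T)) = ?h T" using 1 by (intro app) (auto simp: bounded_form_def)
    have "\<bar>?h T y\<bar> \<le> C * prod_list (map norm \<Phi>s) * norm y" for y using 1 by (intro slice(2)) auto
    then have "norm (Blinfun (?h T)) \<le> C * prod_list (map norm \<Phi>s)"
      using ap p 1(2) by (intro norm_blinfun_bound) auto
    then have "\<bar>\<Phi> (Blinfun (?h T))\<bar> \<le> norm \<Phi> * (C * prod_list (map norm \<Phi>s))"
      using norm_blinfun[of \<Phi> "Blinfun (?h T)"] by (simp add: mult_left_mono order_trans)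
    then show ?case by (simp add: mult_ac)
  next
    case (2 T T' a b)
    have "Blinfun (?h (\<lambda>xs. a * T xs + b * T' xs)) = a *\<^sub>R Blinfun (?h T) + b *\<^sub>R Blinfun (?h T')"
    proof (rule blinfun_eqI)
      fix y
      have "bounded_form ?k (\<lambda>ys. T (y # ys))" "bounded_form ?k (\<lambda>ys. T' (y # ys))"
        using 2 by (auto intro: bounded_form_tail)
      then show "blinfun_apply (Blinfun (?h (\<lambda>xs. a * T xs + b * T' xs))) y =
          blinfun_apply (a *\<^sub>R Blinfun (?h T) + b *\<^sub>R Blinfun (?h T')) y"
        using 2 Cons.IH(2) app[of "\<lambda>xs. a * T xs + b * T' xs"] bounded_form_combine[of "Suc ?k" T T' a b]
        by (simp add: app[of T] app[of T'] blinfun.add_left blinfun.scaleR_left)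
    qed
    then show ?case by (simp add: blinfun.add_right blinfun.scaleR_right)
  }
qed

lemma bidual_eval_slice:
  assumes "bounded_form (Suc (length \<Phi>s)) T"
  shows "blinfun_apply (Blinfun (\<lambda>y. bidual_eval \<Phi>s (\<lambda>ys. T (y # ys)))) = (\<lambda>y. bidual_eval \<Phi>s (\<lambda>ys. T (y # ys)))"
  using assms slice_functional(1)[of "length \<Phi>s" "bidual_eval \<Phi>s" "prod_list (map norm \<Phi>s)",
      OF bidual_eval_cong bidual_eval_bound_combine(2) bidual_eval_bound_combine(1)]
  unfolding bounded_form_def by blast

text \<open>
  The descent: if all evaluations of the forms \<open>T n\<close> at bidual elements in the last \<open>Suc j\<close> arguments
  tend to zero, the slices in the first of them are weakly null functionals, and the disjoint
  Dunford-Pettis property allows this argument to be replaced by \<open>x n\<close>.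
\<close>

lemma bidual_descent:
  fixes x :: "nat \<Rightarrow> 'a::banach_lattice"
  assumes a: "disjoint_DPP p TYPE('a)" and x: "disjoint_seq x" "weakly_summable p x"
    and T: "\<And>n. bounded_form (m + j) (T n)"
    and lim: "\<And>\<Phi>s. length \<Phi>s = j \<Longrightarrow>
      (\<lambda>n. bidual_eval \<Phi>s (\<lambda>ys. T n (replicate m (x n) @ ys))) \<longlonglongrightarrow> 0"
  shows "(\<lambda>n. T n (replicate (m + j) (x n))) \<longlonglongrightarrow> 0"
  using T lim
proof (induction j arbitrary: m)
  case 0
  then show ?case using "0.prems"(2)[of "[]"] by simp
next
  case (Suc j)
  have "(\<lambda>n. T n (replicate (Suc m + j) (x n))) \<longlonglongrightarrow> 0"
  proof (rule Suc.IH)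
    show "bounded_form (Suc m + j) (T n)" for n using Suc.prems(1) by simp
    fix \<Phi>s :: "(('a \<Rightarrow>\<^sub>L real) \<Rightarrow>\<^sub>L real) list" assume len: "length \<Phi>s = j"
    let ?S = "\<lambda>n zs. T n (replicate m (x n) @ zs)"
    define \<phi> where "\<phi> n = Blinfun (\<lambda>y. bidual_eval \<Phi>s (\<lambda>ys. ?S n (y # ys)))" for n
    have app: "blinfun_apply (\<phi> n) = (\<lambda>y. bidual_eval \<Phi>s (\<lambda>ys. ?S n (y # ys)))" for n
      unfolding \<phi>_def using bounded_form_prefix[OF Suc.prems(1)] len by (intro bidual_eval_slice) simp
    have "weakly_null \<phi>"
      unfolding weakly_null_def
    proof
      fix \<Phi> :: "('a \<Rightarrow>\<^sub>L real) \<Rightarrow>\<^sub>L real"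
      show "(\<lambda>n. \<Phi> (\<phi> n)) \<longlonglongrightarrow> 0" using Suc.prems(2)[of "\<Phi> # \<Phi>s"] len by (simp add: \<phi>_def)
    qed
    from disjoint_DPP_diagonal[OF a x this]
    show "(\<lambda>n. bidual_eval \<Phi>s (\<lambda>ys. T n (replicate (Suc m) (x n) @ ys))) \<longlonglongrightarrow> 0"
      by (simp add: app replicate_app_Cons_same)
  qed
  then show ?case by simp
qed

lemma bounded_form_null:
  fixes x :: "nat \<Rightarrow> 'a::banach_lattice"
  assumes a: "disjoint_DPP p TYPE('a)" and x: "disjoint_seq x" "weakly_summable p x"
    and p: "0 < p" and k: "1 \<le> k" and T: "bounded_form k T"
  shows "(\<lambda>n. T (replicate k (x n))) \<longlonglongrightarrow> 0"
proof -
  obtain j where j: "k = 1 + j" using k le_Suc_ex by metis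
  have "(\<lambda>n. T (replicate (1 + j) (x n))) \<longlonglongrightarrow> 0"
  proof (rule bidual_descent[OF a x, where T = "\<lambda>_. T"])
    show "bounded_form (1 + j) T" using T j by simp
    fix \<Phi>s :: "(('a \<Rightarrow>\<^sub>L real) \<Rightarrow>\<^sub>L real) list" assume len: "length \<Phi>s = j"
    let ?h = "Blinfun (\<lambda>y. bidual_eval \<Phi>s (\<lambda>ys. T (y # ys)))"
    have "blinfun_apply ?h = (\<lambda>y. bidual_eval \<Phi>s (\<lambda>ys. T (y # ys)))"
      using T j len by (intro bidual_eval_slice) simp
    then show "(\<lambda>n. bidual_eval \<Phi>s (\<lambda>ys. T (replicate 1 (x n) @ ys))) \<longlonglongrightarrow> 0"
      using weakly_summable_imp_null[OF x(2) p, of ?h] by simp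
  qed
  then show ?thesis using j by simp
qed

lemma positive_form_bounded_form:
  "multilinear_form k T \<Longrightarrow> positive_form k T \<Longrightarrow> bounded_form k T"
  using positive_form_bounded unfolding bounded_form_def by blast

text \<open>
  Evaluations at bidual elements are bounded functionals on the space of regular polynomials, so they
  tend to zero along \<open>P\<close>, and the descent applies.
\<close>

theorem disjoint_DPP_imp_polys_null:
  fixes x :: "nat \<Rightarrow> 'a::banach_lattice" and P :: "nat \<Rightarrow> 'a \<Rightarrow> real"
  assumes a: "disjoint_DPP p TYPE('a)" and x: "disjoint_seq x" "weakly_summable p x" and k: "1 \<le> k"
    and P: "vweakly_null (regular_poly_space real_vlattice k) P"
  shows "(\<lambda>n. P n (x n)) \<longlonglongrightarrow> 0"
proof -
  have reg: "P n \<in> regular_polys real_vlattice k" for n using P by (simp add: vweakly_null_def)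
  have bf: "bounded_form k (form_of k Q)" if Q: "Q \<in> regular_polys real_vlattice k" for Q :: "'a \<Rightarrow> real"
    unfolding bounded_form_def
  proof
    show "multilinear_form k (form_of k Q)" using regular_associated[OF Q] by (simp add: associated_operator_real)
    have "\<bar>form_of k Q xs\<bar> \<le> \<bar>real k ^ k * vnorm (regular_poly_space real_vlattice k) Q\<bar> * prod_list (map norm xs)"
      if "length xs = k" for xs
    proof -
      have "0 \<le> prod_list (map norm xs)" by (induction xs) auto
      then show ?thesis
        by (rule order_trans[OF regular_form_bound[OF k Q that] mult_right_mono[OF abs_ge_self]])
    qed
    then show "\<exists>C\<ge>0. \<forall>xs. length xs = k \<longrightarrow> \<bar>form_of k Q xs\<bar> \<le> C * prod_list (map norm xs)"
      using abs_ge_zero by blast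
  qed
  have "(\<lambda>n. form_of k (P n) (replicate (0 + k) (x n))) \<longlonglongrightarrow> 0"
  proof (rule bidual_descent[OF a x])
    show "bounded_form (0 + k) (form_of k (P n))" for n using bf[OF reg] by simp
    fix \<Phi>s :: "(('a \<Rightarrow>\<^sub>L real) \<Rightarrow>\<^sub>L real) list" assume len: "length \<Phi>s = k"
    have "(\<lambda>Q. bidual_eval \<Phi>s (form_of k Q)) \<in> vdual (regular_poly_space real_vlattice k)"
      unfolding vdual_def
    proof (intro CollectI conjI ballI allI)
      fix Q R :: "'a \<Rightarrow> real"
      assume "Q \<in> vcarrier (regular_poly_space real_vlattice k)" "R \<in> vcarrier (regular_poly_space real_vlattice k)"
      then have Q: "Q \<in> regular_polys real_vlattice k" and R: "R \<in> regular_polys real_vlattice k" by auto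
      have "bidual_eval \<Phi>s (form_of k (\<lambda>x. 1 * Q x + 1 * R x)) =
          bidual_eval \<Phi>s (\<lambda>xs. 1 * form_of k Q xs + 1 * form_of k R xs)"
        by (intro bidual_eval_cong associated_unique[OF regular_associated[OF regular_combine[OF Q R]]
              associated_combine[OF regular_associated[OF Q] regular_associated[OF R]]]) (simp add: len)
      then show "bidual_eval \<Phi>s (form_of k (Q \<oplus>\<^bsub>regular_poly_space real_vlattice k\<^esub> R)) =
          bidual_eval \<Phi>s (form_of k Q) + bidual_eval \<Phi>s (form_of k R)"
        using bidual_eval_bound_combine(2)[of \<Phi>s "form_of k Q" "form_of k R" 1 1] bf Q R len by simp
    next
      fix c and Q :: "'a \<Rightarrow> real" assume "Q \<in> vcarrier (regular_poly_space real_vlattice k)"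
      then have Q: "Q \<in> regular_polys real_vlattice k" by auto
      have "bidual_eval \<Phi>s (form_of k (\<lambda>x. c * Q x + 0 * Q x)) =
          bidual_eval \<Phi>s (\<lambda>xs. c * form_of k Q xs + 0 * form_of k Q xs)"
        by (intro bidual_eval_cong associated_unique[OF regular_associated[OF regular_combine[OF Q Q]]
              associated_combine[OF regular_associated[OF Q] regular_associated[OF Q]]]) (simp add: len)
      then show "bidual_eval \<Phi>s (form_of k (c \<odot>\<^bsub>regular_poly_space real_vlattice k\<^esub> Q)) = c * bidual_eval \<Phi>s (form_of k Q)"
        using bidual_eval_bound_combine(2)[of \<Phi>s "form_of k Q" "form_of k Q" c 0] bf Q len by simp
    next
      show "\<exists>B. \<forall>Q\<in>vcarrier (regular_poly_space real_vlattice k).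
          \<bar>bidual_eval \<Phi>s (form_of k Q)\<bar> \<le> B * vnorm (regular_poly_space real_vlattice k) Q"
      proof (intro exI ballI)
        fix Q :: "'a \<Rightarrow> real" assume "Q \<in> vcarrier (regular_poly_space real_vlattice k)"
        then have Q: "Q \<in> regular_polys real_vlattice k" by auto
        let ?C = "real k ^ k * vnorm (regular_poly_space real_vlattice k) Q"
        obtain S where S: "associated_operator real_vlattice k (poly_abs real_vlattice k Q) S"
          "\<And>xs. nonneg_list k xs \<Longrightarrow> \<bar>form_of k Q xs\<bar> \<le> S xs" using poly_abs_form[OF Q regular_associated[OF Q]] by blast
        have "positive_form k S" unfolding positive_form_def using S(2) abs_ge_zero order_trans by blast
        from order_trans[OF abs_ge_zero poly_norm_upper[OF S(1) this, of 0]]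
        have "0 \<le> ?C" by simp
        then have "\<bar>bidual_eval \<Phi>s (form_of k Q)\<bar> \<le> ?C * prod_list (map norm \<Phi>s)"
          using bf[OF Q] regular_form_bound[OF k Q] len
          by (intro bidual_eval_bound_combine(1)) (auto simp: bounded_form_def)
        then show "\<bar>bidual_eval \<Phi>s (form_of k Q)\<bar> \<le>
            (real k ^ k * prod_list (map norm \<Phi>s)) * vnorm (regular_poly_space real_vlattice k) Q"
          by (simp add: mult_ac)
      qed
    qed
    then have dual: "(\<lambda>Q. bidual_eval \<Phi>s (form_of k Q)) \<in> vdual (regular_poly_space real_vlattice k)" .
    have "\<forall>f\<in>vdual (regular_poly_space real_vlattice k). (\<lambda>n. f (P n)) \<longlonglongrightarrow> 0"
      using P by (simp add: vweakly_null_def)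
    from bspec[OF this dual]
    show "(\<lambda>n. bidual_eval \<Phi>s (\<lambda>ys. form_of k (P n) (replicate 0 (x n) @ ys))) \<longlonglongrightarrow> 0"
      by simp
  qed
  then show ?thesis using regular_associated[OF reg] by (simp add: associated_operator_real)
qed

section \<open>Banach lattices given by a carrier\<close>

context riesz_space_carrier
begin

lemma vsup_lub: "x \<in> vcarrier V \<Longrightarrow> y \<in> vcarrier V \<Longrightarrow> is_lub_on (vcarrier V) (vle V) {x, y} (vsup V x y)"
proof -
  assume xy: "x \<in> vcarrier V" "y \<in> vcarrier V"
  then obtain s where s: "is_lub_on (vcarrier V) (vle V) {x, y} s" using lub_exists by blast
  have "t = s" if "is_lub_on (vcarrier V) (vle V) {x, y} t" for t
    using s that le_antisym unfolding is_lub_on_def by blast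
  then show ?thesis unfolding vsup_def using s by (metis theI)
qed

lemma vinf_glb: "x \<in> vcarrier V \<Longrightarrow> y \<in> vcarrier V \<Longrightarrow> is_glb_on (vcarrier V) (vle V) {x, y} (vinf V x y)"
proof -
  assume xy: "x \<in> vcarrier V" "y \<in> vcarrier V"
  then obtain s where s: "is_glb_on (vcarrier V) (vle V) {x, y} s" using glb_exists by blast
  have "t = s" if "is_glb_on (vcarrier V) (vle V) {x, y} t" for t
    using s that le_antisym unfolding is_glb_on_def by blast
  then show ?thesis unfolding vinf_def using s by (metis theI)
qed

lemma vsup_eqI:
  assumes "is_lub_on (vcarrier V) (vle V) {x, y} s" "x \<in> vcarrier V" "y \<in> vcarrier V"
  shows "vsup V x y = s"
  by (rule le_antisym) (use assms vsup_lub[OF assms(2,3)] in \<open>simp_all add: is_lub_on_def\<close>)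

lemma vsup_props:
  assumes "x \<in> vcarrier V" "y \<in> vcarrier V"
  shows vsup_closed: "vsup V x y \<in> vcarrier V" and vsup_ge1: "x \<sqsubseteq> vsup V x y" and vsup_ge2: "y \<sqsubseteq> vsup V x y"
    and vsup_least: "\<And>z. z \<in> vcarrier V \<Longrightarrow> x \<sqsubseteq> z \<Longrightarrow> y \<sqsubseteq> z \<Longrightarrow> vsup V x y \<sqsubseteq> z"
  using vsup_lub[OF assms] unfolding is_lub_on_def by auto

lemma vinf_props:
  assumes "x \<in> vcarrier V" "y \<in> vcarrier V"
  shows vinf_closed: "vinf V x y \<in> vcarrier V" and vinf_le1: "vinf V x y \<sqsubseteq> x" and vinf_le2: "vinf V x y \<sqsubseteq> y"
    and vinf_greatest: "\<And>z. z \<in> vcarrier V \<Longrightarrow> z \<sqsubseteq> x \<Longrightarrow> z \<sqsubseteq> y \<Longrightarrow> z \<sqsubseteq> vinf V x y"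
  using vinf_glb[OF assms] unfolding is_glb_on_def by auto

lemma add_mono2:
  assumes c: "x \<in> vcarrier V" "x' \<in> vcarrier V" "y \<in> vcarrier V" "y' \<in> vcarrier V"
    and le: "x \<sqsubseteq> x'" "y \<sqsubseteq> y'"
  shows "x \<oplus> y \<sqsubseteq> x' \<oplus> y'"
proof (rule le_trans)
  show "x \<oplus> y \<sqsubseteq> x' \<oplus> y" using c le by (intro add_mono)
  show "x' \<oplus> y \<sqsubseteq> x' \<oplus> y'"
    using add_mono[OF c(3,4,2) le(2)] add_commute[OF c(2,3)] add_commute[OF c(2,4)] by simp
qed (use c add_closed in auto)

lemma add_nonneg: "\<lbrakk>x \<in> vcarrier V; y \<in> vcarrier V; \<zero> \<sqsubseteq> x; \<zero> \<sqsubseteq> y\<rbrakk> \<Longrightarrow> \<zero> \<sqsubseteq> x \<oplus> y"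
  using add_mono2[of \<zero> x \<zero> y] zero_closed add_zero by simp

lemma le_add_nonneg: "\<lbrakk>x \<in> vcarrier V; y \<in> vcarrier V; \<zero> \<sqsubseteq> y\<rbrakk> \<Longrightarrow> x \<sqsubseteq> x \<oplus> y"
  using add_mono2[of x x \<zero> y] zero_closed add_zero_right le_refl by simp

lemma le_diff_iff:
  assumes "x \<in> vcarrier V" "y \<in> vcarrier V" "z \<in> vcarrier V"
  shows "x \<oplus> y \<sqsubseteq> z \<longleftrightarrow> x \<sqsubseteq> z \<ominus> y"
proof
  assume "x \<oplus> y \<sqsubseteq> z"
  then have "(x \<oplus> y) \<oplus> ((- 1) \<odot> y) \<sqsubseteq> z \<oplus> ((- 1) \<odot> y)"
    using assms by (intro add_mono) (auto intro: add_closed scale_closed)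
  then show "x \<sqsubseteq> z \<ominus> y" using assms by (simp add: add_minus_cancel vminus_def)
next
  assume "x \<sqsubseteq> z \<ominus> y"
  then have "x \<oplus> y \<sqsubseteq> (z \<ominus> y) \<oplus> y" using assms by (intro add_mono) (auto intro: minus_closed)
  then show "x \<oplus> y \<sqsubseteq> z" using assms by (simp add: minus_add_cancel)
qed

lemma diff_le_iff:
  assumes "x \<in> vcarrier V" "y \<in> vcarrier V" "z \<in> vcarrier V"
  shows "z \<ominus> y \<sqsubseteq> x \<longleftrightarrow> z \<sqsubseteq> x \<oplus> y"
proof
  assume "z \<ominus> y \<sqsubseteq> x"
  then have "(z \<ominus> y) \<oplus> y \<sqsubseteq> x \<oplus> y" using assms by (intro add_mono) (auto intro: minus_closed)
  then show "z \<sqsubseteq> x \<oplus> y" using assms by (simp add: minus_add_cancel)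
next
  assume "z \<sqsubseteq> x \<oplus> y"
  then have "z \<oplus> ((- 1) \<odot> y) \<sqsubseteq> (x \<oplus> y) \<oplus> ((- 1) \<odot> y)"
    using assms by (intro add_mono) (auto intro: add_closed scale_closed)
  then show "z \<ominus> y \<sqsubseteq> x" using assms by (simp add: add_minus_cancel vminus_def)
qed

lemma diff_nonneg_iff: "x \<in> vcarrier V \<Longrightarrow> y \<in> vcarrier V \<Longrightarrow> \<zero> \<sqsubseteq> y \<ominus> x \<longleftrightarrow> x \<sqsubseteq> y"
  using le_diff_iff[of \<zero> x y] zero_closed add_zero by simp

lemma neg_nonpos: "x \<in> vcarrier V \<Longrightarrow> \<zero> \<sqsubseteq> x \<Longrightarrow> (- 1) \<odot> x \<sqsubseteq> \<zero>"
  using diff_le_iff[of \<zero> x \<zero>] zero_closed add_zero[of x] add_zero[of "(- 1) \<odot> x"] scale_closed[of x "- 1"]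
  by (simp add: vminus_def)

lemma carrier_riesz_decomposition:
  assumes c: "r \<in> vcarrier V" "u \<in> vcarrier V" "v \<in> vcarrier V"
    and r: "\<zero> \<sqsubseteq> r" "r \<sqsubseteq> u \<oplus> v" and uv: "\<zero> \<sqsubseteq> u" "\<zero> \<sqsubseteq> v"
  obtains s t where "s \<in> vcarrier V" "t \<in> vcarrier V" "r = s \<oplus> t" "\<zero> \<sqsubseteq> s" "s \<sqsubseteq> u" "\<zero> \<sqsubseteq> t" "t \<sqsubseteq> v"
proof -
  define s where "s = vinf V r u"
  have s: "s \<in> vcarrier V" "s \<sqsubseteq> r" "s \<sqsubseteq> u" "\<zero> \<sqsubseteq> s"
    unfolding s_def using c r uv vinf_props[of r u] zero_closed by auto
  have t: "r \<ominus> s \<in> vcarrier V" using c s minus_closed by blast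
  have "r \<ominus> v \<sqsubseteq> s"
    unfolding s_def
  proof (rule vinf_greatest)
    show "r \<ominus> v \<sqsubseteq> r" using c uv by (simp add: diff_le_iff le_add_nonneg)
    show "r \<ominus> v \<sqsubseteq> u" using c r by (simp add: diff_le_iff)
  qed (use c minus_closed in auto)
  then have "r \<sqsubseteq> s \<oplus> v" using diff_le_iff c s by blast
  then have "r \<ominus> s \<sqsubseteq> v" using diff_le_iff[of v s r] c s add_commute by simp
  moreover have "\<zero> \<sqsubseteq> r \<ominus> s" using diff_nonneg_iff c s by blast
  moreover have "r = s \<oplus> (r \<ominus> s)" using minus_add_cancel[of r s] add_commute[of s "r \<ominus> s"] c s t by simp
  ultimately show thesis using that s t by blast
qed

definition vpos :: "'a \<Rightarrow> 'a" where "vpos x = vsup V x \<zero>"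

lemma vpos_closed: "x \<in> vcarrier V \<Longrightarrow> vpos x \<in> vcarrier V"
  and vpos_ge: "x \<in> vcarrier V \<Longrightarrow> x \<sqsubseteq> vpos x"
  and vpos_nonneg: "x \<in> vcarrier V \<Longrightarrow> \<zero> \<sqsubseteq> vpos x"
  and vpos_least: "x \<in> vcarrier V \<Longrightarrow> z \<in> vcarrier V \<Longrightarrow> x \<sqsubseteq> z \<Longrightarrow> \<zero> \<sqsubseteq> z \<Longrightarrow> vpos x \<sqsubseteq> z"
  unfolding vpos_def using vsup_props zero_closed by auto

lemma vpos_of_nonneg: "x \<in> vcarrier V \<Longrightarrow> \<zero> \<sqsubseteq> x \<Longrightarrow> vpos x = x"
  using vpos_least[of x x] vpos_ge[of x] vpos_closed le_refl le_antisym by blast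

lemma vpos_of_nonpos: "x \<in> vcarrier V \<Longrightarrow> x \<sqsubseteq> \<zero> \<Longrightarrow> vpos x = \<zero>"
  using vpos_least[of x \<zero>] vpos_nonneg[of x] vpos_closed le_refl le_antisym zero_closed by blast

lemma vpos_add_le: "x \<in> vcarrier V \<Longrightarrow> y \<in> vcarrier V \<Longrightarrow> vpos (x \<oplus> y) \<sqsubseteq> vpos x \<oplus> vpos y"
  by (intro vpos_least add_mono2 add_nonneg add_closed vpos_closed vpos_ge vpos_nonneg)

lemma vpos_scale:
  assumes x: "x \<in> vcarrier V" and c: "0 \<le> c" shows "vpos (c \<odot> x) = c \<odot> vpos x"
proof (cases "c = 0")
  case True
  then show ?thesis using x zero_closed le_refl by (simp add: zero_scale vpos_closed vpos_of_nonneg)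
next
  case False
  have nn: "\<zero> \<sqsubseteq> d \<odot> z" if "0 \<le> d" "z \<in> vcarrier V" "\<zero> \<sqsubseteq> z" for d z
    using scale_mono[of \<zero> z d] that zero_closed scale_zero by simp
  have le: "vpos (d \<odot> z) \<sqsubseteq> d \<odot> vpos z" if "0 \<le> d" "z \<in> vcarrier V" for d z
    using that by (intro vpos_least scale_mono nn scale_closed vpos_closed vpos_ge vpos_nonneg)
  have c: "0 < c" using c False by simp
  have cx: "c \<odot> x \<in> vcarrier V" "vpos (c \<odot> x) \<in> vcarrier V" using x scale_closed vpos_closed by auto
  have "vpos ((1 / c) \<odot> (c \<odot> x)) \<sqsubseteq> (1 / c) \<odot> vpos (c \<odot> x)" using c cx by (intro le) auto
  then have "vpos x \<sqsubseteq> (1 / c) \<odot> vpos (c \<odot> x)" using c x by (simp add: scale_scale scale_one)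
  then have "c \<odot> vpos x \<sqsubseteq> c \<odot> ((1 / c) \<odot> vpos (c \<odot> x))"
    using c x cx by (intro scale_mono scale_closed vpos_closed) auto
  then have "c \<odot> vpos x \<sqsubseteq> vpos (c \<odot> x)" using c cx by (simp add: scale_scale scale_one)
  then show ?thesis using le[of c x] c x cx scale_closed vpos_closed le_antisym by simp
qed

lemma vabs_props:
  assumes x: "x \<in> vcarrier V"
  shows "vabs V x \<in> vcarrier V" "x \<sqsubseteq> vabs V x" "(- 1) \<odot> x \<sqsubseteq> vabs V x" "\<zero> \<sqsubseteq> vabs V x"
    "\<And>z. z \<in> vcarrier V \<Longrightarrow> x \<sqsubseteq> z \<Longrightarrow> (- 1) \<odot> x \<sqsubseteq> z \<Longrightarrow> vabs V x \<sqsubseteq> z"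
proof -
  note nx = neg_closed[OF x]
  show c: "vabs V x \<in> vcarrier V" and 1: "x \<sqsubseteq> vabs V x" and 2: "(- 1) \<odot> x \<sqsubseteq> vabs V x"
    unfolding vabs_def using vsup_props[OF x nx] by auto
  show "\<And>z. z \<in> vcarrier V \<Longrightarrow> x \<sqsubseteq> z \<Longrightarrow> (- 1) \<odot> x \<sqsubseteq> z \<Longrightarrow> vabs V x \<sqsubseteq> z"
    unfolding vabs_def using vsup_props[OF x nx] by auto
  have "x \<oplus> ((- 1) \<odot> x) \<sqsubseteq> vabs V x \<oplus> vabs V x" using x nx c 1 2 by (intro add_mono2)
  also have "vabs V x \<oplus> vabs V x = 2 \<odot> vabs V x" using add_scale[OF c, of 1 1] c by (simp add: scale_one)
  finally have "(1 / 2) \<odot> \<zero> \<sqsubseteq> (1 / 2) \<odot> (2 \<odot> vabs V x)"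
    using c x by (intro scale_mono) (auto simp: add_neg intro: zero_closed scale_closed)
  then show "\<zero> \<sqsubseteq> vabs V x" using c by (simp add: scale_zero scale_scale scale_one)
qed

lemma vabs_of_nonneg:
  assumes x: "x \<in> vcarrier V" "\<zero> \<sqsubseteq> x" shows "vabs V x = x"
proof -
  have "(- 1) \<odot> x \<sqsubseteq> x" using neg_nonpos[OF x] x zero_closed scale_closed le_trans by blast
  then have "vabs V x \<sqsubseteq> x" using vabs_props(5)[OF x(1) x(1)] x le_refl by blast
  then show ?thesis using vabs_props[OF x(1)] x le_antisym by blast
qed

end

context banach_lattice_carrier
begin

lemma norm_mono_nonneg:
  "x \<in> vcarrier V \<Longrightarrow> y \<in> vcarrier V \<Longrightarrow> \<zero> \<sqsubseteq> x \<Longrightarrow> x \<sqsubseteq> y \<Longrightarrow> \<parallel>x\<parallel> \<le> \<parallel>y\<parallel>"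
  by (metis norm_mono vabs_of_nonneg le_trans zero_closed)

lemma norm_vpos_le: "x \<in> vcarrier V \<Longrightarrow> \<parallel>vpos x\<parallel> \<le> \<parallel>x\<parallel>"
  using norm_mono[of "vpos x" x] vpos_least[of x "vabs V x"] vabs_props[of x] vabs_of_nonneg[of "vpos x"]
    vpos_closed[of x] vpos_nonneg[of x] by simp

lemma norm_le_vpos_sum:
  assumes x: "x \<in> vcarrier V" shows "\<parallel>x\<parallel> \<le> \<parallel>vpos x\<parallel> + \<parallel>vpos ((- 1) \<odot> x)\<parallel>"
proof -
  note nx = neg_closed[OF x]
  let ?w = "vpos x \<oplus> vpos ((- 1) \<odot> x)"
  have w: "?w \<in> vcarrier V" "\<zero> \<sqsubseteq> ?w" using x nx by (auto intro: add_closed add_nonneg vpos_closed vpos_nonneg)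
  have "x \<sqsubseteq> ?w" using x nx le_add_nonneg[of "vpos x" "vpos ((- 1) \<odot> x)"]
    by (meson le_trans vpos_closed vpos_ge vpos_nonneg w(1))
  moreover have "(- 1) \<odot> x \<sqsubseteq> ?w"
    using x nx le_add_nonneg[of "vpos ((- 1) \<odot> x)" "vpos x"] add_commute[of "vpos x" "vpos ((- 1) \<odot> x)"]
    by (metis le_trans vpos_closed vpos_ge vpos_nonneg w(1))
  ultimately have "vabs V x \<sqsubseteq> vabs V ?w" using vabs_props(5)[OF x w(1)] vabs_of_nonneg[OF w] by simp
  then have "\<parallel>x\<parallel> \<le> \<parallel>?w\<parallel>" using x w norm_mono by blast
  also have "\<dots> \<le> \<parallel>vpos x\<parallel> + \<parallel>vpos ((- 1) \<odot> x)\<parallel>" using x nx vpos_closed norm_triangle by blast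
  finally show ?thesis .
qed

lemma archimedean:
  assumes u: "u \<in> vcarrier V" and d: "d \<in> vcarrier V" and le: "\<And>n::nat. real n \<odot> u \<sqsubseteq> d"
  shows "u \<sqsubseteq> \<zero>"
proof -
  have "real n * \<parallel>vpos u\<parallel> \<le> \<parallel>vpos d\<parallel>" for n
  proof -
    have nu: "real n \<odot> u \<in> vcarrier V" using u scale_closed by blast
    have "vpos (real n \<odot> u) \<sqsubseteq> vpos d"
      using nu d le[of n] by (intro vpos_least) (auto intro: vpos_closed vpos_nonneg le_trans vpos_ge)
    then have "\<parallel>vpos (real n \<odot> u)\<parallel> \<le> \<parallel>vpos d\<parallel>"
      using nu d by (intro norm_mono_nonneg vpos_closed vpos_nonneg)
    then show ?thesis using u by (simp add: vpos_scale norm_scale vpos_closed)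
  qed
  then have "\<parallel>vpos u\<parallel> = 0"
    using norm_nonneg[OF vpos_closed[OF u]] by (metis antisym_conv not_le reals_Archimedean3)
  then have "vpos u = \<zero>" using norm_eq_zero u vpos_closed by blast
  then show ?thesis using vpos_ge[OF u] by simp
qed

subsection \<open>Order continuous norm\<close>

text \<open>
  An element below all differences \<open>b \<ominus> a\<close> can be added repeatedly to elements of \<open>A\<close> or subtracted
  repeatedly from elements of \<open>B\<close>, so it is negative by the Archimedean property; order continuity
  then makes the differences small in norm.
\<close>

lemma order_continuous_gap:
  assumes oc: "order_continuous_norm V"
    and A: "A \<subseteq> vcarrier V" "A \<noteq> {}" and B: "B \<subseteq> vcarrier V" "B \<noteq> {}"
    and up: "\<And>a a'. a \<in> A \<Longrightarrow> a' \<in> A \<Longrightarrow> \<exists>c\<in>A. a \<sqsubseteq> c \<and> a' \<sqsubseteq> c"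
    and down: "\<And>b b'. b \<in> B \<Longrightarrow> b' \<in> B \<Longrightarrow> \<exists>c\<in>B. c \<sqsubseteq> b \<and> c \<sqsubseteq> b'"
    and le: "\<And>a b. a \<in> A \<Longrightarrow> b \<in> B \<Longrightarrow> a \<sqsubseteq> b"
    and gap: "\<And>w. w \<in> vcarrier V \<Longrightarrow> (\<And>a b. a \<in> A \<Longrightarrow> b \<in> B \<Longrightarrow> a \<oplus> w \<sqsubseteq> b) \<Longrightarrow>
        (\<forall>a\<in>A. a \<oplus> w \<in> A) \<or> (\<forall>b\<in>B. b \<ominus> w \<in> B)"
    and e: "0 < e"
  shows "\<exists>a\<in>A. \<exists>b\<in>B. \<parallel>b \<ominus> a\<parallel> < e"
proof -
  let ?D = "{b \<ominus> a |a b. a \<in> A \<and> b \<in> B}"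
  have D: "?D \<subseteq> vcarrier V" using A(1) B(1) minus_closed by blast
  have ne: "?D \<noteq> {}" using A(2) B(2) by blast
  have dmono: "b \<ominus> a \<sqsubseteq> b' \<ominus> a'" if "a \<in> A" "a' \<in> A" "b \<in> B" "b' \<in> B" "a' \<sqsubseteq> a" "b \<sqsubseteq> b'" for a a' b b'
  proof -
    have c: "a \<in> vcarrier V" "a' \<in> vcarrier V" "b \<in> vcarrier V" "b' \<in> vcarrier V" using that A B by auto
    have "(b \<ominus> a) \<oplus> a' \<sqsubseteq> (b \<ominus> a) \<oplus> a" using c that by (intro add_mono2 minus_closed le_refl)
    then have "(b \<ominus> a) \<oplus> a' \<sqsubseteq> b'" using c that minus_add_cancel add_closed minus_closed le_trans by metis
    then show ?thesis using le_diff_iff c minus_closed by blast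
  qed
  have dir: "\<exists>c\<in>?D. c \<sqsubseteq> d \<and> c \<sqsubseteq> d'" if dd': "d \<in> ?D" "d' \<in> ?D" for d d'
  proof -
    obtain a b a' b' where eq: "d = b \<ominus> a" "d' = b' \<ominus> a'" "a \<in> A" "b \<in> B" "a' \<in> A" "b' \<in> B" using dd' by blast
    obtain a3 b3 where "a3 \<in> A" "a \<sqsubseteq> a3" "a' \<sqsubseteq> a3" "b3 \<in> B" "b3 \<sqsubseteq> b" "b3 \<sqsubseteq> b'"
      using up[OF eq(3,5)] down[OF eq(4,6)] by blast
    then show ?thesis using dmono eq by blast
  qed
  have "is_glb_on (vcarrier V) (vle V) ?D \<zero>"
    unfolding is_glb_on_def
  proof (intro conjI ballI impI zero_closed)
    fix d assume "d \<in> ?D"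
    then show "\<zero> \<sqsubseteq> d" using le A B diff_nonneg_iff by blast
  next
    fix w assume w: "w \<in> vcarrier V" and lb: "\<forall>d\<in>?D. w \<sqsubseteq> d"
    have aw: "a \<oplus> w \<sqsubseteq> b" if "a \<in> A" "b \<in> B" for a b
    proof -
      have "a \<in> vcarrier V" "b \<in> vcarrier V" using that A B by auto
      moreover have "w \<sqsubseteq> b \<ominus> a" using lb that by blast
      ultimately have "w \<oplus> a \<sqsubseteq> b" using le_diff_iff w by blast
      then show ?thesis using add_commute \<open>a \<in> vcarrier V\<close> w by simp
    qed
    have "a \<oplus> (real n \<odot> w) \<sqsubseteq> b" if "a \<in> A" "b \<in> B" for n a b
      using that
    proof (induction n arbitrary: a b)
      case 0
      then show ?case using A w le by (auto simp: zero_scale add_zero_right)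
    next
      case (Suc n)
      have c: "a \<in> vcarrier V" "b \<in> vcarrier V" "real n \<odot> w \<in> vcarrier V" using Suc.prems A B w scale_closed by auto
      have S: "real (Suc n) \<odot> w = w \<oplus> (real n \<odot> w)" using add_scale[OF w, of 1 "real n"] w by (simp add: scale_one)
      consider "a \<oplus> w \<in> A" | "b \<ominus> w \<in> B" using gap[OF w aw] Suc.prems by blast
      then show ?case
      proof cases
        case 1
        then have "(a \<oplus> w) \<oplus> (real n \<odot> w) \<sqsubseteq> b" using Suc by blast
        then show ?thesis using S c w by (simp add: add_assoc)
      next
        case 2
        then have "a \<oplus> (real n \<odot> w) \<sqsubseteq> b \<ominus> w" using Suc by blast
        then have "(a \<oplus> (real n \<odot> w)) \<oplus> w \<sqsubseteq> b" using le_diff_iff c w add_closed by blast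
        then show ?thesis using S c w add_commute[OF w c(3)] by (simp add: add_assoc)
      qed
    qed
    moreover obtain a b where ab: "a \<in> A" "b \<in> B" using A B by blast
    ultimately have "real n \<odot> w \<sqsubseteq> b \<ominus> a" for n
    proof -
      have c: "a \<in> vcarrier V" "b \<in> vcarrier V" "real n \<odot> w \<in> vcarrier V" using ab A B w scale_closed by auto
      have "(real n \<odot> w) \<oplus> a \<sqsubseteq> b" using \<open>\<And>n a b. a \<in> A \<Longrightarrow> b \<in> B \<Longrightarrow> a \<oplus> (real n \<odot> w) \<sqsubseteq> b\<close>[OF ab] add_commute c by metis
      then show ?thesis using le_diff_iff c by blast
    qed
    then show "w \<sqsubseteq> \<zero>" using archimedean[OF w, of "b \<ominus> a"] ab A B minus_closed by blast
  qed
  then have "\<exists>d\<in>?D. \<forall>c\<in>?D. c \<sqsubseteq> d \<longrightarrow> \<parallel>c\<parallel> < e"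
    using oc[unfolded order_continuous_norm_def, rule_format, of ?D e] D ne dir e by blast
  then obtain d where d: "d \<in> ?D" "\<forall>c\<in>?D. c \<sqsubseteq> d \<longrightarrow> \<parallel>c\<parallel> < e" by blast
  then have "\<parallel>d\<parallel> < e" using le_refl D by blast
  then show ?thesis using d by blast
qed

definition contractive_positive :: "('a \<Rightarrow> real) \<Rightarrow> bool" where
  "contractive_positive y \<longleftrightarrow> linear_on_carrier V y \<and> (\<forall>w\<in>vcarrier V. y w \<le> \<parallel>w\<parallel>) \<and>
     (\<forall>w\<in>vcarrier V. \<zero> \<sqsubseteq> w \<longrightarrow> 0 \<le> y w)"

lemma linear_on_simps:
  assumes "linear_on_carrier V y"
  shows "x \<in> vcarrier V \<Longrightarrow> w \<in> vcarrier V \<Longrightarrow> y (x \<oplus> w) = y x + y w"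
    and "x \<in> vcarrier V \<Longrightarrow> y (c \<odot> x) = c * y x" and "y \<zero> = 0"
    and "x \<in> vcarrier V \<Longrightarrow> w \<in> vcarrier V \<Longrightarrow> y (x \<ominus> w) = y x - y w"
proof -
  show add: "x \<in> vcarrier V \<Longrightarrow> w \<in> vcarrier V \<Longrightarrow> y (x \<oplus> w) = y x + y w" for x w
    using assms unfolding linear_on_carrier_def by blast
  show scl: "x \<in> vcarrier V \<Longrightarrow> y (c \<odot> x) = c * y x" for x c
    using assms unfolding linear_on_carrier_def by blast
  show "y \<zero> = 0" using scl[OF zero_closed, of 0] scale_zero by simp
  show "x \<in> vcarrier V \<Longrightarrow> w \<in> vcarrier V \<Longrightarrow> y (x \<ominus> w) = y x - y w"
    unfolding vminus_def using add scl scale_closed by simp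
qed

lemma contractive_positive_mono:
  assumes y: "contractive_positive y" and "x \<in> vcarrier V" "w \<in> vcarrier V" "x \<sqsubseteq> w"
  shows "y x \<le> y w"
proof -
  have "0 \<le> y (w \<ominus> x)" using assms minus_closed diff_nonneg_iff unfolding contractive_positive_def by blast
  then show ?thesis using assms linear_on_simps(4)[of y w x] unfolding contractive_positive_def by simp
qed

lemma contractive_positive_vdual:
  assumes y: "contractive_positive y" shows "y \<in> vdual V"
proof -
  have lin: "linear_on_carrier V y" and le: "\<And>w. w \<in> vcarrier V \<Longrightarrow> y w \<le> \<parallel>w\<parallel>"
    using y unfolding contractive_positive_def by auto
  have "\<bar>y w\<bar> \<le> 1 * \<parallel>w\<parallel>" if w: "w \<in> vcarrier V" for w
    using le[OF w] le[OF neg_closed[OF w]] linear_on_simps(2)[OF lin w, of "- 1"] norm_scale[OF w, of "- 1"] by simp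
  then show ?thesis using lin unfolding vdual_def linear_on_carrier_def by blast
qed

text \<open>
  In a lattice with order continuous norm, positive functionals \<open>y n\<close> of norm at most one tend to zero
  along order bounded \<open>r n\<close> once \<open>\<Sum>\<^sub>n y i (r n) < \<infinity>\<close> for each \<open>i\<close>. Summability forces
  \<open>y i c \<le> 0\<close> for every lower bound \<open>c\<close> of the eventual upper bounds \<open>b\<close> of \<open>r\<close>, and \<open>b \<ominus> c\<close> can be
  made small in norm, whereas \<open>y n (r n) \<le> y n (b \<ominus> c) + y n c\<close>.
\<close>

lemma order_bounded_diagonal_null:
  fixes y :: "nat \<Rightarrow> 'a \<Rightarrow> real" and r :: "nat \<Rightarrow> 'a"
  assumes oc: "order_continuous_norm V" and y: "\<And>n. contractive_positive (y n)"
    and u: "u \<in> vcarrier V" and r: "\<And>n. r n \<in> vcarrier V" "\<And>n. \<zero> \<sqsubseteq> r n" "\<And>n. r n \<sqsubseteq> u"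
    and summ: "\<And>i. summable (\<lambda>n. y i (r n))" and e: "0 < e"
  shows "\<exists>N. \<forall>n\<ge>N. y n (r n) \<le> e"
proof -
  have lin: "linear_on_carrier V (y n)" and ynorm: "\<And>w. w \<in> vcarrier V \<Longrightarrow> y n w \<le> \<parallel>w\<parallel>" for n
    using y unfolding contractive_positive_def by auto
  define U where "U m = {b \<in> vcarrier V. \<forall>n\<ge>m. r n \<sqsubseteq> b}" for m
  have uU: "u \<in> U m" for m using u r(3) by (simp add: U_def)
  have Uinf: "vinf V b b' \<in> U (max m m')" if "b \<in> U m" "b' \<in> U m'" for b b' m m'
    using that r(1) vinf_props unfolding U_def by auto
  \<comment> \<open>The finite suprema \<open>t\<close> of the tail of \<open>r\<close> satisfy \<open>y i (t j) \<le> \<Sum> y i (r n)\<close>, and their upper bounds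
      come close to them in norm.\<close>
  have tail: "\<exists>b\<in>U m. y i b \<le> e'" if e': "0 < e'" and m: "\<And>M. (\<Sum>n = m..<M. y i (r n)) \<le> e' / 2" for i m e'
  proof -
    define t where "t = rec_nat (r m) (\<lambda>j s. vsup V s (r (m + Suc j)))"
    have t0: "t 0 = r m" and tS: "t (Suc j) = vsup V (t j) (r (m + Suc j))" for j by (simp_all add: t_def)
    have tc: "t j \<in> vcarrier V" for j by (induction j) (auto simp: t0 tS r intro: vsup_closed)
    have tmono: "t j \<sqsubseteq> t (j + l)" for j l
    proof (induction l)
      case (Suc l)
      have "t (j + l) \<sqsubseteq> t (Suc (j + l))" unfolding tS using tc r by (intro vsup_ge1)
      then show ?case using Suc tc le_trans[OF tc tc tc] by simp
    qed (simp add: le_refl tc)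
    have tr: "r n \<sqsubseteq> t (n - m)" if "m \<le> n" for n
    proof (cases "n = m")
      case True then show ?thesis using t0 le_refl r by simp
    next
      case False
      then obtain j where "n - m = Suc j" "n = m + Suc j" using \<open>m \<le> n\<close> by (metis Suc_diff_Suc le_add_diff_inverse le_neq_implies_less)
      then show ?thesis using tS vsup_ge2[OF tc r(1)] by simp
    qed
    have t_nn: "\<zero> \<sqsubseteq> t j" for j using tmono[of 0 j] t0 r(1,2) tc zero_closed le_trans by (metis add_0)
    have yt: "y i (t j) \<le> (\<Sum>n = m..<m + Suc j. y i (r n))" for j
    proof (induction j)
      case 0 then show ?case by (simp add: t0)
    next
      case (Suc j)
      have "t (Suc j) \<sqsubseteq> t j \<oplus> r (m + Suc j)"
        unfolding tS using tc r t_nn le_add_nonneg[of "t j" "r (m + Suc j)"] le_add_nonneg[of "r (m + Suc j)" "t j"] add_commute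
        by (intro vsup_least add_closed) auto
      then have "y i (t (Suc j)) \<le> y i (t j) + y i (r (m + Suc j))"
        using contractive_positive_mono[OF y tc add_closed[OF tc r(1)]] linear_on_simps(1)[OF lin tc r(1)] by metis
      then show ?case using Suc by simp
    qed
    have tb: "t j \<sqsubseteq> b" if "b \<in> U m" for b j
      by (induction j) (use that r tc in \<open>auto simp: t0 tS U_def intro: vsup_least\<close>)
    have "\<exists>a\<in>range t. \<exists>b\<in>U m. \<parallel>b \<ominus> a\<parallel> < e' / 2"
    proof (rule order_continuous_gap[OF oc])
      fix a a' assume "a \<in> range t" "a' \<in> range t"
      then obtain j l where "a = t j" "a' = t l" by blast
      then show "\<exists>c\<in>range t. a \<sqsubseteq> c \<and> a' \<sqsubseteq> c" using tmono[of j l] tmono[of l j] by (metis add.commute rangeI)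
    next
      fix b b' assume "b \<in> U m" "b' \<in> U m"
      then show "\<exists>c\<in>U m. c \<sqsubseteq> b \<and> c \<sqsubseteq> b'"
        using Uinf[of b m b' m] vinf_props[of b b'] by (auto simp: U_def)
    next
      fix w assume w: "w \<in> vcarrier V" and gap: "\<And>a b. a \<in> range t \<Longrightarrow> b \<in> U m \<Longrightarrow> a \<oplus> w \<sqsubseteq> b"
      have "b \<ominus> w \<in> U m" if b: "b \<in> U m" for b
      proof -
        have bc: "b \<in> vcarrier V" using b by (simp add: U_def)
        have "r n \<sqsubseteq> b \<ominus> w" if "m \<le> n" for n
        proof -
          have "t (n - m) \<sqsubseteq> b \<ominus> w" using gap[OF _ b] le_diff_iff[OF tc w bc] by blast
          then show ?thesis using tr[OF that] le_trans[OF r(1) tc minus_closed[OF bc w]] by blast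
        qed
        then show ?thesis using bc w minus_closed by (simp add: U_def)
      qed
      then show "(\<forall>a\<in>range t. a \<oplus> w \<in> range t) \<or> (\<forall>b\<in>U m. b \<ominus> w \<in> U m)" by blast
    next
      show "U m \<noteq> {}" using uU by blast
    qed (use tc tb e' in \<open>auto simp: U_def\<close>)
    then obtain j b where jb: "b \<in> U m" "\<parallel>b \<ominus> t j\<parallel> < e' / 2" by blast
    have bc: "b \<in> vcarrier V" using jb by (simp add: U_def)
    have "y i b = y i (b \<ominus> t j) + y i (t j)" using linear_on_simps(4)[OF lin bc tc] by simp
    also have "\<dots> \<le> e' / 2 + e' / 2"
      using ynorm[OF minus_closed[OF bc tc], of i j] jb yt[of j] m[of "m + Suc j"] by linarith
    finally show ?thesis using jb by auto
  qed
  define B where "B = (\<Union>m. U m)"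
  define C where "C = {c \<in> vcarrier V. \<forall>b\<in>B. c \<sqsubseteq> b}"
  have Bc: "B \<subseteq> vcarrier V" by (auto simp: B_def U_def)
  have "\<exists>a\<in>C. \<exists>b\<in>B. \<parallel>b \<ominus> a\<parallel> < e / 2"
  proof (rule order_continuous_gap[OF oc])
    show "B \<noteq> {}" using uU by (auto simp: B_def)
    have "\<zero> \<sqsubseteq> b" if bB: "b \<in> B" for b
    proof -
      obtain m where "r m \<sqsubseteq> b" "b \<in> vcarrier V" using bB by (auto simp: B_def U_def)
      then show ?thesis using r le_trans zero_closed by blast
    qed
    then have "\<zero> \<in> C" using zero_closed by (simp add: C_def)
    then show "C \<noteq> {}" by blast
    fix a a' assume "a \<in> C" "a' \<in> C"
    then show "\<exists>c\<in>C. a \<sqsubseteq> c \<and> a' \<sqsubseteq> c"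
      using vsup_props[of a a'] Bc by (intro bexI[of _ "vsup V a a'"]) (auto simp: C_def)
  next
    fix b b' assume "b \<in> B" "b' \<in> B"
    then obtain m m' where "b \<in> U m" "b' \<in> U m'" by (auto simp: B_def)
    then show "\<exists>c\<in>B. c \<sqsubseteq> b \<and> c \<sqsubseteq> b'"
      using Uinf[of b m b' m'] vinf_props[of b b'] Bc \<open>b \<in> B\<close> \<open>b' \<in> B\<close> by (intro bexI[of _ "vinf V b b'"]) (auto simp: B_def)
  next
    fix w assume w: "w \<in> vcarrier V" and gap: "\<And>a b. a \<in> C \<Longrightarrow> b \<in> B \<Longrightarrow> a \<oplus> w \<sqsubseteq> b"
    then have "\<forall>a\<in>C. a \<oplus> w \<in> C" using add_closed unfolding C_def by blast
    then show "(\<forall>a\<in>C. a \<oplus> w \<in> C) \<or> (\<forall>b\<in>B. b \<ominus> w \<in> B)" ..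
  qed (use Bc e in \<open>auto simp: C_def\<close>)
  then obtain c b m where c: "c \<in> C" and b: "b \<in> U m" "\<parallel>b \<ominus> c\<parallel> < e / 2" by (auto simp: B_def)
  have cc: "c \<in> vcarrier V" and bc: "b \<in> vcarrier V" using c b by (auto simp: C_def U_def)
  have yc: "y n c \<le> 0" for n
  proof (rule field_le_epsilon)
    fix e' :: real assume e': "0 < e'"
    obtain N where N: "\<forall>l\<ge>N. \<forall>M. norm (\<Sum>j = l..<M. y n (r j)) < e' / 2"
      using summ[of n] e' unfolding summable_Cauchy by (meson half_gt_zero)
    have "(\<Sum>j = N..<M. y n (r j)) \<le> e' / 2" for M
      using spec[OF mp[OF spec[OF N, of N] order_refl], of M] by simp
    from tail[OF e' this] obtain b' where b': "b' \<in> U N" "y n b' \<le> e'" by blast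
    have "c \<sqsubseteq> b'" "b' \<in> vcarrier V" using c b' by (auto simp: C_def B_def U_def)
    then show "y n c \<le> 0 + e'" using contractive_positive_mono[OF y cc, of b' n] b' by simp
  qed
  have "y n (r n) \<le> e" if "m \<le> n" for n
  proof -
    have "y n (r n) \<le> y n b" using b that r by (intro contractive_positive_mono[OF y]) (auto simp: U_def)
    also have "\<dots> = y n (b \<ominus> c) + y n c" using linear_on_simps(4)[OF lin bc cc] by simp
    also have "\<dots> \<le> e / 2 + 0" using ynorm[OF minus_closed[OF bc cc], of n] b yc[of n] by linarith
    finally show ?thesis using e by simp
  qed
  then show ?thesis by blast
qed

subsection \<open>Positive functionals\<close>

text \<open>
  Positive functionals norm only up to a factor: \<open>u\<close> is the difference of its positive and negative parts,
  one of which has at least half of its norm and is normed by a functional below \<open>w \<mapsto> \<parallel>vpos w\<parallel>\<close>.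
\<close>

lemma nearly_norming_functional:
  assumes u: "u \<in> vcarrier V"
  obtains y where "contractive_positive y" "\<parallel>u\<parallel> / 2 \<le> \<bar>y u\<bar>"
proof -
  let ?q = "\<lambda>x. \<parallel>vpos x\<parallel>"
  have q: "sublinear_on V ?q"
    unfolding sublinear_on_def
  proof (intro conjI ballI allI impI)
    fix x w assume xw: "x \<in> vcarrier V" "w \<in> vcarrier V"
    have "\<parallel>vpos (x \<oplus> w)\<parallel> \<le> \<parallel>vpos x \<oplus> vpos w\<parallel>"
      using xw by (intro norm_mono_nonneg vpos_add_le vpos_nonneg vpos_closed add_closed)
    also have "\<dots> \<le> \<parallel>vpos x\<parallel> + \<parallel>vpos w\<parallel>" using xw vpos_closed norm_triangle by blast
    finally show "\<parallel>vpos (x \<oplus> w)\<parallel> \<le> \<parallel>vpos x\<parallel> + \<parallel>vpos w\<parallel>" .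
  qed (auto simp: vpos_scale norm_scale vpos_closed)
  have ex: "\<exists>y. contractive_positive y \<and> \<parallel>vpos v\<parallel> \<le> y v" if v: "v \<in> vcarrier V" for v
  proof -
    obtain y where y: "linear_on_carrier V y" "\<And>x. x \<in> vcarrier V \<Longrightarrow> y x \<le> ?q x" "\<parallel>vpos v\<parallel> \<le> y v"
      using mazur_orlicz_single[OF q v, of "\<parallel>vpos v\<parallel>"] by auto
    have "0 \<le> y w" if w: "w \<in> vcarrier V" "\<zero> \<sqsubseteq> w" for w
    proof -
      have "vpos ((- 1) \<odot> w) = \<zero>" using w by (intro vpos_of_nonpos neg_nonpos scale_closed)
      then have "y ((- 1) \<odot> w) \<le> 0" using y(2)[OF neg_closed[OF w(1)]] norm_eq_zero[OF zero_closed] by simp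
      then show ?thesis using linear_on_simps(2)[OF y(1) w(1), of "- 1"] by simp
    qed
    moreover have "y w \<le> \<parallel>w\<parallel>" if "w \<in> vcarrier V" for w using y(2)[OF that] norm_vpos_le[OF that] by simp
    ultimately show ?thesis using y unfolding contractive_positive_def by blast
  qed
  obtain y where y: "contractive_positive y" "\<parallel>vpos u\<parallel> \<le> y u" using ex[OF u] by blast
  obtain z where z: "contractive_positive z" "\<parallel>vpos ((- 1) \<odot> u)\<parallel> \<le> z ((- 1) \<odot> u)" using ex[OF neg_closed[OF u]] by blast
  have "z ((- 1) \<odot> u) = - z u" using z u linear_on_simps(2)[of z u "- 1"] unfolding contractive_positive_def by simp
  then have "\<parallel>u\<parallel> / 2 \<le> \<bar>y u\<bar> \<or> \<parallel>u\<parallel> / 2 \<le> \<bar>z u\<bar>" using norm_le_vpos_sum[OF u] y z by (auto simp: abs_if)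
  then show thesis using that y z by blast
qed

text \<open>
  A substitute for the positive part of \<open>y - z\<close>: it dominates \<open>y - z\<close> at the prescribed vector \<open>v\<close>
  and does not exceed the Riesz--Kantorovich supremum anywhere on the cone.
\<close>

lemma positive_part_functional:
  assumes y: "contractive_positive y" and z: "linear_on_carrier V z" "\<And>w. w \<in> vcarrier V \<Longrightarrow> \<zero> \<sqsubseteq> w \<Longrightarrow> 0 \<le> z w"
    and v: "v \<in> vcarrier V" "\<zero> \<sqsubseteq> v"
  obtains h where "contractive_positive h" "y v - z v \<le> h v"
    "\<And>u m. u \<in> vcarrier V \<Longrightarrow> \<zero> \<sqsubseteq> u \<Longrightarrow> m < h u \<Longrightarrow> \<exists>r\<in>vcarrier V. \<zero> \<sqsubseteq> r \<and> r \<sqsubseteq> u \<and> m < y r - z r"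
proof -
  let ?I = "\<lambda>u. {r \<in> vcarrier V. \<zero> \<sqsubseteq> r \<and> r \<sqsubseteq> u}"
  let ?f = "\<lambda>r. y r - z r"
  let ?s = "\<lambda>u. SUP r\<in>?I u. ?f r"
  have ylin: "linear_on_carrier V y" using y by (simp add: contractive_positive_def)
  have fle: "?f r \<le> \<parallel>u\<parallel>" if "u \<in> vcarrier V" "r \<in> ?I u" for r u
  proof -
    have "?f r \<le> y r" using z(2) that by simp
    also have "\<dots> \<le> \<parallel>r\<parallel>" using y that by (simp add: contractive_positive_def)
    also have "\<dots> \<le> \<parallel>u\<parallel>" using that by (intro norm_mono_nonneg) auto
    finally show ?thesis .
  qed
  have bdd: "bdd_above (?f ` ?I u)" if "u \<in> vcarrier V" for u using fle[OF that] by (intro bdd_aboveI2) auto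
  have up: "?f r \<le> ?s u" if "u \<in> vcarrier V" "r \<in> ?I u" for u r using bdd that by (intro cSUP_upper)
  have ne: "\<zero> \<in> ?I u" if "u \<in> vcarrier V" "\<zero> \<sqsubseteq> u" for u using that zero_closed le_refl by simp
  have least: "?s u \<le> m" if "u \<in> vcarrier V" "\<zero> \<sqsubseteq> u" "\<And>r. r \<in> ?I u \<Longrightarrow> ?f r \<le> m" for u m
    using ne[OF that(1,2)] that(3) by (intro cSUP_least) auto
  let ?q = "\<lambda>u. ?s (vpos u)"
  have f_add: "?f (r \<oplus> w) = ?f r + ?f w" if "r \<in> vcarrier V" "w \<in> vcarrier V" for r w
    using that linear_on_simps(1)[OF ylin] linear_on_simps(1)[OF z(1)] by simp
  have f_scale: "?f (c \<odot> r) = c * ?f r" if "r \<in> vcarrier V" for c r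
    using that linear_on_simps(2)[OF ylin] linear_on_simps(2)[OF z(1)] by (simp add: right_diff_distrib)
  have s_le: "?s (c \<odot> u) \<le> c * ?s u" if c: "0 < c" and u: "u \<in> vcarrier V" "\<zero> \<sqsubseteq> u" for c u
  proof (rule least)
    show "c \<odot> u \<in> vcarrier V" using u scale_closed by blast
    show "\<zero> \<sqsubseteq> c \<odot> u" using scale_mono[of \<zero> u c] u c zero_closed scale_zero by simp
    fix r assume r: "r \<in> ?I (c \<odot> u)"
    have "(1 / c) \<odot> \<zero> \<sqsubseteq> (1 / c) \<odot> r" "(1 / c) \<odot> r \<sqsubseteq> (1 / c) \<odot> (c \<odot> u)"
      using r c u by (auto intro!: scale_mono zero_closed scale_closed)
    then have "(1 / c) \<odot> r \<in> ?I u" using r c u scale_closed by (simp add: scale_zero scale_scale scale_one)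
    then have "?f ((1 / c) \<odot> r) \<le> ?s u" by (rule up[OF u(1)])
    then have "c * ((1 / c) * ?f r) \<le> c * ?s u" using f_scale[of r "1 / c"] r c by (intro mult_left_mono) auto
    then show "?f r \<le> c * ?s u" using c by simp
  qed
  have q: "sublinear_on V ?q"
    unfolding sublinear_on_def
  proof (intro conjI ballI allI impI)
    fix x w assume xw: "x \<in> vcarrier V" "w \<in> vcarrier V"
    show "?q (x \<oplus> w) \<le> ?q x + ?q w"
    proof (rule least)
      fix r assume r: "r \<in> ?I (vpos (x \<oplus> w))"
      have "r \<sqsubseteq> vpos x \<oplus> vpos w"
        using r xw vpos_add_le le_trans vpos_closed add_closed by (metis (mono_tags, lifting) mem_Collect_eq)
      then obtain s t where "s \<in> ?I (vpos x)" "t \<in> ?I (vpos w)" "r = s \<oplus> t"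
        using carrier_riesz_decomposition[of r "vpos x" "vpos w"] r xw vpos_closed vpos_nonneg by blast
      then show "?f r \<le> ?q x + ?q w"
        using up[of "vpos x" s] up[of "vpos w" t] f_add xw vpos_closed by fastforce
    qed (use xw vpos_closed vpos_nonneg add_closed in auto)
  next
    fix c :: real and x assume c: "0 \<le> c" and x: "x \<in> vcarrier V"
    note px = vpos_closed[OF x] vpos_nonneg[OF x]
    show "?q (c \<odot> x) = c * ?q x"
    proof (cases "c = 0")
      case True
      have "?I \<zero> = {\<zero>}" using le_refl zero_closed le_antisym by auto
      moreover have "vpos \<zero> = \<zero>" using vpos_of_nonneg zero_closed le_refl by blast
      ultimately show ?thesis using True x linear_on_simps(3)[OF ylin] linear_on_simps(3)[OF z(1)] by (simp add: zero_scale)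
    next
      case False
      then have c: "0 < c" using c by simp
      have cx: "c \<odot> vpos x \<in> vcarrier V" "\<zero> \<sqsubseteq> c \<odot> vpos x"
        using scale_mono[of \<zero> "vpos x" c] px c zero_closed scale_zero scale_closed by auto
      have "?s ((1 / c) \<odot> (c \<odot> vpos x)) \<le> (1 / c) * ?s (c \<odot> vpos x)" using c cx by (intro s_le) auto
      then have "c * ?s (vpos x) \<le> ?s (c \<odot> vpos x)" using c px by (simp add: scale_scale scale_one field_simps)
      then show ?thesis using s_le[OF c px] c x by (simp add: vpos_scale)
    qed
  qed
  have "y v - z v \<le> ?q v" using v le_refl by (simp add: vpos_of_nonneg up)
  then obtain h where h: "linear_on_carrier V h" "\<And>x. x \<in> vcarrier V \<Longrightarrow> h x \<le> ?q x" "y v - z v \<le> h v"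
    using mazur_orlicz_single[OF q v(1)] by blast
  have "0 \<le> h w" if w: "w \<in> vcarrier V" "\<zero> \<sqsubseteq> w" for w
  proof -
    have "vpos ((- 1) \<odot> w) = \<zero>" using w by (intro vpos_of_nonpos neg_nonpos scale_closed)
    moreover have "?I \<zero> = {\<zero>}" using le_refl zero_closed le_antisym by auto
    ultimately have "h ((- 1) \<odot> w) \<le> 0"
      using h(2)[OF neg_closed[OF w(1)]] linear_on_simps(3)[OF ylin] linear_on_simps(3)[OF z(1)] by simp
    then show ?thesis using linear_on_simps(2)[OF h(1) w(1), of "- 1"] by simp
  qed
  moreover have "h w \<le> \<parallel>w\<parallel>" if w: "w \<in> vcarrier V" for w
  proof -
    have "?q w \<le> \<parallel>vpos w\<parallel>" using w fle by (intro least) (auto intro: vpos_closed vpos_nonneg)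
    then show ?thesis using h(2)[OF w] norm_vpos_le[OF w] by simp
  qed
  ultimately have "contractive_positive h" using h(1) unfolding contractive_positive_def by blast
  moreover have "\<exists>r\<in>vcarrier V. \<zero> \<sqsubseteq> r \<and> r \<sqsubseteq> u \<and> m < y r - z r"
    if u: "u \<in> vcarrier V" "\<zero> \<sqsubseteq> u" "m < h u" for u m
  proof (rule ccontr)
    assume "\<not> ?thesis"
    then have "?s u \<le> m" using u by (intro least) (auto simp: not_less)
    then show False using h(2)[OF u(1)] u by (simp add: vpos_of_nonneg)
  qed
  ultimately show thesis using that h(3) by blast
qed

end

section \<open>Approximation of bidual elements\<close>

text \<open>
  Goldstine's theorem, one functional at a time. The invariant is that \<open>\<Phi>\<close> satisfies every upper
  bound that holds on the convex set \<open>A\<close>; separation in the plane shows that it survives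
  intersecting \<open>A\<close> with the slab \<open>\<bar>g y - \<Phi> g\<bar> < e\<close>.
\<close>

lemma goldstine_slab:
  fixes \<Phi> :: "('a::real_normed_vector \<Rightarrow>\<^sub>L real) \<Rightarrow>\<^sub>L real"
  assumes A: "convex A" and below: "\<And>h b. (\<And>y. y \<in> A \<Longrightarrow> blinfun_apply h y \<le> b) \<Longrightarrow> \<Phi> h \<le> b" and e: "0 < e"
    and b: "\<And>y. y \<in> A \<Longrightarrow> \<bar>blinfun_apply g y - \<Phi> g\<bar> < e \<Longrightarrow> blinfun_apply h y \<le> b"
  shows "\<Phi> h \<le> b"
proof (rule ccontr)
  assume neg: "\<not> \<Phi> h \<le> b"
  let ?C = "(\<lambda>y. (g y, h y)) ` A"
  \<comment> \<open>The image of \<open>A\<close> avoids this rectangle, but the point \<open>(\<Phi> g, \<Phi> h)\<close> would be interior to it.\<close>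
  let ?R = "{\<Phi> g - e<..<\<Phi> g + e} \<times> {b<..}"
  have "linear (\<lambda>y. (blinfun_apply g y, blinfun_apply h y))"
    by (simp add: linear_iff blinfun.add_right blinfun.scaleR_right)
  then have C: "convex ?C" using A by (rule convex_linear_image)
  have R: "convex ?R" by (intro convex_Times) simp_all
  have ne: "?R \<noteq> {}" using e by (auto intro!: exI[of _ "b + 1"] exI[of _ "\<Phi> g"])
  have "A \<noteq> {}"
  proof
    assume "A = {}"
    then have "\<Phi> 0 \<le> - 1" using below by blast
    then show False by (simp add: blinfun.zero_right)
  qed
  moreover have "?C \<inter> ?R = {}" using b by (force simp: abs_less_iff not_less)
  ultimately obtain a c where ac: "a \<noteq> 0" "\<forall>x\<in>?C. a \<bullet> x \<le> c" "\<forall>x\<in>?R. c \<le> a \<bullet> x"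
    using separating_hyperplane_sets[OF C R _ ne] by auto
  obtain \<alpha> \<beta> where a: "a = (\<alpha>, \<beta>)" by (cases a)
  let ?p = "(\<Phi> g, \<Phi> h)"
  have "\<Phi> (\<alpha> *\<^sub>R g + \<beta> *\<^sub>R h) \<le> c"
    using ac(2) by (intro below) (auto simp: a inner_Pair blinfun.add_left blinfun.scaleR_left)
  then have pc: "a \<bullet> ?p \<le> c" by (simp add: a inner_Pair blinfun.add_right blinfun.scaleR_right)
  have "open ?R" by (intro open_Times) auto
  moreover have "?p \<in> ?R" using neg e by auto
  ultimately obtain d where d: "0 < d" "ball ?p d \<subseteq> ?R" using open_contains_ball by blast
  \<comment> \<open>Moving from the interior point against the normal leaves the half plane of the rectangle.\<close>
  let ?x = "?p - (d / (2 * norm a)) *\<^sub>R a"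
  have "?x \<in> ball ?p d" using d ac(1) by (simp add: dist_norm)
  then have "c \<le> a \<bullet> ?x" using d ac(3) by blast
  also have "a \<bullet> ?x = a \<bullet> ?p - (d / (2 * norm a)) * (a \<bullet> a)" by (simp add: inner_diff_right)
  also have "\<dots> < a \<bullet> ?p" using d ac(1) by simp
  finally show False using pc by simp
qed

lemma goldstine_finite:
  fixes \<Phi> :: "('a::real_normed_vector \<Rightarrow>\<^sub>L real) \<Rightarrow>\<^sub>L real"
  assumes G: "finite G" and M: "norm \<Phi> \<le> M" "0 < M" and e: "0 < e"
  shows "\<exists>y. norm y \<le> M \<and> (\<forall>g\<in>G. \<bar>blinfun_apply g y - \<Phi> g\<bar> < e)"
proof -
  let ?A = "\<lambda>G. {y. norm y \<le> M \<and> (\<forall>g\<in>G. \<bar>blinfun_apply g y - \<Phi> g\<bar> < e)}"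
  have "convex (?A G) \<and> (\<forall>h b. (\<forall>y\<in>?A G. blinfun_apply h y \<le> b) \<longrightarrow> \<Phi> h \<le> b)"
    using G
  proof (induction G rule: finite_induct)
    case empty
    have "\<Phi> h \<le> b" if h: "\<forall>y\<in>cball 0 M. blinfun_apply h y \<le> b" for h b
    proof -
      have "norm h \<le> b / M"
      proof (rule norm_blinfun_bound)
        have "blinfun_apply h 0 \<le> b" by (rule bspec[OF h]) (use M in simp)
        then show "0 \<le> b / M" using M by (simp add: blinfun.zero_right)
        fix x
        show "norm (h x) \<le> b / M * norm x"
        proof (cases "x = 0")
          case False
          have "h ((M / norm x) *\<^sub>R x) \<le> b" "h (- ((M / norm x) *\<^sub>R x)) \<le> b" using h M False by simp_all
          then have "M / norm x * \<bar>h x\<bar> \<le> b" by (auto simp: blinfun.scaleR_right blinfun.minus_right abs_if)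
          then show ?thesis using M False by (simp add: field_simps)
        qed (simp add: blinfun.zero_right)
      qed
      then have "M * norm h \<le> b" using M by (simp add: field_simps)
      moreover have "\<Phi> h \<le> M * norm h"
        using blinfun_le_norm[of \<Phi> h] mult_right_mono[OF M(1), of "norm h"] by simp
      ultimately show ?thesis by simp
    qed
    moreover have "?A {} = cball 0 M" by auto
    ultimately show ?case by simp
  next
    case (insert g G)
    have "convex {y. \<bar>blinfun_apply g y - \<Phi> g\<bar> < e}"
    proof -
      have "{y. \<bar>blinfun_apply g y - \<Phi> g\<bar> < e} = blinfun_apply g -` {\<Phi> g - e<..<\<Phi> g + e}" by (auto simp: abs_less_iff)
      then show ?thesis
        by (simp add: convex_linear_vimage bounded_linear.linear blinfun.bounded_linear_right)
    qed
    from convex_Int[OF conjunct1[OF insert.IH] this]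
    have "convex (?A G \<inter> {y. \<bar>blinfun_apply g y - \<Phi> g\<bar> < e})" .
    moreover have "?A (insert g G) = ?A G \<inter> {y. \<bar>blinfun_apply g y - \<Phi> g\<bar> < e}" by auto
    moreover have "\<Phi> h \<le> b" if hb: "\<forall>y\<in>?A (insert g G). blinfun_apply h y \<le> b" for h b
    proof (rule goldstine_slab[of "?A G" \<Phi> e g h b])
      show "convex (?A G)" using insert.IH by blast
      show "\<Phi> h' \<le> b'" if "\<And>y. y \<in> ?A G \<Longrightarrow> blinfun_apply h' y \<le> b'" for h' b'
        using insert.IH that by blast
      show "blinfun_apply h y \<le> b" if "y \<in> ?A G" "\<bar>blinfun_apply g y - \<Phi> g\<bar> < e" for y
      proof (rule bspec[OF hb])
        show "y \<in> ?A (insert g G)" using that by blast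
      qed
    qed (rule e)
    ultimately show ?case by presburger
  qed
  from this[THEN conjunct2, THEN spec[of _ 0], THEN spec[of _ "- 1"]]
  have "(\<forall>y\<in>?A G. blinfun_apply (0 :: 'a \<Rightarrow>\<^sub>L real) y \<le> - 1) \<longrightarrow> \<Phi> 0 \<le> - 1" .
  then have "?A G \<noteq> {}" by (auto simp: blinfun.zero_right)
  then show ?thesis by blast
qed

text \<open>
  Finitely many iterated evaluations are approximated simultaneously at a tuple of bounded vectors:
  Goldstine's theorem is applied to the slices in the first argument, and then the remaining arguments are
  treated by induction.
\<close>

lemma bidual_eval_approx:
  fixes \<Phi>s :: "(('a::real_normed_vector \<Rightarrow>\<^sub>L real) \<Rightarrow>\<^sub>L real) list" and T :: "'i \<Rightarrow> 'a list \<Rightarrow> real"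
  assumes "finite I" "0 < M" "\<forall>\<Phi>\<in>set \<Phi>s. norm \<Phi> \<le> M" "\<And>i. i \<in> I \<Longrightarrow> bounded_form (length \<Phi>s) (T i)" "0 < e"
  shows "\<exists>zs. length zs = length \<Phi>s \<and> (\<forall>z\<in>set zs. norm z \<le> M) \<and>
    (\<forall>i\<in>I. \<bar>T i zs - bidual_eval \<Phi>s (T i)\<bar> < e)"
  using assms
proof (induction \<Phi>s arbitrary: T e)
  case Nil
  then show ?case by simp
next
  case (Cons \<Phi> \<Phi>s)
  define g :: "'i \<Rightarrow> 'a \<Rightarrow>\<^sub>L real" where "g i = Blinfun (\<lambda>y. bidual_eval \<Phi>s (\<lambda>ys. T i (y # ys)))" for i
  have g: "g i y = bidual_eval \<Phi>s (\<lambda>ys. T i (y # ys))" if "i \<in> I" for i y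
    unfolding g_def using bidual_eval_slice[of \<Phi>s "T i"] Cons.prems(4)[OF that] by simp
  obtain y where y: "norm y \<le> M" "\<And>i. i \<in> I \<Longrightarrow> \<bar>g i y - \<Phi> (g i)\<bar> < e / 2"
    using goldstine_finite[of "g ` I" \<Phi> M "e / 2"] Cons.prems by auto
  have "bounded_form (length \<Phi>s) (\<lambda>ys. T i (y # ys))" if "i \<in> I" for i
    using Cons.prems(4)[OF that] by (intro bounded_form_tail) simp
  then obtain zs where zs: "length zs = length \<Phi>s" "\<forall>z\<in>set zs. norm z \<le> M"
    "\<And>i. i \<in> I \<Longrightarrow> \<bar>T i (y # zs) - bidual_eval \<Phi>s (\<lambda>ys. T i (y # ys))\<bar> < e / 2"
    using Cons.IH[of "\<lambda>i ys. T i (y # ys)" "e / 2"] Cons.prems by auto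
  have "\<bar>T i (y # zs) - bidual_eval (\<Phi> # \<Phi>s) (T i)\<bar> < e" if "i \<in> I" for i
  proof -
    have "bidual_eval (\<Phi> # \<Phi>s) (T i) = \<Phi> (g i)" by (simp add: g_def)
    then show ?thesis using y(2)[OF that] zs(3)[OF that] g[OF that, of y] by linarith
  qed
  then show ?case using y(1) zs by (intro exI[of _ "y # zs"]) auto
qed

section \<open>Positive weakly compact polynomials\<close>

lemma openin_weak_topology:
  "f \<in> vdual V \<Longrightarrow> open U \<Longrightarrow> openin (weak_topology V) {x \<in> vcarrier V. f x \<in> U}"
  unfolding weak_topology_def openin_topology_generated_by_iff
  by (intro generate_topology_on.Basis) blast

lemma topspace_weak_topology: "topspace (weak_topology V) = vcarrier V"
proof
  show "topspace (weak_topology V) \<subseteq> vcarrier V" by (auto simp: weak_topology_def topology_generated_by_topspace)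
  have "(\<lambda>_. 0) \<in> vdual V" by (auto simp: vdual_def intro: exI[of _ 0])
  from openin_subset[OF openin_weak_topology[OF this open_UNIV]]
  show "vcarrier V \<subseteq> topspace (weak_topology V)" by simp
qed

context banach_lattice_carrier
begin

lemma positive_functional_form:
  fixes T :: "'e::banach_lattice list \<Rightarrow> 'a"
  assumes T: "symmetric_multilinear V k T" "\<forall>xs. nonneg_list k xs \<longrightarrow> \<zero> \<sqsubseteq> T xs"
    and h: "contractive_positive h"
  shows "multilinear_form k (\<lambda>xs. h (T xs))" "positive_form k (\<lambda>xs. h (T xs))"
proof -
  have lin: "linear_on_carrier V h" using h by (simp add: contractive_positive_def)
  have c: "T xs \<in> vcarrier V" if "length xs = k" for xs using T(1) that unfolding symmetric_multilinear_def by blast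
  show "multilinear_form k (\<lambda>xs. h (T xs))"
    unfolding multilinear_form_def
  proof (intro conjI allI impI)
    fix xs :: "'e list" and i u v assume *: "length xs = k \<and> i < k"
    then have "T (xs[i := u + v]) = T (xs[i := u]) \<oplus> T (xs[i := v])"
      using T(1) unfolding symmetric_multilinear_def by blast
    then show "h (T (xs[i := u + v])) = h (T (xs[i := u])) + h (T (xs[i := v]))"
      using linear_on_simps(1)[OF lin c c] * by simp
  next
    fix xs :: "'e list" and i b u assume *: "length xs = k \<and> i < k"
    then have "T (xs[i := b *\<^sub>R u]) = b \<odot> T (xs[i := u])"
      using T(1) unfolding symmetric_multilinear_def by blast
    then show "h (T (xs[i := b *\<^sub>R u])) = b * h (T (xs[i := u]))"
      using linear_on_simps(2)[OF lin c] * by simp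
  qed
  show "positive_form k (\<lambda>xs. h (T xs))"
    unfolding positive_form_def using T(2) c h by (simp add: contractive_positive_def)
qed

text \<open>
  By weak compactness of the image of the unit ball, one element \<open>W\<close> of the range dominates the
  evaluations of all positive functionals at given bidual elements: otherwise finitely many
  functionals would violate this near the compact set, but values of \<open>T\<close> approximating their
  evaluations are dominated by a value of \<open>P\<close>.
\<close>

lemma bidual_eval_dominated:
  fixes P :: "'e::banach_lattice \<Rightarrow> 'a" and \<Phi>s :: "(('e \<Rightarrow>\<^sub>L real) \<Rightarrow>\<^sub>L real) list"
  assumes T: "symmetric_multilinear V k T" "\<forall>xs. nonneg_list k xs \<longrightarrow> \<zero> \<sqsubseteq> T xs"
    and P: "\<And>x. P x = T (replicate k x)" and wc: "weakly_compact_poly V P" and k: "1 \<le> k" and len: "length \<Phi>s = k"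
  obtains W where "W \<in> vcarrier V"
    "\<And>h. contractive_positive h \<Longrightarrow> \<bar>bidual_eval \<Phi>s (\<lambda>xs. h (T xs))\<bar> \<le> h W"
proof -
  let ?X = "weak_topology V"
  let ?K = "?X closure_of (P ` cball 0 1)"
  let ?L = "\<lambda>h. bidual_eval \<Phi>s (\<lambda>xs. h (T xs))"
  have K: "compactin ?X ?K" and PK: "P ` cball 0 1 \<subseteq> vcarrier V"
    using wc by (auto simp: weakly_compact_poly_def relatively_weakly_compact_def)
  note opn = openin_weak_topology[of _ V] and top = topspace_weak_topology[of V]
  have PK': "P ` cball 0 1 \<subseteq> ?K" using PK top by (intro closure_of_subset) simp
  have Kc: "?K \<subseteq> vcarrier V" using closure_of_subset_topspace top by metis
  define M where "M = Max (insert 1 (norm ` set \<Phi>s))"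
  have M: "1 \<le> M" "\<forall>\<Phi>\<in>set \<Phi>s. norm \<Phi> \<le> M" unfolding M_def by (auto intro: Max_ge)
  \<comment> \<open>The sum of the absolute values of \<open>k\<close> vectors of norm at most \<open>M\<close> is \<open>real k * M\<close> times a vector of the
      unit ball; \<open>c\<close> is the resulting factor for \<open>P\<close>.\<close>
  define c where "c = (real k * M) ^ k"
  have kM: "0 < real k * M" using k M by simp
  then have c: "0 < c" by (simp add: c_def)
  have "\<exists>W\<in>?K. \<forall>h. contractive_positive h \<longrightarrow> \<bar>?L h\<bar> \<le> c * h W"
  proof (rule ccontr)
    assume "\<not> ?thesis"
    then obtain H where H: "\<And>W. W \<in> ?K \<Longrightarrow> contractive_positive (H W)" "\<And>W. W \<in> ?K \<Longrightarrow> c * H W W < \<bar>?L (H W)\<bar>"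
      by (metis not_le)
    \<comment> \<open>Half of the violation at \<open>W\<close> persists on a weak neighbourhood of \<open>W\<close>.\<close>
    define d where "d W = (\<bar>?L (H W)\<bar> - c * H W W) / 2" for W
    define O' where "O' W = {x \<in> vcarrier V. H W x \<in> {s. c * s < \<bar>?L (H W)\<bar> - d W}}" for W
    have d: "0 < d W" if "W \<in> ?K" for W using H(2)[OF that] by (simp add: d_def)
    have "openin ?X (O' W)" if "W \<in> ?K" for W
      unfolding O'_def using contractive_positive_vdual[OF H(1)[OF that]]
      by (intro opn open_Collect_less continuous_intros)
    moreover have "W \<in> O' W" if "W \<in> ?K" for W
    proof -
      have "c * H W W < \<bar>?L (H W)\<bar> - d W" using H(2)[OF that] by (simp add: d_def field_simps)
      then show ?thesis using Kc that by (auto simp: O'_def)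
    qed
    ultimately have "(\<forall>U\<in>O' ` ?K. openin ?X U) \<and> ?K \<subseteq> \<Union> (O' ` ?K)" by blast
    then obtain F where F: "finite F" "F \<subseteq> O' ` ?K" "?K \<subseteq> \<Union> F" using K unfolding compactin_def by meson
    then obtain I where I: "finite I" "I \<subseteq> ?K" "F = O' ` I" by (meson finite_subset_image)
    define e where "e = Min (insert 1 (d ` I))"
    have e: "0 < e" "\<And>W. W \<in> I \<Longrightarrow> e \<le> d W" unfolding e_def using I d by (auto simp: Min_gr_iff intro: Min_le)
    have bf: "bounded_form (length \<Phi>s) (\<lambda>xs. H W (T xs))" if "W \<in> I" for W
      using positive_functional_form[OF T H(1)] I that len by (blast intro: positive_form_bounded_form)
    obtain zs where zs: "length zs = k" "\<forall>z\<in>set zs. norm z \<le> M"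
      "\<And>W. W \<in> I \<Longrightarrow> \<bar>H W (T zs) - ?L (H W)\<bar> < e"
      using bidual_eval_approx[of I M \<Phi>s "\<lambda>W xs. H W (T xs)" e] I M e bf len by auto
    let ?s = "sum_list (map abs zs)"
    let ?w = "(1 / (real k * M)) *\<^sub>R ?s"
    have "norm ?w \<le> 1"
    proof -
      have "norm (sum_list (map abs ys)) \<le> real (length ys) * M" if "\<forall>z\<in>set ys. norm z \<le> M" for ys :: "'e list"
        using that by (induction ys) (auto simp: norm_abs algebra_simps intro: order_trans[OF norm_triangle_ineq])
      then have "norm ?s \<le> real k * M" using zs by metis
      then show ?thesis using kM by (simp add: field_simps)
    qed
    then have wK: "P ?w \<in> ?K" using PK' by auto
    then obtain W where W: "W \<in> I" "P ?w \<in> O' W" using F I by blast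
    then have WK: "W \<in> ?K" using I by blast
    note hm = positive_functional_form[OF T H(1)[OF WK]]
    have "\<bar>H W (T zs)\<bar> \<le> H W (T (map abs zs))" using positive_form_abs[OF hm zs(1)] .
    also have "\<dots> \<le> H W (T (replicate k ?s))"
      using zs(1) by (intro positive_form_le_diagonal[OF hm]) (auto intro!: le_sum_list_nonneg)
    also have "?s = (real k * M) *\<^sub>R ?w"
    proof -
      have "real k * M \<noteq> 0" using kM by linarith
      then have "(real k * M) * (1 / (real k * M)) = 1" by (metis nonzero_mult_div_cancel_left times_divide_eq_right mult.right_neutral)
      then show ?thesis by (simp only: scaleR_scaleR scaleR_one)
    qed
    finally have "\<bar>H W (T zs)\<bar> \<le> H W (T (replicate k ((real k * M) *\<^sub>R ?w)))" .
    also have "\<dots> = c * H W (P ?w)"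
      unfolding c_def P using multilinear_replicate_scale[OF hm(1)] by blast
    also have "\<dots> < \<bar>?L (H W)\<bar> - d W" using W(2) by (simp add: O'_def)
    finally have "\<bar>H W (T zs)\<bar> < \<bar>?L (H W)\<bar> - d W" .
    then show False using zs(3)[OF W(1)] e(2)[OF W(1)] by linarith
  qed
  then obtain W where W: "W \<in> ?K" "\<And>h. contractive_positive h \<Longrightarrow> \<bar>?L h\<bar> \<le> c * h W" by blast
  have "\<bar>?L h\<bar> \<le> h (c \<odot> W)" if "contractive_positive h" for h
    using W that Kc linear_on_simps(2)[of h W c] by (auto simp: contractive_positive_def)
  moreover have "c \<odot> W \<in> vcarrier V" using W Kc scale_closed by blast
  ultimately show thesis using that by blast
qed

text \<open>
  If \<open>P (x n)\<close> does not tend to zero in norm, positive functionals \<open>y n\<close> of norm at most one stay away from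
  zero on \<open>P \<bar>x n\<bar>\<close>, while each single \<open>y i\<close> tends to zero along this sequence. Along a sparse
  subsequence the functionals can therefore be replaced by substitutes \<open>h i\<close> for the positive parts of
  \<open>y i - 4\<^sup>i \<Sum>\<^sub>j\<^sub><\<^sub>i y j\<close>, which in addition tend to zero pointwise by order continuity of the norm. By weak
  compactness the polynomials \<open>h i \<circ> P\<close> tend to zero at all bidual elements, and the descent
  leads to a contradiction.
\<close>

theorem disjoint_DPP_imp_disjoint_convergent:
  fixes P :: "'e::banach_lattice \<Rightarrow> 'a"
  assumes a: "disjoint_DPP p TYPE('e)" and p: "1 \<le> p" and k: "1 \<le> k"
    and oc: "order_continuous_norm V" and pos: "positive_poly V k P" and wc: "weakly_compact_poly V P"
  shows "disjoint_convergent V p P"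
  unfolding disjoint_convergent_def
proof (intro allI impI)
  fix x :: "nat \<Rightarrow> 'e" assume x: "disjoint_seq x \<and> weakly_summable p x"
  obtain T where T: "symmetric_multilinear V k T" "\<forall>xs. nonneg_list k xs \<longrightarrow> \<zero> \<sqsubseteq> T xs" and P: "\<And>x. P x = T (replicate k x)"
    using pos unfolding positive_poly_def associated_operator_def by blast
  have Pc: "P z \<in> vcarrier V" for z using T(1) P unfolding symmetric_multilinear_def by simp
  note form = positive_functional_form[OF T]
  have bform: "bounded_form k (\<lambda>xs. h (T xs))" if "contractive_positive h" for h
    using form[OF that] by (rule positive_form_bounded_form)
  have Ppos: "\<zero> \<sqsubseteq> P z" if "0 \<le> z" for z using spec[OF T(2), of "replicate k z"] P that by simp
  show "(\<lambda>n. \<parallel>P (x n)\<parallel>) \<longlonglongrightarrow> 0"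
  proof (rule ccontr)
    assume "\<not> ?thesis"
    then obtain \<delta> \<sigma> s where s: "0 < \<delta>" "\<sigma> \<in> {1, - 1}" "strict_mono s" "\<And>n::nat. \<delta> \<le> \<sigma> * \<parallel>P (x (s n))\<parallel>"
      by (rule not_null_subsequence) (rule that)
    define X where "X n = \<bar>x (s n)\<bar>" for n
    have d: "disjoint_seq (\<lambda>n. x (s n))" using disjoint_seq_subseq x s(3) by blast
    have X: "disjoint_seq X" "weakly_summable p X"
    proof -
      show "disjoint_seq X" using d by (simp add: disjoint_seq_def X_def)
      show "weakly_summable p X"
        unfolding X_def using weakly_summable_abs[OF d weakly_summable_subseq[OF conjunct2[OF x] s(3)]] p by simp
    qed
    have "\<exists>y. contractive_positive y \<and> \<delta> / 2 \<le> y (P (X n))" for n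
    proof -
      obtain y where y: "contractive_positive y" "\<parallel>P (x (s n))\<parallel> / 2 \<le> \<bar>y (P (x (s n)))\<bar>"
        using nearly_norming_functional[OF Pc] by blast
      have "\<bar>y (P (x (s n)))\<bar> \<le> y (P (X n))"
        using positive_form_abs[OF form[OF y(1)], of "replicate k (x (s n))"] by (simp add: P X_def)
      moreover have "\<delta> \<le> \<parallel>P (x (s n))\<parallel>" using s(2) s(4)[of n] norm_nonneg[OF Pc, of "x (s n)"] s(1) by auto
      ultimately have "\<delta> / 2 \<le> y (P (X n))" using y(2) by linarith
      then show ?thesis using y(1) by blast
    qed
    then obtain y where y: "\<And>n. contractive_positive (y n)" "\<And>n. \<delta> / 2 \<le> y n (P (X n))" by metis
    have ynull: "(\<lambda>n. y i (P (X n))) \<longlonglongrightarrow> 0" for i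
      using bounded_form_null[OF a X _ k bform[OF y(1)], of i] p by (simp add: P)
    have ynn: "0 \<le> y i (P (X n))" for i n
      using y(1)[of i] Pc Ppos[of "X n"] by (auto simp: contractive_positive_def X_def)
    \<comment> \<open>The bound is chosen so that the \<open>Suc n\<close> earlier functionals together, multiplied by the weight
        \<open>4 ^ Suc n\<close>, still contribute at most \<open>\<delta> / 4\<close>.\<close>
    define R where "R n n' \<longleftrightarrow> n < n' \<and> (\<forall>j\<in>{..n}. y j (P (X n')) \<le> \<delta> / (4 * 4 ^ Suc n * real (Suc n)))" for n n'
    have "\<exists>n'. R n n'" for n
    proof -
      have "\<forall>\<^sub>F m in sequentially. \<forall>j\<in>{..n}. y j (P (X m)) \<le> \<delta> / (4 * 4 ^ Suc n * real (Suc n))"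
      proof (intro eventually_ball_finite ballI)
        fix j
        have "0 < \<delta> / (4 * 4 ^ Suc n * real (Suc n))" using s(1) by simp
        from order_tendstoD(2)[OF ynull[of j] this]
        show "\<forall>\<^sub>F m in sequentially. y j (P (X m)) \<le> \<delta> / (4 * 4 ^ Suc n * real (Suc n))"
          by eventually_elim simp
      qed simp
      then have "\<forall>\<^sub>F m in sequentially. R n m"
        using eventually_gt_at_top[of n] unfolding R_def by eventually_elim blast
      then show ?thesis using eventually_happens by fastforce
    qed
    then obtain t where t: "\<And>i. R (t i) (t (Suc i))"
      using dependent_nat_choice[of "\<lambda>_ _. True" "\<lambda>_. R"] by auto
    have tm: "strict_mono t" using t unfolding R_def by (intro strict_monoI_Suc) simp
    \<comment> \<open>The weights make \<open>\<Sum>\<^sub>i y (t j) (r i)\<close> converge whenever \<open>y (t i) - z i\<close> is almost nonnegative at the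
        order bounded \<open>r i\<close>.\<close>
    define z where "z i w = 4 ^ i * (\<Sum>j<i. y (t j) w)" for i w
    have zsmall: "z i (P (X (t i))) \<le> \<delta> / 4" for i
    proof (cases i)
      case 0
      then show ?thesis using s(1) by (simp add: z_def)
    next
      case (Suc i')
      have "y (t j) (P (X (t i))) \<le> \<delta> / (4 * 4 ^ i * real i)" if "j < i" for j
      proof -
        have "y (t j) (P (X (t i))) \<le> \<delta> / (4 * 4 ^ Suc (t i') * real (Suc (t i')))"
          using t[of i'] Suc that tm unfolding R_def by (simp add: strict_mono_less_eq)
        also have "\<dots> \<le> \<delta> / (4 * 4 ^ i * real i)"
        proof -
          have "i \<le> Suc (t i')" using Suc strict_mono_imp_increasing[OF tm, of i'] by simp
          then have "4 * 4 ^ i * real i \<le> 4 * 4 ^ Suc (t i') * real (Suc (t i'))"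
            by (intro mult_mono power_increasing) auto
          then show ?thesis using s(1) Suc by (intro divide_left_mono) auto
        qed
        finally show ?thesis .
      qed
      then have "(\<Sum>j<i. y (t j) (P (X (t i)))) \<le> (\<Sum>j<i. \<delta> / (4 * 4 ^ i * real i))" by (intro sum_mono) simp
      also have "\<dots> = \<delta> / (4 * 4 ^ i)" using Suc by simp
      finally show ?thesis unfolding z_def using mult_left_mono[of _ _ "4 ^ i :: real"] by (fastforce simp: field_simps)
    qed
    have ylin: "linear_on_carrier V (y i)" for i using y(1) by (simp add: contractive_positive_def)
    have zlin: "linear_on_carrier V (z i)" for i
      using linear_on_simps(1,2)[OF ylin]
      unfolding linear_on_carrier_def z_def by (simp add: sum.distrib sum_distrib_left algebra_simps)
    have znn: "0 \<le> z i w" if "w \<in> vcarrier V" "\<zero> \<sqsubseteq> w" for i w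
      unfolding z_def using y(1) that by (intro mult_nonneg_nonneg sum_nonneg) (auto simp: contractive_positive_def)
    have "\<exists>h. contractive_positive h \<and> y (t i) (P (X (t i))) - z i (P (X (t i))) \<le> h (P (X (t i))) \<and>
      (\<forall>u m. u \<in> vcarrier V \<and> \<zero> \<sqsubseteq> u \<and> m < h u \<longrightarrow>
        (\<exists>r\<in>vcarrier V. \<zero> \<sqsubseteq> r \<and> r \<sqsubseteq> u \<and> m < y (t i) r - z i r))" for i
      using positive_part_functional[OF y(1)[of "t i"] zlin[of i] znn Pc Ppos[of "X (t i)"]]
      by (metis X_def abs_ge_zero)
    then obtain h where h: "\<And>i. contractive_positive (h i)"
      "\<And>i. y (t i) (P (X (t i))) - z i (P (X (t i))) \<le> h i (P (X (t i)))"
      "\<And>i u m. u \<in> vcarrier V \<Longrightarrow> \<zero> \<sqsubseteq> u \<Longrightarrow> m < h i u \<Longrightarrow>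
        \<exists>r\<in>vcarrier V. \<zero> \<sqsubseteq> r \<and> r \<sqsubseteq> u \<and> m < y (t i) r - z i r" by metis
    have hbig: "\<delta> / 4 \<le> h i (P (X (t i)))" for i using h(2)[of i] y(2)[of "t i"] zsmall[of i] by linarith
    \<comment> \<open>If \<open>h i u\<close> nearly equals \<open>y (t i) r - z i r\<close> at \<open>r = r i\<close>, then \<open>z i (r i)\<close> is bounded since \<open>h i u \<ge> 0\<close>,
        so the earlier functionals decay geometrically along \<open>r\<close>.\<close>
    have hnull: "(\<lambda>i. h i u) \<longlonglongrightarrow> 0" if u: "u \<in> vcarrier V" "\<zero> \<sqsubseteq> u" for u
    proof (rule tendstoI)
      fix e :: real assume e: "0 < e"
      have hnn: "0 \<le> h i u" for i using h(1) u by (simp add: contractive_positive_def)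
      have "\<exists>r\<in>vcarrier V. \<zero> \<sqsubseteq> r \<and> r \<sqsubseteq> u \<and> h i u - inverse (real (Suc i)) < y (t i) r - z i r" for i
        by (rule h(3)[OF u]) simp
      then obtain r where r: "\<And>i. r i \<in> vcarrier V" "\<And>i. \<zero> \<sqsubseteq> r i" "\<And>i. r i \<sqsubseteq> u"
        "\<And>i. h i u - inverse (real (Suc i)) < y (t i) (r i) - z i (r i)" by metis
      have yr: "y j (r i) \<le> \<parallel>u\<parallel>" "0 \<le> y j (r i)" for i j
      proof -
        have "y j (r i) \<le> \<parallel>r i\<parallel>" using y(1) r(1) by (simp add: contractive_positive_def)
        also have "\<dots> \<le> \<parallel>u\<parallel>" using r u by (intro norm_mono_nonneg)
        finally show "y j (r i) \<le> \<parallel>u\<parallel>" .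
        show "0 \<le> y j (r i)" using y(1) r by (simp add: contractive_positive_def)
      qed
      have "y (t j) (r i) \<le> (\<parallel>u\<parallel> + 1) * (1 / 4) ^ i" if ji: "j < i" for i j
      proof -
        have "inverse (real (Suc i)) \<le> 1" by (simp add: field_simps)
        then have "z i (r i) \<le> \<parallel>u\<parallel> + 1" using r(4)[of i] hnn[of i] yr(1)[of "t i" i] by linarith
        moreover have "y (t j) (r i) \<le> (\<Sum>l<i. y (t l) (r i))"
          using ji yr(2) by (intro member_le_sum) auto
        ultimately have "4 ^ i * y (t j) (r i) \<le> \<parallel>u\<parallel> + 1"
          unfolding z_def by (meson mult_left_mono order_trans zero_le_numeral zero_le_power)
        then show ?thesis by (simp add: field_simps power_one_over)
      qed
      then have "summable (\<lambda>i. y (t j) (r i))" for j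
        using yr(2)
        by (intro summable_comparison_test'[OF summable_mult[OF summable_geometric[of "1 / 4 :: real"]],
              where N = "Suc j" and c1 = "\<parallel>u\<parallel> + 1"]) auto
      then obtain N where N: "\<forall>n\<ge>N. y (t n) (r n) \<le> e / 3"
        using order_bounded_diagonal_null[OF oc, of "\<lambda>i. y (t i)" u r "e / 3"] y(1) u r e by auto
      have inv: "\<forall>\<^sub>F i in sequentially. inverse (real (Suc i)) < e / 3"
        using order_tendstoD(2)[OF LIMSEQ_inverse_real_of_nat, of "e / 3"] e by simp
      show "\<forall>\<^sub>F i in sequentially. dist (h i u) 0 < e"
        using inv eventually_ge_at_top[of N]
      proof eventually_elim
        case (elim i)
        have "h i u < y (t i) (r i) - z i (r i) + inverse (real (Suc i))" using r(4)[of i] by simp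
        also have "\<dots> < e / 3 + e / 3" using N elim znn[OF r(1,2), of i i] by force
        finally show ?case using hnn[of i] e by simp
      qed
    qed
    have "(\<lambda>i. h i (T (replicate (0 + k) (X (t i))))) \<longlonglongrightarrow> 0"
    proof (rule bidual_descent[OF a])
      show "disjoint_seq (\<lambda>i. X (t i))" by (rule disjoint_seq_subseq[OF X(1) tm])
      show "weakly_summable p (\<lambda>i. X (t i))" by (rule weakly_summable_subseq[OF X(2) tm])
      show "bounded_form (0 + k) (\<lambda>xs. h i (T xs))" for i using bform[OF h(1)] by simp
      fix \<Phi>s :: "(('e \<Rightarrow>\<^sub>L real) \<Rightarrow>\<^sub>L real) list" assume len: "length \<Phi>s = k"
      obtain W where W: "W \<in> vcarrier V" "\<And>h. contractive_positive h \<Longrightarrow> \<bar>bidual_eval \<Phi>s (\<lambda>xs. h (T xs))\<bar> \<le> h W"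
        using bidual_eval_dominated[OF T P wc k len] by blast
      have "\<bar>bidual_eval \<Phi>s (\<lambda>xs. h i (T xs))\<bar> \<le> h i (vpos W)" for i
        using W(2)[OF h(1), of i] contractive_positive_mono[OF h(1) W(1) vpos_closed[OF W(1)] vpos_ge[OF W(1)], of i] by simp
      then have "\<forall>\<^sub>F i in sequentially. norm (bidual_eval \<Phi>s (\<lambda>xs. h i (T xs))) \<le> h i (vpos W)" by simp
      from Lim_null_comparison[OF this hnull[OF vpos_closed[OF W(1)] vpos_nonneg[OF W(1)]]]
      have "(\<lambda>i. bidual_eval \<Phi>s (\<lambda>xs. h i (T xs))) \<longlonglongrightarrow> 0" .
      then show "(\<lambda>i. bidual_eval \<Phi>s (\<lambda>ys. h i (T (replicate 0 (X (t i)) @ ys)))) \<longlonglongrightarrow> 0" by simp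
    qed
    then have "(\<lambda>i. h i (P (X (t i)))) \<longlonglongrightarrow> 0" by (simp add: P)
    then have "\<delta> / 4 \<le> 0" using hbig by (intro tendsto_lowerbound[of _ 0 sequentially]) auto
    then show False using s(1) by simp
  qed
qed

end

section \<open>Powers of functionals\<close>

definition power_form :: "('a \<Rightarrow> real) \<Rightarrow> 'a list \<Rightarrow> real" where
  "power_form h xs = prod_list (map h xs)"

lemma power_form_simps [simp]: "power_form h [] = 1" "power_form h (x # xs) = h x * power_form h xs"
  by (simp_all add: power_form_def)

lemma power_form_replicate [simp]: "power_form h (replicate k x) = h x ^ k"
  by (induction k) simp_all

lemma multilinear_power_form: "linear h \<Longrightarrow> multilinear_form k (power_form h)"
proof (induction k)
  case 0
  then show ?case by (simp add: multilinear_form_def)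
next
  case (Suc k)
  show ?case
  proof (rule multilinear_SucI)
    fix x
    show "multilinear_form k (\<lambda>ys. power_form h (x # ys))"
      using multilinear_combine[OF Suc.IH[OF Suc.prems] Suc.IH[OF Suc.prems], of "h x" 0] by simp
  qed (use Suc.prems in \<open>simp_all add: linear_add linear_scale algebra_simps\<close>)
qed

lemma symmetric_power_form: "symmetric_form k (power_form h)"
  unfolding symmetric_form_def
proof (intro allI impI)
  fix xs ys :: "'a list" assume "length xs = k \<and> mset xs = mset ys"
  then have "mset (map h xs) = mset (map h ys)" by simp
  then have "prod_mset (mset (map h xs)) = prod_mset (mset (map h ys))" by (rule arg_cong)
  then show "power_form h xs = power_form h ys" unfolding power_form_def by (simp only: prod_mset_prod_list)
qed

lemma power_form_nonneg: "(\<And>x. x \<in> set xs \<Longrightarrow> 0 \<le> h x) \<Longrightarrow> 0 \<le> power_form h xs"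
  by (induction xs) simp_all

lemma power_form_zero: "x \<in> set xs \<Longrightarrow> h x = 0 \<Longrightarrow> power_form h xs = 0"
  by (induction xs) auto

lemma power_form_le:
  "(\<And>x. x \<in> set xs \<Longrightarrow> 0 \<le> h x \<and> h x \<le> e) \<Longrightarrow> 0 \<le> e \<Longrightarrow> power_form h xs \<le> e ^ length xs"
proof (induction xs)
  case (Cons x xs)
  then have "power_form h xs \<le> e ^ length xs" "0 \<le> power_form h xs" by (auto intro: power_form_nonneg)
  then show ?case using Cons.prems by (auto intro: mult_mono)
qed simp

lemma associated_power_form:
  "associated_operator real_vlattice k (\<lambda>z. blinfun_apply g z ^ k) (power_form (blinfun_apply g))"
  by (simp add: associated_operator_real symmetric_power_form multilinear_power_form
      bounded_linear.linear blinfun.bounded_linear_right)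

text \<open>
  The localised functionals obtained when the disjoint Dunford-Pettis property fails.
\<close>

locale localised_sequence =
  fixes f g :: "nat \<Rightarrow> 'e::banach_lattice \<Rightarrow>\<^sub>L real" and X :: "nat \<Rightarrow> 'e"
  assumes null: "weakly_null f" and disj: "\<And>m n. m \<noteq> n \<Longrightarrow> inf (X m) (X n) = 0"
    and loc: "\<And>n. localised (X n) (f n) (g n)"
begin

lemma X_nonneg: "0 \<le> X n"
  using disj[of n "Suc n"] by (metis inf_le1 n_not_Suc_n)

lemmas g_nonneg = localised_nonneg[OF X_nonneg loc]
lemmas g_abs_le = localised_abs_le[OF X_nonneg loc]

lemma no_l1_subsequence:
  fixes s :: "nat \<Rightarrow> nat"
  assumes "strict_mono s" "0 < \<delta>"
    and "\<And>N a. (\<And>i. 0 \<le> a i) \<Longrightarrow> \<delta> * (\<Sum>i<N. a i) \<le> norm (\<Sum>i<N. a i *\<^sub>R g (s i))"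
  shows False
proof (rule localised_not_l1[of "\<lambda>i. f (s i)" "\<lambda>i. X (s i)" "\<lambda>i. g (s i)" \<delta>])
  show "weakly_null (\<lambda>i. f (s i))" using null assms(1) by (rule weakly_null_subseq)
  show "inf (X (s m)) (X (s n)) = 0" if "m \<noteq> n" for m n using disj that assms(1) by (metis strict_mono_eq)
qed (use assms loc in auto)

lemma bounded: obtains C where "0 < C" "\<And>n. norm (g n) \<le> C"
  using localised_bounded[OF null disj loc] by blast

text \<open>
  Coefficient sequences of elements of the bidual tend to zero, the bidual being represented by the
  inequalities that Helly's theorem would use.
\<close>

definition coefficients :: "(nat \<Rightarrow> real) set" where
  "coefficients = {c. \<forall>(N :: nat) a t. \<bar>\<Sum>i<N. a i * c (t i)\<bar> \<le> norm (\<Sum>i<N. a i *\<^sub>R g (t i))}"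

lemma coefficients_null:
  assumes c: "c \<in> coefficients" shows "c \<longlonglongrightarrow> 0"
proof (rule ccontr)
  assume "\<not> ?thesis"
  then obtain \<delta> \<sigma> s where s: "0 < \<delta>" "\<sigma> \<in> {1, - 1}" "strict_mono s" "\<And>n::nat. \<delta> \<le> \<sigma> * c (s n)"
    by (rule not_null_subsequence) (rule that)
  show False
  proof (rule no_l1_subsequence[OF s(3,1)])
    fix N and a :: "nat \<Rightarrow> real" assume a: "\<And>i. 0 \<le> a i"
    have "\<delta> * (\<Sum>i<N. a i) \<le> (\<Sum>i<N. a i * (\<sigma> * c (s i)))"
      using s(4) a unfolding sum_distrib_left by (intro sum_mono) (metis mult.commute mult_left_mono)
    also have "\<dots> = \<sigma> * (\<Sum>i<N. a i * c (s i))" by (simp add: sum_distrib_left mult_ac)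
    also have "\<dots> \<le> \<bar>\<Sum>i<N. a i * c (s i)\<bar>" using s(2) by auto
    also have "\<dots> \<le> norm (\<Sum>i<N. a i *\<^sub>R g (s i))" using c by (simp add: coefficients_def)
    finally show "\<delta> * (\<Sum>i<N. a i) \<le> norm (\<Sum>i<N. a i *\<^sub>R g (s i))" .
  qed
qed

lemma coefficients_unit_ball:
  assumes "norm z \<le> 1" shows "(\<lambda>n. g n z) \<in> coefficients"
  unfolding coefficients_def
proof (intro CollectI allI)
  fix N and a :: "nat \<Rightarrow> real" and t :: "nat \<Rightarrow> nat"
  let ?h = "\<Sum>i<N. a i *\<^sub>R g (t i)"
  have "(\<Sum>i<N. a i * g (t i) z) = ?h z" by (simp add: blinfun.sum_left blinfun.scaleR_left)
  moreover have "\<bar>?h z\<bar> \<le> norm ?h"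
    using norm_blinfun[of ?h z] mult_left_le[OF assms norm_ge_zero[of ?h]] by simp
  ultimately show "\<bar>\<Sum>i<N. a i * g (t i) z\<bar> \<le> norm ?h" by simp
qed

lemma g_null: "(\<lambda>n. g n z) \<longlonglongrightarrow> 0"
proof (cases "z = 0")
  case False
  have "(\<lambda>n. g n ((1 / norm z) *\<^sub>R z)) \<longlonglongrightarrow> 0" by (intro coefficients_null coefficients_unit_ball) simp
  then have "(\<lambda>n. norm z * g n ((1 / norm z) *\<^sub>R z)) \<longlonglongrightarrow> norm z * 0" by (intro tendsto_intros)
  then show ?thesis using False by (simp add: blinfun.scaleR_right)
qed (simp add: blinfun.zero_right)

text \<open>
  Powers of the localised functionals inherit the absence of \<open>\<ell>\<^sub>1\<close>-behaviour, since for positive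
  polynomials the regular norm is the sup norm and
  \<open>\<Sum>a\<^sub>i (g\<^sub>i z)\<^sup>k \<le> C\<^sup>k\<^sup>-\<^sup>1 \<Sum>a\<^sub>i g\<^sub>i \<bar>z\<bar>\<close> on the unit ball.
\<close>

lemma power_sum_norm_le:
  fixes a :: "nat \<Rightarrow> real" and s :: "nat \<Rightarrow> nat" and N :: nat
  assumes k: "1 \<le> k" and a: "\<And>i. 0 \<le> a i" and C: "0 < C" "\<And>n. norm (g n) \<le> C"
  defines "Q \<equiv> \<lambda>z. \<Sum>i<N. a i * g (s i) z ^ k"
  shows "positive_poly real_vlattice k Q"
    and "vnorm (regular_poly_space real_vlattice k) Q \<le> C ^ (k - 1) * norm (\<Sum>i<N. a i *\<^sub>R g (s i))"
proof -
  have assoc: "associated_operator real_vlattice k Q (\<lambda>xs. \<Sum>i<N. a i * power_form (g (s i)) xs)"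
    unfolding Q_def
  proof (induction N)
    case 0
    then show ?case by (simp add: associated_zero)
  next
    case (Suc N)
    from associated_combine[OF Suc associated_power_form[of k "g (s N)"], of 1 "a N"] show ?case by simp
  qed
  show pos: "positive_poly real_vlattice k Q"
    unfolding positive_poly_iff[OF assoc] positive_form_def
  proof (intro allI impI sum_nonneg mult_nonneg_nonneg a power_form_nonneg)
    show "0 \<le> g (s i) x" if "nonneg_list k xs" "x \<in> set xs" for xs x i using that by (intro g_nonneg) auto
  qed
  let ?h = "\<Sum>i<N. a i *\<^sub>R g (s i)"
  have "\<bar>Q z\<bar> \<le> C ^ (k - 1) * norm ?h" if z: "norm z \<le> 1" for z
  proof -
    have gz: "0 \<le> g i \<bar>z\<bar>" "g i \<bar>z\<bar> \<le> C" for i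
    proof -
      show "0 \<le> g i \<bar>z\<bar>" by (rule g_nonneg) simp
      have "g i \<bar>z\<bar> \<le> norm (g i) * norm \<bar>z\<bar>" by (rule blinfun_le_norm)
      also have "\<dots> \<le> norm (g i)" using mult_left_le[OF z norm_ge_zero[of "g i"]] by (simp add: norm_abs)
      finally show "g i \<bar>z\<bar> \<le> C" using C(2)[of i] by simp
    qed
    have "\<bar>Q z\<bar> \<le> (\<Sum>i<N. a i * \<bar>g (s i) z\<bar> ^ k)"
      unfolding Q_def using a by (intro order_trans[OF sum_abs] sum_mono) (simp add: abs_mult power_abs)
    also have "\<dots> \<le> (\<Sum>i<N. a i * (C ^ (k - 1) * g (s i) \<bar>z\<bar>))"
    proof (intro sum_mono mult_left_mono a)
      fix i
      have "\<bar>g (s i) z\<bar> ^ k \<le> g (s i) \<bar>z\<bar> ^ k" using g_abs_le by (intro power_mono) auto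
      also have "\<dots> = g (s i) \<bar>z\<bar> ^ (k - 1) * g (s i) \<bar>z\<bar>" using k by (metis One_nat_def Suc_le_lessD power_minus_mult)
      also have "\<dots> \<le> C ^ (k - 1) * g (s i) \<bar>z\<bar>" using gz by (intro mult_right_mono power_mono) auto
      finally show "\<bar>g (s i) z\<bar> ^ k \<le> C ^ (k - 1) * g (s i) \<bar>z\<bar>" .
    qed
    also have "\<dots> = C ^ (k - 1) * ?h \<bar>z\<bar>"
      by (simp add: blinfun.sum_left blinfun.scaleR_left sum_distrib_left mult_ac)
    also have "?h \<bar>z\<bar> \<le> norm ?h"
      using blinfun_le_norm[of ?h "\<bar>z\<bar>"] mult_left_le[OF z norm_ge_zero[of ?h]] by (simp add: norm_abs)
    finally show ?thesis using C(1) by (simp add: mult_left_mono)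
  qed
  then have "poly_norm real_vlattice Q \<le> C ^ (k - 1) * norm ?h"
    unfolding poly_norm_def by (intro cSUP_least) auto
  then show "vnorm (regular_poly_space real_vlattice k) Q \<le> C ^ (k - 1) * norm ?h"
    using poly_abs_positive[OF pos] by simp
qed

lemma powers_positive: "vpositive_seq (regular_poly_space real_vlattice k) (\<lambda>n z. g n z ^ k)"
  unfolding vpositive_seq_def
proof (intro allI)
  fix n
  have pos: "positive_poly real_vlattice k (\<lambda>z. g n z ^ k)"
    unfolding positive_poly_iff[OF associated_power_form] positive_form_def
    using g_nonneg by (auto intro!: power_form_nonneg)
  then show "(\<lambda>z. g n z ^ k) \<in> vcarrier (regular_poly_space real_vlattice k) \<and>
      \<zero>\<^bsub>regular_poly_space real_vlattice k\<^esub> \<sqsubseteq>\<^bsub>regular_poly_space real_vlattice k\<^esub> (\<lambda>z. g n z ^ k)"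
    by (simp add: positive_imp_regular poly_le_def)
qed

lemma powers_weakly_null:
  assumes k: "1 \<le> k" shows "vweakly_null (regular_poly_space real_vlattice k) (\<lambda>n z. g n z ^ k)"
  unfolding vweakly_null_def
proof (intro conjI allI ballI)
  let ?V = "regular_poly_space real_vlattice k :: ('e \<Rightarrow> real) vlattice"
  have reg: "(\<lambda>z. g n z ^ k) \<in> regular_polys real_vlattice k" for n
    using powers_positive[of k] by (simp add: vpositive_seq_def)
  then show "(\<lambda>z. g n z ^ k) \<in> vcarrier ?V" for n by simp
  fix \<Psi> assume Psi: "\<Psi> \<in> vdual ?V"
  then obtain B where B: "\<And>Q. Q \<in> regular_polys real_vlattice k \<Longrightarrow> \<bar>\<Psi> Q\<bar> \<le> B * vnorm ?V Q"
  proof -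
    have "\<exists>B. \<forall>Q\<in>vcarrier ?V. \<bar>\<Psi> Q\<bar> \<le> B * vnorm ?V Q" using Psi unfolding vdual_def by blast
    then obtain B where "\<forall>Q\<in>vcarrier ?V. \<bar>\<Psi> Q\<bar> \<le> B * vnorm ?V Q" ..
    then show ?thesis by (intro that[of B]) auto
  qed
  have add: "\<Psi> (\<lambda>z. Q z + R z) = \<Psi> Q + \<Psi> R"
    if "Q \<in> regular_polys real_vlattice k" "R \<in> regular_polys real_vlattice k" for Q R
    using Psi that by (auto simp: vdual_def)
  have scl: "\<Psi> (\<lambda>z. c * Q z) = c * \<Psi> Q" if "Q \<in> regular_polys real_vlattice k" for c Q
    using Psi that by (auto simp: vdual_def)
  obtain C where C: "0 < C" "\<And>n. norm (g n) \<le> C" by (rule bounded) (rule that)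
  show "(\<lambda>n. \<Psi> (\<lambda>z. g n z ^ k)) \<longlonglongrightarrow> 0"
  proof (rule ccontr)
    assume "\<not> ?thesis"
    then obtain \<delta> \<sigma> s where s: "0 < \<delta>" "\<sigma> \<in> {1, - 1}" "strict_mono s" "\<And>n::nat. \<delta> \<le> \<sigma> * \<Psi> (\<lambda>z. g (s n) z ^ k)"
      by (rule not_null_subsequence) (rule that)
    define B' where "B' = max B 1"
    have B': "0 < B'" "B \<le> B'" by (auto simp: B'_def)
    have pos: "0 < B' * C ^ (k - 1)" using B' C by simp
    show False
    proof (rule no_l1_subsequence[OF s(3), of "\<delta> / (B' * C ^ (k - 1))"])
      show "0 < \<delta> / (B' * C ^ (k - 1))" using pos s(1) by simp
      fix N and a :: "nat \<Rightarrow> real" assume a: "\<And>i. 0 \<le> a i"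
      let ?Q = "\<lambda>N z. \<Sum>i<N. a i * g (s i) z ^ k"
      have posQ: "positive_poly real_vlattice k (?Q N)" for N by (rule power_sum_norm_le(1)[OF k a C])
      then have regQ: "?Q N \<in> regular_polys real_vlattice k" for N by (rule positive_imp_regular)
      have regS: "(\<lambda>z. c * g (s i) z ^ k) \<in> regular_polys real_vlattice k" for c i
        using regular_combine[OF reg reg, of c "s i" 0 "s i"] by simp
      have "\<Psi> (?Q N) = (\<Sum>i<N. a i * \<Psi> (\<lambda>z. g (s i) z ^ k))"
      proof (induction N)
        case 0
        then show ?case using scl[OF regQ, of 0 0] by simp
      next
        case (Suc N)
        have "\<Psi> (?Q (Suc N)) = \<Psi> (\<lambda>z. ?Q N z + a N * g (s N) z ^ k)" by simp
        also have "\<dots> = \<Psi> (?Q N) + \<Psi> (\<lambda>z. a N * g (s N) z ^ k)" by (rule add[OF regQ regS])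
        also have "\<Psi> (\<lambda>z. a N * g (s N) z ^ k) = a N * \<Psi> (\<lambda>z. g (s N) z ^ k)" by (rule scl[OF reg])
        finally show ?case using Suc by simp
      qed
      then have "\<sigma> * \<Psi> (?Q N) = (\<Sum>i<N. a i * (\<sigma> * \<Psi> (\<lambda>z. g (s i) z ^ k)))"
        by (simp add: sum_distrib_left mult_ac)
      moreover have "\<delta> * (\<Sum>i<N. a i) \<le> \<dots>"
        using s(4) a unfolding sum_distrib_left by (intro sum_mono) (metis mult.commute mult_left_mono)
      moreover have "\<sigma> * \<Psi> (?Q N) \<le> \<bar>\<Psi> (?Q N)\<bar>" using s(2) by auto
      moreover have "\<bar>\<Psi> (?Q N)\<bar> \<le> B' * (C ^ (k - 1) * norm (\<Sum>i<N. a i *\<^sub>R g (s i)))"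
      proof -
        have nn: "0 \<le> vnorm ?V (?Q N)"
        proof -
          obtain S where S: "associated_operator real_vlattice k (?Q N) S" "positive_form k S"
            using posQ[of N] unfolding positive_poly_real by blast
          have "0 \<le> poly_norm real_vlattice (?Q N)" using poly_norm_upper[OF S, of 0] abs_ge_zero order_trans by auto
          then show ?thesis using poly_abs_positive[OF posQ] by simp
        qed
        have "\<bar>\<Psi> (?Q N)\<bar> \<le> B * vnorm ?V (?Q N)" by (rule B[OF regQ])
        also have "\<dots> \<le> B' * vnorm ?V (?Q N)" using B'(2) nn by (rule mult_right_mono)
        also have "\<dots> \<le> B' * (C ^ (k - 1) * norm (\<Sum>i<N. a i *\<^sub>R g (s i)))"
          using B' by (intro mult_left_mono power_sum_norm_le(2)[OF k a C]) auto
        finally show ?thesis .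
      qed
      ultimately have "\<delta> * (\<Sum>i<N. a i) \<le> (B' * C ^ (k - 1)) * norm (\<Sum>i<N. a i *\<^sub>R g (s i))" by (simp add: mult.assoc)
      then show "\<delta> / (B' * C ^ (k - 1)) * (\<Sum>i<N. a i) \<le> norm (\<Sum>i<N. a i *\<^sub>R g (s i))"
        using pos by (simp add: field_simps)
    qed
  qed
qed

end

text \<open>
  The components \<open>\<alpha> x\<close> are dropped from left to right; by multilinearity, each step discards a value of
  \<open>U\<close> at a list that meets \<open>Z\<close>.
\<close>

lemma multilinear_drop_components:
  assumes "multilinear_form k U"
    and "\<And>ys. nonneg_list k ys \<Longrightarrow> \<exists>y\<in>set ys. y \<in> Z \<Longrightarrow> U ys \<le> 0"
    and "nonneg_list k xs"
    and "\<And>x. x \<in> set xs \<Longrightarrow> x = \<alpha> x + \<beta> x \<and> \<alpha> x \<in> Z \<and> 0 \<le> \<alpha> x \<and> 0 \<le> \<beta> x"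
  shows "U xs \<le> U (map \<beta> xs)"
  using assms
proof (induction k arbitrary: U xs)
  case (Suc k)
  then obtain x ys where xs: "xs = x # ys" and ys: "nonneg_list k ys" by (cases xs) auto
  have x: "x = \<alpha> x + \<beta> x" "\<alpha> x \<in> Z" "0 \<le> \<alpha> x" "0 \<le> \<beta> x" using Suc.prems(4)[of x] xs by auto
  have "U xs = U (\<alpha> x # ys) + U (\<beta> x # ys)"
    using multilinear_head_add[OF Suc.prems(1), of ys "\<alpha> x" "\<beta> x"] x(1) xs ys by simp
  also have "\<dots> \<le> U (\<beta> x # ys)" using Suc.prems(2)[of "\<alpha> x # ys"] x ys by simp
  also have "\<dots> \<le> U (\<beta> x # map \<beta> ys)"
  proof (rule Suc.IH)
    show "multilinear_form k (\<lambda>ys. U (\<beta> x # ys))" using Suc.prems(1) by (rule multilinear_tail)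
    show "U (\<beta> x # zs) \<le> 0" if "nonneg_list k zs" "\<exists>y\<in>set zs. y \<in> Z" for zs
      using Suc.prems(2)[of "\<beta> x # zs"] that x by simp
    show "\<And>x. x \<in> set ys \<Longrightarrow> x = \<alpha> x + \<beta> x \<and> \<alpha> x \<in> Z \<and> 0 \<le> \<alpha> x \<and> 0 \<le> \<beta> x" using Suc.prems(4) xs by auto
  qed (rule ys)
  finally show ?case using xs by simp
qed simp

context localised_sequence
begin

text \<open>
  Splitting each argument \<open>x\<close> as \<open>inf x (j *\<^sub>R X n)\<close> plus a remainder, a form below the powers of both
  \<open>g m\<close> and \<open>g n\<close> is nonpositive whenever some component of the first kind occurs, because \<open>g m\<close>
  vanishes there; on the remainders \<open>g n\<close> is small.
\<close>

lemma powers_disjoint: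
  assumes k: "1 \<le> k" shows "vdisjoint_seq (regular_poly_space real_vlattice k) (\<lambda>n z. g n z ^ k)"
  unfolding vdisjoint_seq_def
proof (intro conjI allI impI)
  let ?V = "regular_poly_space real_vlattice k :: ('e \<Rightarrow> real) vlattice"
  let ?P = "\<lambda>n z. g n z ^ k"
  have pos: "positive_poly real_vlattice k (?P n)" for n
    using powers_positive[of k] by (simp add: vpositive_seq_def poly_le_def)
  have reg: "?P n \<in> regular_polys real_vlattice k" for n using pos by (rule positive_imp_regular)
  then show "?P n \<in> vcarrier ?V" for n by simp
  have abs: "vabs ?V (?P n) = ?P n" for n
    using poly_abs_positive[OF pos] by (simp add: vabs_def vsup_def poly_abs_def)
  fix m n :: nat assume mn: "m \<noteq> n"
  have nonpos: "form_of k U xs \<le> 0"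
    if U: "U \<in> regular_polys real_vlattice k" and le: "poly_le real_vlattice k U (?P m)" "poly_le real_vlattice k U (?P n)"
      and xs: "nonneg_list k xs" for U xs
  proof -
    note Ua = regular_associated[OF U]
    have Um: "multilinear_form k (form_of k U)" using Ua by (simp add: associated_operator_real)
    have lem: "form_of k U ys \<le> power_form (g m) ys" and len: "form_of k U ys \<le> power_form (g n) ys"
      if "nonneg_list k ys" for ys
      using le that by (auto simp: poly_le_iff[OF Ua associated_power_form])
    have "form_of k U xs \<le> e" if e: "0 < e" "e \<le> 1" for e
    proof -
      have "\<forall>x\<in>set xs. \<exists>i::nat. \<forall>j\<ge>i. g n (x - inf x (real j *\<^sub>R X n)) \<le> e"
        using localised_remainder[OF X_nonneg loc _ e(1)] xs by blast
      then obtain i where i: "\<And>x j. x \<in> set xs \<Longrightarrow> i x \<le> j \<Longrightarrow> g n (x - inf x (real j *\<^sub>R X n)) \<le> e" by metis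
      define j where "j = Max (insert 0 (i ` set xs))"
      have j: "i x \<le> j" if "x \<in> set xs" for x unfolding j_def using that by (intro Max_ge) auto
      define \<alpha> where "\<alpha> x = inf x (real j *\<^sub>R X n)" for x
      define \<beta> where "\<beta> x = x - \<alpha> x" for x
      have gm: "g m (\<alpha> x) = 0" if "0 \<le> x" for x
      proof (rule localised_off_ideal[OF X_nonneg loc])
        show nn: "0 \<le> \<alpha> x" unfolding \<alpha>_def using that X_nonneg by (simp add: scaleR_nonneg_nonneg)
        have "inf (real j *\<^sub>R X n) (X m) = 0" using disj[of n m] mn by (intro disjoint_scaleR) auto
        then show "inf (\<alpha> x) (X m) = 0"
          by (rule disjoint_mono) (use nn X_nonneg in \<open>simp_all add: \<alpha>_def\<close>)
      qed
      have nn: "0 \<le> \<alpha> x" "0 \<le> \<beta> x" if "0 \<le> x" for x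
        using that X_nonneg[of n] unfolding \<alpha>_def \<beta>_def by (simp_all only: diff_ge_0_iff_ge inf_le1 inf_greatest scaleR_nonneg_nonneg of_nat_0_le_iff)
      have "form_of k U xs \<le> form_of k U (map \<beta> xs)"
      proof (rule multilinear_drop_components[OF Um _ xs, where Z = "{y. g m y = 0}" and \<alpha> = \<alpha>])
        fix ys assume "nonneg_list k ys" "\<exists>y\<in>set ys. y \<in> {y. g m y = 0}"
        then show "form_of k U ys \<le> 0" using lem[of ys] power_form_zero[of _ ys "g m"] by fastforce
      next
        fix x assume "x \<in> set xs"
        then have "0 \<le> x" using xs by blast
        then show "x = \<alpha> x + \<beta> x \<and> \<alpha> x \<in> {y. g m y = 0} \<and> 0 \<le> \<alpha> x \<and> 0 \<le> \<beta> x"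
          using gm nn by (simp add: \<beta>_def)
      qed
      also have "\<dots> \<le> power_form (g n) (map \<beta> xs)" using xs nn by (intro len) auto
      also have "\<dots> \<le> e ^ length (map \<beta> xs)"
        using i j xs nn g_nonneg e by (intro power_form_le) (auto simp: \<beta>_def \<alpha>_def)
      also have "\<dots> \<le> e" using xs e k by (simp add: power_le_one_iff self_le_power power_decreasing[of 1 k e, simplified])
      finally show ?thesis .
    qed
    then have "form_of k U xs \<le> 0 + e" if "0 < e" for e :: real
      using that by (metis add_0 min.cobounded1 min.cobounded2 min_less_iff_conj order_trans zero_less_one)
    then show ?thesis by (rule field_le_epsilon)
  qed
  have z: "(\<lambda>x :: 'e. 0 :: real) \<in> regular_polys real_vlattice k" using regular_combine[OF reg reg, of 0 0 0 0] by simp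
  have glb: "is_glb_on (regular_polys real_vlattice k) (poly_le real_vlattice k) {?P m, ?P n} (\<lambda>x. 0)"
    unfolding is_glb_on_def
  proof (intro conjI ballI impI z)
    fix Q assume "Q \<in> {?P m, ?P n}"
    then show "poly_le real_vlattice k (\<lambda>x. 0) Q" using pos by (auto simp: poly_le_def)
  next
    fix U assume "U \<in> regular_polys real_vlattice k" "\<forall>Q\<in>{?P m, ?P n}. poly_le real_vlattice k U Q"
    then show "poly_le real_vlattice k U (\<lambda>x. 0)"
      using nonpos[of U] by (simp add: poly_le_iff[OF regular_associated associated_zero])
  qed
  have uniq: "Q = (\<lambda>x. 0)" if Q: "is_glb_on (regular_polys real_vlattice k) (poly_le real_vlattice k) {?P m, ?P n} Q" for Q
  proof -
    have Qr: "Q \<in> regular_polys real_vlattice k" using Q by (simp add: is_glb_on_def)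
    note Qa = regular_associated[OF Qr]
    have "poly_le real_vlattice k Q (\<lambda>x. 0)" "poly_le real_vlattice k (\<lambda>x. 0) Q"
      using Q glb Qr z unfolding is_glb_on_def by auto
    then show ?thesis unfolding poly_le_iff[OF Qa associated_zero] poly_le_iff[OF associated_zero Qa]
      by (intro associated_eq_on_cone[OF Qa associated_zero]) (auto intro: antisym)
  qed
  have "vinf ?V (?P m) (?P n) = (THE Q. is_glb_on (regular_polys real_vlattice k) (poly_le real_vlattice k) {?P m, ?P n} Q)"
    by (simp add: vinf_def)
  also have "\<dots> = (\<lambda>x. 0)" using glb uniq by (rule the_equality)
  finally show "vinf ?V (vabs ?V (?P m)) (vabs ?V (?P n)) = \<zero>\<^bsub>?V\<^esub>"
    unfolding abs by simp
qed

end

section \<open>Copies of the space of null sequences\<close>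

text \<open>
  The copy of \<open>c0\<close> along an injection. For \<open>emb = id\<close> it is \<open>c0\<close> itself, so that \<open>c0\<close> and its copies
  inside an arbitrary large type are treated together.
\<close>

definition c0_copy :: "((nat \<Rightarrow> real) \<Rightarrow> 'f) \<Rightarrow> 'f vlattice" where
  "c0_copy emb = \<lparr>vcarrier = emb ` {a. a \<longlonglongrightarrow> 0},
     vadd = (\<lambda>u v. emb (\<lambda>n. inv emb u n + inv emb v n)), vzero = emb (\<lambda>n. 0),
     vscale = (\<lambda>c u. emb (\<lambda>n. c * inv emb u n)), vle = (\<lambda>u v. \<forall>n. inv emb u n \<le> inv emb v n),
     vnorm = (\<lambda>u. SUP n. \<bar>inv emb u n\<bar>)\<rparr>"

lemma c0_copy_id: "c0_copy id = c0"
  by (simp add: c0_copy_def c0_def inv_id)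

context
  fixes emb :: "(nat \<Rightarrow> real) \<Rightarrow> 'f" and F :: "'f vlattice"
  assumes inj: "inj emb"
  defines "F \<equiv> c0_copy emb"
begin

lemma F_simps [simp]:
  "vcarrier F = emb ` {a. a \<longlonglongrightarrow> 0}" "vzero F = emb (\<lambda>n. 0)"
  "vadd F (emb a) (emb b) = emb (\<lambda>n. a n + b n)"
  "vscale F c (emb a) = emb (\<lambda>n. c * a n)"
  "vle F (emb a) (emb b) \<longleftrightarrow> (\<forall>n. a n \<le> b n)"
  "vnorm F (emb a) = (SUP n. \<bar>a n\<bar>)"
  "vminus F (emb a) (emb b) = emb (\<lambda>n. a n - b n)"
  "emb a = emb b \<longleftrightarrow> a = b"
  using inj by (simp_all add: F_def c0_copy_def vminus_def inj_eq)

lemma null_seq_bdd: "a \<longlonglongrightarrow> 0 \<Longrightarrow> bdd_above (range (\<lambda>n. \<bar>a n :: real\<bar>))"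
  using Bseq_def[of a] convergent_imp_Bseq[of a] unfolding convergent_def
  by (force simp: bdd_above_def)

lemma F_norm_le_iff: "a \<longlonglongrightarrow> 0 \<Longrightarrow> vnorm F (emb a) \<le> B \<longleftrightarrow> (\<forall>n. \<bar>a n\<bar> \<le> B)"
  using null_seq_bdd[of a] by (simp add: cSUP_le_iff)

lemma F_norm_ge: "a \<longlonglongrightarrow> 0 \<Longrightarrow> \<bar>a n\<bar> \<le> vnorm F (emb a)"
  using F_norm_le_iff by blast

lemma vector_space_F: "vector_space_carrier F"
proof
  fix x y assume "x \<in> vcarrier F" "y \<in> vcarrier F"
  then show "x \<oplus>\<^bsub>F\<^esub> y \<in> vcarrier F"
    by (auto intro!: imageI tendsto_add_zero)
next
  fix x and c :: real assume "x \<in> vcarrier F"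
  then show "c \<odot>\<^bsub>F\<^esub> x \<in> vcarrier F" by (auto intro!: imageI tendsto_mult_right_zero)
qed (auto simp: algebra_simps)

lemma F_diff_null: "a \<longlonglongrightarrow> 0 \<Longrightarrow> b \<longlonglongrightarrow> 0 \<Longrightarrow> (\<lambda>n. a n - b n :: real) \<longlonglongrightarrow> 0"
  using tendsto_diff[of a 0 sequentially b 0] by simp

lemma banach_space_F: "banach_space_carrier F"
proof (rule banach_space_carrier.intro[OF vector_space_F], unfold_locales)
  fix x assume "x \<in> vcarrier F"
  then obtain a where a: "x = emb a" "a \<longlonglongrightarrow> 0" by auto
  show nn: "0 \<le> vnorm F x" using F_norm_ge[OF a(2), of 0] a(1) abs_ge_zero order_trans by blast
  show "vnorm F x = 0 \<longleftrightarrow> x = \<zero>\<^bsub>F\<^esub>"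
    using F_norm_le_iff[OF a(2), of 0] nn a(1) by (auto simp: fun_eq_iff simp del: F_simps(6))
  fix c
  have ca: "(\<lambda>n. c * a n) \<longlonglongrightarrow> 0" using a(2) by (rule tendsto_mult_right_zero)
  have "vnorm F (emb (\<lambda>n. c * a n)) \<le> \<bar>c\<bar> * vnorm F (emb a)"
    unfolding F_norm_le_iff[OF ca] using F_norm_ge[OF a(2)] by (auto simp: abs_mult intro: mult_left_mono)
  moreover have "\<bar>c\<bar> * vnorm F (emb a) \<le> vnorm F (emb (\<lambda>n. c * a n))"
  proof (cases "c = 0")
    case True
    then show ?thesis using F_norm_ge[OF ca, of 0] by (simp del: F_simps(6))
  next
    case False
    have "vnorm F (emb a) \<le> vnorm F (emb (\<lambda>n. c * a n)) / \<bar>c\<bar>"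
      unfolding F_norm_le_iff[OF a(2)]
    proof
      fix n
      show "\<bar>a n\<bar> \<le> vnorm F (emb (\<lambda>n. c * a n)) / \<bar>c\<bar>"
        using F_norm_ge[OF ca, of n] False by (simp add: abs_mult field_simps del: F_simps(6))
    qed
    then show ?thesis using False by (simp add: field_simps del: F_simps(6))
  qed
  ultimately show "vnorm F (c \<odot>\<^bsub>F\<^esub> x) = \<bar>c\<bar> * vnorm F x" using a(1) by (simp del: F_simps(6))
next
  fix x y assume "x \<in> vcarrier F" "y \<in> vcarrier F"
  then obtain a b where a: "x = emb a" "a \<longlonglongrightarrow> 0" and b: "y = emb b" "b \<longlonglongrightarrow> 0" by auto
  have "\<bar>a n + b n\<bar> \<le> vnorm F (emb a) + vnorm F (emb b)" for n
    using F_norm_ge[OF a(2), of n] F_norm_ge[OF b(2), of n] abs_triangle_ineq[of "a n" "b n"] by linarith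
  then have "vnorm F (emb (\<lambda>n. a n + b n)) \<le> vnorm F (emb a) + vnorm F (emb b)"
    using F_norm_le_iff[OF tendsto_add_zero[OF a(2) b(2)]] by blast
  then show "vnorm F (x \<oplus>\<^bsub>F\<^esub> y) \<le> vnorm F x + vnorm F y" using a b by simp
next
  fix X :: "nat \<Rightarrow> 'f"
  assume X: "\<And>n. X n \<in> vcarrier F" and cau: "\<And>e. 0 < e \<Longrightarrow> \<exists>N. \<forall>m\<ge>N. \<forall>n\<ge>N. vnorm F (X m \<ominus>\<^bsub>F\<^esub> X n) < e"
  have "\<exists>a. X n = emb a \<and> a \<longlonglongrightarrow> 0" for n using X[of n] by auto
  then obtain a where a: "\<And>n. X n = emb (a n)" "\<And>n. a n \<longlonglongrightarrow> 0" by metis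
  have unif: "\<exists>N. \<forall>m\<ge>N. \<forall>n\<ge>N. \<forall>i. \<bar>a m i - a n i\<bar> < e" if e: "0 < e" for e
  proof -
    obtain N where N: "\<forall>m\<ge>N. \<forall>n\<ge>N. vnorm F (X m \<ominus>\<^bsub>F\<^esub> X n) < e" using cau[OF e] by blast
    have "\<bar>a m i - a n i\<bar> < e" if "m \<ge> N" "n \<ge> N" for m n i
    proof -
      have "vnorm F (emb (\<lambda>i. a m i - a n i)) < e" using N that a(1) by (simp del: F_simps(6))
      then show ?thesis using F_norm_ge[OF F_diff_null[OF a(2)[of m] a(2)[of n]], of i] by linarith
    qed
    then show ?thesis by blast
  qed
  have "Cauchy (\<lambda>n. a n i)" for i
    unfolding Cauchy_def dist_real_def using unif by blast
  then have "\<exists>l. (\<lambda>n. a n i) \<longlonglongrightarrow> l" for i using Cauchy_convergent convergent_def by blast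
  then obtain l where l: "\<And>i. (\<lambda>n. a n i) \<longlonglongrightarrow> l i" by metis
  have close: "\<exists>N. \<forall>m\<ge>N. \<forall>i. \<bar>a m i - l i\<bar> \<le> e" if e: "0 < e" for e
  proof -
    obtain N where N: "\<forall>m\<ge>N. \<forall>n\<ge>N. \<forall>i. \<bar>a m i - a n i\<bar> < e" using unif[OF e] by blast
    have "\<bar>a m i - l i\<bar> \<le> e" if "m \<ge> N" for m i
    proof (rule tendsto_upperbound)
      show "(\<lambda>n. \<bar>a m i - a n i\<bar>) \<longlonglongrightarrow> \<bar>a m i - l i\<bar>" by (intro tendsto_intros l)
      show "\<forall>\<^sub>F n in sequentially. \<bar>a m i - a n i\<bar> \<le> e"
        using eventually_ge_at_top[of N] by eventually_elim (use N that in \<open>force intro: less_imp_le\<close>)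
    qed simp
    then show ?thesis by blast
  qed
  have l0: "l \<longlonglongrightarrow> 0"
  proof (rule tendstoI)
    fix e :: real assume e: "0 < e"
    then obtain N where N: "\<And>i. \<bar>a N i - l i\<bar> \<le> e / 2" using close[of "e / 2"] by auto
    have "\<forall>\<^sub>F i in sequentially. dist (a N i) 0 < e / 2" using a(2) e by (intro tendstoD) auto
    then show "\<forall>\<^sub>F i in sequentially. dist (l i) 0 < e"
    proof eventually_elim
      case (elim i)
      then have "\<bar>a N i\<bar> < e / 2" by (simp add: dist_real_def)
      then have "\<bar>l i\<bar> < e" using N[of i] by linarith
      then show ?case by (simp add: dist_real_def)
    qed
  qed
  have "(\<lambda>n. vnorm F (X n \<ominus>\<^bsub>F\<^esub> emb l)) \<longlonglongrightarrow> 0"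
  proof (rule tendstoI)
    fix e :: real assume e: "0 < e"
    then obtain N where N: "\<forall>m\<ge>N. \<forall>i. \<bar>a m i - l i\<bar> \<le> e / 2" using close[of "e / 2"] by auto
    show "\<forall>\<^sub>F n in sequentially. dist (vnorm F (X n \<ominus>\<^bsub>F\<^esub> emb l)) 0 < e"
      using eventually_ge_at_top[of N]
    proof eventually_elim
      case (elim n)
      have d: "(\<lambda>i. a n i - l i) \<longlonglongrightarrow> 0" by (rule F_diff_null[OF a(2) l0])
      have "vnorm F (emb (\<lambda>i. a n i - l i)) \<le> e / 2" unfolding F_norm_le_iff[OF d] using N elim by blast
      moreover have "0 \<le> vnorm F (emb (\<lambda>i. a n i - l i))" using F_norm_ge[OF d, of 0] by linarith
      ultimately have "\<bar>vnorm F (emb (\<lambda>i. a n i - l i))\<bar> < e" using e by linarith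
      moreover have "X n \<ominus>\<^bsub>F\<^esub> emb l = emb (\<lambda>i. a n i - l i)" using a(1) by simp
      ultimately show ?case by (simp only: dist_real_def diff_0_right)
    qed
  qed
  then show "\<exists>l\<in>vcarrier F. (\<lambda>n. vnorm F (X n \<ominus>\<^bsub>F\<^esub> l)) \<longlonglongrightarrow> 0" using l0 by auto
qed

lemma riesz_space_F: "riesz_space_carrier F"
proof (rule riesz_space_carrier.intro[OF vector_space_F], unfold_locales)
  fix x y assume "x \<in> vcarrier F" "y \<in> vcarrier F"
  then obtain a b where a: "x = emb a" "a \<longlonglongrightarrow> 0" and b: "y = emb b" "b \<longlonglongrightarrow> 0" by auto
  have "(\<lambda>n. max (a n) (b n)) \<longlonglongrightarrow> 0" "(\<lambda>n. min (a n) (b n)) \<longlonglongrightarrow> 0"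
    using tendsto_max[OF a(2) b(2)] tendsto_min[OF a(2) b(2)] by auto
  then show "\<exists>s. is_lub_on (vcarrier F) (vle F) {x, y} s" "\<exists>s. is_glb_on (vcarrier F) (vle F) {x, y} s"
    using a b
    by (auto simp: is_lub_on_def is_glb_on_def intro!: exI[of _ "emb (\<lambda>n. max (a n) (b n))"] exI[of _ "emb (\<lambda>n. min (a n) (b n))"])
qed (auto simp: fun_eq_iff intro!: antisym mult_left_mono, meson order_trans)

lemma banach_lattice_F: "banach_lattice_carrier F"
proof (rule banach_lattice_carrier.intro[OF banach_space_F riesz_space_F], unfold_locales)
  interpret riesz_space_carrier F by (rule riesz_space_F)
  have abs: "vabs F (emb a) = emb (\<lambda>n. \<bar>a n\<bar>)" if "a \<longlonglongrightarrow> 0" for a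
  proof -
    have "(\<lambda>n. - a n) \<longlonglongrightarrow> 0" "(\<lambda>n. \<bar>a n\<bar>) \<longlonglongrightarrow> 0"
      using tendsto_minus[OF that] tendsto_rabs[OF that] by auto
    then have "vsup F (emb a) (emb (\<lambda>n. - a n)) = emb (\<lambda>n. \<bar>a n\<bar>)"
      using that by (intro vsup_eqI) (auto simp: is_lub_on_def abs_le_iff)
    then show ?thesis by (simp add: vabs_def)
  qed
  fix x y assume "x \<in> vcarrier F" "y \<in> vcarrier F" and le: "vabs F x \<sqsubseteq>\<^bsub>F\<^esub> vabs F y"
  then obtain a b where a: "x = emb a" "a \<longlonglongrightarrow> 0" and b: "y = emb b" "b \<longlonglongrightarrow> 0" by auto
  have "\<bar>a n\<bar> \<le> \<bar>b n\<bar>" for n using le a b abs by simp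
  then have "\<bar>a n\<bar> \<le> vnorm F (emb b)" for n using F_norm_ge[OF b(2)] order_trans by blast
  then show "vnorm F x \<le> vnorm F y" unfolding a(1) b(1) F_norm_le_iff[OF a(2)] by blast
qed

text \<open>
  Some element of a downward directed set with infimum zero is small off a finite set of
  coordinates. At each coordinate the infimum is zero, and directedness combines finitely many
  elements.
\<close>

lemma order_continuous_F: "order_continuous_norm F"
  unfolding order_continuous_norm_def
proof (intro allI impI)
  fix D and e :: real
  assume D: "D \<subseteq> vcarrier F" and e: "0 < e"
    and *: "D \<noteq> {} \<and> (\<forall>a\<in>D. \<forall>b\<in>D. \<exists>c\<in>D. c \<sqsubseteq>\<^bsub>F\<^esub> a \<and> c \<sqsubseteq>\<^bsub>F\<^esub> b) \<and> is_glb_on (vcarrier F) (vle F) D \<zero>\<^bsub>F\<^esub>"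
  interpret riesz_space_carrier F by (rule riesz_space_F)
  define v where "v d = inv emb d" for d
  have ev: "d = emb (v d)" "v d \<longlonglongrightarrow> 0" if "d \<in> D" for d
    using that D inj by (auto simp: v_def)
  obtain d0 where d0: "d0 \<in> D" using * by blast
  have "\<forall>\<^sub>F n in sequentially. dist (v d0 n) 0 < e / 2" using ev(2)[OF d0] e by (intro tendstoD) auto
  then obtain N where N: "\<And>n. N \<le> n \<Longrightarrow> \<bar>v d0 n\<bar> < e / 2" by (auto simp: eventually_sequentially)
  have pt: "\<exists>d\<in>D. v d n < e / 2" for n
  proof (rule ccontr)
    assume "\<not> ?thesis"
    then have big: "e / 2 \<le> v d n" if "d \<in> D" for d using that by (auto simp: not_less)
    let ?u = "\<lambda>i. if i = n then e / 2 else 0"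
    have u: "?u \<longlonglongrightarrow> 0" by (rule tendsto_eventually, rule eventually_sequentiallyI[of "Suc n"]) auto
    have "\<zero>\<^bsub>F\<^esub> \<sqsubseteq>\<^bsub>F\<^esub> d" if "d \<in> D" for d using * that by (auto simp: is_glb_on_def)
    then have "0 \<le> v d i" if "d \<in> D" for d i using that ev(1)[OF that] F_simps(2,5) by metis
    then have "emb ?u \<sqsubseteq>\<^bsub>F\<^esub> d" if "d \<in> D" for d
      using that big ev(1)[OF that] F_simps(5)[of ?u "v d"] by auto
    moreover have "\<forall>z\<in>vcarrier F. (\<forall>a\<in>D. z \<sqsubseteq>\<^bsub>F\<^esub> a) \<longrightarrow> z \<sqsubseteq>\<^bsub>F\<^esub> \<zero>\<^bsub>F\<^esub>"
      using * unfolding is_glb_on_def by blast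
    moreover have "emb ?u \<in> vcarrier F" using u by simp
    ultimately have "emb ?u \<sqsubseteq>\<^bsub>F\<^esub> \<zero>\<^bsub>F\<^esub>" by blast
    then have "\<forall>i. ?u i \<le> 0" by simp
    from spec[OF this, of n] have "e / 2 \<le> 0" by simp
    then show False using e by simp
  qed
  have "\<exists>d\<in>D. d \<sqsubseteq>\<^bsub>F\<^esub> d0 \<and> (\<forall>n<M. v d n < e / 2)" for M
  proof (induction M)
    case 0
    have "d0 \<in> vcarrier F" using d0 D by blast
    then show ?case using d0 le_refl[of d0] by auto
  next
    case (Suc M)
    then obtain d where d: "d \<in> D" "d \<sqsubseteq>\<^bsub>F\<^esub> d0" "\<forall>n<M. v d n < e / 2" by blast
    obtain d' where d': "d' \<in> D" "v d' M < e / 2" using pt by blast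
    obtain c where c: "c \<in> D" "c \<sqsubseteq>\<^bsub>F\<^esub> d" "c \<sqsubseteq>\<^bsub>F\<^esub> d'" using * d d' by blast
    have "v c n \<le> v d n" "v c n \<le> v d' n" for n
      using c ev(1)[OF c(1)] ev(1)[OF d(1)] ev(1)[OF d'(1)] F_simps(5) by metis+
    then have "\<forall>n<Suc M. v c n < e / 2" using d(3) d'(2) by (metis le_less_trans less_Suc_eq)
    moreover have "c \<sqsubseteq>\<^bsub>F\<^esub> d0" using le_trans c d d0 D by blast
    ultimately show ?case using c by blast
  qed
  then obtain d where d: "d \<in> D" "d \<sqsubseteq>\<^bsub>F\<^esub> d0" "\<forall>n<N. v d n < e / 2" by blast
  have "vnorm F c < e" if c: "c \<in> D" "c \<sqsubseteq>\<^bsub>F\<^esub> d" for c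
  proof -
    have "v c n \<le> v d n" "v d n \<le> v d0 n" "0 \<le> v c n" for n
    proof -
      show "v c n \<le> v d n" "v d n \<le> v d0 n"
        using c d ev(1)[OF c(1)] ev(1)[OF d(1)] ev(1)[OF d0] F_simps(5) by metis+
      have "\<zero>\<^bsub>F\<^esub> \<sqsubseteq>\<^bsub>F\<^esub> c" using * c by (auto simp: is_glb_on_def)
      then show "0 \<le> v c n" using ev(1)[OF c(1)] F_simps(2,5) by metis
    qed
    then have "\<bar>v c n\<bar> \<le> e / 2" for n
      using d(3) N[of n] by (metis abs_ge_self abs_of_nonneg less_imp_le not_le order_trans)
    then have "vnorm F (emb (v c)) \<le> e / 2" unfolding F_norm_le_iff[OF ev(2)[OF c(1)]] by blast
    then show ?thesis using ev(1)[OF c(1)] e by simp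
  qed
  then show "\<exists>d\<in>D. \<forall>c\<in>D. c \<sqsubseteq>\<^bsub>F\<^esub> d \<longrightarrow> vnorm F c < e" using d by blast
qed

text \<open>
  The weights are the values at the unit vectors. Testing the functional on finite sign patterns
  bounds their absolute sum, and truncations of a null sequence converge to it in norm.
\<close>

lemma F_functional_series:
  assumes f: "f \<in> vdual F"
  obtains w where "summable (\<lambda>n. \<bar>w n\<bar>)" "\<And>a. a \<longlonglongrightarrow> 0 \<Longrightarrow> (\<lambda>n. w n * a n) sums f (emb a)"
proof -
  obtain B where B: "\<And>a. a \<longlonglongrightarrow> 0 \<Longrightarrow> \<bar>f (emb a)\<bar> \<le> B * vnorm F (emb a)"
    using f unfolding vdual_def by auto
  have add: "f (emb (\<lambda>n. a n + b n)) = f (emb a) + f (emb b)" if "a \<longlonglongrightarrow> 0" "b \<longlonglongrightarrow> 0" for a b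
    using f that F_simps(3)[of a b] unfolding vdual_def by force
  have scl: "f (emb (\<lambda>n. c * a n)) = c * f (emb a)" if "a \<longlonglongrightarrow> 0" for a c
    using f that F_simps(4)[of c a] unfolding vdual_def by force
  let ?e = "\<lambda>i n. if n = i then 1 else 0 :: real"
  let ?cut = "\<lambda>a N n. if n < N then a n else 0 :: real"
  define w where "w i = f (emb (?e i))" for i
  have e0: "?e i \<longlonglongrightarrow> 0" for i
    by (rule tendsto_eventually) (auto simp: eventually_sequentially intro!: exI[of _ "Suc i"])
  have cut0: "?cut a N \<longlonglongrightarrow> 0" for a N
    by (rule tendsto_eventually) (auto simp: eventually_sequentially intro!: exI[of _ N])
  have fin: "f (emb (?cut a N)) = (\<Sum>n<N. w n * a n)" for a N
  proof (induction N)
    case 0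
    then show ?case using scl[OF e0, of 0 0] by simp
  next
    case (Suc N)
    have "?cut a (Suc N) = (\<lambda>n. ?cut a N n + a N * ?e N n)" by (auto simp: fun_eq_iff less_Suc_eq)
    then have "f (emb (?cut a (Suc N))) = f (emb (?cut a N)) + f (emb (\<lambda>n. a N * ?e N n))"
      using add[OF cut0 tendsto_mult_right_zero[OF e0]] by simp
    then show ?case using Suc scl[OF e0, of "a N" N] by (simp add: w_def)
  qed
  have bound: "(\<Sum>n\<le>N. \<bar>w n\<bar>) \<le> \<bar>B\<bar>" for N
  proof -
    let ?s = "?cut (\<lambda>n. sgn (w n)) (Suc N)"
    have "(\<Sum>n\<le>N. \<bar>w n\<bar>) = f (emb ?s)" unfolding fin lessThan_Suc_atMost by (simp add: abs_sgn)
    also have "\<dots> \<le> B * vnorm F (emb ?s)" by (rule order_trans[OF abs_ge_self B[OF cut0]])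
    also have "\<dots> \<le> \<bar>B\<bar> * vnorm F (emb ?s)"
    proof (rule mult_right_mono)
      have "?s \<longlonglongrightarrow> 0" by (rule cut0)
      from F_norm_ge[OF this, of 0] show "0 \<le> vnorm F (emb ?s)" by linarith
    qed simp
    also have "\<dots> \<le> \<bar>B\<bar> * 1"
    proof (rule mult_left_mono)
      show "vnorm F (emb ?s) \<le> 1" unfolding F_norm_le_iff[OF cut0] by (simp add: abs_sgn_eq)
    qed simp
    finally show ?thesis by simp
  qed
  have "summable (\<lambda>n. \<bar>w n\<bar>)" by (rule bounded_imp_summable[OF _ bound]) simp
  moreover have "(\<lambda>n. w n * a n) sums f (emb a)" if a: "a \<longlonglongrightarrow> 0" for a
    unfolding sums_def
  proof (rule tendstoI)
    fix e :: real assume e: "0 < e"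
    define e' where "e' = e / (2 * (\<bar>B\<bar> + 1))"
    have e': "0 < e'" using e by (simp add: e'_def)
    obtain N where N: "\<And>n. N \<le> n \<Longrightarrow> \<bar>a n\<bar> < e'"
      using tendstoD[OF a e'] by (auto simp: eventually_sequentially)
    show "\<forall>\<^sub>F M in sequentially. dist (\<Sum>n<M. w n * a n) (f (emb a)) < e"
      using eventually_ge_at_top[of N]
    proof eventually_elim
      case (elim M)
      let ?t = "\<lambda>n. a n + (- 1) * ?cut a M n"
      have t0: "?t \<longlonglongrightarrow> 0" using tendsto_add_zero[OF a tendsto_mult_right_zero[OF cut0]] .
      have "f (emb ?t) = f (emb a) - (\<Sum>n<M. w n * a n)"
      proof -
        have "(\<lambda>n. (- 1) * ?cut a M n) \<longlonglongrightarrow> 0" by (rule tendsto_mult_right_zero[OF cut0])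
        then have "f (emb ?t) = f (emb a) + f (emb (\<lambda>n. (- 1) * ?cut a M n))" by (rule add[OF a])
        also have "f (emb (\<lambda>n. (- 1) * ?cut a M n)) = (- 1) * f (emb (?cut a M))" by (rule scl[OF cut0])
        finally show ?thesis unfolding fin by simp
      qed
      moreover have "\<bar>f (emb ?t)\<bar> \<le> \<bar>B\<bar> * e'"
      proof -
        have "vnorm F (emb ?t) \<le> e'"
          unfolding F_norm_le_iff[OF t0] using N elim e' by (auto simp: not_less intro!: less_imp_le)
        moreover have "0 \<le> vnorm F (emb ?t)" using F_norm_ge[OF t0, of 0] by linarith
        moreover have "B * vnorm F (emb ?t) \<le> \<bar>B\<bar> * vnorm F (emb ?t)"
          using \<open>0 \<le> vnorm F (emb ?t)\<close> by (intro mult_right_mono) auto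
        ultimately show ?thesis using B[OF t0] mult_left_mono[of "vnorm F (emb ?t)" e' "\<bar>B\<bar>"] by linarith
      qed
      moreover have "\<bar>B\<bar> * e' < e"
      proof -
        have "\<bar>B\<bar> * e < 2 * (\<bar>B\<bar> + 1) * e" using e by (intro mult_strict_right_mono) auto
        then show ?thesis by (simp add: e'_def field_simps)
      qed
      ultimately show ?case by (simp add: dist_real_def abs_minus_commute)
    qed
  qed
  ultimately show thesis by (rule that)
qed

lemma Hausdorff_weak_F: "Hausdorff_space (weak_topology F)"
  unfolding Hausdorff_space_def
proof (intro allI impI)
  fix x y assume *: "x \<in> topspace (weak_topology F) \<and> y \<in> topspace (weak_topology F) \<and> x \<noteq> y"
  then obtain a b where a: "x = emb a" "a \<longlonglongrightarrow> 0" and b: "y = emb b" "b \<longlonglongrightarrow> 0"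
    unfolding topspace_weak_topology by auto
  then obtain n where n: "a n \<noteq> b n" using * by auto
  let ?f = "\<lambda>u. inv emb u n"
  have f: "?f \<in> vdual F"
    unfolding vdual_def
  proof (intro CollectI conjI)
    show "\<exists>B. \<forall>x\<in>vcarrier F. \<bar>?f x\<bar> \<le> B * vnorm F x"
      using F_norm_ge inj by (intro exI[of _ 1]) (auto simp del: F_simps(6))
  qed (use inj in auto)
  obtain U V where UV: "open U" "open V" "a n \<in> U" "b n \<in> V" "U \<inter> V = {}" using hausdorff[OF n] by blast
  show "\<exists>U V. openin (weak_topology F) U \<and> openin (weak_topology F) V \<and> x \<in> U \<and> y \<in> V \<and> disjnt U V"
    using openin_weak_topology[OF f UV(1)] openin_weak_topology[OF f UV(2)] UV a b inj
    by (intro exI[of _ "{x \<in> vcarrier F. ?f x \<in> U}"] exI[of _ "{x \<in> vcarrier F. ?f x \<in> V}"]) (auto simp: disjnt_def)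
qed

text \<open>
  On a uniformly bounded set of null sequences every bounded functional is a uniform limit of
  finite combinations of coordinates, so coordinatewise compactness suffices for weak compactness.
\<close>

lemma weakly_compact_powers:
  assumes K: "compact K" and null: "\<And>c. c \<in> K \<Longrightarrow> c \<longlonglongrightarrow> 0" and bdd: "\<And>c n. c \<in> K \<Longrightarrow> \<bar>c n\<bar> \<le> C" and k: "1 \<le> k"
  shows "compactin (weak_topology F) ((\<lambda>c. emb (\<lambda>n. c n ^ k)) ` K)"
proof (rule image_compactin)
  show "compactin (top_of_set K) K" using K by (simp add: compactin_subtopology)
  let ?p = "\<lambda>c. emb (\<lambda>n. c n ^ k)"
  have null_power: "(\<lambda>n. c n ^ k) \<longlonglongrightarrow> 0" if "c \<in> K" for c
    using tendsto_power[OF null[OF that], of k] k by (simp add: power_0_left)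
  have carr: "?p c \<in> vcarrier F" if "c \<in> K" for c using null_power[OF that] by auto
  show "continuous_map (top_of_set K) (weak_topology F) ?p"
    unfolding weak_topology_def continuous_on_generated_topo_iff
  proof (intro conjI allI impI)
    fix W assume "W \<in> {{x \<in> vcarrier F. f x \<in> U} |f U. f \<in> vdual F \<and> open U}"
    then obtain f U where W: "W = {x \<in> vcarrier F. f x \<in> U}" "f \<in> vdual F" "open U" by blast
    obtain w where w: "summable (\<lambda>n. \<bar>w n\<bar>)" "\<And>a. a \<longlonglongrightarrow> 0 \<Longrightarrow> (\<lambda>n. w n * a n) sums f (emb a)"
      using F_functional_series[OF W(2)] by blast
    have "continuous_on K (\<lambda>c. f (?p c))"
    proof (rule uniform_limit_theorem)
      have "uniform_limit K (\<lambda>N c. \<Sum>n<N. w n * c n ^ k) (\<lambda>c. suminf (\<lambda>n. w n * c n ^ k)) sequentially"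
      proof (rule Weierstrass_m_test)
        show "summable (\<lambda>n. \<bar>w n\<bar> * C ^ k)" using w(1) by (rule summable_mult2)
        fix n c assume "c \<in> K"
        then have "\<bar>c n\<bar> ^ k \<le> C ^ k" using bdd by (intro power_mono) auto
        then show "norm (w n * c n ^ k) \<le> \<bar>w n\<bar> * C ^ k" by (simp add: abs_mult power_abs mult_left_mono)
      qed
      moreover have "suminf (\<lambda>n. w n * c n ^ k) = f (?p c)" if "c \<in> K" for c
        using w(2)[OF null_power[OF that]] by (rule sums_unique[symmetric])
      ultimately show "uniform_limit K (\<lambda>N c. \<Sum>n<N. w n * c n ^ k) (\<lambda>c. f (?p c)) sequentially"
        by (simp cong: uniform_limit_cong')
      have "continuous_on K (\<lambda>c :: nat \<Rightarrow> real. c n)" for n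
        by (rule continuous_on_subset[OF continuous_on_product_coordinates]) simp
      then show "\<forall>\<^sub>F N in sequentially. continuous_on K (\<lambda>c. \<Sum>n<N. w n * c n ^ k)"
        by (intro always_eventually allI continuous_intros)
    qed simp
    from continuous_openin_preimage_gen[OF this W(3)]
    have "openin (top_of_set K) (K \<inter> (\<lambda>c. f (?p c)) -` U)" .
    moreover have "?p -` W \<inter> topspace (top_of_set K) = K \<inter> (\<lambda>c. f (?p c)) -` U" using carr W(1) by auto
    ultimately show "openin (top_of_set K) (?p -` W \<inter> topspace (top_of_set K))" by simp
  next
    have "(\<lambda>_. 0) \<in> vdual F" by (auto simp: vdual_def intro: exI[of _ 0])
    then have "vcarrier F \<in> {{x \<in> vcarrier F. f x \<in> U} |f U. f \<in> vdual F \<and> open U}"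
      by (intro CollectI exI[of _ "\<lambda>_. 0"] exI[of _ UNIV]) auto
    then show "?p ` topspace (top_of_set K) \<subseteq> \<Union> {{x \<in> vcarrier F. f x \<in> U} |f U. f \<in> vdual F \<and> open U}"
      using carr by (simp only: topspace_euclidean_subtopology) blast
  qed
qed

end

section \<open>The equivalence\<close>

context localised_sequence
begin

lemma coefficient_le: "c \<in> coefficients \<Longrightarrow> \<bar>c n\<bar> \<le> norm (g n)"
proof -
  assume "c \<in> coefficients"
  then have "\<forall>(N :: nat) a t. \<bar>\<Sum>i<N. a i * c (t i)\<bar> \<le> norm (\<Sum>i<N. a i *\<^sub>R g (t i))"
    by (simp add: coefficients_def)
  from spec[OF spec[OF spec[OF this, of 1], of "\<lambda>_. 1"], of "\<lambda>_. n"] show ?thesis by simp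
qed

lemma compact_coefficients: "compact coefficients"
proof -
  obtain C where C: "0 < C" "\<And>n. norm (g n) \<le> C" by (rule bounded) (rule that)
  let ?B = "PiE UNIV (\<lambda>_. {- C..C}) :: (nat \<Rightarrow> real) set"
  have "compactin (product_topology (\<lambda>_. euclidean) UNIV) ?B" unfolding compactin_PiE by simp
  then have B: "compact ?B" by (simp only: euclidean_product_topology compactin_euclidean_iff)
  have coord: "continuous_on UNIV (\<lambda>c :: nat \<Rightarrow> real. c n)" for n by simp
  have "closed coefficients"
    unfolding coefficients_def
    by (intro closed_Collect_all closed_Collect_le continuous_intros coord)
  then have "compact (?B \<inter> coefficients)" using B by (rule compact_Int_closed[rotated])
  moreover have "coefficients \<subseteq> ?B"
  proof
    fix c assume c: "c \<in> coefficients"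
    have "\<bar>c n\<bar> \<le> C" for n using coefficient_le[OF c, of n] C(2)[of n] by linarith
    then have "c n \<in> {- C..C}" for n by (simp add: abs_le_iff minus_le_iff)
    then show "c \<in> ?B" by (simp add: PiE_UNIV_domain)
  qed
  ultimately show ?thesis by (simp add: Int_absorb1)
qed

text \<open>
  The polynomial with coordinates \<open>(g n z)\<^sup>k\<close>. It maps the unit ball into the compact set of powers
  of coefficient sequences.
\<close>

lemma power_map_positive_weakly_compact:
  assumes inj: "inj emb" and k: "1 \<le> k"
  shows "positive_poly (c0_copy emb) k (\<lambda>z. emb (\<lambda>n. g n z ^ k))"
    and "weakly_compact_poly (c0_copy emb) (\<lambda>z. emb (\<lambda>n. g n z ^ k))"
proof -
  let ?F = "c0_copy emb"
  let ?P = "\<lambda>z. emb (\<lambda>n. g n z ^ k)"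
  note simps = F_simps[OF inj]
  let ?T = "\<lambda>xs. emb (\<lambda>n. power_form (g n) xs)"
  have conv: "\<exists>l. (\<lambda>n. power_form (g n) xs) \<longlonglongrightarrow> l" for xs
  proof (induction xs)
    case (Cons x xs)
    then obtain l where "(\<lambda>n. power_form (g n) xs) \<longlonglongrightarrow> l" by blast
    then have "(\<lambda>n. g n x * power_form (g n) xs) \<longlonglongrightarrow> 0 * l" using g_null by (intro tendsto_mult)
    then show ?case by auto
  qed auto
  have null': "(\<lambda>n. power_form (g n) xs) \<longlonglongrightarrow> 0" if len: "length xs = k" for xs
  proof -
    obtain x ys where xs: "xs = x # ys" using len k by (cases xs) auto
    obtain l where "(\<lambda>n. power_form (g n) ys) \<longlonglongrightarrow> l" using conv by blast
    then have "(\<lambda>n. g n x * power_form (g n) ys) \<longlonglongrightarrow> 0 * l" using g_null by (intro tendsto_mult)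
    then show ?thesis using xs by simp
  qed
  have lin: "multilinear_form k (power_form (g n))" for n
    using associated_power_form[of k "g n"] by (simp add: associated_operator_real)
  have sm: "symmetric_multilinear ?F k ?T"
    unfolding symmetric_multilinear_def
  proof (intro conjI allI impI)
    fix xs :: "'e list" assume "length xs = k"
    then show "?T xs \<in> vcarrier ?F" using null' by (simp add: simps)
  next
    fix xs :: "'e list" and i and u v :: 'e assume "length xs = k \<and> i < k"
    then show "?T (xs[i := u + v]) = ?T (xs[i := u]) \<oplus>\<^bsub>?F\<^esub> ?T (xs[i := v])"
      using lin by (simp add: simps multilinear_form_def)
  next
    fix xs :: "'e list" and i c and u :: 'e assume "length xs = k \<and> i < k"
    then show "?T (xs[i := c *\<^sub>R u]) = c \<odot>\<^bsub>?F\<^esub> ?T (xs[i := u])"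
      using lin by (simp add: simps multilinear_form_def)
  next
    fix xs ys :: "'e list" assume "length xs = k \<and> mset xs = mset ys"
    then have "power_form (g n) xs = power_form (g n) ys" for n
      using symmetric_power_form unfolding symmetric_form_def by blast
    then show "?T xs = ?T ys" by simp
  qed
  have "\<zero>\<^bsub>?F\<^esub> \<sqsubseteq>\<^bsub>?F\<^esub> ?T xs" if "nonneg_list k xs" for xs
    using that g_nonneg by (auto simp: simps intro!: power_form_nonneg)
  then show "positive_poly ?F k ?P"
    unfolding positive_poly_def associated_operator_def using sm by (intro exI[of _ ?T]) simp
  obtain C where C: "0 < C" "\<And>n. norm (g n) \<le> C" by (rule bounded) (rule that)
  let ?K = "(\<lambda>c. emb (\<lambda>n. c n ^ k)) ` coefficients"
  have K: "compactin (weak_topology ?F) ?K"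
  proof (rule weakly_compact_powers[OF inj compact_coefficients coefficients_null _ k])
    show "\<bar>c n\<bar> \<le> C" if "c \<in> coefficients" for c n using coefficient_le[OF that, of n] C(2)[of n] by linarith
  qed
  have "?P ` cball 0 1 \<subseteq> ?K"
    using coefficients_unit_ball by auto
  then have "weak_topology ?F closure_of (?P ` cball 0 1) \<subseteq> ?K"
    using compactin_imp_closedin[OF Hausdorff_weak_F[OF inj] K] by (rule closure_of_minimal)
  from closed_compactin[OF K this closedin_closure_of]
  have "compactin (weak_topology ?F) (weak_topology ?F closure_of (?P ` cball 0 1))" .
  moreover have "?P ` cball 0 1 \<subseteq> vcarrier ?F"
    using null'[of "replicate k _"] by (auto simp: simps)
  ultimately show "weakly_compact_poly ?F ?P"
    by (simp add: weakly_compact_poly_def relatively_weakly_compact_def)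
qed

lemma power_map_not_convergent:
  assumes inj: "inj emb" and k: "1 \<le> k" and e: "0 < \<epsilon>" "\<And>n. \<epsilon> \<le> g n (X n)"
    and x: "disjoint_seq X" "weakly_summable p X"
  shows "\<not> disjoint_convergent (c0_copy emb) p (\<lambda>z. emb (\<lambda>n. g n z ^ k))"
proof
  assume "disjoint_convergent (c0_copy emb) p (\<lambda>z. emb (\<lambda>n. g n z ^ k))"
  then have lim: "(\<lambda>n. vnorm (c0_copy emb) (emb (\<lambda>m. g m (X n) ^ k))) \<longlonglongrightarrow> 0"
    using x unfolding disjoint_convergent_def by blast
  have "\<epsilon> ^ k \<le> vnorm (c0_copy emb) (emb (\<lambda>m. g m (X n) ^ k))" for n
  proof -
    have "(\<lambda>m. g m (X n) ^ k) \<longlonglongrightarrow> 0" using tendsto_power[OF g_null, of "X n" k] k by (simp add: power_0_left)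
    from F_norm_ge[OF inj this, of n] have "\<bar>g n (X n) ^ k\<bar> \<le> vnorm (c0_copy emb) (emb (\<lambda>m. g m (X n) ^ k))" .
    moreover have "\<epsilon> ^ k \<le> g n (X n) ^ k" using e by (intro power_mono) auto
    ultimately show ?thesis by linarith
  qed
  then have "\<epsilon> ^ k \<le> 0" by (intro tendsto_lowerbound[OF lim]) auto
  then show False using zero_less_power[OF e(1), of k] by linarith
qed

end

text \<open>
  The property implies the other statements by the two descent theorems. If it fails, the powers of
  the localised functionals refute the statements on sequences of polynomials, and the polynomial
  formed from them refutes the statements on ranges, in \<open>c0\<close> and in its copy along \<open>embed\<close>.
\<close>

theorem theorem4p3:
  fixes p :: real and k :: nat
    and embed :: "(nat \<Rightarrow> real) \<Rightarrow> 'f"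
  assumes "1 \<le> p" and "1 \<le> k"
    and "inj embed"
  defines "a \<equiv> disjoint_DPP p TYPE('a::banach_lattice)"
    and "b \<equiv> \<forall>F :: 'f vlattice. banach_lattice_carrier F \<and> order_continuous_norm F \<longrightarrow>
           (\<forall>P :: 'a \<Rightarrow> 'f. positive_poly F k P \<and> weakly_compact_poly F P \<longrightarrow>
              disjoint_convergent F p P)"
    and "c \<equiv> \<forall>P :: 'a \<Rightarrow> nat \<Rightarrow> real. positive_poly c0 k P \<and> weakly_compact_poly c0 P \<longrightarrow>
           disjoint_convergent c0 p P"
    and "d \<equiv> \<forall>(x :: nat \<Rightarrow> 'a) (P :: nat \<Rightarrow> 'a \<Rightarrow> real).
           disjoint_seq x \<and> weakly_summable p x \<and>
           vpositive_seq (regular_poly_space real_vlattice k) P \<and>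
           vweakly_null (regular_poly_space real_vlattice k) P \<longrightarrow>
           (\<lambda>n. P n (x n)) \<longlonglongrightarrow> 0"
    and "e \<equiv> \<forall>(x :: nat \<Rightarrow> 'a) (P :: nat \<Rightarrow> 'a \<Rightarrow> real).
           disjoint_seq x \<and> weakly_summable p x \<and>
           vpositive_seq (regular_poly_space real_vlattice k) P \<and>
           vdisjoint_seq (regular_poly_space real_vlattice k) P \<and>
           vweakly_null (regular_poly_space real_vlattice k) P \<longrightarrow>
           (\<lambda>n. P n (x n)) \<longlonglongrightarrow> 0"
    and "f \<equiv> \<forall>(x :: nat \<Rightarrow> 'a) (P :: nat \<Rightarrow> 'a \<Rightarrow> real).
           disjoint_seq x \<and> weakly_summable p x \<and>
           vdisjoint_seq (regular_poly_space real_vlattice k) P \<and>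
           vweakly_null (regular_poly_space real_vlattice k) P \<longrightarrow>
           (\<lambda>n. P n (x n)) \<longlonglongrightarrow> 0"
  shows "(a \<longleftrightarrow> b) \<and> (a \<longleftrightarrow> c) \<and> (a \<longleftrightarrow> d) \<and> (a \<longleftrightarrow> e) \<and> (a \<longleftrightarrow> f)"
proof -
  let ?V = "regular_poly_space real_vlattice k :: ('a \<Rightarrow> real) vlattice"
  note pk = \<open>1 \<le> p\<close> \<open>1 \<le> k\<close>
  have ab: "b" if "a"
    unfolding b_def
    using banach_lattice_carrier.disjoint_DPP_imp_disjoint_convergent[OF _ that[unfolded a_def] pk] by blast
  have ac: "c" if "a"
    unfolding c_def c0_copy_id[symmetric]
    using banach_lattice_carrier.disjoint_DPP_imp_disjoint_convergent[OF banach_lattice_F[OF inj_on_id]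
        that[unfolded a_def] pk order_continuous_F[OF inj_on_id]] by blast
  have a_polys: "(\<lambda>n. P n (x n)) \<longlonglongrightarrow> 0"
    if "a" "disjoint_seq x" "weakly_summable p x" "vweakly_null ?V P" for x :: "nat \<Rightarrow> 'a" and P
    using disjoint_DPP_imp_polys_null[OF that(1)[unfolded a_def] that(2,3) pk(2) that(4)] .
  have ad: "d" if "a" unfolding d_def using a_polys[OF that] by blast
  have ae: "e" if "a" unfolding e_def using a_polys[OF that] by blast
  have af: "f" if "a" unfolding f_def using a_polys[OF that] by blast
  have not_all: "\<not> b \<and> \<not> c \<and> \<not> d \<and> \<not> e \<and> \<not> f" if na: "\<not> a"
  proof -
    obtain X :: "nat \<Rightarrow> 'a" and h g :: "nat \<Rightarrow> 'a \<Rightarrow>\<^sub>L real" and \<epsilon>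
      where X: "disjoint_seq X" "weakly_summable p X" "\<And>m n. m \<noteq> n \<Longrightarrow> inf (X m) (X n) = 0"
        and hg: "weakly_null h" "\<And>n. localised (X n) (h n) (g n)" and eps: "0 < \<epsilon>" "\<And>n. \<epsilon> \<le> g n (X n)"
      using not_disjoint_DPP_witness[OF pk(1) na[unfolded a_def]] by metis
    interpret localised_sequence h g X by standard (use X(3) hg in auto)
    let ?P = "\<lambda>n z. g n z ^ k"
    have "\<not> (\<lambda>n. ?P n (X n)) \<longlonglongrightarrow> 0"
    proof
      assume lim: "(\<lambda>n. ?P n (X n)) \<longlonglongrightarrow> 0"
      have "\<epsilon> ^ k \<le> ?P n (X n)" for n using eps by (intro power_mono) auto
      then have "\<epsilon> ^ k \<le> 0" by (intro tendsto_lowerbound[OF lim]) auto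
      then show False using zero_less_power[OF eps(1), of k] by linarith
    qed
    then have "\<not> d" "\<not> e" "\<not> f"
      unfolding d_def e_def f_def
      using X(1,2) powers_positive[of k] powers_disjoint[OF pk(2)] powers_weakly_null[OF pk(2)] by blast+
    moreover have "\<not> b"
      unfolding b_def
      using power_map_positive_weakly_compact[OF \<open>inj embed\<close> pk(2)]
        power_map_not_convergent[OF \<open>inj embed\<close> pk(2) eps X(1,2)]
        banach_lattice_F[OF \<open>inj embed\<close>] order_continuous_F[OF \<open>inj embed\<close>] by blast
    moreover have "\<not> c"
      unfolding c_def c0_copy_id[symmetric]
      using power_map_positive_weakly_compact[OF inj_on_id pk(2)]
        power_map_not_convergent[OF inj_on_id pk(2) eps X(1,2)] by blast
    ultimately show ?thesis by blast
  qed
  show ?thesis using ab ac ad ae af not_all by blast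
qed

end
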